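(* Let $\epsilon\in\{0,1\}$ and $a\in(0,1]$ be fixed. For $N\in\mathbb N$ and $m\in\{1,\ldots,N\}$ write $\mu=m/N$, and let $k$ be a non-negative integer. As $N\to\infty$, $$\log F_N^{m,k+1}(a;\epsilon)=F_2(\mu)N^2+F_1(k,\mu)N-\frac{k^2}{2}\log N+F_0(k,\mu)+O(N^{-1/2}),$$ uniformly in $\delta\le\mu\le1-\delta$ and $0\le k\le M$, for any fixed $M\in\mathbb N$ and $\delta>0$, where $$F_2(\mu)=\Big(\tfrac12-\mu+\mu^2\Big)\log(1+a^2),\qquad F_1(k,\mu)=k\varphi_0(x_0)+\Big(\tfrac12-\epsilon\mu\Big)\log(1+a^2),$$ $$F_0(k,\mu)=\log\mathcal G(k+1)-\frac{k^2}{2}\log\big(|x_0|^2\varphi_0''(x_0)\big)+\epsilon k\log(1-ax_0)-\frac k2\log(2\pi),$$ $\mathcal G$ is Barnes' $G$-function, and $$x_0=\frac{-a-\sqrt{a^2+4\mu(1-\mu)}}{2(1-\mu)}<-a,\qquad \varphi_0(z)=(1-\mu)\log(1-az)+\mu\log\Big(\frac{z}{z+a}\Big).$$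
   Context: For integers $i,j$ let $S_{i,j}=[i,i+1]\times[j,j+1]\subset\mathbb R^2$. The Aztec diamond $A_N$ is the union of all $S_{i,j}$ contained in $\{|x|+|y|\le N+1\}$. For $1\le m\le N$ and $1\le k\le m+1$, $A_N^{m,k}$ is the union of all $S_{i,j}$ contained in $$\{(x,y)\in\mathbb R^2:|x|+|y|\le N+1\text{ and }y\le\max\{2m-1-N-x,\;x-2m-1+N+2k\}\}.$$ For $0\le m\le N-1$, $\tilde A_N^{m,k}=A_N^{m+1,k+1}\setminus v^{m,k}$, where $v^{m,k}$ is the vertical segment from $(2m-k-N+1,k-1)$ to $(2m-k-N+1,k)$; for $m=N$, $\tilde A_N^{N,k}=A_N$. A domino is a rectangle $[i,i+1]\times[j,j+2]$ (vertical) or $[i,i+2]\times[j,j+1]$ (horizontal) with $i,j\in\mathbb Z$. A domino tiling of a domain is a collection of dominoes with pairwise disjoint interiors covering exactly the domain; for $\tilde A_N^{m,k}$ this means that no domino of the tiling has interior meeting the slit $v^{m,k}$. $\mathcal T(\cdot)$ is the set of domino tilings and $v(T)$ is the number of vertical dominoes of $T$. For $0<a\le1$, $$F_N^{m,k}(a;1)=\sum_{T\in\mathcal T(A_N^{m,k})}a^{v(T)},\qquad F_N^{m,k}(a;0)=\sum_{T\in\mathcal T(\tilde A_N^{m,k})}a^{v(T)}.$$ *)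

theory Defs
  imports "HOL-Analysis.Analysis"
begin

section \<open>Aztec diamonds and domino tilings\<close>

definition unit_square :: "int \<Rightarrow> int \<Rightarrow> (real \<times> real) set" where
  "unit_square i j = {of_int i .. of_int i + 1} \<times> {of_int j .. of_int j + 1}"

definition squares_within :: "(real \<times> real) set \<Rightarrow> (real \<times> real) set" where
  "squares_within R = \<Union> {unit_square i j | i j. unit_square i j \<subseteq> R}"

definition aztec :: "nat \<Rightarrow> (real \<times> real) set" where
  "aztec N = squares_within {(x, y). \<bar>x\<bar> + \<bar>y\<bar> \<le> real N + 1}"

text \<open>The domain \<open>A\<^sub>N\<^sup>m\<^sup>,\<^sup>k\<close>, of interest for \<open>1 \<le> m \<le> N\<close> and \<open>1 \<le> k \<le> m + 1\<close>.\<close>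

definition aztec_part :: "nat \<Rightarrow> nat \<Rightarrow> nat \<Rightarrow> (real \<times> real) set" where
  "aztec_part N m k = squares_within
     {(x, y). \<bar>x\<bar> + \<bar>y\<bar> \<le> real N + 1 \<and>
        y \<le> max (2 * real m - 1 - real N - x) (x - 2 * real m - 1 + real N + 2 * real k)}"

definition slit :: "nat \<Rightarrow> nat \<Rightarrow> nat \<Rightarrow> (real \<times> real) set" where
  "slit N m k = {2 * real m - real k - real N + 1} \<times> {real k - 1 .. real k}"

definition aztec_slit :: "nat \<Rightarrow> nat \<Rightarrow> nat \<Rightarrow> (real \<times> real) set" where
  "aztec_slit N m k =
     (if m < N then aztec_part N (m + 1) (k + 1) - slit N m k else aztec N)"

definition vertical_dominoes :: "(real \<times> real) set set" where
  "vertical_dominoes =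
     {{of_int i .. of_int i + 1} \<times> {of_int j .. of_int j + 2} | i j :: int. True}"

definition horizontal_dominoes :: "(real \<times> real) set set" where
  "horizontal_dominoes =
     {{of_int i .. of_int i + 2} \<times> {of_int j .. of_int j + 1} | i j :: int. True}"

text \<open>
  The definition serves both closed domains and closed domains with a slit removed. Dominoes
  are closed, so they can cover a slit domain only up to its closure, and the slit is respected
  by requiring the interiors of the dominoes to lie in the domain. The lemmas
  \<open>tilings_aztec_part\<close> and \<open>tilings_aztec_slit\<close> below spell this out for the two families.
\<close>

definition domino_tilings :: "(real \<times> real) set \<Rightarrow> (real \<times> real) set set set" where
  "domino_tilings D =
     {T. T \<subseteq> vertical_dominoes \<union> horizontal_dominoes \<and>
         pairwise (\<lambda>d e. interior d \<inter> interior e = {}) T \<and>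
         (\<forall>d\<in>T. interior d \<subseteq> D) \<and> \<Union> T = closure D}"

definition num_vertical :: "(real \<times> real) set set \<Rightarrow> nat" where
  "num_vertical T = card (T \<inter> vertical_dominoes)"

definition aztec_F :: "nat \<Rightarrow> nat \<Rightarrow> nat \<Rightarrow> real \<Rightarrow> nat \<Rightarrow> real" where
  "aztec_F N m k a \<epsilon> =
     (\<Sum>T\<in>domino_tilings (if \<epsilon> = 1 then aztec_part N m k else aztec_slit N m k).
        a ^ num_vertical T)"

section \<open>The coefficients of the expansion\<close>

text \<open>Barnes' \<open>G\<close>-function on the real line, by its Weierstrass product at \<open>1 + z\<close>.\<close>

definition barnes_G :: "real \<Rightarrow> real" where
  "barnes_G x = (let z = x - 1 in
     (2 * pi) powr (z / 2) * exp (- (z + z\<^sup>2 * (1 + euler_mascheroni)) / 2) *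
     (\<Prod>n. (1 + z / real (Suc n)) ^ Suc n * exp (z\<^sup>2 / (2 * real (Suc n)) - z)))"

definition x0 :: "real \<Rightarrow> real \<Rightarrow> real" where
  "x0 a \<mu> = (- a - sqrt (a\<^sup>2 + 4 * \<mu> * (1 - \<mu>))) / (2 * (1 - \<mu>))"

definition phi0 :: "real \<Rightarrow> real \<Rightarrow> real \<Rightarrow> real" where
  "phi0 a \<mu> z = (1 - \<mu>) * ln (1 - a * z) + \<mu> * ln (z / (z + a))"

definition F2 :: "real \<Rightarrow> real \<Rightarrow> real" where
  "F2 a \<mu> = (1/2 - \<mu> + \<mu>\<^sup>2) * ln (1 + a\<^sup>2)"

definition F1 :: "real \<Rightarrow> nat \<Rightarrow> nat \<Rightarrow> real \<Rightarrow> real" where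
  "F1 a \<epsilon> k \<mu> = real k * phi0 a \<mu> (x0 a \<mu>) + (1/2 - real \<epsilon> * \<mu>) * ln (1 + a\<^sup>2)"

definition F0 :: "real \<Rightarrow> nat \<Rightarrow> nat \<Rightarrow> real \<Rightarrow> real" where
  "F0 a \<epsilon> k \<mu> =
     ln (barnes_G (real k + 1))
     - (real k)\<^sup>2 / 2 * ln (\<bar>x0 a \<mu>\<bar>\<^sup>2 * (deriv ^^ 2) (phi0 a \<mu>) (x0 a \<mu>))
     + real \<epsilon> * real k * ln (1 - a * x0 a \<mu>)
     - real k / 2 * ln (2 * pi)"

section \<open>Tilings of the closed and of the slit domains\<close>

lemma domino_closed: "d \<in> vertical_dominoes \<union> horizontal_dominoes \<Longrightarrow> closed d"
  by (auto simp: vertical_dominoes_def horizontal_dominoes_def intro!: closed_Times)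

lemma closure_interior_domino:
  assumes "d \<in> vertical_dominoes \<union> horizontal_dominoes"
  shows "closure (interior d) = d"
  using assms
  by (auto simp: vertical_dominoes_def horizontal_dominoes_def interior_Times closure_Times)

lemma closure_interior_unit_square: "closure (interior (unit_square i j)) = unit_square i j"
  by (simp add: unit_square_def interior_Times closure_Times)

lemma finite_squares_aztec:
  "finite {(i, j). unit_square i j \<subseteq> {(x, y). \<bar>x\<bar> + \<bar>y\<bar> \<le> real N + 1}}" (is "finite ?S")
proof (rule finite_subset)
  show "?S \<subseteq> {- int N - 1 .. int N + 1} \<times> {- int N - 1 .. int N + 1}"
  proof clarify
    fix i j assume sub: "unit_square i j \<subseteq> {(x, y). \<bar>x\<bar> + \<bar>y\<bar> \<le> real N + 1}"
    have "(of_int i, of_int j) \<in> unit_square i j"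
      by (simp add: unit_square_def)
    with sub have "\<bar>of_int i\<bar> + \<bar>of_int j\<bar> \<le> real N + 1"
      by blast
    then have "\<bar>i\<bar> + \<bar>j\<bar> \<le> int N + 1"
      by linarith
    then show "i \<in> {- int N - 1 .. int N + 1} \<and> j \<in> {- int N - 1 .. int N + 1}"
      by auto
  qed
qed auto

lemma closed_aztec_part: "closed (aztec_part N m k)"
proof -
  let ?R = "{(x, y). \<bar>x\<bar> + \<bar>y\<bar> \<le> real N + 1 \<and>
        y \<le> max (2 * real m - 1 - real N - x) (x - 2 * real m - 1 + real N + 2 * real k)}"
  have "finite {(i, j). unit_square i j \<subseteq> ?R}"
    by (rule finite_subset[OF _ finite_squares_aztec[of N]]) auto
  then have "finite ((\<lambda>(i, j). unit_square i j) ` {(i, j). unit_square i j \<subseteq> ?R})"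
    by (rule finite_imageI)
  moreover have "(\<lambda>(i, j). unit_square i j) ` {(i, j). unit_square i j \<subseteq> ?R}
      = {unit_square i j | i j. unit_square i j \<subseteq> ?R}"
    by auto
  ultimately have "finite {unit_square i j | i j. unit_square i j \<subseteq> ?R}"
    by simp
  then show ?thesis
    unfolding aztec_part_def squares_within_def
    by (rule closed_Union) (auto simp: unit_square_def intro!: closed_Times)
qed

lemma closure_diff_thin:
  assumes "open U" "interior V = {}"
  shows "closure (U - V) = closure U"
proof (rule antisym)
  have "U \<subseteq> closure (U - V)"
  proof
    fix x assume "x \<in> U"
    show "x \<in> closure (U - V)"
    proof (rule ccontr)
      assume "x \<notin> closure (U - V)"
      then have "x \<in> U \<inter> - closure (U - V)"
        using \<open>x \<in> U\<close> by simp
      moreover have "U \<inter> - closure (U - V) \<subseteq> V"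
        using closure_subset[of "U - V"] by blast
      moreover have "open (U \<inter> - closure (U - V))"
        using assms(1) by blast
      ultimately show False
        using assms(2) by (metis empty_iff interiorI)
    qed
  qed
  then show "closure U \<subseteq> closure (U - V)"
    by (simp add: closure_minimal)
qed (simp add: closure_mono)

lemma closure_aztec_part_diff_slit: "closure (aztec_part N m k - slit N' m' k') = aztec_part N m k"
proof (rule antisym)
  show "closure (aztec_part N m k - slit N' m' k') \<subseteq> aztec_part N m k"
    by (simp add: closed_aztec_part closure_minimal)
  have thin: "interior (slit N' m' k') = {}"
    by (simp add: slit_def interior_Times)
  show "aztec_part N m k \<subseteq> closure (aztec_part N m k - slit N' m' k')"
  proof
    fix p assume "p \<in> aztec_part N m k"
    then obtain i j where p: "p \<in> unit_square i j" and sub: "unit_square i j \<subseteq> aztec_part N m k"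
      by (fastforce simp: aztec_part_def squares_within_def)
    have "p \<in> closure (interior (unit_square i j) - slit N' m' k')"
      using p closure_diff_thin[OF _ thin] closure_interior_unit_square by auto
    also have "\<dots> \<subseteq> closure (aztec_part N m k - slit N' m' k')"
      using sub interior_subset by (intro closure_mono) blast
    finally show "p \<in> closure (aztec_part N m k - slit N' m' k')" .
  qed
qed

lemma tilings_aztec_part:
  "domino_tilings (aztec_part N m k) =
     {T. T \<subseteq> vertical_dominoes \<union> horizontal_dominoes \<and>
         pairwise (\<lambda>d e. interior d \<inter> interior e = {}) T \<and> \<Union> T = aztec_part N m k}"
  unfolding domino_tilings_def closure_closed[OF closed_aztec_part]
  using interior_subset by blast

lemma tilings_aztec_slit:
  assumes "m < N"
  shows "domino_tilings (aztec_slit N m k) =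
     {T \<in> domino_tilings (aztec_part N (m + 1) (k + 1)). \<forall>d\<in>T. interior d \<inter> slit N m k = {}}"
  using assms
  unfolding domino_tilings_def aztec_slit_def
  by (auto simp: closure_aztec_part_diff_slit closure_closed[OF closed_aztec_part])

end

theory Submission
  imports Defs "HOL-Library.Disjoint_Sets" "HOL-Real_Asymp.Real_Asymp"
    "HOL-Probability.Characteristic_Functions"
    "Jordan_Normal_Form.Determinant"
begin

text \<open>
  Cut the domain along diagonal layers, so that a tiling becomes a perfect matching of
  consecutive layers. To the left and to the right of the cut the matchings with prescribed
  particles on the last layer are counted by a Vandermonde product times a power of
  \<open>1 + a\<^sup>2\<close>; gluing the two halves gives a discrete orthogonal polynomial ensemble with Krawtchouk
  weight. Its partition function is a Hankel determinant, and passing to the \<open>k\<close> holes turns it into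
  \<open>F = (1 + a\<^sup>2)\<^sup>L det D\<close>, where \<open>D\<close> is a \<open>k \<times> k\<close> matrix whose entries are the contour integrals
  \<open>(2 \<pi> i)\<^sup>-\<^sup>1 \<integral> (1 - u)\<^bsup>-(m - k + 1 + i)\<^esup> (1 + a\<^sup>2 / u)\<^bsup>N - m + \<epsilon> + k - 1 - l\<^esup> u\<^bsup>-l - 1\<^esup> du\<close>.
  The exponents are large and their saddle point is \<open>u = - a / x\<^sub>0\<close>. On the circle through it the two
  factors are characteristic functions of a geometric and of a Bernoulli variable, whose means cancel.
  A unitriangular change of basis replaces the entries by integrals against
  \<open>(e\<^bsup>it\<^esup> - 1)\<^sup>i (e\<^bsup>-it\<^esup> - 1)\<^sup>l\<close>, which after rescaling by the variance converge, with error
  \<open>O(N\<^bsup>-1/2\<^esup>)\<close>, to moments of the normal law. The Hankel determinant of the latter is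
  \<open>\<Prod>i<k. i! = G(k + 1)\<close>.
\<close>

section \<open>Determinants of functions on initial segments\<close>

text \<open>The number of particles on the cut layer grows with \<open>N\<close>, while the
  complementary set keeps the size \<open>k\<close>; \<open>vdm_complement\<close> makes this
  exchange cost no more than a product weight. The resulting \<open>k\<close> by \<open>k\<close>
  matrix still resists a direct expansion: all entries share one saddle point, so after
  normalisation the leading term has rank one and its determinant vanishes for \<open>k > 1\<close>.
  The binomial row and column operations subtract this common part. Afterwards entry
  \<open>(i, l)\<close> lives on the scale N^(-(i+l+1)/2), and the product of these scales is
  N^(-k^2/2), the source of the \<open>ln N\<close> term. Uniformity in \<mu> comes from explicit
  inequalities on the whole circle that depend on a bound for the geometric mean, a lower bound for
  the Bernoulli variance and the linear growth of the exponents, all controlled by \<delta>. Decay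
  away from the saddle is drawn from the Bernoulli factor alone. Both values of \<epsilon> follow
  one route: the cut runs along an odd layer for \<epsilon> = 1 and along an even one for \<epsilon>
  = 0. The determinants differ only in the exponent \<open>N - m + \<epsilon>\<close>.\<close>

definition dt :: "nat \<Rightarrow> (nat \<Rightarrow> nat \<Rightarrow> 'a::comm_ring_1) \<Rightarrow> 'a" where
  "dt n f = Determinant.det (Matrix.mat n n (\<lambda>(i, j). f i j))"

lemma dt_leibniz: "dt n f = (\<Sum>p | p permutes {0..<n}. signof p * (\<Prod>i = 0..<n. f i (p i)))"
proof -
  have "Matrix.mat n n (\<lambda>(i, j). f i j) \<in> carrier_mat n n" by simp
  then have "dt n f = (\<Sum>p | p permutes {0..<n}. signof p * (\<Prod>i = 0..<n. Matrix.mat n n (\<lambda>(i, j). f i j) $$ (i, p i)))"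
    unfolding dt_def by (rule det_def')
  also have "\<dots> = (\<Sum>p | p permutes {0..<n}. signof p * (\<Prod>i = 0..<n. f i (p i)))"
  proof (rule sum.cong)
    fix p assume "p \<in> {p. p permutes {0..<n}}"
    then have "p i < n" if "i < n" for i
      using that permutes_in_image[of p "{0..<n}" i] by auto
    then show "signof p * (\<Prod>i = 0..<n. Matrix.mat n n (\<lambda>(i, j). f i j) $$ (i, p i))
      = signof p * (\<Prod>i = 0..<n. f i (p i))" by simp
  qed simp
  finally show ?thesis .
qed

lemma dt_cong: "(\<And>i j. i < n \<Longrightarrow> j < n \<Longrightarrow> f i j = g i j) \<Longrightarrow> dt n f = dt n g"
  unfolding dt_def by (intro arg_cong[where f = Determinant.det] cong_mat) auto

lemma dt_mult: "dt n f * dt n g = dt n (\<lambda>i j. \<Sum>k<n. f i k * g k j)"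
proof -
  have "Matrix.mat n n (\<lambda>(i, j). f i j) * Matrix.mat n n (\<lambda>(i, j). g i j)
      = Matrix.mat n n (\<lambda>(i, j). \<Sum>k<n. f i k * g k j)"
    by (rule eq_matI) (auto simp: scalar_prod_def atLeast0LessThan)
  then show ?thesis unfolding dt_def by (subst det_mult[symmetric, of _ n]) auto
qed

lemma dt_transpose: "dt n (\<lambda>i j. f j i) = dt n f"
proof -
  have "Matrix.mat n n (\<lambda>(i, j). f j i) = transpose_mat (Matrix.mat n n (\<lambda>(i, j). f i j))"
    by (rule eq_matI) auto
  then show ?thesis unfolding dt_def by (simp add: det_transpose[of _ n])
qed

lemma dt_lower_triangular:
  assumes "\<And>i j. i < j \<Longrightarrow> j < n \<Longrightarrow> f i j = 0"
  shows "dt n f = (\<Prod>i<n. f i i)"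
proof -
  have "dt n f = prod_list (diag_mat (Matrix.mat n n (\<lambda>(i, j). f i j)))"
    unfolding dt_def by (rule det_lower_triangular[of n]) (use assms in auto)
  also have "\<dots> = (\<Prod>i = 0..<n. f i i)" by (simp add: prod_list_diag_prod)
  finally show ?thesis by (simp add: atLeast0LessThan)
qed

lemma dt_upper_triangular:
  assumes "\<And>i j. j < i \<Longrightarrow> i < n \<Longrightarrow> f i j = 0"
  shows "dt n f = (\<Prod>i<n. f i i)"
  using dt_lower_triangular[of n "\<lambda>i j. f j i"] assms by (simp add: dt_transpose[of n f])

lemma dt_identical_rows:
  assumes "i \<noteq> j" "i < n" "j < n" "\<And>k. k < n \<Longrightarrow> f i k = f j k"
  shows "dt n f = 0"
  unfolding dt_def
  by (rule det_identical_rows[OF _ assms(1-3)]) (use assms in \<open>auto intro!: eq_vecI\<close>)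

lemma dt_scale_rows: "dt n (\<lambda>i j. c i * f i j) = (\<Prod>i<n. c i) * dt n f"
  unfolding dt_leibniz by (simp add: sum_distrib_left prod.distrib mult_ac atLeast0LessThan)

lemma dt_scale_cols: "dt n (\<lambda>i j. c j * f i j) = (\<Prod>i<n. c i) * dt n f"
  using dt_scale_rows[of n c "\<lambda>i j. f j i"] dt_transpose[of n "\<lambda>i j. c j * f i j"]
  by (simp add: dt_transpose[of n f])

lemma dt_permute_rows:
  assumes "p permutes {0..<n}"
  shows "dt n (\<lambda>i j. f (p i) j) = signof p * dt n f"
proof -
  have "p i < n" if "i < n" for i using that permutes_in_image[OF assms, of i] by auto
  then have "Matrix.mat n n (\<lambda>(i, j). f (p i) j)
      = Matrix.mat n n (\<lambda>(i, j). Matrix.mat n n (\<lambda>(i, j). f i j) $$ (p i, j))"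
    by (intro eq_matI) auto
  then show ?thesis unfolding dt_def by (simp only: det_permute_rows[OF mat_carrier assms])
qed

text \<open>Multilinearity in the rows. The set \<open>B\<close> stays abstract and
  \<open>\<phi>\<close> merely enumerates it, so that the choice functions are those that occur when
  the cells of one layer pick partners in the previous one.\<close>

lemma dt_rows_sum:
  fixes f :: "'b \<Rightarrow> nat \<Rightarrow> 'a::comm_ring_1" and c :: "'c \<Rightarrow> 'b \<Rightarrow> 'a"
  assumes bij: "bij_betw \<phi> {..<n} B" and fin: "\<And>b. b \<in> B \<Longrightarrow> finite (X b)"
  shows "dt n (\<lambda>i j. \<Sum>x\<in>X (\<phi> i). c (\<phi> i) x * f x j)
    = (\<Sum>g\<in>PiE B X. (\<Prod>b\<in>B. c b (g b)) * dt n (\<lambda>i. f (g (\<phi> i))))"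
proof -
  have finB: "finite B" using bij bij_betw_finite by blast
  define \<psi> where "\<psi> = the_inv_into {..<n} \<phi>"
  have re: "(\<Prod>i = 0..<n. F i) = (\<Prod>b\<in>B. F (\<psi> b))" for F :: "nat \<Rightarrow> 'a"
    using prod.reindex_bij_betw[OF bij_betw_the_inv_into[OF bij], of F]
    by (simp add: \<psi>_def atLeast0LessThan)
  have \<phi>\<psi>: "\<phi> (\<psi> b) = b" if "b \<in> B" for b
    unfolding \<psi>_def using bij that by (simp add: f_the_inv_into_f_bij_betw)
  have "(\<Prod>i = 0..<n. \<Sum>x\<in>X (\<phi> i). c (\<phi> i) x * f x (p i))
      = (\<Sum>g\<in>PiE B X. (\<Prod>b\<in>B. c b (g b)) * (\<Prod>i = 0..<n. f (g (\<phi> i)) (p i)))" for p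
  proof -
    have "(\<Prod>i = 0..<n. \<Sum>x\<in>X (\<phi> i). c (\<phi> i) x * f x (p i))
        = (\<Prod>b\<in>B. \<Sum>x\<in>X b. c b x * f x (p (\<psi> b)))"
      unfolding re by (rule prod.cong) (simp_all add: \<phi>\<psi>)
    also have "\<dots> = (\<Sum>g\<in>PiE B X. \<Prod>b\<in>B. c b (g b) * f (g b) (p (\<psi> b)))"
      by (rule prod_sum_PiE[OF finB fin])
    also have "\<dots> = (\<Sum>g\<in>PiE B X. (\<Prod>b\<in>B. c b (g b)) * (\<Prod>i = 0..<n. f (g (\<phi> i)) (p i)))"
      unfolding re prod.distrib by (intro sum.cong arg_cong2[of _ _ _ _ "(*)"] prod.cong) (simp_all add: \<phi>\<psi>)
    finally show ?thesis .
  qed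
  then show ?thesis
    unfolding dt_leibniz by (simp add: sum_distrib_left mult.left_commute sum.swap[of _ "PiE B X"])
qed

text \<open>The Cauchy-Binet identity in Andreief's form. After expanding both determinants the sum
  over maps factorises over the rows, and each of the \<open>n!\<close> permutations
  \<open>p\<close> returns the same determinant. Summing over maps instead of subsets needs no order
  on \<open>X\<close>.\<close>

lemma fact_dt_sum:
  fixes f g :: "nat \<Rightarrow> 'b \<Rightarrow> 'a::comm_ring_1"
  assumes "finite X"
  shows "of_nat (fact n) * dt n (\<lambda>i j. \<Sum>x\<in>X. f i x * g j x)
    = (\<Sum>\<phi>\<in>PiE {..<n} (\<lambda>_. X). dt n (\<lambda>i j. f j (\<phi> i)) * dt n (\<lambda>i j. g j (\<phi> i)))"
proof -
  let ?P = "{p. p permutes {0..<n}}" and ?M = "\<lambda>i j. \<Sum>x\<in>X. f i x * g j x"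
  have sq: "signof p * signof p = (1::'a)" for p :: "nat \<Rightarrow> nat"
    by (cases "sign p = 1") (auto simp: sign_def)
  have "(\<Sum>\<phi>\<in>PiE {..<n} (\<lambda>_. X). dt n (\<lambda>i j. f j (\<phi> i)) * dt n (\<lambda>i j. g j (\<phi> i)))
    = (\<Sum>\<phi>\<in>PiE {..<n} (\<lambda>_. X). \<Sum>p\<in>?P. \<Sum>q\<in>?P. signof p * signof q * (\<Prod>i<n. f (p i) (\<phi> i) * g (q i) (\<phi> i)))"
    unfolding dt_leibniz sum_product
    by (intro sum.cong refl) (simp add: prod.distrib mult_ac atLeast0LessThan)
  also have "\<dots> = (\<Sum>p\<in>?P. \<Sum>\<phi>\<in>PiE {..<n} (\<lambda>_. X). \<Sum>q\<in>?P. signof p * signof q * (\<Prod>i<n. f (p i) (\<phi> i) * g (q i) (\<phi> i)))"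
    by (rule sum.swap)
  also have "\<dots> = (\<Sum>p\<in>?P. \<Sum>q\<in>?P. \<Sum>\<phi>\<in>PiE {..<n} (\<lambda>_. X). signof p * signof q * (\<Prod>i<n. f (p i) (\<phi> i) * g (q i) (\<phi> i)))"
    by (intro sum.cong refl, rule sum.swap)
  also have "\<dots> = (\<Sum>p\<in>?P. \<Sum>q\<in>?P. signof p * signof q * (\<Prod>i<n. ?M (p i) (q i)))"
    using assms by (simp add: prod_sum_PiE sum_distrib_left)
  also have "\<dots> = (\<Sum>p\<in>?P. signof p * dt n (\<lambda>i. ?M (p i)))"
    unfolding dt_leibniz by (simp add: sum_distrib_left mult.assoc atLeast0LessThan)
  also have "\<dots> = (\<Sum>p\<in>?P. dt n ?M)"
  proof (rule sum.cong)
    fix p assume "p \<in> ?P"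
    then have "dt n (\<lambda>i. ?M (p i)) = signof p * dt n ?M"
      by (intro dt_permute_rows) simp
    then show "signof p * dt n (\<lambda>i. ?M (p i)) = dt n ?M"
      using sq[of p] by (simp add: mult.assoc[symmetric])
  qed simp
  also have "\<dots> = of_nat (fact n) * dt n ?M"
    by (simp add: card_permutations[of _ n])
  finally show ?thesis by simp
qed

text \<open>The matrix of values is the matrix of powers times the matrix of coefficients. The
  hypothesis bounds the degree of \<open>p j\<close> by \<open>j\<close>, which makes the second
  factor triangular.\<close>

lemma dt_poly:
  fixes x :: "nat \<Rightarrow> 'a::comm_ring_1"
  assumes "\<And>j i. j < n \<Longrightarrow> j < i \<Longrightarrow> coeff (p j) i = 0"
  shows "dt n (\<lambda>i j. poly (p j) (x i)) = (\<Prod>j<n. coeff (p j) j) * dt n (\<lambda>i j. x i ^ j)"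
proof -
  have "poly (p j) (x i) = (\<Sum>k<n. x i ^ k * coeff (p j) k)" if j: "j < n" for i j
  proof -
    have "degree (p j) \<le> j" using assms[OF j] by (intro degree_le) auto
    then have "poly (p j) (x i) = (\<Sum>k\<le>n - 1. coeff (p j) k * x i ^ k)"
      using j by (intro poly_altdef[THEN trans] sum.mono_neutral_left) (auto simp: coeff_eq_0)
    also have "{..n - 1} = {..<n}" using j by auto
    finally show ?thesis by (simp add: mult.commute)
  qed
  then have "dt n (\<lambda>i j. poly (p j) (x i)) = dt n (\<lambda>i j. \<Sum>k<n. x i ^ k * coeff (p j) k)"
    by (intro dt_cong) auto
  also have "\<dots> = dt n (\<lambda>i j. x i ^ j) * dt n (\<lambda>i j. coeff (p j) i)"
    by (rule dt_mult[symmetric])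
  also have "dt n (\<lambda>i j. coeff (p j) i) = (\<Prod>j<n. coeff (p j) j)"
    using assms by (intro dt_upper_triangular) auto
  finally show ?thesis by (simp add: mult.commute)
qed

text \<open>In the Newton basis, where \<open>p j\<close> is monic and vanishes at the first
  \<open>j\<close> nodes, the matrix of values is lower triangular, and \<open>dt_poly\<close> shows
  that this change of basis preserves the determinant.\<close>

lemma dt_vandermonde:
  fixes x :: "nat \<Rightarrow> 'a::idom"
  shows "dt n (\<lambda>i j. x i ^ j) = (\<Prod>i<n. \<Prod>j<i. x i - x j)"
proof -
  define p where "p j = (\<Prod>l<j. [:- x l, 1:])" for j
  have deg: "degree (p j) = j" for j
    unfolding p_def by (subst degree_prod_eq_sum_degree) auto
  have lc: "coeff (p j) j = 1" for j
  proof -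
    have "lead_coeff (p j) = 1" unfolding p_def lead_coeff_prod by simp
    then show ?thesis by (simp add: deg)
  qed
  have "dt n (\<lambda>i j. poly (p j) (x i)) = (\<Prod>i<n. poly (p i) (x i))"
    by (rule dt_lower_triangular) (auto simp: p_def poly_prod prod_zero_iff)
  moreover have "dt n (\<lambda>i j. poly (p j) (x i)) = (\<Prod>j<n. coeff (p j) j) * dt n (\<lambda>i j. x i ^ j)"
    by (rule dt_poly) (auto simp: coeff_eq_0 deg)
  ultimately show ?thesis unfolding lc by (simp add: p_def poly_prod)
qed

section \<open>Vandermonde products of finite sets of integers\<close>

definition vdm :: "int set \<Rightarrow> real" where
  "vdm A = (\<Prod>(x, y)\<in>{(x, y). x \<in> A \<and> y \<in> A \<and> x < y}. real_of_int (y - x))"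

lemma finite_pairs: "finite A \<Longrightarrow> finite {(x, y). x \<in> A \<and> y \<in> A \<and> P x y}"
  by (rule finite_subset[of _ "A \<times> A"]) auto

lemma vdm_pos: "finite A \<Longrightarrow> 0 < vdm A"
  unfolding vdm_def by (rule prod_pos) auto

lemma vdm_image_strict_mono:
  fixes \<phi> :: "nat \<Rightarrow> int"
  assumes "strict_mono_on {..<n} \<phi>"
  shows "vdm (\<phi> ` {..<n}) = (\<Prod>i<n. \<Prod>j<i. real_of_int (\<phi> i) - real_of_int (\<phi> j))"
proof -
  have less: "\<phi> i < \<phi> j \<longleftrightarrow> i < j" if "i < n" "j < n" for i j
    using strict_mono_onD[OF assms, of i j] strict_mono_onD[OF assms, of j i] that
    by (cases i j rule: linorder_cases) auto
  have eq: "\<phi> i = \<phi> j \<longleftrightarrow> i = j" if "i < n" "j < n" for i j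
    using less[OF that] less[OF that(2,1)] by auto
  have inj: "inj_on (\<lambda>(i, j). (\<phi> j, \<phi> i)) (SIGMA i:{..<n}. {..<i})"
    by (auto simp: inj_on_def eq)
  have "{(x, y). x \<in> \<phi> ` {..<n} \<and> y \<in> \<phi> ` {..<n} \<and> x < y} = (\<lambda>(i, j). (\<phi> j, \<phi> i)) ` (SIGMA i:{..<n}. {..<i})"
    by (force simp: less)
  then show ?thesis unfolding vdm_def
    by (simp only: prod.reindex[OF inj]) (subst prod.Sigma; simp add: split_def)
qed

lemma obtain_enumeration:
  fixes A :: "int set"
  assumes "finite A" "card A = n"
  obtains \<phi> where "strict_mono_on {..<n} \<phi>" "bij_betw \<phi> {..<n} A"
proof
  let ?\<phi> = "\<lambda>i. sorted_list_of_set A ! i"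
  show "strict_mono_on {..<n} ?\<phi>"
    using assms strict_sorted_list_of_set[of A]
    by (auto simp: strict_mono_on_def sorted_wrt_iff_nth_less)
  show "bij_betw ?\<phi> {..<n} A"
    using assms by (intro bij_betw_nth) auto
qed

lemma dt_power_eq_vdm:
  fixes \<phi> :: "nat \<Rightarrow> int"
  assumes "strict_mono_on {..<n} \<phi>"
  shows "dt n (\<lambda>i j. real_of_int (\<phi> i) ^ j) = vdm (\<phi> ` {..<n})"
  unfolding dt_vandermonde vdm_image_strict_mono[OF assms] ..

text \<open>Ordered pairs count every difference twice. This form mentions no order, so it passes
  through injective maps and reflections without any bookkeeping of signs.\<close>

lemma vdm_square:
  assumes "finite A"
  shows "vdm A ^ 2 = (\<Prod>x\<in>A. \<Prod>y\<in>A - {x}. \<bar>real_of_int (y - x)\<bar>)"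
proof -
  let ?L = "{(x, y). x \<in> A \<and> y \<in> A \<and> x < y}" and ?G = "{(x, y). x \<in> A \<and> y \<in> A \<and> y < x}"
  have "(\<Prod>x\<in>A. \<Prod>y\<in>A - {x}. \<bar>real_of_int (y - x)\<bar>) = (\<Prod>(x, y)\<in>(SIGMA x:A. A - {x}). \<bar>real_of_int (y - x)\<bar>)"
    using assms by (intro prod.Sigma) auto
  also have "(SIGMA x:A. A - {x}) = ?L \<union> ?G" by auto
  also have "(\<Prod>(x, y)\<in>?L \<union> ?G. \<bar>real_of_int (y - x)\<bar>)
    = (\<Prod>(x, y)\<in>?L. \<bar>real_of_int (y - x)\<bar>) * (\<Prod>(x, y)\<in>?G. \<bar>real_of_int (y - x)\<bar>)"
    using assms by (intro prod.union_disjoint finite_pairs) auto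
  also have "(\<Prod>(x, y)\<in>?L. \<bar>real_of_int (y - x)\<bar>) = vdm A"
    unfolding vdm_def by (intro prod.cong) auto
  also have "(\<Prod>(x, y)\<in>?G. \<bar>real_of_int (y - x)\<bar>) = vdm A"
    unfolding vdm_def by (rule prod.reindex_bij_witness[of _ prod.swap prod.swap]) auto
  finally show ?thesis by (simp add: power2_eq_square)
qed

text \<open>For an enumeration that is merely injective, the determinant is the Vandermonde product
  up to a sign, which the square removes.\<close>

lemma dt_power_square:
  assumes "inj_on \<phi> {..<n}"
  shows "(dt n (\<lambda>i j. real_of_int (\<phi> i) ^ j))\<^sup>2 = vdm (\<phi> ` {..<n}) ^ 2"
proof -
  let ?L = "SIGMA i:{..<n}. {..<i}" and ?G = "SIGMA i:{..<n}. {i<..<n}"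
  let ?f = "\<lambda>i j. \<bar>real_of_int (\<phi> j - \<phi> i)\<bar>"
  have "vdm (\<phi> ` {..<n}) ^ 2 = (\<Prod>i<n. \<Prod>y\<in>\<phi> ` {..<n} - {\<phi> i}. \<bar>real_of_int (y - \<phi> i)\<bar>)"
    by (subst vdm_square) (simp_all add: prod.reindex[OF assms])
  also have "\<dots> = (\<Prod>i<n. \<Prod>j\<in>{..<n} - {i}. ?f i j)"
  proof (rule prod.cong)
    fix i assume i: "i \<in> {..<n}"
    have "\<phi> ` {..<n} - {\<phi> i} = \<phi> ` ({..<n} - {i})" using i assms by (auto dest: inj_onD)
    then show "(\<Prod>y\<in>\<phi> ` {..<n} - {\<phi> i}. \<bar>real_of_int (y - \<phi> i)\<bar>) = (\<Prod>j\<in>{..<n} - {i}. ?f i j)"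
      using inj_on_subset[OF assms, of "{..<n} - {i}"] by (simp add: prod.reindex)
  qed simp
  also have "\<dots> = (\<Prod>(i, j)\<in>(SIGMA i:{..<n}. {..<n} - {i}). ?f i j)"
    by (intro prod.Sigma) auto
  also have "(SIGMA i:{..<n}. {..<n} - {i}) = ?L \<union> ?G" by auto
  also have "(\<Prod>(i, j)\<in>?L \<union> ?G. ?f i j) = (\<Prod>(i, j)\<in>?L. ?f i j) * (\<Prod>(i, j)\<in>?G. ?f i j)"
    by (intro prod.union_disjoint) auto
  also have "(\<Prod>(i, j)\<in>?G. ?f i j) = (\<Prod>(i, j)\<in>?L. ?f i j)"
    by (rule prod.reindex_bij_witness[of _ prod.swap prod.swap]) auto
  also have "(\<Prod>(i, j)\<in>?L. ?f i j) = (\<Prod>i<n. \<Prod>j<i. ?f i j)"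
    by (intro prod.Sigma[symmetric]) auto
  also have "\<dots> = \<bar>dt n (\<lambda>i j. real_of_int (\<phi> i) ^ j)\<bar>"
    unfolding dt_vandermonde abs_prod by (simp add: abs_minus_commute)
  finally show ?thesis by (simp add: power2_eq_square)
qed

text \<open>The sum over \<open>n\<close>-subsets is \<open>1 / n!\<close> times the sum over all maps from \<open>{..<n}\<close>, the
  non-injective ones contributing nothing.\<close>

lemma sum_vdm_square:
  fixes X :: "int set" and w :: "int \<Rightarrow> real"
  assumes "finite X"
  shows "(\<Sum>H | H \<subseteq> X \<and> card H = n. vdm H ^ 2 * (\<Prod>x\<in>H. w x))
    = dt n (\<lambda>i j. \<Sum>x\<in>X. of_int x ^ i * (of_int x ^ j * w x))"
proof -
  let ?S = "{H. H \<subseteq> X \<and> card H = n}" and ?E = "PiE {..<n} (\<lambda>_. X)"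
  let ?F = "\<lambda>H. vdm H ^ 2 * (\<Prod>x\<in>H. w x)"
  have finS: "finite ?S" using assms by simp
  have finE: "finite ?E" using assms by (intro finite_PiE) auto
  have "fact n * dt n (\<lambda>i j. \<Sum>x\<in>X. of_int x ^ i * (of_int x ^ j * w x))
    = (\<Sum>\<phi>\<in>?E. dt n (\<lambda>i j. of_int (\<phi> i) ^ j) * dt n (\<lambda>i j. of_int (\<phi> i) ^ j * w (\<phi> i)))"
    using fact_dt_sum[OF assms, of n "\<lambda>i x. of_int x ^ i" "\<lambda>j x. of_int x ^ j * w x"] by simp
  also have "\<dots> = (\<Sum>\<phi>\<in>?E. (dt n (\<lambda>i j. of_int (\<phi> i) ^ j))\<^sup>2 * (\<Prod>i<n. w (\<phi> i)))"
    using dt_scale_rows[of n "\<lambda>i. w (\<phi> i)" "\<lambda>i j. of_int (\<phi> i) ^ j" for \<phi>]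
    by (simp add: mult.commute power2_eq_square mult.left_commute)
  also have "\<dots> = (\<Sum>\<phi>\<in>{\<phi> \<in> ?E. inj_on \<phi> {..<n}}. (dt n (\<lambda>i j. of_int (\<phi> i) ^ j))\<^sup>2 * (\<Prod>i<n. w (\<phi> i)))"
  proof (rule sum.mono_neutral_right[OF finE])
    show "\<forall>\<phi>\<in>?E - {\<phi> \<in> ?E. inj_on \<phi> {..<n}}. (dt n (\<lambda>i j. real_of_int (\<phi> i) ^ j))\<^sup>2 * (\<Prod>i<n. w (\<phi> i)) = 0"
    proof
      fix \<phi> assume "\<phi> \<in> ?E - {\<phi> \<in> ?E. inj_on \<phi> {..<n}}"
      then obtain i j where "i < n" "j < n" "i \<noteq> j" "\<phi> i = \<phi> j" by (auto simp: inj_on_def)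
      then have "dt n (\<lambda>i j. real_of_int (\<phi> i) ^ j) = 0" by (intro dt_identical_rows[of i j]) auto
      then show "(dt n (\<lambda>i j. real_of_int (\<phi> i) ^ j))\<^sup>2 * (\<Prod>i<n. w (\<phi> i)) = 0" by simp
    qed
  qed auto
  also have "\<dots> = (\<Sum>\<phi>\<in>{\<phi> \<in> ?E. inj_on \<phi> {..<n}}. ?F (\<phi> ` {..<n}))"
    by (intro sum.cong) (auto simp: dt_power_square prod.reindex)
  also have "\<dots> = (\<Sum>H\<in>?S. \<Sum>\<phi>\<in>{\<phi> \<in> {\<phi> \<in> ?E. inj_on \<phi> {..<n}}. \<phi> ` {..<n} = H}. ?F (\<phi> ` {..<n}))"
  proof (rule sum.group[symmetric])
    show "finite {\<phi> \<in> ?E. inj_on \<phi> {..<n}}" by (rule finite_subset[OF _ finE]) auto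
  qed (use finS in \<open>auto simp: card_image PiE_def\<close>)
  also have "\<dots> = (\<Sum>H\<in>?S. fact n * ?F H)"
  proof (rule sum.cong)
    fix H assume H: "H \<in> ?S"
    then have finH: "finite H" using assms finite_subset by auto
    have "{\<phi> \<in> {\<phi> \<in> ?E. inj_on \<phi> {..<n}}. \<phi> ` {..<n} = H} = {\<phi> \<in> {..<n} \<rightarrow>\<^sub>E H. inj_on \<phi> {..<n}}"
    proof (intro equalityI subsetI)
      fix \<phi> assume \<phi>: "\<phi> \<in> {\<phi> \<in> {..<n} \<rightarrow>\<^sub>E H. inj_on \<phi> {..<n}}"
      then have "card (\<phi> ` {..<n}) = card H" using H by (simp add: card_image)
      moreover have "\<phi> ` {..<n} \<subseteq> H" using \<phi> by auto
      ultimately have "\<phi> ` {..<n} = H" using finH by (simp add: card_subset_eq)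
      then show "\<phi> \<in> {\<phi> \<in> {\<phi> \<in> ?E. inj_on \<phi> {..<n}}. \<phi> ` {..<n} = H}"
        using \<phi> H by (auto simp: PiE_iff)
    qed (auto simp: PiE_iff)
    then have "card {\<phi> \<in> {\<phi> \<in> ?E. inj_on \<phi> {..<n}}. \<phi> ` {..<n} = H} = fact n"
      using card_inj_on_subset_funcset[of "{..<n}" H "{..<n}"] finH H
      by (simp add: fact_prod_rev)
    then show "(\<Sum>\<phi>\<in>{\<phi> \<in> {\<phi> \<in> ?E. inj_on \<phi> {..<n}}. \<phi> ` {..<n} = H}. ?F (\<phi> ` {..<n})) = fact n * ?F H"
      by (subst sum.cong[OF refl, of _ _ "\<lambda>_. ?F H"]) auto
  qed simp
  finally show ?thesis by (simp add: sum_distrib_left[symmetric])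
qed

text \<open>Particle-hole exchange. On the right, pairs inside \<open>A\<close> occur twice and
  pairs between \<open>A\<close> and \<open>L - A\<close> once; on the left, \<open>vdm L\<close>
  supplies each pair once and \<open>vdm A\<close> the second copy. When \<open>L\<close> is an
  interval, the inner products are products of two factorials
  (\<open>prod_int_dist\<close>).\<close>

lemma vdm_complement:
  assumes "finite L" "A \<subseteq> L"
  shows "vdm L * vdm A = vdm (L - A) * (\<Prod>x\<in>A. \<Prod>y\<in>L - {x}. \<bar>real_of_int (y - x)\<bar>)"
proof -
  let ?B = "L - A"
  have fin: "finite A" "finite ?B" using assms finite_subset by auto
  let ?P = "\<lambda>A B. {(x, y). x \<in> A \<and> y \<in> B \<and> x < y}"
  have finP: "finite (?P A' B')" if "A' \<subseteq> L" "B' \<subseteq> L" for A' B'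
    by (rule finite_subset[of _ "L \<times> L"]) (use that assms in auto)
  have fP: "finite (?P A A)" "finite (?P ?B ?B)" "finite (?P A ?B)" "finite (?P ?B A)"
      "finite {(x, y). x \<in> A \<and> y \<in> ?B \<and> y < x}"
    by (rule finP; use assms in blast)+ (rule finite_subset[of _ "L \<times> L"]; use assms in auto)
  let ?pr = "\<lambda>S. \<Prod>(x, y)\<in>S. real_of_int (y - x)"
  have "{(x, y). x \<in> L \<and> y \<in> L \<and> x < y} = (?P A A \<union> ?P ?B ?B) \<union> (?P A ?B \<union> ?P ?B A)"
    using assms(2) by auto
  then have "vdm L = ?pr ((?P A A \<union> ?P ?B ?B) \<union> (?P A ?B \<union> ?P ?B A))" by (simp add: vdm_def)
  also have "\<dots> = ?pr (?P A A \<union> ?P ?B ?B) * ?pr (?P A ?B \<union> ?P ?B A)"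
    by (rule prod.union_disjoint; (intro finite_UnI fP)?; blast?)
  also have "?pr (?P A A \<union> ?P ?B ?B) = ?pr (?P A A) * ?pr (?P ?B ?B)"
    by (rule prod.union_disjoint; (intro finite_UnI fP)?; blast?)
  also have "?pr (?P A ?B \<union> ?P ?B A) = ?pr (?P A ?B) * ?pr (?P ?B A)"
    by (rule prod.union_disjoint; (intro finite_UnI fP)?; blast?)
  finally have L: "vdm L = vdm A * vdm ?B * (?pr (?P A ?B) * ?pr (?P ?B A))"
    by (simp add: vdm_def)
  have cross: "(\<Prod>x\<in>A. \<Prod>y\<in>?B. \<bar>real_of_int (y - x)\<bar>) = ?pr (?P A ?B) * ?pr (?P ?B A)"
  proof -
    have "(\<Prod>x\<in>A. \<Prod>y\<in>?B. \<bar>real_of_int (y - x)\<bar>) = (\<Prod>(x, y)\<in>A \<times> ?B. \<bar>real_of_int (y - x)\<bar>)"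
      using fin by (intro prod.Sigma) auto
    also have "A \<times> ?B = ?P A ?B \<union> {(x, y). x \<in> A \<and> y \<in> ?B \<and> y < x}"
      by (auto, metis linorder_neqE)
    also have "(\<Prod>(x, y)\<in>\<dots>. \<bar>real_of_int (y - x)\<bar>) = (\<Prod>(x, y)\<in>?P A ?B. \<bar>real_of_int (y - x)\<bar>)
       * (\<Prod>(x, y)\<in>{(x, y). x \<in> A \<and> y \<in> ?B \<and> y < x}. \<bar>real_of_int (y - x)\<bar>)"
      by (rule prod.union_disjoint[OF fP(3) fP(5)]) auto
    also have "(\<Prod>(x, y)\<in>?P A ?B. \<bar>real_of_int (y - x)\<bar>) = ?pr (?P A ?B)"
      by (intro prod.cong) auto
    also have "(\<Prod>(x, y)\<in>{(x, y). x \<in> A \<and> y \<in> ?B \<and> y < x}. \<bar>real_of_int (y - x)\<bar>) = ?pr (?P ?B A)"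
      by (rule prod.reindex_bij_witness[of _ prod.swap prod.swap]) auto
    finally show ?thesis .
  qed
  have "(\<Prod>x\<in>A. \<Prod>y\<in>L - {x}. \<bar>real_of_int (y - x)\<bar>)
    = (\<Prod>x\<in>A. (\<Prod>y\<in>A - {x}. \<bar>real_of_int (y - x)\<bar>) * (\<Prod>y\<in>?B. \<bar>real_of_int (y - x)\<bar>))"
  proof (rule prod.cong)
    fix x assume "x \<in> A"
    then have "L - {x} = (A - {x}) \<union> ?B" using assms by auto
    then show "(\<Prod>y\<in>L - {x}. \<bar>real_of_int (y - x)\<bar>)
       = (\<Prod>y\<in>A - {x}. \<bar>real_of_int (y - x)\<bar>) * (\<Prod>y\<in>?B. \<bar>real_of_int (y - x)\<bar>)"
      using fin by (simp only:) (intro prod.union_disjoint, auto)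
  qed simp
  also have "\<dots> = vdm A ^ 2 * (?pr (?P A ?B) * ?pr (?P ?B A))"
    unfolding prod.distrib vdm_square[OF fin(1)] cross ..
  finally show ?thesis by (simp add: L power2_eq_square mult_ac)
qed

section \<open>Hafnians\<close>

definition pairings :: "'a set \<Rightarrow> 'a set set set" where
  "pairings C = {T. partition_on C T \<and> (\<forall>D\<in>T. card D = 2)}"

text \<open>A hafnian needs no bipartition of the cells: blocks are unordered pairs, and forbidding
  a pair means giving it weight 0.\<close>

definition haf :: "('a set \<Rightarrow> real) \<Rightarrow> 'a set \<Rightarrow> real" where
  "haf w C = (\<Sum>T\<in>pairings C. \<Prod>D\<in>T. w D)"

lemma pairings_empty [simp]: "pairings {} = {{}}"
  by (auto simp: pairings_def partition_on_def)

lemma haf_empty [simp]: "haf w {} = 1"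
  by (simp add: haf_def)

lemma finite_pairings: "finite C \<Longrightarrow> finite (pairings C)"
  by (rule finite_subset[of _ "Pow (Pow C)"]) (auto simp: pairings_def partition_on_def)

lemma pairings_subset: "T \<in> pairings C \<Longrightarrow> D \<in> T \<Longrightarrow> D \<subseteq> C"
  by (auto simp: pairings_def partition_on_def)

lemma pairings_insert:
  assumes "T \<in> pairings (C - {c, x})" "c \<in> C" "x \<in> C" "x \<noteq> c"
  shows "insert {c, x} T \<in> pairings C"
  using assms unfolding pairings_def partition_on_def disjoint_def
  by (auto simp: card_insert_if)

lemma pairings_remove:
  assumes "T \<in> pairings C" "D \<in> T"
  shows "T - {D} \<in> pairings (C - D)"
  using assms unfolding pairings_def partition_on_def disjoint_def by auto

text \<open>The matchings are sorted by the partner of \<open>c\<close>. The block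
  \<open>{c, x}\<close> is the only one containing \<open>c\<close>, so it can be recovered from the
  matching, and removing it leaves a matching of the rest.\<close>

lemma haf_expand:
  assumes "finite C" "c \<in> C"
  shows "haf w C = (\<Sum>x\<in>C - {c}. w {c, x} * haf w (C - {c, x}))"
proof -
  let ?A = "SIGMA x:C - {c}. pairings (C - {c, x})"
  let ?f = "\<lambda>(x, T). insert {c, x} T"
  have notin: "{c, x} \<notin> T" if "T \<in> pairings (C - {c, x})" for x T
    using pairings_subset[OF that] by auto
  have inj: "inj_on ?f ?A"
  proof (rule inj_onI)
    fix z z' assume z: "z \<in> ?A" "z' \<in> ?A" "?f z = ?f z'"
    obtain x T y T' where zz: "z = (x, T)" "z' = (y, T')" by (cases z, cases z')
    have x: "x \<in> C" "x \<noteq> c" "T \<in> pairings (C - {c, x})"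
      and y: "y \<in> C" "y \<noteq> c" "T' \<in> pairings (C - {c, y})"
      and eq: "insert {c, x} T = insert {c, y} T'"
      using z by (auto simp: zz)
    have "{c, x} \<notin> T'" using pairings_subset[OF y(3)] by blast
    with eq have "{c, x} = {c, y}" by blast
    then have "x = y" by (auto simp: doubleton_eq_iff)
    then show "z = z'"
      using eq notin[OF x(3)] notin[OF y(3)] by (metis insert_ident zz)
  qed
  have im: "?f ` ?A = pairings C"
  proof (intro equalityI subsetI)
    fix T assume "T \<in> ?f ` ?A"
    then obtain x T' where "T = insert {c, x} T'" "x \<in> C - {c}" "T' \<in> pairings (C - {c, x})"
      by auto
    then show "T \<in> pairings C" using pairings_insert[of T' C c x] assms(2) by simp
  next
    fix T assume T: "T \<in> pairings C"
    then obtain D where D: "D \<in> T" "c \<in> D"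
      using assms(2) by (auto simp: pairings_def partition_on_def)
    then have "card D = 2" using T by (auto simp: pairings_def)
    then obtain x where x: "D = {c, x}" "x \<noteq> c"
      using D(2) by (metis card_2_iff doubleton_eq_iff insertE singletonD)
    have "T = ?f (x, T - {D})" using D x by auto
    moreover have "(x, T - {D}) \<in> ?A"
      using pairings_remove[OF T D(1)] pairings_subset[OF T D(1)] x by auto
    ultimately show "T \<in> ?f ` ?A" by (rule image_eqI)
  qed
  have fin: "finite T" if "T \<in> pairings (C - {c, x})" for x T
    using pairings_subset[OF that] assms(1)
    by (meson Diff_subset finite_Pow_iff finite_subset PowI subset_trans subsetI)
  have "haf w C = (\<Sum>z\<in>?A. \<Prod>D\<in>?f z. w D)"
    unfolding haf_def im[symmetric] by (subst sum.reindex[OF inj]) simp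
  also have "\<dots> = (\<Sum>(x, T)\<in>?A. w {c, x} * (\<Prod>D\<in>T. w D))"
    by (rule sum.cong) (auto simp: notin fin)
  also have "\<dots> = (\<Sum>x\<in>C - {c}. \<Sum>T\<in>pairings (C - {c, x}). w {c, x} * (\<Prod>D\<in>T. w D))"
    by (rule sum.Sigma[symmetric]) (use assms(1) in \<open>auto simp: finite_pairings\<close>)
  finally show ?thesis by (simp add: haf_def sum_distrib_left)
qed

lemma haf_cong:
  assumes "finite C" "\<And>x y. x \<in> C \<Longrightarrow> y \<in> C \<Longrightarrow> x \<noteq> y \<Longrightarrow> w {x, y} = w' {x, y}"
  shows "haf w C = haf w' C"
proof -
  have "w D = w' D" if "T \<in> pairings C" "D \<in> T" for T D
  proof -
    have "card D = 2" using that by (auto simp: pairings_def)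
    then obtain x y where "D = {x, y}" "x \<noteq> y" by (meson card_2_iff)
    then show ?thesis using assms(2) pairings_subset[OF that] by auto
  qed
  then show ?thesis unfolding haf_def by (intro sum.cong prod.cong) auto
qed

lemma haf_image:
  assumes "finite C" "inj_on f C"
  shows "haf w (f ` C) = haf (\<lambda>D. w (f ` D)) C"
  using assms
proof (induction "card C" arbitrary: C rule: less_induct)
  case less
  show ?case
  proof (cases "C = {}")
    case False
    then obtain c where c: "c \<in> C" by blast
    have inj: "inj_on f (C - {c})" using less.prems(2) by (rule inj_on_subset) auto
    have "haf w (f ` C) = (\<Sum>x\<in>f ` C - {f c}. w {f c, x} * haf w (f ` C - {f c, x}))"
      using less.prems c by (intro haf_expand) auto
    also have "f ` C - {f c} = f ` (C - {c})"
      using less.prems(2) c by (auto dest: inj_onD)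
    also have "(\<Sum>x\<in>f ` (C - {c}). w {f c, x} * haf w (f ` C - {f c, x}))
        = (\<Sum>x\<in>C - {c}. w {f c, f x} * haf w (f ` C - {f c, f x}))"
      by (subst sum.reindex[OF inj]) simp
    also have "\<dots> = (\<Sum>x\<in>C - {c}. w (f ` {c, x}) * haf (\<lambda>D. w (f ` D)) (C - {c, x}))"
    proof (rule sum.cong)
      fix x assume x: "x \<in> C - {c}"
      have "f ` C - {f c, f x} = f ` (C - {c, x})"
        using less.prems(2) c x by (auto dest: inj_onD)
      moreover have "card (C - {c, x}) < card C"
        using less.prems(1) c by (intro psubset_card_mono) auto
      then have "haf w (f ` (C - {c, x})) = haf (\<lambda>D. w (f ` D)) (C - {c, x})"
        using less.prems by (intro less.hyps) (auto intro: inj_on_subset)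
      ultimately show "w {f c, f x} * haf w (f ` C - {f c, f x})
          = w (f ` {c, x}) * haf (\<lambda>D. w (f ` D)) (C - {c, x})" by simp
    qed simp
    also have "\<dots> = haf (\<lambda>D. w (f ` D)) C"
      using less.prems c by (intro haf_expand[symmetric]) auto
    finally show ?thesis .
  qed simp
qed

lemma haf_eq_0:
  assumes "finite C" "c \<in> C" "\<And>x. x \<in> C \<Longrightarrow> x \<noteq> c \<Longrightarrow> w {c, x} = 0"
  shows "haf w C = 0"
  by (subst haf_expand[OF assms(1,2)]) (auto intro!: sum.neutral simp: assms(3))

lemma haf_split:
  assumes "finite L" "finite M" "finite R" "L \<inter> M = {}" "L \<inter> R = {}" "M \<inter> R = {}"
    and "\<And>x y. x \<in> L \<Longrightarrow> y \<in> R \<Longrightarrow> w {x, y} = 0"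
    and "\<And>x y. x \<in> M \<Longrightarrow> y \<in> M \<Longrightarrow> w {x, y} = 0"
  shows "haf w (L \<union> M \<union> R) = (\<Sum>S\<in>Pow M. haf w (L \<union> S) * haf w ((M - S) \<union> R))"
  using assms
proof (induction "card R" arbitrary: M R rule: less_induct)
  case less
  show ?case
  proof (cases "R = {}")
    case True
    have "haf w (M - S) = 0" if "S \<in> Pow M - {M}" for S
    proof -
      from that obtain c where "c \<in> M - S" by blast
      then show ?thesis using less.prems by (intro haf_eq_0[of _ c]) auto
    qed
    then have "(\<Sum>S\<in>Pow M. haf w (L \<union> S) * haf w (M - S)) = (\<Sum>S\<in>{M}. haf w (L \<union> S) * haf w (M - S))"
      using less.prems by (intro sum.mono_neutral_right) auto
    then show ?thesis using True by simp
  next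
    case False
    then obtain c where c: "c \<in> R" by blast
    have cn: "c \<notin> L" "c \<notin> M" using c less.prems by auto
    have card: "card (R - {c} - X) < card R" for X
      using c less.prems(3) by (intro psubset_card_mono) auto
    let ?R = "R - {c}"
    have "haf w (L \<union> M \<union> R) = (\<Sum>x\<in>L \<union> M \<union> R - {c}. w {c, x} * haf w (L \<union> M \<union> R - {c, x}))"
      using less.prems c by (intro haf_expand) auto
    also have "\<dots> = (\<Sum>x\<in>M \<union> ?R. w {c, x} * haf w (L \<union> M \<union> R - {c, x}))"
      using less.prems c cn by (intro sum.mono_neutral_right) (auto simp: insert_commute)
    also have "\<dots> = (\<Sum>x\<in>M. w {c, x} * haf w (L \<union> M \<union> R - {c, x}))
        + (\<Sum>x\<in>?R. w {c, x} * haf w (L \<union> M \<union> R - {c, x}))"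
      using less.prems by (intro sum.union_disjoint) auto
    also have "(\<Sum>x\<in>M. w {c, x} * haf w (L \<union> M \<union> R - {c, x}))
       = (\<Sum>x\<in>M. \<Sum>S\<in>{S \<in> Pow M. x \<notin> S}. w {c, x} * (haf w (L \<union> S) * haf w ((M - S \<union> R) - {c, x})))"
    proof (rule sum.cong)
      fix x assume x: "x \<in> M"
      have "L \<union> M \<union> R - {c, x} = L \<union> (M - {x}) \<union> (?R - {})"
        using x less.prems cn by auto
      also have "haf w \<dots> = (\<Sum>S\<in>Pow (M - {x}). haf w (L \<union> S) * haf w ((M - {x} - S) \<union> (?R - {})))"
        using less.prems by (intro less.hyps card) auto
      also have "\<dots> = (\<Sum>S\<in>{S \<in> Pow M. x \<notin> S}. haf w (L \<union> S) * haf w ((M - S \<union> R) - {c, x}))"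
      proof (rule sum.cong)
        fix S assume "S \<in> {S \<in> Pow M. x \<notin> S}"
        have "(M - {x} - S) \<union> (?R - {}) = (M - S \<union> R) - {c, x}"
          using x less.prems cn by auto
        then show "haf w (L \<union> S) * haf w ((M - {x} - S) \<union> (?R - {}))
          = haf w (L \<union> S) * haf w ((M - S \<union> R) - {c, x})" by simp
      qed auto
      finally show "w {c, x} * haf w (L \<union> M \<union> R - {c, x})
        = (\<Sum>S\<in>{S \<in> Pow M. x \<notin> S}. w {c, x} * (haf w (L \<union> S) * haf w ((M - S \<union> R) - {c, x})))"
        by (simp add: sum_distrib_left)
    qed simp
    also have "\<dots> = (\<Sum>S\<in>Pow M. \<Sum>x\<in>{x \<in> M. x \<notin> S}. w {c, x} * (haf w (L \<union> S) * haf w ((M - S \<union> R) - {c, x})))"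
      using less.prems by (intro sum.swap_restrict) auto
    also have "(\<Sum>x\<in>?R. w {c, x} * haf w (L \<union> M \<union> R - {c, x}))
       = (\<Sum>x\<in>?R. \<Sum>S\<in>Pow M. w {c, x} * (haf w (L \<union> S) * haf w ((M - S \<union> R) - {c, x})))"
    proof (rule sum.cong)
      fix x assume x: "x \<in> ?R"
      have "L \<union> M \<union> R - {c, x} = L \<union> M \<union> (?R - {x})"
        using x less.prems cn by auto
      also have "haf w \<dots> = (\<Sum>S\<in>Pow M. haf w (L \<union> S) * haf w ((M - S) \<union> (?R - {x})))"
        using less.prems by (intro less.hyps card) auto
      also have "\<dots> = (\<Sum>S\<in>Pow M. haf w (L \<union> S) * haf w ((M - S \<union> R) - {c, x}))"
      proof (rule sum.cong)
        fix S assume "S \<in> Pow M"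
        have "(M - S) \<union> (?R - {x}) = (M - S \<union> R) - {c, x}"
          using x less.prems cn by auto
        then show "haf w (L \<union> S) * haf w ((M - S) \<union> (?R - {x}))
          = haf w (L \<union> S) * haf w ((M - S \<union> R) - {c, x})" by simp
      qed auto
      finally show "w {c, x} * haf w (L \<union> M \<union> R - {c, x})
        = (\<Sum>S\<in>Pow M. w {c, x} * (haf w (L \<union> S) * haf w ((M - S \<union> R) - {c, x})))"
        by (simp add: sum_distrib_left)
    qed simp
    also have "\<dots> = (\<Sum>S\<in>Pow M. \<Sum>x\<in>?R. w {c, x} * (haf w (L \<union> S) * haf w ((M - S \<union> R) - {c, x})))"
      by (rule sum.swap)
    also have "(\<Sum>S\<in>Pow M. \<Sum>x\<in>{x \<in> M. x \<notin> S}. w {c, x} * (haf w (L \<union> S) * haf w ((M - S \<union> R) - {c, x}))) + \<dots>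
      = (\<Sum>S\<in>Pow M. haf w (L \<union> S) * haf w ((M - S) \<union> R))"
      unfolding sum.distrib[symmetric]
    proof (rule sum.cong)
      fix S assume "S \<in> Pow M"
      have "haf w ((M - S) \<union> R) = (\<Sum>x\<in>(M - S) \<union> R - {c}. w {c, x} * haf w ((M - S) \<union> R - {c, x}))"
        using less.prems c by (intro haf_expand) auto
      also have "(M - S) \<union> R - {c} = {x \<in> M. x \<notin> S} \<union> ?R" using cn by auto
      also have "(\<Sum>x\<in>\<dots>. w {c, x} * haf w ((M - S) \<union> R - {c, x}))
         = (\<Sum>x\<in>{x \<in> M. x \<notin> S}. w {c, x} * haf w ((M - S) \<union> R - {c, x})) + (\<Sum>x\<in>?R. w {c, x} * haf w ((M - S) \<union> R - {c, x}))"
        using less.prems by (intro sum.union_disjoint) auto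
      finally show "(\<Sum>x\<in>{x \<in> M. x \<notin> S}. w {c, x} * (haf w (L \<union> S) * haf w ((M - S \<union> R) - {c, x})))
          + (\<Sum>x\<in>?R. w {c, x} * (haf w (L \<union> S) * haf w ((M - S \<union> R) - {c, x})))
          = haf w (L \<union> S) * haf w ((M - S) \<union> R)"
        by (simp add: distrib_left sum_distrib_left mult.left_commute)
    qed simp
    finally show ?thesis .
  qed
qed

section \<open>Layer coordinates and the removal of a last layer\<close>

text \<open>A point \<open>(d, J)\<close> is a cell on the diagonal layer \<open>d\<close> at height \<open>J\<close>. In these coordinates every
  domino joins consecutive layers: a horizontal one keeps the height, a vertical one raises it.\<close>

definition dw :: "real \<Rightarrow> (int \<times> int) set \<Rightarrow> real" where
  "dw a D = (if \<exists>d J. D = {(d, J), (d + 1, J)} then 1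
     else if \<exists>d J. D = {(d, J), (d + 1, J + 1)} then a else 0)"

lemma dw_pair:
  "dw a {(d, J), (d', J')} =
     (if d' = d + 1 then (if J' = J then 1 else if J' = J + 1 then a else 0)
      else if d = d' + 1 then (if J' = J then 1 else if J = J' + 1 then a else 0) else 0)"
proof -
  have h: "(\<exists>e K. {(d, J), (d', J')} = {(e, K), (e + 1, K)}) \<longleftrightarrow> J' = J \<and> (d' = d + 1 \<or> d = d' + 1)"
    unfolding doubleton_eq_iff prod.inject by blast
  have v: "(\<exists>e K. {(d, J), (d', J')} = {(e, K), (e + 1, K + 1)})
      \<longleftrightarrow> (d' = d + 1 \<and> J' = J + 1) \<or> (d = d' + 1 \<and> J = J' + 1)"
    unfolding doubleton_eq_iff prod.inject by blast
  show ?thesis unfolding dw_def h v by auto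
qed

text \<open>The cells of \<open>C\<close> lie in layers up to \<open>d\<close>, so
  \<open>(d + 1, b)\<close> can only be paired with height \<open>b\<close> of layer
  \<open>d\<close> (horizontal, weight 1) or with height \<open>b - 1\<close> (vertical, weight
  \<open>a\<close>). The function \<open>g\<close> records these heights; it comes from a matching
  when it is injective and the chosen cells belong to \<open>C\<close>. The cells of
  \<open>B\<close> are removed one at a time.\<close>

lemma haf_peel:
  assumes "finite B" "finite C" "\<And>x. x \<in> C \<Longrightarrow> fst x \<le> d"
  shows "haf (dw a) (C \<union> {d + 1} \<times> B) =
    (\<Sum>g\<in>PiE B (\<lambda>b. {b, b - 1}). if inj_on g B \<and> {d} \<times> g ` B \<subseteq> C
        then (\<Prod>b\<in>B. if g b = b then 1 else a) * haf (dw a) (C - {d} \<times> g ` B) else 0)"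
proof -
  let ?S = "\<lambda>B C. (\<Sum>g\<in>PiE B (\<lambda>b. {b, b - 1}). if inj_on g B \<and> {d} \<times> g ` B \<subseteq> C
        then (\<Prod>b\<in>B. if g b = b then 1 else a) * haf (dw a) (C - {d} \<times> g ` B) else 0)"
  have step: "haf (dw a) (C \<union> {d + 1} \<times> insert b B) = ?S (insert b B) C"
    if fB: "finite B" and bB: "b \<notin> B" and fC: "finite C" and low: "\<forall>x\<in>C. fst x \<le> d"
      and IH: "\<forall>C. finite C \<longrightarrow> (\<forall>x\<in>C. fst x \<le> d) \<longrightarrow> haf (dw a) (C \<union> {d + 1} \<times> B) = ?S B C"
    for b B C
  proof -
  let ?c = "(d + 1, b)"
  let ?C = "C \<union> {d + 1} \<times> insert b B"
  let ?w = "\<lambda>b x. if x = b then 1 else a"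
  let ?F = "\<lambda>B C g. if inj_on g B \<and> {d} \<times> g ` B \<subseteq> C
        then (\<Prod>b\<in>B. ?w b (g b)) * haf (dw a) (C - {d} \<times> g ` B) else 0"
  have cC: "?c \<notin> C" using low by force
  have "haf (dw a) ?C = (\<Sum>x\<in>?C - {?c}. dw a {?c, x} * haf (dw a) (?C - {?c, x}))"
    using fB fC by (intro haf_expand) auto
  also have "\<dots> = (\<Sum>x\<in>Pair d ` {y \<in> {b, b - 1}. (d, y) \<in> C}. dw a {?c, x} * haf (dw a) (?C - {?c, x}))"
  proof (rule sum.mono_neutral_right)
    show "\<forall>x\<in>?C - {?c} - Pair d ` {y \<in> {b, b - 1}. (d, y) \<in> C}. dw a {?c, x} * haf (dw a) (?C - {?c, x}) = 0"
    proof
      fix x assume x: "x \<in> ?C - {?c} - Pair d ` {y \<in> {b, b - 1}. (d, y) \<in> C}"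
      obtain p q where pq: "x = (p, q)" by (cases x)
      have "dw a {?c, x} = 0" using x low unfolding pq dw_pair by (auto simp: image_iff)
      then show "dw a {?c, x} * haf (dw a) (?C - {?c, x}) = 0" by simp
    qed
  qed (use fB fC in auto)
  also have "\<dots> = (\<Sum>y\<in>{y \<in> {b, b - 1}. (d, y) \<in> C}. dw a {?c, (d, y)} * haf (dw a) (?C - {?c, (d, y)}))"
    by (subst sum.reindex) (auto simp: inj_on_def)
  also have "\<dots> = (\<Sum>y\<in>{y \<in> {b, b - 1}. (d, y) \<in> C}. ?w b y * (\<Sum>g\<in>PiE B (\<lambda>b. {b, b - 1}). ?F B (C - {(d, y)}) g))"
  proof (rule sum.cong)
    fix y assume y: "y \<in> {y \<in> {b, b - 1}. (d, y) \<in> C}"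
    have "?C - {?c, (d, y)} = (C - {(d, y)}) \<union> {d + 1} \<times> B"
      using cC bB y by auto
    moreover have "haf (dw a) ((C - {(d, y)}) \<union> {d + 1} \<times> B) = (\<Sum>g\<in>PiE B (\<lambda>b. {b, b - 1}). ?F B (C - {(d, y)}) g)"
      using fC low by (intro IH[rule_format]) auto
    moreover have "dw a {?c, (d, y)} = ?w b y" using y by (auto simp: dw_pair)
    ultimately show "dw a {?c, (d, y)} * haf (dw a) (?C - {?c, (d, y)})
       = ?w b y * (\<Sum>g\<in>PiE B (\<lambda>b. {b, b - 1}). ?F B (C - {(d, y)}) g)" by simp
  qed simp
  also have "\<dots> = (\<Sum>y\<in>{b, b - 1}. if (d, y) \<in> C then ?w b y * (\<Sum>g\<in>PiE B (\<lambda>b. {b, b - 1}). ?F B (C - {(d, y)}) g) else 0)"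
    by (rule sum.inter_filter) auto
  also have "\<dots> = (\<Sum>y\<in>{b, b - 1}. \<Sum>g\<in>PiE B (\<lambda>b. {b, b - 1}). ?F (insert b B) C (g(b := y)))"
  proof (rule sum.cong)
    fix y
    show "(if (d, y) \<in> C then ?w b y * (\<Sum>g\<in>PiE B (\<lambda>b. {b, b - 1}). ?F B (C - {(d, y)}) g) else 0)
      = (\<Sum>g\<in>PiE B (\<lambda>b. {b, b - 1}). ?F (insert b B) C (g(b := y)))"
    proof (cases "(d, y) \<in> C")
      case True
      \<comment> \<open>Choosing \<open>y\<close> for \<open>b\<close> and then \<open>g\<close> on
        \<open>B\<close> is choosing \<open>g(b := y)\<close>. That the image of \<open>g\<close>
        must lie in \<open>C\<close> without \<open>(d, y)\<close> is the injectivity of the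
        extended function at \<open>b\<close>.\<close>
      have "?w b y * ?F B (C - {(d, y)}) g = ?F (insert b B) C (g(b := y))" for g
      proof -
        have im: "(g(b := y)) ` insert b B = insert y (g ` B)" using bB by auto
        have inj: "inj_on (g(b := y)) (insert b B) \<longleftrightarrow> inj_on g B \<and> y \<notin> g ` B"
        proof -
          have "inj_on (g(b := y)) B \<longleftrightarrow> inj_on g B"
            by (rule inj_on_cong) (use bB in auto)
          moreover have "(g(b := y)) ` (B - {b}) = g ` B" using bB by auto
          ultimately show ?thesis unfolding inj_on_insert by simp
        qed
        have C: "C - {d} \<times> insert y (g ` B) = C - {(d, y)} - {d} \<times> g ` B" by auto
        have sub: "{d} \<times> insert y (g ` B) \<subseteq> C \<longleftrightarrow> {d} \<times> g ` B \<subseteq> C" using True by auto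
        have sub': "{d} \<times> g ` B \<subseteq> C - {(d, y)} \<longleftrightarrow> {d} \<times> g ` B \<subseteq> C \<and> y \<notin> g ` B" by auto
        have "(\<Prod>x\<in>insert b B. ?w x ((g(b := y)) x)) = ?w b y * (\<Prod>x\<in>B. ?w x ((g(b := y)) x))"
          using fB bB by (subst prod.insert) auto
        also have "(\<Prod>x\<in>B. ?w x ((g(b := y)) x)) = (\<Prod>x\<in>B. ?w x (g x))"
          using bB by (intro prod.cong) auto
        finally have prod: "(\<Prod>x\<in>insert b B. ?w x ((g(b := y)) x)) = ?w b y * (\<Prod>x\<in>B. ?w x (g x))" .
        show ?thesis unfolding im inj C sub sub' prod
          by (simp only: mult.assoc mult_zero_right if_distrib[of "(*) (?w b y)"] conj_ac)
      qed
      then show ?thesis using True by (simp add: sum_distrib_left)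
    next
      case False
      then show ?thesis by (auto intro!: sum.neutral[symmetric])
    qed
  qed simp
  also have "\<dots> = (\<Sum>(y, g)\<in>{b, b - 1} \<times> PiE B (\<lambda>b. {b, b - 1}). ?F (insert b B) C (g(b := y)))"
    by (rule sum.cartesian_product)
  also have "\<dots> = (\<Sum>g\<in>PiE (insert b B) (\<lambda>b. {b, b - 1}). ?F (insert b B) C g)"
  proof -
    have inj: "inj_on (\<lambda>(y, g). g(b := y)) ({b, b - 1} \<times> PiE B (\<lambda>b. {b, b - 1}))"
      using inj_combinator[OF bB, of "\<lambda>b. {b, b - 1}"] by simp
    show ?thesis
      unfolding PiE_insert_eq sum.reindex[OF inj] by (intro sum.cong) (auto simp only: comp_def split: prod.split)
  qed
  finally show ?thesis .
  qed
  have "\<forall>C. finite C \<longrightarrow> (\<forall>x\<in>C. fst x \<le> d) \<longrightarrow> haf (dw a) (C \<union> {d + 1} \<times> B) = ?S B C"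
    using assms(1)
  proof (rule finite_induct)
    show "\<forall>C. finite C \<longrightarrow> (\<forall>x\<in>C. fst x \<le> d) \<longrightarrow> haf (dw a) (C \<union> {d + 1} \<times> {}) = ?S {} C"
      by (simp only: PiE_empty_domain) simp
  next
    fix b B assume "finite B" "b \<notin> B"
      "\<forall>C. finite C \<longrightarrow> (\<forall>x\<in>C. fst x \<le> d) \<longrightarrow> haf (dw a) (C \<union> {d + 1} \<times> B) = ?S B C"
    then show "\<forall>C. finite C \<longrightarrow> (\<forall>x\<in>C. fst x \<le> d) \<longrightarrow>
        haf (dw a) (C \<union> {d + 1} \<times> insert b B) = ?S (insert b B) C"
      using step by (intro allI impI) blast
  qed
  then show ?thesis using assms(2,3) by blast
qed

section \<open>Domino tilings as perfect matchings of layers\<close>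

definition squares :: "(int \<times> int) set \<Rightarrow> (real \<times> real) set" where
  "squares D = (\<Union>(i, j)\<in>D. unit_square i j)"

definition vdom :: "int \<Rightarrow> int \<Rightarrow> (int \<times> int) set" where
  "vdom i j = {(i, j), (i, j + 1)}"

definition hdom :: "int \<Rightarrow> int \<Rightarrow> (int \<times> int) set" where
  "hdom i j = {(i, j), (i + 1, j)}"

definition cell_dominoes :: "(int \<times> int) set set" where
  "cell_dominoes = {vdom i j | i j. True} \<union> {hdom i j | i j. True}"

lemma squares_vdom: "squares (vdom i j) = {of_int i .. of_int i + 1} \<times> {of_int j .. of_int j + 2}"
  unfolding squares_def vdom_def unit_square_def by auto

lemma squares_hdom: "squares (hdom i j) = {of_int i .. of_int i + 2} \<times> {of_int j .. of_int j + 1}"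
  unfolding squares_def hdom_def unit_square_def by auto

text \<open>Closed squares overlap along edges, but a midpoint lies in a single one. Midpoints
  therefore serve as test points from which a set of cells is recovered.\<close>

lemma mid_in_unit_square: "(of_int i + 1/2, of_int j + 1/2) \<in> unit_square i' j' \<longleftrightarrow> i = i' \<and> j = j'"
proof
  assume "(of_int i + 1/2, of_int j + 1/2) \<in> unit_square i' j'"
  then have *: "real_of_int i' \<le> of_int i + 1/2" "of_int i + 1/2 \<le> real_of_int i' + 1"
     "real_of_int j' \<le> of_int j + 1/2" "of_int j + 1/2 \<le> real_of_int j' + 1"
    by (auto simp: unit_square_def)
  then show "i = i' \<and> j = j'" by linarith
qed (auto simp: unit_square_def)

lemma mid_in_squares: "(of_int i + 1/2, of_int j + 1/2) \<in> squares D \<longleftrightarrow> (i, j) \<in> D"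
  unfolding squares_def by (fastforce simp: mid_in_unit_square)

lemma inj_squares: "inj squares"
proof (rule injI)
  fix D E assume "squares D = squares E"
  then have "(i, j) \<in> D \<longleftrightarrow> (i, j) \<in> E" for i j
    using mid_in_squares by metis
  then show "D = E" by auto
qed

lemma dominoes_eq: "vertical_dominoes = squares ` {vdom i j | i j. True}"
  "horizontal_dominoes = squares ` {hdom i j | i j. True}"
  unfolding vertical_dominoes_def horizontal_dominoes_def image_Collect
    squares_vdom[symmetric] squares_hdom[symmetric] by auto

lemma all_dominoes_eq: "vertical_dominoes \<union> horizontal_dominoes = squares ` cell_dominoes"
  unfolding dominoes_eq cell_dominoes_def image_Un ..

text \<open>The interior of a domino also contains the open edge shared by its two cells; rounding
  down still assigns such a point to one of the two.\<close>

lemma interior_squares_cell: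
  assumes "D \<in> cell_dominoes" "(x, y) \<in> interior (squares D)"
  shows "(\<lfloor>x\<rfloor>, \<lfloor>y\<rfloor>) \<in> D"
  using assms(1) unfolding cell_dominoes_def
proof
  assume "D \<in> {vdom i j | i j. True}"
  then obtain i j where D: "D = vdom i j" by auto
  have "of_int i < x" "x < of_int i + 1" "of_int j < y" "y < of_int j + 2"
    using assms(2) unfolding D squares_vdom by (auto simp: interior_Times)
  then have "\<lfloor>x\<rfloor> = i" "\<lfloor>y\<rfloor> = j \<or> \<lfloor>y\<rfloor> = j + 1" by linarith+
  then show ?thesis by (auto simp: D vdom_def)
next
  assume "D \<in> {hdom i j | i j. True}"
  then obtain i j where D: "D = hdom i j" by auto
  have "of_int i < x" "x < of_int i + 2" "of_int j < y" "y < of_int j + 1"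
    using assms(2) unfolding D squares_hdom by (auto simp: interior_Times)
  then have "\<lfloor>y\<rfloor> = j" "\<lfloor>x\<rfloor> = i \<or> \<lfloor>x\<rfloor> = i + 1" by linarith+
  then show ?thesis by (auto simp: D hdom_def)
qed

lemma mid_in_interior:
  assumes "(i, j) \<in> D"
  shows "(of_int i + 1/2, of_int j + 1/2) \<in> interior (squares D)"
proof -
  have "(of_int i + 1/2, of_int j + 1/2) \<in> interior (unit_square i j)"
    by (simp add: unit_square_def interior_Times)
  moreover have "unit_square i j \<subseteq> squares D" using assms by (auto simp: squares_def)
  ultimately show ?thesis using interior_mono by blast
qed

lemma interior_squares_disjoint:
  assumes "D \<in> cell_dominoes" "E \<in> cell_dominoes"
  shows "interior (squares D) \<inter> interior (squares E) = {} \<longleftrightarrow> D \<inter> E = {}"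
proof
  assume disj: "interior (squares D) \<inter> interior (squares E) = {}"
  show "D \<inter> E = {}"
  proof (rule ccontr)
    assume "D \<inter> E \<noteq> {}"
    then obtain i j where "(i, j) \<in> D" "(i, j) \<in> E" by fastforce
    from mid_in_interior[OF this(1)] mid_in_interior[OF this(2)] disj show False by blast
  qed
next
  assume disj: "D \<inter> E = {}"
  show "interior (squares D) \<inter> interior (squares E) = {}"
  proof (rule ccontr)
    assume "interior (squares D) \<inter> interior (squares E) \<noteq> {}"
    then obtain x y where "(x, y) \<in> interior (squares D)" "(x, y) \<in> interior (squares E)" by fastforce
    from interior_squares_cell[OF assms(1) this(1)] interior_squares_cell[OF assms(2) this(2)] disj
    show False by blast
  qed
qed

definition cell_weight :: "real \<Rightarrow> (int \<times> int) set \<Rightarrow> real" where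
  "cell_weight a D = (if \<exists>i j. D = vdom i j then a else if \<exists>i j. D = hdom i j then 1 else 0)"

lemma cell_weight_eq_0: "D \<notin> cell_dominoes \<Longrightarrow> cell_weight a D = 0"
  unfolding cell_weight_def cell_dominoes_def by auto

lemma card_cell_domino: "D \<in> cell_dominoes \<Longrightarrow> card D = 2 \<and> D \<noteq> {}"
  by (auto simp: cell_dominoes_def vdom_def hdom_def)

text \<open>Disjointness of interiors becomes disjointness of cell sets, and covering becomes
  equality of unions of cells, by injectivity of \<open>squares\<close>. The preimage of a tiling
  consists of the cell dominoes whose squares belong to it.\<close>

lemma bij_betw_tilings:
  "bij_betw ((`) squares) {T \<in> pairings C. T \<subseteq> cell_dominoes}
    {T. T \<subseteq> vertical_dominoes \<union> horizontal_dominoes \<and>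
         pairwise (\<lambda>d e. interior d \<inter> interior e = {}) T \<and> \<Union> T = squares C}"
  (is "bij_betw _ ?A ?B")
  unfolding bij_betw_def
proof
  have inj: "squares D = squares E \<longleftrightarrow> D = E" for D E
    using inj_squares by (auto dest: injD)
  show "inj_on ((`) squares) ?A"
    using inj_squares by (intro inj_onI) (simp add: inj_image_eq_iff)
  have un: "squares (\<Union>T) = \<Union>(squares ` T)" for T by (auto simp: squares_def)
  show "(`) squares ` ?A = ?B"
  proof (intro equalityI subsetI)
    fix T' assume "T' \<in> (`) squares ` ?A"
    then obtain T where T: "T' = squares ` T" "T \<in> pairings C" "T \<subseteq> cell_dominoes" by auto
    have "\<Union>T' = squares C"
      using T(2) unfolding T(1) un[symmetric] by (simp add: pairings_def partition_on_def)
    moreover have "pairwise (\<lambda>d e. interior d \<inter> interior e = {}) T'"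
    proof (rule pairwiseI)
      fix d e assume "d \<in> T'" "e \<in> T'" "d \<noteq> e"
      then obtain D E where "D \<in> T" "E \<in> T" "d = squares D" "e = squares E" "D \<noteq> E"
        unfolding T(1) by auto
      moreover from this have "D \<inter> E = {}"
        using T(2) by (auto simp: pairings_def partition_on_def disjoint_def)
      ultimately show "interior d \<inter> interior e = {}"
        using interior_squares_disjoint T(3) by auto
    qed
    ultimately show "T' \<in> ?B" unfolding all_dominoes_eq using T by auto
  next
    fix T' assume T': "T' \<in> ?B"
    define T where "T = {D \<in> cell_dominoes. squares D \<in> T'}"
    have im: "squares ` T = T'" using T' unfolding all_dominoes_eq T_def by auto
    have "squares (\<Union>T) = squares C" using T' im by (simp add: un)
    then have "\<Union>T = C" by (simp add: inj)
    moreover have "D \<inter> E = {}" if "D \<in> T" "E \<in> T" "D \<noteq> E" for D E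
    proof -
      have "interior (squares D) \<inter> interior (squares E) = {}"
        using that T' by (auto simp: T_def pairwise_def inj)
      then show ?thesis using interior_squares_disjoint that by (auto simp: T_def)
    qed
    moreover have sub: "T \<subseteq> cell_dominoes" by (auto simp: T_def)
    then have "{} \<notin> T" "\<forall>D\<in>T. card D = 2" using card_cell_domino by blast+
    ultimately have "T \<in> ?A"
      using sub unfolding pairings_def partition_on_def disjoint_def by blast
    then show "T' \<in> (`) squares ` ?A" using im by blast
  qed
qed

text \<open>\<open>s\<close> is the slit, or empty for a domain without one. A domino whose interior
  meets \<open>s\<close> gets weight 0, as does any pair of cells that is no domino, so the sum over
  all pairings reduces to the tilings that respect \<open>s\<close>.\<close>

lemma sum_tilings_eq_haf:
  assumes "finite C"
  shows "(\<Sum>T\<in>{T \<in> {T. T \<subseteq> vertical_dominoes \<union> horizontal_dominoes \<and>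
         pairwise (\<lambda>d e. interior d \<inter> interior e = {}) T \<and> \<Union> T = squares C}.
           \<forall>d\<in>T. interior d \<inter> s = {}}. a ^ num_vertical T)
     = haf (\<lambda>D. if interior (squares D) \<inter> s = {} then cell_weight a D else 0) C"
    (is "sum _ {T \<in> ?B. _} = haf ?w C")
proof -
  let ?A = "{T \<in> pairings C. T \<subseteq> cell_dominoes}"
  have finB: "finite ?B"
    using bij_betw_finite[OF bij_betw_tilings[of C]] finite_pairings[OF assms] by simp
  have inj: "squares D = squares E \<longleftrightarrow> D = E" for D E
    using inj_squares by (auto dest: injD)
  have finT: "finite T" if "T \<in> pairings C" for T
    using pairings_subset[OF that] assms
    by (meson finite_Pow_iff finite_subset PowI subsetI)
  have "haf ?w C = (\<Sum>T\<in>?A. \<Prod>D\<in>T. ?w D)"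
    unfolding haf_def
  proof (rule sum.mono_neutral_right)
    show "\<forall>T\<in>pairings C - ?A. (\<Prod>D\<in>T. ?w D) = 0"
    proof
      fix T assume T: "T \<in> pairings C - ?A"
      then obtain D where "D \<in> T" "D \<notin> cell_dominoes" by auto
      then have "\<exists>D\<in>T. ?w D = 0" using cell_weight_eq_0 by auto
      then show "(\<Prod>D\<in>T. ?w D) = 0" using finT T by (simp add: prod_zero_iff)
    qed
  qed (use assms in \<open>auto simp: finite_pairings\<close>)
  also have "\<dots> = (\<Sum>T\<in>?A. if \<forall>d\<in>squares ` T. interior d \<inter> s = {} then a ^ num_vertical (squares ` T) else 0)"
  proof (rule sum.cong)
    fix T assume T: "T \<in> ?A"
    then have fin: "finite T" using finT by simp
    show "(\<Prod>D\<in>T. ?w D) = (if \<forall>d\<in>squares ` T. interior d \<inter> s = {} then a ^ num_vertical (squares ` T) else 0)"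
    proof (cases "\<forall>d\<in>squares ` T. interior d \<inter> s = {}")
      case True
      let ?V = "{vdom i j | i j. True}"
      have "(\<Prod>D\<in>T. ?w D) = (\<Prod>D\<in>T. if D \<in> ?V then a else 1)"
      proof (rule prod.cong)
        fix D assume D: "D \<in> T"
        then have "interior (squares D) \<inter> s = {}" "D \<in> cell_dominoes" using T True by blast+
        moreover from this have "D \<in> ?V \<or> (\<exists>i j. D = hdom i j)" unfolding cell_dominoes_def by blast
        ultimately show "?w D = (if D \<in> ?V then a else 1)"
          unfolding cell_weight_def mem_Collect_eq by (simp; blast)
      qed simp
      also have "\<dots> = a ^ card (T \<inter> ?V)"
        using fin by (simp add: prod.If_cases)
      also have "card (T \<inter> ?V) = card (squares ` (T \<inter> ?V))"
        using inj_squares by (intro card_image[symmetric]) (auto intro: inj_on_subset)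
      also have "squares ` (T \<inter> ?V) = squares ` T \<inter> vertical_dominoes"
        unfolding dominoes_eq using inj_squares by (simp add: image_Int)
      finally show ?thesis using True by (simp add: num_vertical_def)
    next
      case False
      then have "\<exists>D\<in>T. ?w D = 0" by auto
      then have "(\<Prod>D\<in>T. ?w D) = 0" using fin by (simp add: prod_zero_iff)
      then show ?thesis unfolding if_not_P[OF False] .
    qed
  qed simp
  also have "\<dots> = (\<Sum>T\<in>?B. if \<forall>d\<in>T. interior d \<inter> s = {} then a ^ num_vertical T else 0)"
    by (rule sum.reindex_bij_betw[OF bij_betw_tilings])
  also have "\<dots> = (\<Sum>T\<in>{T \<in> ?B. \<forall>d\<in>T. interior d \<inter> s = {}}. a ^ num_vertical T)"
    by (rule sum.inter_filter[symmetric, OF finB])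
  finally show ?thesis by simp
qed

section \<open>The cells of the two families of domains\<close>

definition part_cells :: "nat \<Rightarrow> nat \<Rightarrow> nat \<Rightarrow> (int \<times> int) set" where
  "part_cells N m k = {(i, j). \<bar>i + j + 1\<bar> \<le> int N \<and> \<bar>j - i\<bar> \<le> int N \<and>
     (i + j + 1 \<le> 2 * int m - 2 - int N \<or> j - i \<le> int N + 2 * int k - 2 * int m - 2)}"

lemma finite_part_cells: "finite (part_cells N m k)"
proof (rule finite_subset)
  show "part_cells N m k \<subseteq> {- int N - 1..int N + 1} \<times> {- int N - 1..int N + 1}"
    unfolding part_cells_def by auto
qed simp

lemma unit_square_subset_part:
  "unit_square i j \<subseteq> {(x, y). \<bar>x\<bar> + \<bar>y\<bar> \<le> real N + 1 \<and>
        y \<le> max (2 * real m - 1 - real N - x) (x - 2 * real m - 1 + real N + 2 * real k)}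
   \<longleftrightarrow> (i, j) \<in> part_cells N m k" (is "_ \<subseteq> ?R \<longleftrightarrow> _")
proof
  assume sub: "unit_square i j \<subseteq> ?R"
  have mem: "(x, y) \<in> unit_square i j \<Longrightarrow> (x, y) \<in> ?R" for x y using sub by blast
  \<comment> \<open>The corners give the diamond. The bound by a maximum is a union of two
    half-planes, and different corners could satisfy different alternatives; the midpoint of the top
    edge singles out one, and integrality sharpens its inequality to that of the whole
    square.\<close>
  have 1: "(of_int i, of_int j) \<in> ?R" "(of_int i + 1, of_int j) \<in> ?R" "(of_int i, of_int j + 1) \<in> ?R"
    "(of_int i + 1, of_int j + 1) \<in> ?R" "(of_int i + 1/2, of_int j + 1) \<in> ?R"
    by (intro mem; simp add: unit_square_def)+
  have "\<bar>i + j + 1\<bar> \<le> int N" "\<bar>j - i\<bar> \<le> int N"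
    using 1(1-4) unfolding mem_Collect_eq prod.case by linarith+
  moreover have "i + j + 1 \<le> 2 * int m - 2 - int N \<or> j - i \<le> int N + 2 * int k - 2 * int m - 2"
  proof -
    have "real_of_int j + 1 \<le> 2 * real m - 1 - real N - (of_int i + 1/2)
        \<or> real_of_int j + 1 \<le> of_int i + 1/2 - 2 * real m - 1 + real N + 2 * real k"
      using 1(5) by auto
    then show ?thesis by linarith
  qed
  ultimately show "(i, j) \<in> part_cells N m k" by (auto simp: part_cells_def)
next
  assume a: "(i, j) \<in> part_cells N m k"
  show "unit_square i j \<subseteq> ?R"
  proof clarify
    fix x y assume "(x, y) \<in> unit_square i j"
    then have xy: "of_int i \<le> x" "x \<le> of_int i + 1" "of_int j \<le> y" "y \<le> of_int j + 1"
      by (auto simp: unit_square_def)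
    have "\<bar>real_of_int i + of_int j + 1\<bar> \<le> real N" "\<bar>real_of_int j - of_int i\<bar> \<le> real N"
      using a unfolding part_cells_def mem_Collect_eq prod.case by linarith+
    then have "\<bar>x\<bar> + \<bar>y\<bar> \<le> real N + 1" using xy by linarith
    moreover have "real_of_int i + of_int j + 1 \<le> 2 * real m - 2 - real N
        \<or> real_of_int j - of_int i \<le> real N + 2 * real k - 2 * real m - 2"
      using a unfolding part_cells_def mem_Collect_eq prod.case by linarith
    then have "y \<le> 2 * real m - 1 - real N - x \<or> y \<le> x - 2 * real m - 1 + real N + 2 * real k"
      using xy by linarith
    ultimately show "\<bar>x\<bar> + \<bar>y\<bar> \<le> real N + 1 \<and> y \<le> max (2 * real m - 1 - real N - x) (x - 2 * real m - 1 + real N + 2 * real k)"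
      by (auto simp: le_max_iff_disj)
  qed
qed

lemma aztec_part_eq_squares: "aztec_part N m k = squares (part_cells N m k)"
  unfolding aztec_part_def squares_within_def unit_square_subset_part squares_def by auto

text \<open>A shear that makes the lines of constant \<open>i + j\<close> into layers. The shifts
  number the layers of the diamond from 0 to \<open>2 N\<close> and make all heights positive
  there.\<close>

definition to_layers :: "nat \<Rightarrow> int \<times> int \<Rightarrow> int \<times> int" where
  "to_layers N = (\<lambda>(i, j). (i + j + 1 + int N, j + int N + 1))"

lemma inj_to_layers: "inj_on (to_layers N) A"
  by (auto simp: inj_on_def to_layers_def)

lemma dw_to_layers: "c \<noteq> c' \<Longrightarrow> dw a (to_layers N ` {c, c'}) = cell_weight a {c, c'}"
proof -
  obtain i j i' j' where c: "c = (i, j)" "c' = (i', j')" by (cases c, cases c')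
  have v: "(\<exists>p q. {c, c'} = vdom p q) \<longleftrightarrow> i = i' \<and> (j' = j + 1 \<or> j = j' + 1)"
    unfolding c vdom_def doubleton_eq_iff prod.inject by blast
  have h: "(\<exists>p q. {c, c'} = hdom p q) \<longleftrightarrow> j = j' \<and> (i' = i + 1 \<or> i = i' + 1)"
    unfolding c hdom_def doubleton_eq_iff prod.inject by blast
  have im: "to_layers N ` {c, c'} = {(i + j + 1 + int N, j + int N + 1), (i' + j' + 1 + int N, j' + int N + 1)}"
    by (simp add: c to_layers_def)
  have none: "(if A then (if B then 1 else if E then a else 0)
      else if A' then (if B then 1 else if E' then a else 0) else 0) = 0"
    if "\<not> (A \<and> B)" "\<not> (A \<and> E)" "\<not> (A' \<and> B)" "\<not> (A' \<and> E')" for A B E A' E'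
    using that by auto
  have "(if i' + j' + 1 + int N = i + j + 1 + int N + 1
          then if j' + int N + 1 = j + int N + 1 then 1 else if j' + int N + 1 = j + int N + 1 + 1 then a else 0
          else if i + j + 1 + int N = i' + j' + 1 + int N + 1
            then if j' + int N + 1 = j + int N + 1 then 1 else if j + int N + 1 = j' + int N + 1 + 1 then a else 0
            else 0) =
         (if i = i' \<and> (j' = j + 1 \<or> j = j' + 1) then a
          else if j = j' \<and> (i' = i + 1 \<or> i = i' + 1) then 1 else 0)" (is ?goal)
  proof (cases "i = i' \<and> (j' = j + 1 \<or> j = j' + 1)")
    case True
    then show ?goal by (elim conjE disjE) simp_all
  next
    case 1: False
    show ?goal
    proof (cases "j = j' \<and> (i' = i + 1 \<or> i = i' + 1)")
      case True
      then show ?thesis by (elim conjE disjE) simp_all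
    next
      case False
      show ?thesis unfolding if_not_P[OF 1] if_not_P[OF False]
        by (rule none) (use 1 False in presburger)+
    qed
  qed
  then show ?thesis unfolding im dw_pair cell_weight_def v h .
qed

lemma aztec_F_1_eq_haf:
  "aztec_F N m k a 1 = haf (dw a) (to_layers N ` part_cells N m k)"
proof -
  have "aztec_F N m k a 1 = haf (\<lambda>D. if interior (squares D) \<inter> {} = {} then cell_weight a D else 0) (part_cells N m k)"
    unfolding aztec_F_def using sum_tilings_eq_haf[where s = "{}" and a = a, OF finite_part_cells[of N m k]]
    by (simp add: tilings_aztec_part[unfolded aztec_part_eq_squares] aztec_part_eq_squares)
  also have "\<dots> = haf (dw a) (to_layers N ` part_cells N m k)"
    unfolding haf_image[OF finite_part_cells inj_to_layers]
    by (rule haf_cong[OF finite_part_cells]) (subst dw_to_layers, simp_all)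
  finally show ?thesis .
qed

text \<open>The only domino that the slit forbids, in layer coordinates: the horizontal one whose
  two cells have the slit as common edge.\<close>

definition slit_pair :: "nat \<Rightarrow> nat \<Rightarrow> nat \<Rightarrow> (int \<times> int) set" where
  "slit_pair N m k = {(2 * int m, int k + int N), (2 * int m + 1, int k + int N)}"

text \<open>The slit has an integer abscissa, and the interior of a vertical domino lies strictly
  between consecutive integers, so it is never hit. For a horizontal domino the abscissa must be the
  middle one; since its vertical extent is open, the end points of the slit do not touch the rows
  above and below.\<close>

lemma interior_domino_slit:
  assumes "D \<in> cell_dominoes"
  shows "interior (squares D) \<inter> slit N m k \<noteq> {} \<longleftrightarrow> to_layers N ` D = slit_pair N m k"
  using assms unfolding cell_dominoes_def
proof
  assume "D \<in> {vdom i j | i j. True}"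
  then obtain i j where D: "D = vdom i j" by auto
  obtain X :: int where X: "2 * real m - real k - real N + 1 = real_of_int X"
    by (rule that[of "2 * int m - int k - int N + 1"]) simp
  have "False" if "real_of_int i < 2 * real m - real k - real N + 1" "2 * real m - real k - real N + 1 < real_of_int i + 1"
  proof -
    have "real_of_int i < real_of_int X" "real_of_int X < real_of_int (i + 1)"
      using that unfolding X by simp_all
    then have "i < X" "X < i + 1" by (simp_all only: of_int_less_iff)
    then show ?thesis by simp
  qed
  then have "interior (squares D) \<inter> slit N m k = {}"
    unfolding D squares_vdom slit_def interior_Times by auto
  moreover have "to_layers N ` D \<noteq> slit_pair N m k"
    unfolding D vdom_def to_layers_def slit_pair_def by (simp add: doubleton_eq_iff)
  ultimately show ?thesis by simp
next
  assume "D \<in> {hdom i j | i j. True}"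
  then obtain i j where D: "D = hdom i j" by auto
  have "interior (squares D) \<inter> slit N m k \<noteq> {} \<longleftrightarrow>
    of_int i < 2 * real m - real k - real N + 1 \<and> 2 * real m - real k - real N + 1 < of_int i + 2 \<and>
    (\<exists>y. of_int j < y \<and> y < real_of_int j + 1 \<and> real k - 1 \<le> y \<and> y \<le> real k)"
  proof -
    have "A \<times> B \<inter> {c} \<times> E \<noteq> {} \<longleftrightarrow> c \<in> A \<and> (\<exists>y. y \<in> B \<and> y \<in> E)"
      for A B E :: "real set" and c by auto
    then show ?thesis unfolding D squares_hdom slit_def interior_Times
      interior_atLeastAtMost_real by (simp only: conj_assoc greaterThanLessThan_iff atLeastAtMost_iff)
  qed
  also have "(\<exists>y. of_int j < y \<and> y < real_of_int j + 1 \<and> real k - 1 \<le> y \<and> y \<le> real k) \<longleftrightarrow> j = int k - 1"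
  proof
    assume "\<exists>y. of_int j < y \<and> y < real_of_int j + 1 \<and> real k - 1 \<le> y \<and> y \<le> real k"
    then obtain y where "of_int j < y" "y < real_of_int j + 1" "real k - 1 \<le> y" "y \<le> real k" by blast
    then show "j = int k - 1" by linarith
  next
    assume "j = int k - 1"
    then show "\<exists>y. of_int j < y \<and> y < real_of_int j + 1 \<and> real k - 1 \<le> y \<and> y \<le> real k"
      by (intro exI[of _ "real k - 1/2"]) auto
  qed
  also have "of_int i < 2 * real m - real k - real N + 1 \<and> 2 * real m - real k - real N + 1 < of_int i + 2 \<and> j = int k - 1
    \<longleftrightarrow> i = 2 * int m - int k - int N \<and> j = int k - 1"
  proof -
    define X where "X = 2 * int m - int k - int N + 1"
    have X: "2 * real m - real k - real N + 1 = real_of_int X" by (simp add: X_def)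
    have "i = 2 * int m - int k - int N \<longleftrightarrow> i = X - 1" by (auto simp: X_def)
    moreover have "real_of_int X < of_int i + 2 \<longleftrightarrow> X < i + 2"
      using of_int_less_iff[of X "i + 2", where ?'a = real] by simp
    ultimately show ?thesis unfolding X of_int_less_iff by auto
  qed
  also have "\<dots> \<longleftrightarrow> to_layers N ` D = slit_pair N m k"
    unfolding D hdom_def to_layers_def slit_pair_def image_insert image_empty prod.case
      doubleton_eq_iff prod.inject by presburger
  finally show ?thesis .
qed

lemma aztec_F_0_eq_haf:
  assumes "m < N"
  shows "aztec_F N m k a 0 = haf (\<lambda>D. if D = slit_pair N m k then 0 else dw a D)
    (to_layers N ` part_cells N (m + 1) (k + 1))"
proof -
  let ?C = "part_cells N (m + 1) (k + 1)"
  have "aztec_F N m k a 0 = haf (\<lambda>D. if interior (squares D) \<inter> slit N m k = {} then cell_weight a D else 0) ?C"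
    unfolding aztec_F_def using sum_tilings_eq_haf[where s = "slit N m k" and a = a, OF finite_part_cells[of N "m + 1" "k + 1"]]
    by (simp add: tilings_aztec_slit[OF assms, unfolded aztec_part_eq_squares] tilings_aztec_part[unfolded aztec_part_eq_squares])
  also have "\<dots> = haf (\<lambda>D. if D = slit_pair N m k then 0 else dw a D) (to_layers N ` ?C)"
    unfolding haf_image[OF finite_part_cells inj_to_layers]
  proof (rule haf_cong[OF finite_part_cells])
    fix x y :: "int \<times> int" assume xy: "x \<noteq> y"
    show "(if interior (squares {x, y}) \<inter> slit N m k = {} then cell_weight a {x, y} else 0) =
      (if to_layers N ` {x, y} = slit_pair N m k then 0 else dw a (to_layers N ` {x, y}))"
      using interior_domino_slit[of "{x, y}" N m k] dw_to_layers[OF xy, of a N] cell_weight_eq_0[of "{x, y}" a]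
      by (cases "{x, y} \<in> cell_dominoes") auto
  qed
  finally show ?thesis .
qed

text \<open>The width \<open>w\<close> means \<open>w\<close> cells on an even layer and
  \<open>w + 1\<close> on an odd one; \<open>w = N\<close> gives the layers of the full
  diamond.\<close>

definition layer :: "int \<Rightarrow> int \<Rightarrow> int set" where
  "layer w d = {J. d + 1 \<le> 2 * J \<and> 2 * J \<le> d + 2 * w + 1}"

text \<open>The two alternatives in \<open>part_cells\<close> become \<open>d \<le> 2 m - 2\<close>
  and \<open>2 J \<le> d + 2 (N + k - m) + 1\<close>. Because \<open>k \<le> m\<close>, the second
  implies the upper bound of the full diamond, so the domain narrows from width \<open>N\<close> to
  width \<open>N + k - m\<close> after layer \<open>2 m - 2\<close>.\<close>

lemma to_layers_part_cells:
  assumes "k \<le> m" "m \<le> N"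
  shows "to_layers N ` part_cells N m (k + 1) =
    {(d, J). 0 \<le> d \<and> d \<le> 2 * int N \<and>
       J \<in> layer (if d \<le> 2 * int m - 2 then int N else int N + int k - int m) d}"
proof -
  have 1: "(d, J) \<in> to_layers N ` part_cells N m (k + 1) \<longleftrightarrow> (d - J, J - int N - 1) \<in> part_cells N m (k + 1)" for d J
  proof
    assume "(d, J) \<in> to_layers N ` part_cells N m (k + 1)"
    then show "(d - J, J - int N - 1) \<in> part_cells N m (k + 1)"
      by (auto simp: to_layers_def)
  next
    assume "(d - J, J - int N - 1) \<in> part_cells N m (k + 1)"
    then show "(d, J) \<in> to_layers N ` part_cells N m (k + 1)"
      by (rule rev_image_eqI) (simp add: to_layers_def)
  qed
  have 2: "(d - J, J - int N - 1) \<in> part_cells N m (k + 1) \<longleftrightarrow> 0 \<le> d \<and> d \<le> 2 * int N \<and>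
       J \<in> layer (if d \<le> 2 * int m - 2 then int N else int N + int k - int m) d" for d J
    using assms unfolding part_cells_def layer_def by auto
  have iff: "(d, J) \<in> to_layers N ` part_cells N m (k + 1) \<longleftrightarrow> 0 \<le> d \<and> d \<le> 2 * int N \<and>
       J \<in> layer (if d \<le> 2 * int m - 2 then int N else int N + int k - int m) d" for d J
    by (rule trans[OF 1 2])
  show ?thesis by (rule Set.set_eqI) (simp only: split_paired_all mem_Collect_eq prod.case iff)
qed

section \<open>The hafnian of a partial Aztec diamond\<close>

lemma layer_even: "layer w (2 * n) = {n + 1..n + w}"
  unfolding layer_def by auto

lemma layer_odd: "layer w (2 * n + 1) = {n + 1..n + 1 + w}"
  unfolding layer_def by auto

lemma finite_layer [simp]: "finite (layer w d)"
  by (rule finite_subset[of _ "{d - \<bar>d\<bar> - 1..d + 2 * w + 1 + \<bar>d\<bar> + \<bar>w\<bar>}"]) (auto simp: layer_def)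

definition rect :: "int \<Rightarrow> int \<Rightarrow> (int \<times> int) set" where
  "rect w d = {(e, J). 0 \<le> e \<and> e < d \<and> J \<in> layer w e}"

lemma rect_0 [simp]: "rect w 0 = {}" by (auto simp: rect_def)

lemma rect_Suc: "0 \<le> d \<Longrightarrow> rect w (d + 1) = rect w d \<union> {d} \<times> layer w d"
  by (auto simp: rect_def less_le)

lemma finite_rect [simp]: "finite (rect w d)"
  by (rule finite_subset[of _ "SIGMA e:{0..d}. layer w e"]) (auto simp: rect_def)

text \<open>The layers below \<open>d\<close>, together with the cells \<open>S\<close> of layer
  \<open>d\<close> that are matched to the left; the remaining cells of layer \<open>d\<close> are
  left to layer \<open>d + 1\<close>.\<close>

definition partial_haf :: "real \<Rightarrow> int \<Rightarrow> int \<Rightarrow> int set \<Rightarrow> real" where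
  "partial_haf a w d S = haf (dw a) (rect w d \<union> {d} \<times> S)"

lemma partial_haf_peel:
  assumes "0 \<le> d" "finite B"
  shows "partial_haf a w (d + 1) B =
    (\<Sum>g\<in>PiE B (\<lambda>b. {b, b - 1}). if inj_on g B \<and> g ` B \<subseteq> layer w d
        then (\<Prod>b\<in>B. if g b = b then 1 else a) * partial_haf a w d (layer w d - g ` B) else 0)"
proof -
  let ?C = "rect w d \<union> {d} \<times> layer w d"
  have "partial_haf a w (d + 1) B = haf (dw a) (?C \<union> {d + 1} \<times> B)"
    unfolding partial_haf_def rect_Suc[OF assms(1)] ..
  also have "\<dots> = (\<Sum>g\<in>PiE B (\<lambda>b. {b, b - 1}). if inj_on g B \<and> {d} \<times> g ` B \<subseteq> ?C
        then (\<Prod>b\<in>B. if g b = b then 1 else a) * haf (dw a) (?C - {d} \<times> g ` B) else 0)"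
    by (rule haf_peel) (use assms(2) in simp, simp, auto simp: rect_def)
  also have "\<dots> = (\<Sum>g\<in>PiE B (\<lambda>b. {b, b - 1}). if inj_on g B \<and> g ` B \<subseteq> layer w d
        then (\<Prod>b\<in>B. if g b = b then 1 else a) * partial_haf a w d (layer w d - g ` B) else 0)"
  proof (rule sum.cong)
    fix g assume "g \<in> PiE B (\<lambda>b. {b, b - 1})"
    have 1: "{d} \<times> g ` B \<subseteq> ?C \<longleftrightarrow> g ` B \<subseteq> layer w d" by (auto simp: rect_def)
    have 2: "?C - {d} \<times> g ` B = rect w d \<union> {d} \<times> (layer w d - g ` B)" by (auto simp: rect_def)
    show "(if inj_on g B \<and> {d} \<times> g ` B \<subseteq> ?C
        then (\<Prod>b\<in>B. if g b = b then 1 else a) * haf (dw a) (?C - {d} \<times> g ` B) else 0)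
      = (if inj_on g B \<and> g ` B \<subseteq> layer w d
        then (\<Prod>b\<in>B. if g b = b then 1 else a) * partial_haf a w d (layer w d - g ` B) else 0)"
      unfolding 1 2 partial_haf_def ..
  qed simp
  finally show ?thesis .
qed

lemma partial_haf_step_eq_0:
  assumes "0 \<le> d" "finite B"
    and "\<And>A. A \<subseteq> layer w d \<Longrightarrow> card A = card B \<Longrightarrow> partial_haf a w d (layer w d - A) = 0"
  shows "partial_haf a w (d + 1) B = 0"
  unfolding partial_haf_peel[OF assms(1,2)]
  by (rule sum.neutral) (auto simp: assms(3) card_image)

text \<open>Each choice function \<open>g\<close> lowers a point by at most 1, so an injective one
  is increasing, and the Vandermonde product of its image is a determinant with the right sign; a
  non-injective one gives two equal rows. Since \<open>v\<close> vanishes outside the layer, choices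
  that leave it contribute nothing. The sum over \<open>g\<close> is thus a complete multilinear
  expansion. It collapses to one determinant with the rows described by \<open>u\<close> and
  \<open>q\<close>, and \<open>dt_poly\<close> turns that into a Vandermonde product again.\<close>

lemma partial_haf_step:
  assumes "0 \<le> d" "finite B" "card B = n"
    and V: "\<And>A. A \<subseteq> layer w d \<Longrightarrow> card A = n \<Longrightarrow>
      partial_haf a w d (layer w d - A) = \<kappa> * vdm A * (\<Prod>x\<in>A. v x)"
    and out: "\<And>b x. b \<in> B \<Longrightarrow> x = b \<or> x = b - 1 \<Longrightarrow> x \<notin> layer w d \<Longrightarrow> v x = 0"
    and u: "\<And>b j. b \<in> B \<Longrightarrow> j < n \<Longrightarrow>
      v b * real_of_int b ^ j + a * v (b - 1) * real_of_int (b - 1) ^ j = u b * poly (q j) (real_of_int b)"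
    and q: "\<And>j i. j < n \<Longrightarrow> j < i \<Longrightarrow> coeff (q j) i = 0"
  shows "partial_haf a w (d + 1) B = \<kappa> * (\<Prod>j<n. coeff (q j) j) * vdm B * (\<Prod>b\<in>B. u b)"
proof -
  obtain \<phi> where \<phi>: "strict_mono_on {..<n} \<phi>" "bij_betw \<phi> {..<n} B"
    using obtain_enumeration[OF assms(2,3)] .
  have im\<phi>: "\<phi> ` {..<n} = B" using \<phi>(2) by (simp add: bij_betw_def)
  let ?c = "\<lambda>b x. (if x = b then 1 else a) * v x"
  have "partial_haf a w (d + 1) B = (\<Sum>g\<in>PiE B (\<lambda>b. {b, b - 1}).
      \<kappa> * ((\<Prod>b\<in>B. ?c b (g b)) * dt n (\<lambda>i. (\<lambda>j. real_of_int (g (\<phi> i)) ^ j))))"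
    unfolding partial_haf_peel[OF assms(1,2)]
  proof (rule sum.cong)
    fix g assume g: "g \<in> PiE B (\<lambda>b. {b, b - 1})"
    then have gb: "g b = b \<or> g b = b - 1" if "b \<in> B" for b using that by auto
    show "(if inj_on g B \<and> g ` B \<subseteq> layer w d
        then (\<Prod>b\<in>B. if g b = b then 1 else a) * partial_haf a w d (layer w d - g ` B) else 0)
      = \<kappa> * ((\<Prod>b\<in>B. ?c b (g b)) * dt n (\<lambda>i. (\<lambda>j. real_of_int (g (\<phi> i)) ^ j)))"
    proof (cases "inj_on g B")
      case inj: True
      show ?thesis
      proof (cases "g ` B \<subseteq> layer w d")
        case True
        have "strict_mono_on {..<n} (\<lambda>i. g (\<phi> i))"
        proof (rule strict_mono_onI)
          fix i j assume ij: "i \<in> {..<n}" "j \<in> {..<n}" "i < j"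
          then have less: "\<phi> i < \<phi> j" using strict_mono_onD[OF \<phi>(1)] by blast
          have mem: "\<phi> i \<in> B" "\<phi> j \<in> B" using ij im\<phi> by auto
          then have "g (\<phi> i) \<noteq> g (\<phi> j)" using inj less by (auto dest: inj_onD)
          moreover have "g (\<phi> i) \<le> g (\<phi> j)" using gb[OF mem(1)] gb[OF mem(2)] less by linarith
          ultimately show "g (\<phi> i) < g (\<phi> j)" by simp
        qed
        from dt_power_eq_vdm[OF this] have "dt n (\<lambda>i j. real_of_int (g (\<phi> i)) ^ j) = vdm (g ` B)"
          by (simp add: im\<phi>[symmetric] image_image)
        moreover have "partial_haf a w d (layer w d - g ` B) = \<kappa> * vdm (g ` B) * (\<Prod>x\<in>g ` B. v x)"
          using True inj assms(3) by (intro V) (auto simp: card_image)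
        ultimately show ?thesis using True inj
          by (simp add: prod.reindex prod.distrib)
      next
        case False
        then obtain b where b: "b \<in> B" "g b \<notin> layer w d" by auto
        then have "v (g b) = 0" using out[of b "g b"] gb by blast
        then have "(\<Prod>b\<in>B. ?c b (g b)) = 0" using assms(2) by (intro prod_zero bexI[of _ b]) (use b(1) in auto)
        then show ?thesis using False by simp
      qed
    next
      case False
      then obtain x y where xy: "x \<in> B" "y \<in> B" "x \<noteq> y" "g x = g y" by (auto simp: inj_on_def)
      then obtain i j where "i < n" "j < n" "x = \<phi> i" "y = \<phi> j" using im\<phi> by blast
      then have "dt n (\<lambda>i j. real_of_int (g (\<phi> i)) ^ j) = 0"
        using xy by (intro dt_identical_rows[of i j]) auto
      then show ?thesis using False by simp
    qed
  qed simp
  also have "\<dots> = \<kappa> * dt n (\<lambda>i j. \<Sum>x\<in>{\<phi> i, \<phi> i - 1}. ?c (\<phi> i) x * real_of_int x ^ j)"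
    by (subst dt_rows_sum[OF \<phi>(2)]) (simp_all add: sum_distrib_left)
  also have "dt n (\<lambda>i j. \<Sum>x\<in>{\<phi> i, \<phi> i - 1}. ?c (\<phi> i) x * real_of_int x ^ j)
      = dt n (\<lambda>i j. u (\<phi> i) * poly (q j) (real_of_int (\<phi> i)))"
  proof (rule dt_cong)
    fix i j assume "i < n" "j < n"
    then show "(\<Sum>x\<in>{\<phi> i, \<phi> i - 1}. ?c (\<phi> i) x * real_of_int x ^ j) = u (\<phi> i) * poly (q j) (real_of_int (\<phi> i))"
      using u[of "\<phi> i" j] im\<phi> by auto
  qed
  also have "\<dots> = (\<Prod>i<n. u (\<phi> i)) * ((\<Prod>j<n. coeff (q j) j) * vdm B)"
    unfolding dt_scale_rows using dt_poly[of n q "\<lambda>i. real_of_int (\<phi> i)"] q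
    by (simp add: dt_power_eq_vdm[OF \<phi>(1)] im\<phi>)
  also have "(\<Prod>i<n. u (\<phi> i)) = (\<Prod>b\<in>B. u b)"
    by (rule prod.reindex_bij_betw[OF \<phi>(2)])
  finally show ?thesis by (simp add: mult_ac)
qed

lemma prod_int_dist_below: "c \<le> x \<Longrightarrow> (\<Prod>y\<in>{c..<x}. \<bar>real_of_int (y - x)\<bar>) = fact (nat (x - c))"
proof -
  assume "c \<le> x"
  have "(\<Prod>y\<in>{c..<x}. \<bar>real_of_int (y - x)\<bar>) = (\<Prod>i\<in>{1..nat (x - c)}. real i)"
    by (rule prod.reindex_bij_witness[of _ "\<lambda>i. x - int i" "\<lambda>y. nat (x - y)"]) auto
  then show ?thesis by (simp add: fact_prod)
qed

lemma prod_int_dist_above: "x \<le> c \<Longrightarrow> (\<Prod>y\<in>{x<..c}. \<bar>real_of_int (y - x)\<bar>) = fact (nat (c - x))"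
proof -
  assume "x \<le> c"
  have "(\<Prod>y\<in>{x<..c}. \<bar>real_of_int (y - x)\<bar>) = (\<Prod>i\<in>{1..nat (c - x)}. real i)"
    by (rule prod.reindex_bij_witness[of _ "\<lambda>i. x + int i" "\<lambda>y. nat (y - x)"]) auto
  then show ?thesis by (simp add: fact_prod)
qed

lemma prod_int_dist:
  assumes "x \<in> {c..e}"
  shows "(\<Prod>y\<in>{c..e} - {x}. \<bar>real_of_int (y - x)\<bar>) = fact (nat (x - c)) * fact (nat (e - x))"
proof -
  have "{c..e} - {x} = {c..<x} \<union> {x<..e}" using assms by auto
  then have "(\<Prod>y\<in>{c..e} - {x}. \<bar>real_of_int (y - x)\<bar>)
      = (\<Prod>y\<in>{c..<x} \<union> {x<..e}. \<bar>real_of_int (y - x)\<bar>)" by (rule arg_cong)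
  also have "\<dots> = (\<Prod>y\<in>{c..<x}. \<bar>real_of_int (y - x)\<bar>) * (\<Prod>y\<in>{x<..e}. \<bar>real_of_int (y - x)\<bar>)"
    by (rule prod.union_disjoint) auto
  finally have "(\<Prod>y\<in>{c..e} - {x}. \<bar>real_of_int (y - x)\<bar>)
      = (\<Prod>y\<in>{c..<x}. \<bar>real_of_int (y - x)\<bar>) * (\<Prod>y\<in>{x<..e}. \<bar>real_of_int (y - x)\<bar>)" .
  moreover have "c \<le> x" "x \<le> e" using assms by auto
  ultimately show ?thesis by (simp only: prod_int_dist_below prod_int_dist_above)
qed

lemma vdm_singleton [simp]: "vdm {x} = 1"
proof -
  have "{(u, v). u \<in> {x} \<and> v \<in> {x} \<and> u < v} = {}" by auto
  then show ?thesis unfolding vdm_def by (simp only: prod.empty)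
qed

lemma vdm_empty [simp]: "vdm {} = 1"
  by (simp add: vdm_def)

lemma vdm_interval_Suc:
  assumes "c \<le> e + 1"
  shows "vdm {c..e + 1} = fact (nat (e + 1 - c)) * vdm {c..e}"
proof -
  have "vdm {c..e + 1} * vdm {e + 1} = vdm ({c..e + 1} - {e + 1}) *
     (\<Prod>x\<in>{e + 1}. \<Prod>y\<in>{c..e + 1} - {x}. \<bar>real_of_int (y - x)\<bar>)"
    by (rule vdm_complement) (use assms in auto)
  moreover have "{c..e + 1} - {e + 1} = {c..e}" by auto
  moreover have "(\<Prod>x\<in>{e + 1}. \<Prod>y\<in>{c..e + 1} - {x}. \<bar>real_of_int (y - x)\<bar>) = fact (nat (e + 1 - c))"
  proof -
    have "(\<Prod>x\<in>{e + 1}. F x) = F (e + 1)" for F :: "int \<Rightarrow> real" by simp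
    then have "(\<Prod>x\<in>{e + 1}. \<Prod>y\<in>{c..e + 1} - {x}. \<bar>real_of_int (y - x)\<bar>)
        = (\<Prod>y\<in>{c..e + 1} - {e + 1}. \<bar>real_of_int (y - (e + 1))\<bar>)" .
    also have "\<dots> = fact (nat (e + 1 - c)) * fact (nat (e + 1 - (e + 1)))"
      by (rule prod_int_dist) (use assms in auto)
    finally show ?thesis by simp
  qed
  ultimately show ?thesis by simp
qed

section \<open>Closed form for rectangles of constant width\<close>

fun rect_const :: "real \<Rightarrow> nat \<Rightarrow> nat \<Rightarrow> real" where
  "rect_const a w 0 = 1"
| "rect_const a w (Suc n) = rect_const a w n * a ^ (n + w + 1) / fact n * (1 + a\<^sup>2) ^ Suc n"

lemma coeff_shift_power: "coeff ([:-1, 1:] ^ j) i = (if i \<le> j then of_nat (j choose i) * (- 1) ^ (j - i) else (0::real))"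
proof (cases "i \<le> j")
  case True
  then show ?thesis by (simp add: coeff_linear_poly_power)
next
  case False
  then show ?thesis by (simp add: coeff_eq_0 degree_linear_power)
qed

text \<open>Bare algebra for the passage between a set and its complement in a layer, kept apart so
  that simplification never meets the actual products. \<open>vL\<close>, \<open>vB\<close>,
  \<open>vP\<close> stand for Vandermonde products of a layer, a subset and its complement,
  \<open>Dp\<close> for distance products, and the remaining letters for powers of
  \<open>a\<close>.\<close>

lemma cancel_complement:
  fixes vL :: real
  assumes "vL * vB = vP * Dp" "QL = QB * QP" "U = QB / Dp" "Dp > 0" "QP * PP = 1" "vL > 0"
  shows "vB * U = vP / vL * (QL * PP)"
proof -
  have "vP / vL = vB / Dp" using assms by (simp add: field_simps)
  then show ?thesis using assms(5) by (simp add: assms(2,3) mult.assoc)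
qed

lemma cancel_step:
  fixes X :: real
  assumes "X = K * vL * W * cf * vB * U" "cf = fw / fn" "vB * U = vP / vL' * (Q * PP)" "vL' = fw * vL"
    "W * Q = aa" "vL > 0" "fw > 0"
  shows "X = K * aa / fn * vP * PP"
proof -
  have "X = K * vL * W * (fw / fn) * (vP / (fw * vL) * (Q * PP))"
    unfolding assms(1,2) using assms(3,4) by (simp add: mult.assoc)
  also have "\<dots> = K * (W * Q) / fn * vP * PP" using assms(6,7) by (simp add: field_simps)
  finally show ?thesis unfolding assms(5) .
qed

lemma prod_falling: "r \<le> w \<Longrightarrow> (\<Prod>j<r. real w - real j) * fact (w - r) = fact w"
proof (induction r)
  case (Suc r)
  then have "w - r = Suc (w - Suc r)" by simp
  then have "fact (w - r) = (real w - real r) * fact (w - Suc r)"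
    using Suc.prems by (simp add: of_nat_diff)
  then show ?case using Suc by (simp add: mult.assoc)
qed simp

text \<open>\<open>vdm_complement\<close> in layer \<open>2 n\<close> turns the hypothesis into a
  Vandermonde product over the cells handed on to the next layer, with weight \<open>v\<close>.
  \<open>partial_haf_step\<close> moves this to layer \<open>2 n + 1\<close>, and
  \<open>vdm_complement\<close> there leads back to \<open>P\<close>.\<close>

lemma partial_haf_even_to_odd:
  fixes n w :: nat
  assumes a: "a \<noteq> 0" and nw: "n \<le> w"
    and IH: "\<And>P. P \<subseteq> layer w (2 * int n) \<Longrightarrow> card P = n \<Longrightarrow>
      partial_haf a w (2 * int n) P = K * vdm P * (\<Prod>x\<in>P. a powi (- x))"
    and P: "P \<subseteq> layer w (2 * int n + 1)" "card P = n + 1"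
  shows "partial_haf a w (2 * int n + 1) (layer w (2 * int n + 1) - P) =
    K * a ^ (n + w + 1) / fact n * vdm P * (\<Prod>x\<in>P. a powi (- x))"
proof -
  let ?L = "layer w (2 * int n)" and ?L' = "layer w (2 * int n + 1)"
  have L: "?L = {int n + 1..int n + int w}" and L': "?L' = {int n + 1..int n + int w + 1}"
    unfolding layer_even layer_odd by auto
  have finP: "finite P" using P(1) finite_subset finite_layer by blast
  let ?B = "?L' - P"
  have cardB: "card ?B = w - n"
    using P finP by (subst card_Diff_subset) (auto simp: L')
  define D where "D x = (fact (nat (x - (int n + 1))) * fact (nat (int n + int w - x)) :: real)" for x
  define D' where "D' x = (fact (nat (x - (int n + 1))) * fact (nat (int n + int w + 1 - x)) :: real)" for x
  \<comment> \<open>The value 0 outside the even layer is what \<open>partial_haf_step\<close>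
    demands for choices that leave it.\<close>
  define v where "v x = (if x \<in> ?L then a powi x / D x else 0)" for x
  define u where "u x = a powi x / D' x" for x
  \<comment> \<open>\<open>n + w + 1 - b\<close> and \<open>b - (n + 1)\<close> are the quotients of
    the distance product of the longer layer at \<open>b\<close> by that of the shorter one at
    \<open>b\<close> and at \<open>b - 1\<close>. The terms of degree \<open>j + 1\<close> cancel,
    and the coefficient in degree \<open>j\<close> becomes \<open>w - j\<close>.\<close>
  define q where "q j = [:real n + real w + 1, -1:] * monom 1 j + [:- (real n + 1), 1:] * [:-1, 1:] ^ j" for j
  have Dpos: "D x > 0" "D' x > 0" for x by (simp_all add: D_def D'_def)
  have pos: "vdm A > 0" if "A \<subseteq> ?L'" for A using that by (intro vdm_pos) (auto intro: finite_subset)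
  have powi_prod: "(\<Prod>x\<in>A. a powi x) * (\<Prod>x\<in>A. a powi (- x)) = 1" for A
    unfolding prod.distrib[symmetric] using a by (simp add: power_int_minus)
  have "partial_haf a w (2 * int n + 1) ?B = (K * vdm ?L * (\<Prod>x\<in>?L. a powi (- x))) *
      (\<Prod>j<w - n. coeff (q j) j) * vdm ?B * (\<Prod>b\<in>?B. u b)"
  proof (rule partial_haf_step[OF _ _ cardB])
    fix A assume A: "A \<subseteq> ?L" "card A = w - n"
    then have finA: "finite A" using finite_subset finite_layer by blast
    have "card (?L - A) = n"
      using A finA nw by (subst card_Diff_subset) (auto simp: L)
    then have "partial_haf a w (2 * int n) (?L - A) = K * vdm (?L - A) * (\<Prod>x\<in>?L - A. a powi (- x))"
      by (intro IH) auto
    moreover have 1: "vdm ?L * vdm A = vdm (?L - A) * (\<Prod>x\<in>A. D x)"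
    proof -
      have "vdm ?L * vdm A = vdm (?L - A) * (\<Prod>x\<in>A. \<Prod>y\<in>?L - {x}. \<bar>real_of_int (y - x)\<bar>)"
        by (rule vdm_complement) (use A in auto)
      also have "(\<Prod>x\<in>A. \<Prod>y\<in>?L - {x}. \<bar>real_of_int (y - x)\<bar>) = (\<Prod>x\<in>A. D x)"
        unfolding D_def using A unfolding L by (intro prod.cong refl prod_int_dist) auto
      finally show ?thesis .
    qed
    moreover have 2: "(\<Prod>x\<in>?L. a powi (- x)) = (\<Prod>x\<in>?L - A. a powi (- x)) * (\<Prod>x\<in>A. a powi (- x))"
      using A by (intro prod.subset_diff) auto
    moreover have 3: "(\<Prod>x\<in>A. v x) = (\<Prod>x\<in>A. a powi x) / (\<Prod>x\<in>A. D x)"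
      using A by (auto simp: v_def prod_dividef[symmetric] intro!: prod.cong)
    moreover have "(\<Prod>x\<in>A. D x) > 0" using Dpos by (intro prod_pos) auto
    moreover have "K * vdm ?L * (\<Prod>x\<in>?L. a powi (- x)) * vdm A * (\<Prod>x\<in>A. v x)
        = K * (\<Prod>x\<in>?L - A. a powi (- x)) * (vdm ?L * vdm A) * ((\<Prod>x\<in>A. a powi x) * (\<Prod>x\<in>A. a powi (- x))) / (\<Prod>x\<in>A. D x)"
      unfolding 2 3 by (simp only: times_divide_eq_right times_divide_eq_left mult_ac)
    ultimately show "partial_haf a w (2 * int n) (?L - A) =
        K * vdm ?L * (\<Prod>x\<in>?L. a powi (- x)) * vdm A * (\<Prod>x\<in>A. v x)"
      unfolding 1 powi_prod by simp
  next
    fix b j assume b: "b \<in> ?B" and j: "j < w - n"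
    have b': "int n + 1 \<le> b" "b \<le> int n + int w + 1" using b by (auto simp: L')
    have 1: "v b = u b * (real n + real w + 1 - real_of_int b)"
    proof (cases "b = int n + int w + 1")
      case False
      then have "nat (int n + int w + 1 - b) = Suc (nat (int n + int w - b))" using b' by linarith
      moreover have "real (nat (int n + int w - b)) = real n + real w - b" using b' False by simp
      ultimately have "D' b = D b * (real n + real w + 1 - real_of_int b)"
        by (simp add: D_def D'_def)
      moreover have "v b = a powi b / D b" unfolding v_def L using False b' by simp
      moreover have "real n + real w + 1 - real_of_int b > 0" using b' False by linarith
      ultimately show ?thesis unfolding u_def by simp
    next
      case True
      then show ?thesis unfolding v_def L by simp
    qed
    have 2: "a * v (b - 1) = u b * (real_of_int b - (real n + 1))"
    proof (cases "b = int n + 1")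
      case False
      then have e1: "nat (b - (int n + 1)) = Suc (nat (b - 1 - (int n + 1)))" using b' by linarith
      have e2: "real (nat (b - 1 - (int n + 1))) = b - 1 - (real n + 1)" using b' False by simp
      have e3: "int n + int w - (b - 1) = int n + int w + 1 - b" by simp
      have "D' b = D (b - 1) * (real_of_int b - (real n + 1))"
        unfolding D_def D'_def e1 e3 fact_Suc of_nat_Suc e2 by simp
      moreover have "v (b - 1) = a powi (b - 1) / D (b - 1)" unfolding v_def L using False b' by simp
      moreover have "a powi b = a * a powi (b - 1)"
        using a power_int_add[of a 1 "b - 1"] by simp
      moreover have "real_of_int b - (real n + 1) > 0" using b' False by linarith
      ultimately show ?thesis unfolding u_def by simp
    next
      case True
      then show ?thesis unfolding v_def L by simp
    qed
    show "v b * real_of_int b ^ j + a * v (b - 1) * real_of_int (b - 1) ^ j = u b * poly (q j) (real_of_int b)"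
      unfolding 1 2 q_def by (simp add: poly_monom algebra_simps)
  next
    fix j i :: nat assume "j < w - n" and ij: "j < i"
    then obtain i' where i': "i = Suc i'" by (cases i) auto
    show "coeff (q j) i = 0" unfolding q_def i' using ij i' by (auto simp: coeff_shift_power coeff_pCons)
  qed (auto simp: v_def)
  moreover have "coeff (q j) j = real w - real j" for j
    unfolding q_def by (cases j) (simp_all add: coeff_shift_power coeff_pCons del: power_Suc)
  then have "(\<Prod>j<w - n. coeff (q j) j) = fact w / fact n"
  proof -
    assume "\<And>j. coeff (q j) j = real w - real j"
    then have "(\<Prod>j<w - n. coeff (q j) j) = (\<Prod>j<w - n. real w - real j)" by (simp only:)
    then show ?thesis using prod_falling[of "w - n" w] nw by (simp add: field_simps)
  qed
  moreover have "vdm ?B * (\<Prod>b\<in>?B. u b) = vdm P / vdm ?L' * ((\<Prod>x\<in>?L'. a powi x) * (\<Prod>x\<in>P. a powi (- x)))"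
  proof -
    have "vdm ?L' * vdm ?B = vdm (?L' - ?B) * (\<Prod>x\<in>?B. \<Prod>y\<in>?L' - {x}. \<bar>real_of_int (y - x)\<bar>)"
      by (rule vdm_complement) auto
    also have "?L' - ?B = P" using P by auto
    also have "(\<Prod>x\<in>?B. \<Prod>y\<in>?L' - {x}. \<bar>real_of_int (y - x)\<bar>) = (\<Prod>x\<in>?B. D' x)"
      unfolding D'_def unfolding L' by (intro prod.cong refl prod_int_dist) auto
    finally have "vdm ?L' * vdm ?B = vdm P * (\<Prod>x\<in>?B. D' x)" .
    moreover have "(\<Prod>x\<in>?L'. a powi x) = (\<Prod>x\<in>?B. a powi x) * (\<Prod>x\<in>P. a powi x)"
      using P by (intro prod.subset_diff) auto
    moreover have "(\<Prod>b\<in>?B. u b) = (\<Prod>x\<in>?B. a powi x) / (\<Prod>x\<in>?B. D' x)"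
      by (simp add: u_def prod_dividef)
    moreover have "(\<Prod>x\<in>?B. D' x) > 0" using Dpos by (intro prod_pos) auto
    ultimately show ?thesis using powi_prod[of P] pos[of ?L']
      by (intro cancel_complement[where Dp = "\<Prod>x\<in>?B. D' x" and QB = "\<Prod>x\<in>?B. a powi x" and QP = "\<Prod>x\<in>P. a powi x"]) auto
  qed
  \<comment> \<open>The odd layer has one more point, \<open>n + w + 1\<close>, at distances 1 to
    \<open>w\<close> from the others. It accounts for this factorial and for the power of
    \<open>a\<close> below.\<close>
  moreover have "vdm ?L' = fact w * vdm ?L"
    unfolding L L' using vdm_interval_Suc[of "int n + 1" "int n + int w"] by (simp add: add.assoc)
  moreover have "(\<Prod>x\<in>?L. a powi (- x)) * (\<Prod>x\<in>?L'. a powi x) = a ^ (n + w + 1)"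
  proof -
    have "?L' = insert (int n + int w + 1) ?L" unfolding L L' by auto
    moreover have "int n + int w + 1 \<notin> ?L" by (simp add: L)
    ultimately have "(\<Prod>x\<in>?L'. a powi x) = a powi (int n + int w + 1) * (\<Prod>x\<in>?L. a powi x)"
      by (simp only:) (rule prod.insert, simp_all)
    also have "a powi (int n + int w + 1) = a ^ (n + w + 1)"
      by (metis of_nat_1 of_nat_add power_int_of_nat)
    finally show ?thesis using powi_prod[of ?L] by (simp add: mult_ac)
  qed
  moreover have "vdm ?L > 0" by (intro vdm_pos) simp
  ultimately show ?thesis
    by (intro cancel_step[where fw = "fact w" and vB = "vdm ?B" and U = "\<Prod>b\<in>?B. u b" and W = "\<Prod>x\<in>?L. a powi (- x)"
        and Q = "\<Prod>x\<in>?L'. a powi x" and vL = "vdm ?L" and vL' = "vdm ?L'" and cf = "\<Prod>j<w - n. coeff (q j) j"]) auto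
qed

text \<open>Both possible partners of a cell of layer \<open>2 n + 2\<close> lie in layer
  \<open>2 n + 1\<close>. Lowering the height by 1 multiplies the weight \<open>a powi (- x)\<close>
  by \<open>a\<close>, so a vertical domino counts \<open>a\<^sup>2\<close> relative to a horizontal
  one; the leading coefficient \<open>1 + a\<^sup>2\<close> of \<open>q\<close> is the origin of all
  such powers.\<close>

lemma partial_haf_odd_to_even:
  fixes n w :: nat
  assumes a: "a \<noteq> 0"
    and IH: "\<And>P. P \<subseteq> layer w (2 * int n + 1) \<Longrightarrow> card P = n + 1 \<Longrightarrow>
      partial_haf a w (2 * int n + 1) (layer w (2 * int n + 1) - P) = K * vdm P * (\<Prod>x\<in>P. a powi (- x))"
    and P: "P \<subseteq> layer w (2 * int n + 2)" "card P = n + 1"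
  shows "partial_haf a w (2 * int n + 2) P = K * (1 + a\<^sup>2) ^ (n + 1) * vdm P * (\<Prod>x\<in>P. a powi (- x))"
proof -
  define q where "q j = monom 1 j + Polynomial.smult (a\<^sup>2) ([:-1, 1:] ^ j)" for j
  have L: "layer w (2 * int n + 1) = {int n + 1..int n + 1 + int w}" by (rule layer_odd)
  have L2: "layer w (2 * int n + 2) = {int n + 2..int n + 1 + int w}"
    using layer_even[of "int w" "int n + 1"] by (simp add: algebra_simps)
  have finP: "finite P" using P(1) finite_subset finite_layer by blast
  have "partial_haf a w (2 * int n + 1 + 1) P = K * (\<Prod>j<n + 1. coeff (q j) j) * vdm P * (\<Prod>b\<in>P. a powi (- b))"
  proof (rule partial_haf_step[OF _ finP P(2) IH])
    fix b j assume "b \<in> P"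
    have "a * a powi (- (b - 1)) = a\<^sup>2 * a powi (- b)"
      using a power_int_add[of a 1 "- b"] by (simp add: power2_eq_square algebra_simps)
    then show "a powi (- b) * real_of_int b ^ j + a * a powi (- (b - 1)) * real_of_int (b - 1) ^ j
        = a powi (- b) * poly (q j) (real_of_int b)"
      unfolding q_def by (simp add: poly_monom algebra_simps)
  next
    fix j i :: nat assume "j < i"
    then show "coeff (q j) i = 0" by (simp add: q_def coeff_shift_power)
  qed (use P in \<open>auto simp: L L2\<close>)
  moreover have "coeff (q j) j = 1 + a\<^sup>2" for j by (simp add: q_def coeff_shift_power)
  ultimately show ?thesis by (simp add: add.assoc)
qed

text \<open>One induction step crosses two layers. Even layers are described by the cells matched to
  the left and odd layers by the complement, which keeps the Vandermonde products at
  \<open>n\<close> and \<open>n + 1\<close> points. In \<open>rect_const\<close> the factor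
  \<open>a ^ (n + w + 1) / fact n\<close> belongs to the step onto the odd layer and the power of
  \<open>1 + a\<^sup>2\<close> to the step off it.\<close>

lemma partial_haf_even:
  fixes n w :: nat
  assumes "a \<noteq> 0" "n \<le> w" "P \<subseteq> layer w (2 * int n)" "card P = n"
  shows "partial_haf a w (2 * int n) P = rect_const a w n * vdm P * (\<Prod>x\<in>P. a powi (- x))"
  using assms(2-4)
proof (induction n arbitrary: P)
  case 0
  then have "P = {}" using finite_subset[OF 0(2) finite_layer] by simp
  then show ?case by (simp add: partial_haf_def)
next
  case (Suc n)
  have eq: "2 * int (Suc n) = 2 * int n + 2" by simp
  have IH: "partial_haf a w (2 * int n) P = rect_const a w n * vdm P * (\<Prod>x\<in>P. a powi (- x))"
    if "P \<subseteq> layer w (2 * int n)" "card P = n" for P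
    by (rule Suc.IH[OF _ that]) (use Suc.prems(1) in simp)
  have odd: "partial_haf a w (2 * int n + 1) (layer w (2 * int n + 1) - Q) =
      (rect_const a w n * a ^ (n + w + 1) / fact n) * vdm Q * (\<Prod>x\<in>Q. a powi (- x))"
    if "Q \<subseteq> layer w (2 * int n + 1)" "card Q = n + 1" for Q
    by (rule partial_haf_even_to_odd[OF assms(1) _ IH that]) (use Suc.prems(1) in simp)
  have "partial_haf a w (2 * int n + 2) P
      = rect_const a w n * a ^ (n + w + 1) / fact n * (1 + a\<^sup>2) ^ (n + 1) * vdm P * (\<Prod>x\<in>P. a powi (- x))"
    by (rule partial_haf_odd_to_even[OF assms(1) odd]) (use Suc.prems(2,3)[unfolded eq] in simp_all)
  then show ?case unfolding eq by simp
qed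

lemma partial_haf_odd:
  fixes n w :: nat
  assumes "a \<noteq> 0" "n \<le> w" "P \<subseteq> layer w (2 * int n + 1)" "card P = n + 1"
  shows "partial_haf a w (2 * int n + 1) (layer w (2 * int n + 1) - P) =
    rect_const a w n * a ^ (n + w + 1) / fact n * vdm P * (\<Prod>x\<in>P. a powi (- x))"
  by (rule partial_haf_even_to_odd[OF assms(1,2) partial_haf_even assms(3,4)]) (use assms in auto)

lemma partial_haf_eq_0_even_to_odd:
  fixes n w :: nat
  assumes "\<And>P. P \<subseteq> layer w (2 * int n) \<Longrightarrow> card P \<noteq> n \<Longrightarrow> partial_haf a w (2 * int n) P = 0"
    and P: "P \<subseteq> layer w (2 * int n + 1)" "card P + n \<noteq> w"
  shows "partial_haf a w (2 * int n + 1) P = 0"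
proof (rule partial_haf_step_eq_0)
  fix A assume A: "A \<subseteq> layer w (2 * int n)" "card A = card P"
  have fin: "finite A" using A(1) finite_subset finite_layer by blast
  have "card A \<le> w" "card (layer w (2 * int n) - A) = w - card A"
    using card_mono[OF finite_layer A(1)] card_Diff_subset[OF fin A(1)] unfolding layer_even by auto
  then show "partial_haf a w (2 * int n) (layer w (2 * int n) - A) = 0"
    using A P(2) by (intro assms(1)) auto
qed (use finite_subset[OF P(1) finite_layer] in simp_all)

lemma partial_haf_eq_0_odd_to_even:
  fixes n w :: nat
  assumes "\<And>P. P \<subseteq> layer w (2 * int n + 1) \<Longrightarrow> card P + n \<noteq> w \<Longrightarrow> partial_haf a w (2 * int n + 1) P = 0"
    and P: "P \<subseteq> layer w (2 * int n + 2)" "card P \<noteq> n + 1"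
  shows "partial_haf a w (2 * int n + 1 + 1) P = 0"
proof (rule partial_haf_step_eq_0)
  fix A assume A: "A \<subseteq> layer w (2 * int n + 1)" "card A = card P"
  have fin: "finite A" using A(1) finite_subset finite_layer by blast
  have "card A \<le> w + 1" "card (layer w (2 * int n + 1) - A) = w + 1 - card A"
    using card_mono[OF finite_layer A(1)] card_Diff_subset[OF fin A(1)] unfolding layer_odd by auto
  then show "partial_haf a w (2 * int n + 1) (layer w (2 * int n + 1) - A) = 0"
    using A P(2) by (intro assms(1)) auto
qed (use finite_subset[OF P(1) finite_layer] in simp_all)

text \<open>Every domino joins layers of opposite parity, and balancing the two classes forces
  exactly \<open>n\<close> cells on layer \<open>2 n\<close>. The induction carries out this count
  one layer at a time.\<close>

lemma partial_haf_even_eq_0: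
  fixes n w :: nat
  assumes "P \<subseteq> layer w (2 * int n)" "card P \<noteq> n"
  shows "partial_haf a w (2 * int n) P = 0"
  using assms
proof (induction n arbitrary: P)
  case 0
  then obtain x where x: "x \<in> P" by (metis card.empty ex_in_conv)
  have "finite P" using 0(1) finite_subset finite_layer by blast
  then show ?case unfolding partial_haf_def
    by (intro haf_eq_0[of _ "(0, x)"]) (use x in \<open>auto simp: dw_pair\<close>)
next
  case (Suc n)
  have eq: "2 * int (Suc n) = 2 * int n + 1 + 1" by simp
  have P: "P \<subseteq> layer w (2 * int n + 2)" using Suc.prems(1) by (simp add: add.commute)
  show ?case unfolding eq
    by (rule partial_haf_eq_0_odd_to_even[OF partial_haf_eq_0_even_to_odd[OF Suc.IH] P])
       (use Suc.prems in simp_all)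
qed

lemma partial_haf_odd_eq_0:
  fixes n w :: nat
  assumes "P \<subseteq> layer w (2 * int n + 1)" "card P + n \<noteq> w"
  shows "partial_haf a w (2 * int n + 1) P = 0"
  by (rule partial_haf_eq_0_even_to_odd[OF partial_haf_even_eq_0 assms])

section \<open>Summation over the particles on a layer\<close>

text \<open>A point reflection preserves both kinds of dominoes. Sending \<open>d\<close> to
  \<open>2 N - d\<close> and \<open>J\<close> to \<open>N + R + 1 - J\<close> maps layers of width
  \<open>R\<close> to layers of width \<open>R\<close>, so the part to the right of a cut becomes a
  rectangle of the kind already evaluated.\<close>

lemma partial_haf_rotated:
  fixes N R d0 :: int
  assumes "d0 \<le> 2 * N" "finite S"
  shows "haf (dw a) ({d0} \<times> S \<union> {(d, J). d0 < d \<and> d \<le> 2 * N \<and> J \<in> layer R d})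
    = partial_haf a R (2 * N - d0) ((\<lambda>J. N + R + 1 - J) ` S)"
proof -
  let ?C = "{d0} \<times> S \<union> {(d, J). d0 < d \<and> d \<le> 2 * N \<and> J \<in> layer R d}"
  let ?\<rho> = "\<lambda>(d, J). (2 * N - d, N + R + 1 - J)"
  have fin: "finite ?C"
  proof (intro finite_UnI)
    show "finite {(d, J). d0 < d \<and> d \<le> 2 * N \<and> J \<in> layer R d}"
      by (rule finite_subset[of _ "SIGMA d:{d0..2 * N}. layer R d"]) auto
  qed (use assms(2) in auto)
  have inj: "inj_on ?\<rho> ?C" by (auto simp: inj_on_def)
  have lay: "N + R + 1 - J \<in> layer R d \<longleftrightarrow> J \<in> layer R (2 * N - d)" for d J
    unfolding layer_def by auto
  have im: "?\<rho> ` ?C = rect R (2 * N - d0) \<union> {2 * N - d0} \<times> ((\<lambda>J. N + R + 1 - J) ` S)"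
  proof (rule Set.set_eqI)
    fix z :: "int \<times> int"
    obtain d J where z: "z = (d, J)" by (cases z)
    have mem: "(d = e \<and> J \<in> X) \<or> (0 \<le> d \<and> d < e \<and> J \<in> layer R d) \<longleftrightarrow> (d, J) \<in> rect R e \<union> {e} \<times> X"
      for e X by (simp add: rect_def disj_commute)
    have "z \<in> ?\<rho> ` ?C \<longleftrightarrow> (2 * N - d, N + R + 1 - J) \<in> ?C"
    proof
      assume "z \<in> ?\<rho> ` ?C"
      then obtain e K where "(e, K) \<in> ?C" "z = (2 * N - e, N + R + 1 - K)" by auto
      then show "(2 * N - d, N + R + 1 - J) \<in> ?C" by (simp add: z)
    next
      assume "(2 * N - d, N + R + 1 - J) \<in> ?C"
      then show "z \<in> ?\<rho> ` ?C" by (rule rev_image_eqI) (simp add: z)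
    qed
    also have "\<dots> \<longleftrightarrow> (d = 2 * N - d0 \<and> N + R + 1 - J \<in> S) \<or> (0 \<le> d \<and> d < 2 * N - d0 \<and> J \<in> layer R d)"
      using lay[of J "2 * N - d"] by auto
    also have "N + R + 1 - J \<in> S \<longleftrightarrow> J \<in> (\<lambda>J. N + R + 1 - J) ` S"
    proof
      assume "N + R + 1 - J \<in> S"
      then show "J \<in> (\<lambda>J. N + R + 1 - J) ` S" by (rule rev_image_eqI) simp
    next
      assume "J \<in> (\<lambda>J. N + R + 1 - J) ` S"
      then obtain K where "K \<in> S" "J = N + R + 1 - K" by blast
      then show "N + R + 1 - J \<in> S" by simp
    qed
    also have "(d = 2 * N - d0 \<and> J \<in> (\<lambda>J. N + R + 1 - J) ` S) \<or> (0 \<le> d \<and> d < 2 * N - d0 \<and> J \<in> layer R d)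
        \<longleftrightarrow> z \<in> rect R (2 * N - d0) \<union> {2 * N - d0} \<times> ((\<lambda>J. N + R + 1 - J) ` S)"
      unfolding z by (rule mem)
    finally show "z \<in> ?\<rho> ` ?C \<longleftrightarrow> z \<in> rect R (2 * N - d0) \<union> {2 * N - d0} \<times> ((\<lambda>J. N + R + 1 - J) ` S)"
      .
  qed
  have "dw a (?\<rho> ` {x, y}) = dw a {x, y}" for x y
  proof -
    obtain d J d' J' where xy: "x = (d, J)" "y = (d', J')" by (cases x, cases y)
    have im': "?\<rho> ` {x, y} = {(2 * N - d, N + R + 1 - J), (2 * N - d', N + R + 1 - J')}"
      by (simp add: xy)
    have e: "2 * N - d' = 2 * N - d + 1 \<longleftrightarrow> d = d' + 1" "2 * N - d = 2 * N - d' + 1 \<longleftrightarrow> d' = d + 1"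
      "N + R + 1 - J' = N + R + 1 - J \<longleftrightarrow> J' = J" "N + R + 1 - J' = N + R + 1 - J + 1 \<longleftrightarrow> J = J' + 1"
      "N + R + 1 - J = N + R + 1 - J' + 1 \<longleftrightarrow> J' = J + 1" by auto
    show ?thesis unfolding im' unfolding xy dw_pair e by simp
  qed
  then have "haf (dw a) (?\<rho> ` ?C) = haf (dw a) ?C"
    unfolding haf_image[OF fin inj] by (intro haf_cong[OF fin])
  then show ?thesis unfolding im partial_haf_def by simp
qed

lemma sum_Pow_layer:
  "(\<Sum>S\<in>Pow ({d} \<times> I). f S) = (\<Sum>S\<in>Pow I. f ({d} \<times> S))"
proof -
  have "Pow ({d} \<times> I) = (\<lambda>S. {d} \<times> S) ` Pow I"
  proof (intro equalityI subsetI)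
    fix X assume "X \<in> Pow ({d} \<times> I)"
    then have "X = {d} \<times> (snd ` X)" "snd ` X \<in> Pow I" by force+
    then show "X \<in> (\<lambda>S. {d} \<times> S) ` Pow I" by blast
  qed auto
  moreover have "inj_on (\<lambda>S. {d} \<times> S) (Pow I)" by (auto simp: inj_on_def)
  ultimately show ?thesis by (simp add: sum.reindex)
qed

lemma image_minus_interval: "(\<lambda>J. c - J) ` {x..y} = {c - y..c - x :: int}"
proof (intro equalityI subsetI)
  fix z assume "z \<in> {c - y..c - x}"
  then show "z \<in> (\<lambda>J. c - J) ` {x..y}" by (intro image_eqI[of _ _ "c - z"]) auto
qed auto

lemma region_split:
  fixes N c :: int
  assumes "0 \<le> c" "c \<le> 2 * N"
  shows "{(d, J). 0 \<le> d \<and> d \<le> 2 * N \<and> J \<in> layer (W d) d} =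
    {(d, J). 0 \<le> d \<and> d < c \<and> J \<in> layer (W d) d} \<union> {c} \<times> layer (W c) c \<union>
    {(d, J). c < d \<and> d \<le> 2 * N \<and> J \<in> layer (W d) d}"
proof (rule Set.set_eqI)
  fix z :: "int \<times> int"
  obtain d J where z: "z = (d, J)" by (cases z)
  show "z \<in> {(d, J). 0 \<le> d \<and> d \<le> 2 * N \<and> J \<in> layer (W d) d} \<longleftrightarrow>
    z \<in> {(d, J). 0 \<le> d \<and> d < c \<and> J \<in> layer (W d) d} \<union> {c} \<times> layer (W c) c \<union>
    {(d, J). c < d \<and> d \<le> 2 * N \<and> J \<in> layer (W d) d}"
    unfolding z using assms by (cases d c rule: linorder_cases) auto
qed

text \<open>The cut runs along layer \<open>2 m - 1\<close>, the first of width \<open>R\<close>.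
  \<open>T\<close> consists of the cells that a layer of width \<open>N\<close> would have in
  addition; counting them among the cells not matched to the left lets the left half be evaluated as
  part of a rectangle of width \<open>N\<close>. \<open>H\<close> is the set of cells matched to the
  right, and balancing the left half forces it to have \<open>k\<close> elements.\<close>

lemma aztec_F_1_sum:
  fixes N m k R :: nat
  assumes "a \<noteq> 0" "1 \<le> m" "m \<le> N" "k \<le> m" and R: "R = N + k - m"
  defines "I \<equiv> {int m..int m + int R}" and "T \<equiv> {int m + int R + 1..int m + int N}"
    and "\<rho> \<equiv> \<lambda>J. int N + int R + 1 - J"
  shows "aztec_F N m (k + 1) a 1 = (\<Sum>H | H \<subseteq> I \<and> card H = k.
     (rect_const a N (m - 1) * a ^ (m + N) / fact (m - 1) * vdm (H \<union> T) * (\<Prod>x\<in>H \<union> T. a powi (- x))) *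
     (rect_const a R (N - m) * a ^ (N - m + R + 1) / fact (N - m) * vdm (\<rho> ` (I - H)) * (\<Prod>x\<in>\<rho> ` (I - H). a powi (- x))))"
proof -
  obtain n where n: "m = Suc n" using assms(2) by (cases m) auto
  define d0 where "d0 = 2 * int n + 1"
  have R': "int R = int N + int k - int m" using assms by simp
  have I: "I = layer (int R) d0" unfolding d0_def layer_odd I_def by (simp add: n)
  have lN: "layer (int N) d0 = I \<union> T" "I \<inter> T = {}"
    unfolding d0_def layer_odd I_def T_def using R' assms(4) by (auto simp: n)
  let ?L = "rect (int N) d0" and ?R = "{(d, J). d0 < d \<and> d \<le> 2 * int N \<and> J \<in> layer (int R) d}"
  have finR: "finite ?R"
    by (rule finite_subset[of _ "SIGMA d:{d0..2 * int N}. layer (int R) d"]) auto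
  have finI: "finite I" by (simp add: I_def)
  have "to_layers N ` part_cells N m (k + 1) = ?L \<union> {d0} \<times> I \<union> ?R"
  proof -
    have c: "0 \<le> d0" "d0 \<le> 2 * int N" using assms(3) by (auto simp: d0_def n)
    have le: "d \<le> 2 * int m - 2 \<longleftrightarrow> d < d0" for d by (auto simp: d0_def n)
    show ?thesis
      unfolding to_layers_part_cells[OF assms(4,3)] R'[symmetric] le region_split[OF c] I rect_def
      by (intro arg_cong2[of _ _ _ _ "(\<union>)"]) auto
  qed
  then have "aztec_F N m (k + 1) a 1 = haf (dw a) (?L \<union> {d0} \<times> I \<union> ?R)"
    unfolding aztec_F_1_eq_haf by simp
  also have "\<dots> = (\<Sum>S\<in>Pow ({d0} \<times> I). haf (dw a) (?L \<union> S) * haf (dw a) (({d0} \<times> I - S) \<union> ?R))"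
  proof (rule haf_split)
    show "finite ({d0} \<times> I)" using finI by simp
    show "?L \<inter> ({d0} \<times> I) = {}" "?L \<inter> ?R = {}" "{d0} \<times> I \<inter> ?R = {}" by (auto simp: rect_def)
    show "dw a {x, y} = 0" if "x \<in> ?L" "y \<in> ?R" for x y
      using that by (cases x; cases y) (auto simp: rect_def dw_pair)
    show "dw a {x, y} = 0" if "x \<in> {d0} \<times> I" "y \<in> {d0} \<times> I" for x y
      using that by (cases x; cases y) (auto simp: dw_pair)
  qed (use finR in simp_all)
  also have "\<dots> = (\<Sum>S\<in>Pow I. partial_haf a (int N) d0 S * partial_haf a (int R) (2 * int N - d0) (\<rho> ` (I - S)))"
    unfolding sum_Pow_layer
  proof (rule sum.cong)
    fix S assume "S \<in> Pow I"
    have "{d0} \<times> I - {d0} \<times> S = {d0} \<times> (I - S)" by auto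
    then show "haf (dw a) (?L \<union> {d0} \<times> S) * haf (dw a) (({d0} \<times> I - {d0} \<times> S) \<union> ?R)
      = partial_haf a (int N) d0 S * partial_haf a (int R) (2 * int N - d0) (\<rho> ` (I - S))"
      unfolding \<rho>_def using assms(3) finI
      by (simp add: partial_haf_rotated d0_def n) (simp add: partial_haf_def)
  qed simp
  also have "\<dots> = (\<Sum>S\<in>{S \<in> Pow I. card S + n = N}. partial_haf a (int N) d0 S * partial_haf a (int R) (2 * int N - d0) (\<rho> ` (I - S)))"
  proof (rule sum.mono_neutral_right)
    show "\<forall>S\<in>Pow I - {S \<in> Pow I. card S + n = N}. partial_haf a (int N) d0 S * partial_haf a (int R) (2 * int N - d0) (\<rho> ` (I - S)) = 0"
    proof
      fix S assume "S \<in> Pow I - {S \<in> Pow I. card S + n = N}"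
      then have "partial_haf a (int N) d0 S = 0"
        unfolding d0_def by (intro partial_haf_odd_eq_0) (use lN in \<open>auto simp: d0_def\<close>)
      then show "partial_haf a (int N) d0 S * partial_haf a (int R) (2 * int N - d0) (\<rho> ` (I - S)) = 0" by simp
    qed
  qed (use finI in auto)
  also have "\<dots> = (\<Sum>H | H \<subseteq> I \<and> card H = k. partial_haf a (int N) d0 (I - H) * partial_haf a (int R) (2 * int N - d0) (\<rho> ` H))"
  proof (rule sum.reindex_bij_witness[of _ "\<lambda>H. I - H" "\<lambda>S. I - S"])
    have cI: "card I = R + 1" by (simp add: I_def)
    have cD: "card (I - S) = R + 1 - card S" "card S \<le> R + 1" if "S \<subseteq> I" for S
      using card_Diff_subset[of S I] card_mono[OF finI that] that finI finite_subset cI by auto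
    show "I - S \<in> {H. H \<subseteq> I \<and> card H = k}" if "S \<in> {S \<in> Pow I. card S + n = N}" for S
      using that cD[of S] assms n by auto
    show "I - H \<in> {S \<in> Pow I. card S + n = N}" if "H \<in> {H. H \<subseteq> I \<and> card H = k}" for H
      using that cD[of H] assms n by auto
  qed (auto simp: double_diff)
  also have "\<dots> = (\<Sum>H | H \<subseteq> I \<and> card H = k.
     (rect_const a N (m - 1) * a ^ (m + N) / fact (m - 1) * vdm (H \<union> T) * (\<Prod>x\<in>H \<union> T. a powi (- x))) *
     (rect_const a R (N - m) * a ^ (N - m + R + 1) / fact (N - m) * vdm (\<rho> ` (I - H)) * (\<Prod>x\<in>\<rho> ` (I - H). a powi (- x))))"
  proof (rule sum.cong)
    fix H assume "H \<in> {H. H \<subseteq> I \<and> card H = k}"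
    then have H: "H \<subseteq> I" "card H = k" by auto
    have finH: "finite H" using H finI finite_subset by blast
    have "I - H = layer (int N) d0 - (H \<union> T)" using lN H by auto
    moreover have "partial_haf a (int N) (2 * int n + 1) (layer (int N) (2 * int n + 1) - (H \<union> T))
       = rect_const a N n * a ^ (n + N + 1) / fact n * vdm (H \<union> T) * (\<Prod>x\<in>H \<union> T. a powi (- x))"
    proof (rule partial_haf_odd[OF assms(1)])
      show "H \<union> T \<subseteq> layer (int N) (2 * int n + 1)" using lN H by (auto simp: d0_def)
      have "card (H \<union> T) = k + card T" using H lN finH by (subst card_Un_disjoint) (auto simp: T_def)
      also have "card T = N - R" by (simp add: T_def)
      finally show "card (H \<union> T) = n + 1" using assms n by auto
    qed (use assms n in auto)
    ultimately have left: "partial_haf a (int N) d0 (I - H)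
      = rect_const a N (m - 1) * a ^ (m + N) / fact (m - 1) * vdm (H \<union> T) * (\<Prod>x\<in>H \<union> T. a powi (- x))"
      by (simp add: d0_def n)
    have inj: "inj \<rho>" by (auto simp: inj_on_def \<rho>_def)
    have lR: "layer (int R) (2 * int (N - m) + 1) = \<rho> ` I"
      unfolding layer_odd I_def \<rho>_def image_minus_interval using assms(3) by (simp add: of_nat_diff)
    have "\<rho> ` H = layer (int R) (2 * int (N - m) + 1) - \<rho> ` (I - H)"
      unfolding lR image_set_diff[OF inj, symmetric] using H by (simp add: double_diff)
    moreover have "partial_haf a (int R) (2 * int (N - m) + 1) (layer (int R) (2 * int (N - m) + 1) - \<rho> ` (I - H))
      = rect_const a R (N - m) * a ^ (N - m + R + 1) / fact (N - m) * vdm (\<rho> ` (I - H)) * (\<Prod>x\<in>\<rho> ` (I - H). a powi (- x))"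
    proof (rule partial_haf_odd[OF assms(1)])
      show "\<rho> ` (I - H) \<subseteq> layer (int R) (2 * int (N - m) + 1)" unfolding lR by auto
      have "card (\<rho> ` (I - H)) = card (I - H)" using inj by (intro card_image) (auto intro: inj_on_subset)
      also have "\<dots> = R + 1 - k" using H finH by (subst card_Diff_subset) (auto simp: I_def)
      finally show "card (\<rho> ` (I - H)) = N - m + 1" using assms by auto
    qed (use assms in auto)
    moreover have "2 * int N - d0 = 2 * int (N - m) + 1" using assms(3) by (simp add: d0_def n of_nat_diff)
    ultimately have right: "partial_haf a (int R) (2 * int N - d0) (\<rho> ` H) =
      rect_const a R (N - m) * a ^ (N - m + R + 1) / fact (N - m) * vdm (\<rho> ` (I - H)) * (\<Prod>x\<in>\<rho> ` (I - H). a powi (- x))"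
      by simp
    show "partial_haf a (int N) d0 (I - H) * partial_haf a (int R) (2 * int N - d0) (\<rho> ` H) =
     (rect_const a N (m - 1) * a ^ (m + N) / fact (m - 1) * vdm (H \<union> T) * (\<Prod>x\<in>H \<union> T. a powi (- x))) *
     (rect_const a R (N - m) * a ^ (N - m + R + 1) / fact (N - m) * vdm (\<rho> ` (I - H)) * (\<Prod>x\<in>\<rho> ` (I - H). a powi (- x)))"
      unfolding left right ..
  qed simp
  finally show ?thesis .
qed

text \<open>The cut layer \<open>2 m\<close> still has width \<open>N\<close>. Of the cells in
  \<open>T\<close> only the lowest has a neighbour on layer \<open>2 m + 1\<close>, namely through
  the domino that the slit forbids, so all of \<open>T\<close> is matched to the left. In this case
  \<open>H\<close> consists of the \<open>k\<close> other cells matched to the left, and the summand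
  has the same shape as for the odd cut.\<close>

lemma aztec_F_0_sum:
  fixes N m k R :: nat
  assumes "a \<noteq> 0" "m < N" "k \<le> m" and R: "R = N + k - m"
  defines "I \<equiv> {int m + 1..int m + int R}" and "T \<equiv> {int m + int R + 1..int m + int N}"
    and "\<rho> \<equiv> \<lambda>J. int N + int R + 1 - J"
  shows "aztec_F N m (k + 1) a 0 = (\<Sum>H | H \<subseteq> I \<and> card H = k.
     (rect_const a N m * vdm (H \<union> T) * (\<Prod>x\<in>H \<union> T. a powi (- x))) *
     (rect_const a R (N - m) * vdm (\<rho> ` (I - H)) * (\<Prod>x\<in>\<rho> ` (I - H). a powi (- x))))"
proof -
  define d0 where "d0 = 2 * int m"
  have R': "int R = int N + int k - int m" using assms by simp
  have I: "I = layer (int R) d0" unfolding d0_def layer_even I_def by simp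
  have lN: "layer (int N) d0 = I \<union> T" "I \<inter> T = {}"
    unfolding d0_def layer_even I_def T_def using R' assms(3) by auto
  define sp where "sp = slit_pair N m (k + 1)"
  have sp: "sp = {(d0, int m + int R + 1), (d0 + 1, int m + int R + 1)}"
    unfolding sp_def slit_pair_def d0_def using R' by (simp add: algebra_simps)
  let ?w = "\<lambda>D. if D = sp then 0 else dw a D"
  let ?L = "rect (int N) d0" and ?R = "{(d, J). d0 < d \<and> d \<le> 2 * int N \<and> J \<in> layer (int R) d}"
    and ?M = "layer (int N) d0"
  have finR: "finite ?R"
    by (rule finite_subset[of _ "SIGMA d:{d0..2 * int N}. layer (int R) d"]) auto
  have finI: "finite I" by (simp add: I_def)
  have eqR: "int N + int (k + 1) - int (m + 1) = int R" using R' by simp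
  have "to_layers N ` part_cells N (m + 1) (k + 2) = ?L \<union> {d0} \<times> ?M \<union> ?R"
  proof -
    have c: "0 \<le> d0" "d0 \<le> 2 * int N" using assms(2) by (auto simp: d0_def)
    have le: "d \<le> 2 * int (m + 1) - 2 \<longleftrightarrow> d \<le> d0" for d by (auto simp: d0_def)
    have k2: "k + 2 = k + 1 + 1" by simp
    have le': "k + 1 \<le> m + 1" "m + 1 \<le> N" using assms by auto
    show ?thesis
      unfolding k2 to_layers_part_cells[OF le'] eqR le region_split[OF c] rect_def
      by (intro arg_cong2[of _ _ _ _ "(\<union>)"]) auto
  qed
  then have "aztec_F N m (k + 1) a 0 = haf ?w (?L \<union> {d0} \<times> ?M \<union> ?R)"
    using aztec_F_0_eq_haf[OF assms(2), of "k + 1" a] by (simp add: sp_def)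
  also have "\<dots> = (\<Sum>S\<in>Pow ({d0} \<times> ?M). haf ?w (?L \<union> S) * haf ?w (({d0} \<times> ?M - S) \<union> ?R))"
  proof (rule haf_split)
    show "finite ({d0} \<times> ?M)" by simp
    show "?L \<inter> ({d0} \<times> ?M) = {}" "?L \<inter> ?R = {}" "{d0} \<times> ?M \<inter> ?R = {}" by (auto simp: rect_def)
    show "?w {x, y} = 0" if "x \<in> ?L" "y \<in> ?R" for x y
      using that by (cases x; cases y) (auto simp: rect_def dw_pair)
    show "?w {x, y} = 0" if "x \<in> {d0} \<times> ?M" "y \<in> {d0} \<times> ?M" for x y
      using that by (cases x; cases y) (auto simp: dw_pair)
  qed (use finR in simp_all)
  also have "\<dots> = (\<Sum>S\<in>Pow ?M. haf ?w (?L \<union> {d0} \<times> S) * haf ?w ({d0} \<times> (?M - S) \<union> ?R))"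
  proof -
    have "{d0} \<times> ?M - {d0} \<times> S = {d0} \<times> (?M - S)" for S by auto
    then show ?thesis unfolding sum_Pow_layer by simp
  qed
  also have "\<dots> = (\<Sum>S\<in>{S \<in> Pow ?M. card S = m \<and> ?M - S \<subseteq> I}.
      partial_haf a (int N) d0 S * partial_haf a (int R) (2 * int N - d0) (\<rho> ` (?M - S)))"
  proof (rule sum.mono_neutral_cong_right)
    have left: "haf ?w (?L \<union> {d0} \<times> S) = partial_haf a (int N) d0 S" if "S \<subseteq> ?M" for S
      unfolding partial_haf_def
    proof (rule haf_cong)
      show "finite (?L \<union> {d0} \<times> S)" using finite_subset[OF that] by simp
      fix x y assume "x \<in> ?L \<union> {d0} \<times> S" "y \<in> ?L \<union> {d0} \<times> S"
      then have "{x, y} \<noteq> sp" unfolding sp by (auto simp: rect_def doubleton_eq_iff)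
      then show "?w {x, y} = dw a {x, y}" by simp
    qed
    show "haf ?w (?L \<union> {d0} \<times> S) * haf ?w ({d0} \<times> (?M - S) \<union> ?R) =
        partial_haf a (int N) d0 S * partial_haf a (int R) (2 * int N - d0) (\<rho> ` (?M - S))"
      if S: "S \<in> {S \<in> Pow ?M. card S = m \<and> ?M - S \<subseteq> I}" for S
    proof -
      have fin: "finite ({d0} \<times> (?M - S) \<union> ?R)" using finR by simp
      have "haf ?w ({d0} \<times> (?M - S) \<union> ?R) = haf (dw a) ({d0} \<times> (?M - S) \<union> ?R)"
      proof (rule haf_cong[OF fin])
        fix x y assume xy: "x \<in> {d0} \<times> (?M - S) \<union> ?R" "y \<in> {d0} \<times> (?M - S) \<union> ?R"
        have "(d0, int m + int R + 1) \<notin> {d0} \<times> (?M - S) \<union> ?R" using S by (auto simp: I_def)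
        moreover have "(d0, int m + int R + 1) \<in> {x, y}" if "{x, y} = sp" using that unfolding sp by simp
        ultimately have "{x, y} \<noteq> sp" using xy by blast
        then show "?w {x, y} = dw a {x, y}" by simp
      qed
      then show ?thesis using left[of S] S assms(2)
        by (simp add: partial_haf_rotated d0_def \<rho>_def)
    qed
    show "\<forall>S\<in>Pow ?M - {S \<in> Pow ?M. card S = m \<and> ?M - S \<subseteq> I}. haf ?w (?L \<union> {d0} \<times> S) * haf ?w ({d0} \<times> (?M - S) \<union> ?R) = 0"
    proof
      fix S assume S: "S \<in> Pow ?M - {S \<in> Pow ?M. card S = m \<and> ?M - S \<subseteq> I}"
      show "haf ?w (?L \<union> {d0} \<times> S) * haf ?w ({d0} \<times> (?M - S) \<union> ?R) = 0"
      proof (cases "card S = m")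
        case True
        then obtain J where J: "J \<in> ?M - S" "J \<notin> I" using S by auto
        then have J': "J \<ge> int m + int R + 1" using lN(1) by (auto simp: T_def)
        have "haf ?w ({d0} \<times> (?M - S) \<union> ?R) = 0"
        proof (rule haf_eq_0[of _ "(d0, J)"])
          fix x assume x: "x \<in> {d0} \<times> (?M - S) \<union> ?R"
          obtain d K where dK: "x = (d, K)" by (cases x)
          show "?w {(d0, J), x} = 0"
          proof (cases "d = d0 + 1")
            case True
            then have "K \<in> layer (int R) (2 * int m + 1)" using x dK by (auto simp: d0_def)
            then have K: "K \<le> int m + 1 + int R" unfolding layer_odd by simp
            show ?thesis
            proof (cases "J = int m + int R + 1 \<and> K = J")
              case True
              then show ?thesis unfolding dK sp using \<open>d = d0 + 1\<close> by simp
            next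
              case False
              then have "dw a {(d0, J), x} = 0" unfolding dK dw_pair using K J' \<open>d = d0 + 1\<close> by auto
              then show ?thesis by simp
            qed
          next
            case False
            then have "dw a {(d0, J), x} = 0" unfolding dK dw_pair using x dK by auto
            then show ?thesis by simp
          qed
        qed (use finR J in auto)
        then show ?thesis by simp
      next
        case False
        then have "partial_haf a (int N) d0 S = 0"
          unfolding d0_def by (intro partial_haf_even_eq_0) (use S in \<open>auto simp: d0_def\<close>)
        then show ?thesis using left[of S] S by simp
      qed
    qed
  qed auto
  also have "\<dots> = (\<Sum>H | H \<subseteq> I \<and> card H = k. partial_haf a (int N) d0 (H \<union> T) * partial_haf a (int R) (2 * int N - d0) (\<rho> ` (I - H)))"
  proof (rule sum.reindex_bij_witness[of _ "\<lambda>H. H \<union> T" "\<lambda>S. S \<inter> I"])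
    have cT: "card T = m - k" using assms by (simp add: T_def)
    have cU: "card (H \<union> T) = card H + (m - k)" if "H \<subseteq> I" for H
      using that lN(2) finI finite_subset[OF that] cT by (subst card_Un_disjoint) (auto simp: T_def)
    have ST: "S = (S \<inter> I) \<union> T" if "S \<in> {S \<in> Pow ?M. card S = m \<and> ?M - S \<subseteq> I}" for S
      using that lN by auto
    show "(S \<inter> I) \<union> T = S" if "S \<in> {S \<in> Pow ?M. card S = m \<and> ?M - S \<subseteq> I}" for S
      using ST[OF that] by simp
    show "S \<inter> I \<in> {H. H \<subseteq> I \<and> card H = k}" if "S \<in> {S \<in> Pow ?M. card S = m \<and> ?M - S \<subseteq> I}" for S
      using cU[of "S \<inter> I"] ST[OF that] that assms(3) by auto
    show "H \<union> T \<in> {S \<in> Pow ?M. card S = m \<and> ?M - S \<subseteq> I}" if "H \<in> {H. H \<subseteq> I \<and> card H = k}" for H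
      using cU[of H] that lN assms(3) by auto
    show "(H \<union> T) \<inter> I = H" if "H \<in> {H. H \<subseteq> I \<and> card H = k}" for H
      using that lN by auto
    show "partial_haf a (int N) d0 (S \<inter> I \<union> T) * partial_haf a (int R) (2 * int N - d0) (\<rho> ` (I - S \<inter> I))
      = partial_haf a (int N) d0 S * partial_haf a (int R) (2 * int N - d0) (\<rho> ` (?M - S))"
      if "S \<in> {S \<in> Pow ?M. card S = m \<and> ?M - S \<subseteq> I}" for S
    proof -
      have "I - S \<inter> I = ?M - S" using that lN by auto
      then show ?thesis using ST[OF that] by simp
    qed
  qed
  also have "\<dots> = (\<Sum>H | H \<subseteq> I \<and> card H = k.
     (rect_const a N m * vdm (H \<union> T) * (\<Prod>x\<in>H \<union> T. a powi (- x))) *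
     (rect_const a R (N - m) * vdm (\<rho> ` (I - H)) * (\<Prod>x\<in>\<rho> ` (I - H). a powi (- x))))"
  proof (rule sum.cong)
    fix H assume "H \<in> {H. H \<subseteq> I \<and> card H = k}"
    then have H: "H \<subseteq> I" "card H = k" by auto
    have finH: "finite H" using H finI finite_subset by blast
    have left: "partial_haf a (int N) (2 * int m) (H \<union> T) = rect_const a N m * vdm (H \<union> T) * (\<Prod>x\<in>H \<union> T. a powi (- x))"
    proof (rule partial_haf_even[OF assms(1)])
      show "H \<union> T \<subseteq> layer (int N) (2 * int m)" using lN H by (auto simp: d0_def)
      have "card (H \<union> T) = k + card T" using H lN finH by (subst card_Un_disjoint) (auto simp: T_def)
      also have "card T = N - R" by (simp add: T_def)
      finally show "card (H \<union> T) = m" using assms by auto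
    qed (use assms in auto)
    have inj: "inj \<rho>" by (auto simp: inj_on_def \<rho>_def)
    have lR: "layer (int R) (2 * int (N - m)) = \<rho> ` I"
      unfolding layer_even I_def \<rho>_def image_minus_interval using assms(2) by (simp add: of_nat_diff)
    have right: "partial_haf a (int R) (2 * int (N - m)) (\<rho> ` (I - H))
      = rect_const a R (N - m) * vdm (\<rho> ` (I - H)) * (\<Prod>x\<in>\<rho> ` (I - H). a powi (- x))"
    proof (rule partial_haf_even[OF assms(1)])
      show "\<rho> ` (I - H) \<subseteq> layer (int R) (2 * int (N - m))" unfolding lR by auto
      have "card (\<rho> ` (I - H)) = card (I - H)" using inj by (intro card_image) (auto intro: inj_on_subset)
      also have "\<dots> = R - k" using H finH by (subst card_Diff_subset) (auto simp: I_def)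
      finally show "card (\<rho> ` (I - H)) = N - m" using assms by auto
    qed (use assms in auto)
    have e: "2 * int N - 2 * int m = 2 * int (N - m)" using assms(2) by (simp add: of_nat_diff)
    show "partial_haf a (int N) d0 (H \<union> T) * partial_haf a (int R) (2 * int N - d0) (\<rho> ` (I - H)) =
     (rect_const a N m * vdm (H \<union> T) * (\<Prod>x\<in>H \<union> T. a powi (- x))) *
     (rect_const a R (N - m) * vdm (\<rho> ` (I - H)) * (\<Prod>x\<in>\<rho> ` (I - H). a powi (- x)))"
      unfolding d0_def e left right ..
  qed simp
  finally show ?thesis .
qed

section \<open>Reduction to a determinant of fixed size\<close>

lemma vdm_Un_disjoint:
  assumes "finite A" "finite B" "A \<inter> B = {}"
  shows "vdm (A \<union> B) = vdm A * vdm B * (\<Prod>x\<in>A. \<Prod>y\<in>B. \<bar>real_of_int (y - x)\<bar>)"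
proof -
  have "vdm (A \<union> B) * vdm A = vdm B * (\<Prod>x\<in>A. \<Prod>y\<in>A \<union> B - {x}. \<bar>real_of_int (y - x)\<bar>)"
    using vdm_complement[of "A \<union> B" A] assms by (simp add: Un_Diff Diff_triv inf_commute)
  also have "(\<Prod>x\<in>A. \<Prod>y\<in>A \<union> B - {x}. \<bar>real_of_int (y - x)\<bar>)
      = (\<Prod>x\<in>A. (\<Prod>y\<in>A - {x}. \<bar>real_of_int (y - x)\<bar>) * (\<Prod>y\<in>B. \<bar>real_of_int (y - x)\<bar>))"
  proof (rule prod.cong)
    fix x assume "x \<in> A"
    then have "A \<union> B - {x} = (A - {x}) \<union> B" using assms by auto
    then have "(\<Prod>y\<in>A \<union> B - {x}. \<bar>real_of_int (y - x)\<bar>) = (\<Prod>y\<in>(A - {x}) \<union> B. \<bar>real_of_int (y - x)\<bar>)"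
      by (rule arg_cong)
    also have "\<dots> = (\<Prod>y\<in>A - {x}. \<bar>real_of_int (y - x)\<bar>) * (\<Prod>y\<in>B. \<bar>real_of_int (y - x)\<bar>)"
      using assms by (intro prod.union_disjoint) auto
    finally show "(\<Prod>y\<in>A \<union> B - {x}. \<bar>real_of_int (y - x)\<bar>)
        = (\<Prod>y\<in>A - {x}. \<bar>real_of_int (y - x)\<bar>) * (\<Prod>y\<in>B. \<bar>real_of_int (y - x)\<bar>)" .
  qed simp
  also have "\<dots> = vdm A ^ 2 * (\<Prod>x\<in>A. \<Prod>y\<in>B. \<bar>real_of_int (y - x)\<bar>)"
    unfolding prod.distrib vdm_square[OF assms(1)] ..
  finally show ?thesis using vdm_pos[OF assms(1)] by (simp add: power2_eq_square)
qed

text \<open>Reflection changes only the signs of differences, so the squares agree in their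
  order-free form, and both products are positive.\<close>

lemma vdm_reflect:
  assumes "finite A"
  shows "vdm ((\<lambda>x. e - x) ` A) = vdm A"
proof -
  have "(vdm ((\<lambda>x. e - x) ` A))\<^sup>2 = (vdm A)\<^sup>2"
  proof -
    have inj: "inj_on (\<lambda>x. e - x) B" for B :: "int set" by (auto simp: inj_on_def)
    have im: "(\<lambda>x. e - x) ` A - {e - x} = (\<lambda>x. e - x) ` (A - {x})" for x by auto
    have "(vdm ((\<lambda>x. e - x) ` A))\<^sup>2 = (\<Prod>x\<in>A. \<Prod>y\<in>A - {x}. \<bar>real_of_int ((e - y) - (e - x))\<bar>)"
      unfolding vdm_square[OF finite_imageI[OF assms]] prod.reindex[OF inj] comp_def im ..
    also have "\<dots> = (vdm A)\<^sup>2"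
      unfolding vdm_square[OF assms] by (intro prod.cong refl) (simp add: abs_minus_commute)
    finally show ?thesis .
  qed
  then show ?thesis
    using vdm_pos[OF assms] vdm_pos[OF finite_imageI[OF assms, of "\<lambda>x. e - x"]]
    by (simp add: power2_eq_iff_nonneg less_imp_le)
qed

lemma vdm_interval: "vdm {c + 1..c + int n} = (\<Prod>i<n. fact i)"
proof (induction n)
  case (Suc n)
  have "vdm {c + 1..c + int n + 1} = fact (nat (c + int n + 1 - (c + 1))) * vdm {c + 1..c + int n}"
    by (rule vdm_interval_Suc) simp
  moreover have "c + int (Suc n) = c + int n + 1" by simp
  ultimately show ?case using Suc by (simp only:) simp
qed simp

lemma prod_powi:
  fixes a :: real
  assumes "a \<noteq> 0" "finite A"
  shows "(\<Prod>x\<in>A. a powi f x) = a powi (\<Sum>x\<in>A. f x)"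
  using assms(2) by (induction A rule: finite_induct) (simp_all add: power_int_add assms(1))

text \<open>By Cauchy-Binet such a determinant is a sum of products of two Vandermonde determinants.
  Hence the polynomials for the rows and those for the columns may be chosen independently of each
  other.\<close>

lemma dt_basis_change:
  fixes w :: "'b \<Rightarrow> real" and f :: "'b \<Rightarrow> real"
  assumes "finite X" "\<And>j i. j < n \<Longrightarrow> j < i \<Longrightarrow> coeff (p j) i = 0" "\<And>j i. j < n \<Longrightarrow> j < i \<Longrightarrow> coeff (q j) i = 0"
  shows "dt n (\<lambda>i j. \<Sum>x\<in>X. poly (p i) (f x) * (poly (q j) (f x) * w x))
    = (\<Prod>j<n. coeff (p j) j) * (\<Prod>j<n. coeff (q j) j) * dt n (\<lambda>i j. \<Sum>x\<in>X. f x ^ i * (f x ^ j * w x))"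
proof -
  have sc: "dt n (\<lambda>i j. h j i * w (\<phi> i)) = (\<Prod>i<n. w (\<phi> i)) * dt n (\<lambda>i j. h j i)" for h \<phi>
    using dt_scale_rows[of n "\<lambda>i. w (\<phi> i)" "\<lambda>i j. h j i"] by (simp add: mult.commute)
  have "fact n * dt n (\<lambda>i j. \<Sum>x\<in>X. poly (p i) (f x) * (poly (q j) (f x) * w x))
    = (\<Sum>\<phi>\<in>PiE {..<n} (\<lambda>_. X). dt n (\<lambda>i j. poly (p j) (f (\<phi> i))) * dt n (\<lambda>i j. poly (q j) (f (\<phi> i)) * w (\<phi> i)))"
    using fact_dt_sum[OF assms(1), of n "\<lambda>i x. poly (p i) (f x)" "\<lambda>j x. poly (q j) (f x) * w x"] by simp
  also have "\<dots> = (\<Prod>j<n. coeff (p j) j) * (\<Prod>j<n. coeff (q j) j) *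
      (\<Sum>\<phi>\<in>PiE {..<n} (\<lambda>_. X). dt n (\<lambda>i j. f (\<phi> i) ^ j) * dt n (\<lambda>i j. f (\<phi> i) ^ j * w (\<phi> i)))"
    unfolding sum_distrib_left
  proof (rule sum.cong)
    fix \<phi>
    have 1: "dt n (\<lambda>i j. poly (p j) (f (\<phi> i))) = (\<Prod>j<n. coeff (p j) j) * dt n (\<lambda>i j. f (\<phi> i) ^ j)"
      by (rule dt_poly[OF assms(2)])
    have 2: "dt n (\<lambda>i j. poly (q j) (f (\<phi> i))) = (\<Prod>j<n. coeff (q j) j) * dt n (\<lambda>i j. f (\<phi> i) ^ j)"
      by (rule dt_poly[OF assms(3)])
    show "dt n (\<lambda>i j. poly (p j) (f (\<phi> i))) * dt n (\<lambda>i j. poly (q j) (f (\<phi> i)) * w (\<phi> i))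
      = (\<Prod>j<n. coeff (p j) j) * (\<Prod>j<n. coeff (q j) j) * (dt n (\<lambda>i j. f (\<phi> i) ^ j) * dt n (\<lambda>i j. f (\<phi> i) ^ j * w (\<phi> i)))"
      unfolding sc[of "\<lambda>j i. poly (q j) (f (\<phi> i))"] sc[of "\<lambda>j i. f (\<phi> i) ^ j"] 1 2 by simp
  qed simp
  also have "(\<Sum>\<phi>\<in>PiE {..<n} (\<lambda>_. X). dt n (\<lambda>i j. f (\<phi> i) ^ j) * dt n (\<lambda>i j. f (\<phi> i) ^ j * w (\<phi> i)))
    = fact n * dt n (\<lambda>i j. \<Sum>x\<in>X. f x ^ i * (f x ^ j * w x))"
    using fact_dt_sum[OF assms(1), of n "\<lambda>i x. f x ^ i" "\<lambda>j x. f x ^ j * w x"] by simp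
  finally show ?thesis by simp
qed

text \<open>Only used for \<open>l < Q\<close>, where the subtractions do not truncate.\<close>

definition entry :: "real \<Rightarrow> nat \<Rightarrow> nat \<Rightarrow> nat \<Rightarrow> nat \<Rightarrow> real" where
  "entry a \<tau> Q i l = (\<Sum>s\<le>Q - 1 - l. real ((Q - 1 - l) choose s) * a ^ (2 * s) * real ((\<tau> + i + l + s) choose (l + s)))"

lemma coeff_prod_neg_linear:
  fixes c :: "nat \<Rightarrow> real"
  shows "degree (\<Prod>r<i. [:c r, -1:]) = i" "coeff (\<Prod>r<i. [:c r, -1:]) i = (- 1) ^ i"
proof -
  show deg: "degree (\<Prod>r<i. [:c r, -1:]) = i"
    by (subst degree_prod_eq_sum_degree) auto
  have "lead_coeff (\<Prod>r<i. [:c r, -1:]) = (- 1) ^ i"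
    unfolding lead_coeff_prod by simp
  then show "coeff (\<Prod>r<i. [:c r, -1:]) i = (- 1) ^ i" by (simp add: deg)
qed

lemma prod_rising: "(\<Prod>r<i. real c + real r + 1) * fact c = fact (c + i)"
proof (induction i)
  case (Suc i)
  have "(\<Prod>r<Suc i. real c + real r + 1) * fact c = (real c + real i + 1) * ((\<Prod>r<i. real c + real r + 1) * fact c)"
    by simp
  also have "\<dots> = fact (c + Suc i)" unfolding Suc by simp
  finally show ?case .
qed simp

lemma prod_falling_eq_0: "j < l \<Longrightarrow> (\<Prod>r<l. real j - real r) = 0"
  by (auto simp: prod_zero_iff)

text \<open>The bases fit the weight: the rising product turns \<open>fact (\<tau> + j)\<close> into
  \<open>fact (\<tau> + j + i)\<close>, and the falling one turns one \<open>fact j\<close> in the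
  denominator into \<open>fact (j - l)\<close>. Terms with \<open>j < l\<close> vanish, and
  \<open>s = j - l\<close> gives products of two binomial coefficients.\<close>

lemma sum_hole_weights:
  fixes \<tau> Q i l :: nat and a :: real
  assumes "l < Q"
  shows "(\<Sum>j<Q. (\<Prod>r<i. real \<tau> + real j + real r + 1) * ((\<Prod>r<l. real j - real r) *
      (a ^ (2 * j) * fact (\<tau> + j) / (fact j * fact j * fact (Q - 1 - j)))))
    = a ^ (2 * l) * fact (\<tau> + i) / fact (Q - 1 - l) * entry a \<tau> Q i l"
proof -
  let ?t = "\<lambda>j. (\<Prod>r<i. real \<tau> + real j + real r + 1) * ((\<Prod>r<l. real j - real r) *
      (a ^ (2 * j) * fact (\<tau> + j) / (fact j * fact j * fact (Q - 1 - j))))"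
  have "(\<Sum>j<Q. ?t j) = (\<Sum>j\<in>{l..<Q}. ?t j)"
    by (rule sum.mono_neutral_right) (auto simp: prod_falling_eq_0)
  also have "\<dots> = (\<Sum>s\<le>Q - 1 - l. ?t (l + s))"
    by (rule sum.reindex_bij_witness[of _ "\<lambda>s. l + s" "\<lambda>j. j - l"]) (use assms in auto)
  also have "\<dots> = (\<Sum>s\<le>Q - 1 - l. a ^ (2 * l) * fact (\<tau> + i) / fact (Q - 1 - l) *
      (real ((Q - 1 - l) choose s) * a ^ (2 * s) * real ((\<tau> + i + l + s) choose (l + s))))"
  proof (rule sum.cong)
    fix s assume s: "s \<in> {..Q - 1 - l}"
    let ?j = "l + s"
    have 1: "(\<Prod>r<i. real \<tau> + real ?j + real r + 1) = fact (\<tau> + ?j + i) / fact (\<tau> + ?j)"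
      using prod_rising[where c = "\<tau> + ?j" and i = i] by (simp add: field_simps)
    have 2: "(\<Prod>r<l. real ?j - real r) = fact ?j / fact s"
      using prod_falling[of l ?j] by (simp add: field_simps)
    have 3: "real ((\<tau> + i + l + s) choose (l + s)) = fact (\<tau> + ?j + i) / (fact ?j * fact (\<tau> + i))"
      using binomial_fact[of "l + s" "\<tau> + i + l + s", where ?'a = real] by (simp add: add_ac)
    have 4: "real ((Q - 1 - l) choose s) = fact (Q - 1 - l) / (fact s * fact (Q - 1 - ?j))"
      using binomial_fact[of s "Q - 1 - l", where ?'a = real] s by simp
    have pos: "fact n > (0::real)" for n by simp
    show "?t ?j = a ^ (2 * l) * fact (\<tau> + i) / fact (Q - 1 - l) *
      (real ((Q - 1 - l) choose s) * a ^ (2 * s) * real ((\<tau> + i + l + s) choose (l + s)))"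
      unfolding 1 2 3 4 by (simp add: field_simps power_add)
  qed simp
  finally show ?thesis unfolding entry_def by (simp add: sum_distrib_left)
qed

lemma prod_fact_split: "(\<Prod>i<\<tau> + k. fact i) = (\<Prod>i<\<tau>. fact i) * (\<Prod>i<k. fact (\<tau> + i) :: real)"
  by (induction k) (simp_all add: mult_ac)

lemma prod_fact_split_rev: "(\<Prod>i<n + k. fact i) = (\<Prod>i<n. fact i) * (\<Prod>i<k. fact (n + k - 1 - i) :: real)"
  unfolding prod_fact_split prod.nat_diff_reindex[of "\<lambda>i. fact (n + i)" k, symmetric]
  by (intro arg_cong2[of _ _ _ _ "(*)"] prod.cong refl arg_cong[of _ _ fact]) auto

text \<open>General \<open>b\<close>, \<open>e\<close> and \<open>n\<close> serve both cuts.
  \<open>I\<close> is an interval of \<open>Q\<close> cells with upper end \<open>b\<close>, and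
  \<open>T\<close> consists of the \<open>\<tau>\<close> cells above it. The differences to
  \<open>T\<close>, the passage to the complement \<open>I - H\<close> and the powers of
  \<open>a\<close> each contribute a product over \<open>H\<close>, so the summand is the square of
  \<open>vdm H\<close> times a product weight, and the sum is a Hankel determinant.\<close>

lemma hole_sum:
  fixes \<tau> n k :: nat and b e :: int and a cl cr :: real
  assumes a: "a \<noteq> 0"
  defines "Q \<equiv> n + k"
  defines "I \<equiv> {b - int Q + 1..b}" and "T \<equiv> {b + 1..b + int \<tau>}" and "\<rho> \<equiv> \<lambda>x. e - x"
  shows "(\<Sum>H | H \<subseteq> I \<and> card H = k. (cl * vdm (H \<union> T) * (\<Prod>x\<in>H \<union> T. a powi (- x))) *
       (cr * vdm (\<rho> ` (I - H)) * (\<Prod>x\<in>\<rho> ` (I - H). a powi (- x))))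
    = cl * cr * (\<Prod>i<\<tau> + k. fact i) * (\<Prod>i<n. fact i) *
      a powi ((\<Sum>x\<in>T. - x) + (\<Sum>x\<in>I. x - e) + (\<Sum>i<k. e - 2 * b + 2 * int i)) * dt k (entry a \<tau> Q)"
proof -
  have fin: "finite I" "finite T" by (simp_all add: I_def T_def)
  define w where "w x = a powi (e - 2 * x) * (fact (nat (b + int \<tau> - x)) / fact (nat (b - x))) /
    (fact (nat (x - (b - int Q + 1))) * fact (nat (b - x)))" for x
  \<comment> \<open>In terms of \<open>j = b - x\<close>, the distance from the upper end of
    \<open>I\<close>, these are the rising and falling products of \<open>sum_hole_weights\<close>.
    The leading signs of the two families cancel.\<close>
  define p where "p i = (\<Prod>r<i. [:real \<tau> + real_of_int b + real r + 1, -1:])" for i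
  define q where "q l = (\<Prod>r<l. [:real_of_int b - real r, -1:])" for l
  let ?c = "cl * cr * vdm T * a powi (\<Sum>x\<in>T. - x) * (vdm I * a powi (\<Sum>x\<in>I. x - e))"
  have "(\<Sum>H | H \<subseteq> I \<and> card H = k. (cl * vdm (H \<union> T) * (\<Prod>x\<in>H \<union> T. a powi (- x))) *
       (cr * vdm (\<rho> ` (I - H)) * (\<Prod>x\<in>\<rho> ` (I - H). a powi (- x))))
     = (\<Sum>H | H \<subseteq> I \<and> card H = k. ?c * (vdm H ^ 2 * (\<Prod>x\<in>H. w x)))"
  proof (rule sum.cong)
    fix H assume "H \<in> {H. H \<subseteq> I \<and> card H = k}"
    then have H: "H \<subseteq> I" by auto
    then have finH: "finite H" using fin finite_subset by blast
    have HT: "H \<inter> T = {}" using H by (auto simp: I_def T_def)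
    define D where "D x = (fact (nat (x - (b - int Q + 1))) * fact (nat (b - x)) :: real)" for x
    define V where "V x = (fact (nat (b + int \<tau> - x)) / fact (nat (b - x)) :: real)" for x
    have "(\<Prod>y\<in>T. \<bar>real_of_int (y - x)\<bar>) = V x" if "x \<in> H" for x
    proof -
      have x: "x \<le> b" using that H by (auto simp: I_def)
      have "{x<..b + int \<tau>} = {x<..b} \<union> T" using x by (auto simp: T_def)
      then have "(\<Prod>y\<in>{x<..b + int \<tau>}. \<bar>real_of_int (y - x)\<bar>) = (\<Prod>y\<in>{x<..b} \<union> T. \<bar>real_of_int (y - x)\<bar>)"
        by (rule arg_cong)
      also have "\<dots> = (\<Prod>y\<in>{x<..b}. \<bar>real_of_int (y - x)\<bar>) * (\<Prod>y\<in>T. \<bar>real_of_int (y - x)\<bar>)"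
        by (rule prod.union_disjoint) (auto simp: T_def)
      finally show ?thesis
        using prod_int_dist_above[of x "b + int \<tau>"] prod_int_dist_above[of x b] x
        by (simp add: V_def field_simps)
    qed
    then have cross: "(\<Prod>x\<in>H. \<Prod>y\<in>T. \<bar>real_of_int (y - x)\<bar>) = (\<Prod>x\<in>H. V x)" by simp
    have 1: "vdm (H \<union> T) = vdm H * vdm T * (\<Prod>x\<in>H. V x)"
      unfolding vdm_Un_disjoint[OF finH fin(2) HT] cross ..
    have 2: "(\<Prod>x\<in>H \<union> T. a powi (- x)) = (\<Prod>x\<in>H. a powi (- x)) * a powi (\<Sum>x\<in>T. - x)"
      by (subst prod.union_disjoint) (use finH fin HT in \<open>auto simp: prod_powi[OF a]\<close>)
    have "vdm I * vdm H = vdm (I - H) * (\<Prod>x\<in>H. \<Prod>y\<in>I - {x}. \<bar>real_of_int (y - x)\<bar>)"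
      by (rule vdm_complement[OF fin(1) H])
    also have "(\<Prod>x\<in>H. \<Prod>y\<in>I - {x}. \<bar>real_of_int (y - x)\<bar>) = (\<Prod>x\<in>H. D x)"
      unfolding I_def D_def by (intro prod.cong refl prod_int_dist) (use H in \<open>auto simp: I_def\<close>)
    finally have "vdm I * vdm H = vdm (I - H) * (\<Prod>x\<in>H. D x)" .
    moreover have "(\<Prod>x\<in>H. D x) > 0" by (intro prod_pos) (simp add: D_def)
    ultimately have "vdm (I - H) = vdm I * vdm H / (\<Prod>x\<in>H. D x)" by (simp add: field_simps)
    then have 3: "vdm (\<rho> ` (I - H)) = vdm I * vdm H / (\<Prod>x\<in>H. D x)"
      unfolding \<rho>_def using vdm_reflect[of "I - H" e] fin by simp
    have 4: "(\<Prod>x\<in>\<rho> ` (I - H). a powi (- x)) = a powi (\<Sum>x\<in>I. x - e) * (\<Prod>x\<in>H. a powi (e - x))"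
    proof -
      have "(\<Prod>x\<in>\<rho> ` (I - H). a powi (- x)) = (\<Prod>x\<in>I - H. a powi (x - e))"
        unfolding \<rho>_def by (subst prod.reindex) (auto simp: inj_on_def)
      moreover have "(\<Prod>x\<in>I. a powi (x - e)) = (\<Prod>x\<in>I - H. a powi (x - e)) * (\<Prod>x\<in>H. a powi (x - e))"
        using H fin by (intro prod.subset_diff) auto
      moreover have "(\<Prod>x\<in>H. a powi (x - e)) * (\<Prod>x\<in>H. a powi (e - x)) = 1"
        unfolding prod.distrib[symmetric] using a by (simp add: power_int_add[symmetric])
      ultimately show ?thesis using fin by (simp add: prod_powi[OF a] mult.assoc)
    qed
    have 5: "(\<Prod>x\<in>H. w x) = (\<Prod>x\<in>H. a powi (- x)) * (\<Prod>x\<in>H. a powi (e - x)) * (\<Prod>x\<in>H. V x) / (\<Prod>x\<in>H. D x)"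
    proof -
      have "w x = a powi (- x) * a powi (e - x) * V x / D x" for x
      proof -
        have "a powi (e - 2 * x) = a powi (- x) * a powi (e - x)"
          using a by (simp add: power_int_add[symmetric])
        then show ?thesis by (simp add: w_def V_def D_def)
      qed
      then show ?thesis by (simp add: prod.distrib prod_dividef)
    qed
    show "(cl * vdm (H \<union> T) * (\<Prod>x\<in>H \<union> T. a powi (- x))) *
       (cr * vdm (\<rho> ` (I - H)) * (\<Prod>x\<in>\<rho> ` (I - H). a powi (- x))) = ?c * (vdm H ^ 2 * (\<Prod>x\<in>H. w x))"
      unfolding 1 2 3 4 5 by (simp add: power2_eq_square)
  qed simp
  also have "\<dots> = ?c * dt k (\<lambda>i j. \<Sum>x\<in>I. real_of_int x ^ i * (real_of_int x ^ j * w x))"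
    unfolding sum_distrib_left[symmetric] sum_vdm_square[OF fin(1)] ..
  also have "dt k (\<lambda>i j. \<Sum>x\<in>I. real_of_int x ^ i * (real_of_int x ^ j * w x))
      = dt k (\<lambda>i j. \<Sum>x\<in>I. poly (p i) (real_of_int x) * (poly (q j) (real_of_int x) * w x))"
  proof -
    have "(\<Prod>j<k. coeff (p j) j) * (\<Prod>j<k. coeff (q j) j) = (1::real)"
      unfolding p_def q_def coeff_prod_neg_linear prod.distrib[symmetric] by (simp add: power_add[symmetric] flip: mult_2)
    then show ?thesis
      by (subst dt_basis_change[OF fin(1)]) (simp_all add: p_def q_def coeff_eq_0 coeff_prod_neg_linear)
  qed
  also have "\<dots> = dt k (\<lambda>i l. (a powi (e - 2 * b + 2 * int l) / fact (Q - 1 - l)) * (fact (\<tau> + i) * entry a \<tau> Q i l))"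
  proof (rule dt_cong)
    fix i l assume "i < k" "l < k"
    then have l: "l < Q" by (simp add: Q_def)
    have "(\<Sum>x\<in>I. poly (p i) (real_of_int x) * (poly (q l) (real_of_int x) * w x))
      = (\<Sum>j<Q. poly (p i) (real_of_int (b - int j)) * (poly (q l) (real_of_int (b - int j)) * w (b - int j)))"
      by (rule sum.reindex_bij_witness[of _ "\<lambda>j. b - int j" "\<lambda>x. nat (b - x)"]) (auto simp: I_def)
    also have "\<dots> = (\<Sum>j<Q. a powi (e - 2 * b) * ((\<Prod>r<i. real \<tau> + real j + real r + 1) * ((\<Prod>r<l. real j - real r) *
      (a ^ (2 * j) * fact (\<tau> + j) / (fact j * fact j * fact (Q - 1 - j))))))"
    proof (rule sum.cong)
      fix j assume j: "j \<in> {..<Q}"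
      have 1: "poly (p i) (real_of_int (b - int j)) = (\<Prod>r<i. real \<tau> + real j + real r + 1)"
        unfolding p_def poly_prod by (intro prod.cong) auto
      have 2: "poly (q l) (real_of_int (b - int j)) = (\<Prod>r<l. real j - real r)"
        unfolding q_def poly_prod by (intro prod.cong) auto
      have "a powi (e - 2 * (b - int j)) = a powi (e - 2 * b) * a powi (int (2 * j))"
        using a by (simp add: power_int_add[symmetric] algebra_simps)
      then have "a powi (e - 2 * (b - int j)) = a powi (e - 2 * b) * a ^ (2 * j)"
        by (simp only: power_int_of_nat)
      moreover have "nat (b + int \<tau> - (b - int j)) = \<tau> + j" "nat (b - (b - int j)) = j"
        "nat (b - int j - (b - int Q + 1)) = Q - 1 - j" using j by auto
      ultimately have 3: "w (b - int j) = a powi (e - 2 * b) * (a ^ (2 * j) * fact (\<tau> + j) / (fact j * fact j * fact (Q - 1 - j)))"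
        unfolding w_def by (simp add: field_simps)
      show "poly (p i) (real_of_int (b - int j)) * (poly (q l) (real_of_int (b - int j)) * w (b - int j))
        = a powi (e - 2 * b) * ((\<Prod>r<i. real \<tau> + real j + real r + 1) * ((\<Prod>r<l. real j - real r) *
      (a ^ (2 * j) * fact (\<tau> + j) / (fact j * fact j * fact (Q - 1 - j)))))"
        unfolding 1 2 3 by simp
    qed simp
    also have "\<dots> = a powi (e - 2 * b) * (a ^ (2 * l) * fact (\<tau> + i) / fact (Q - 1 - l) * entry a \<tau> Q i l)"
      unfolding sum_distrib_left[symmetric] sum_hole_weights[OF l] ..
    also have "\<dots> = (a powi (e - 2 * b) * a ^ (2 * l)) / fact (Q - 1 - l) * (fact (\<tau> + i) * entry a \<tau> Q i l)"
      by simp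
    also have "a powi (e - 2 * b) * a ^ (2 * l) = a powi (e - 2 * b + 2 * int l)"
    proof -
      have "a powi (e - 2 * b + 2 * int l) = a powi (e - 2 * b) * a powi (int (2 * l))"
        using a by (simp add: power_int_add[symmetric])
      then show ?thesis by (simp only: power_int_of_nat)
    qed
    finally show "(\<Sum>x\<in>I. poly (p i) (real_of_int x) * (poly (q l) (real_of_int x) * w x))
      = a powi (e - 2 * b + 2 * int l) / fact (Q - 1 - l) * (fact (\<tau> + i) * entry a \<tau> Q i l)" .
  qed
  also have "\<dots> = (a powi (\<Sum>i<k. e - 2 * b + 2 * int i) / (\<Prod>i<k. fact (Q - 1 - i))) *
      ((\<Prod>i<k. fact (\<tau> + i)) * dt k (entry a \<tau> Q))"
    unfolding dt_scale_cols dt_scale_rows by (simp add: prod_dividef prod_powi[OF a])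
  finally have main: "(\<Sum>H | H \<subseteq> I \<and> card H = k. (cl * vdm (H \<union> T) * (\<Prod>x\<in>H \<union> T. a powi (- x))) *
       (cr * vdm (\<rho> ` (I - H)) * (\<Prod>x\<in>\<rho> ` (I - H). a powi (- x))))
     = ?c * ((a powi (\<Sum>i<k. e - 2 * b + 2 * int i) / (\<Prod>i<k. fact (Q - 1 - i))) *
      ((\<Prod>i<k. fact (\<tau> + i)) * dt k (entry a \<tau> Q)))" .
  have T: "vdm T = (\<Prod>i<\<tau>. fact i)" unfolding T_def by (rule vdm_interval)
  have "I = {(b - int Q) + 1..(b - int Q) + int Q}" by (simp add: I_def)
  then have I: "vdm I = (\<Prod>i<n. fact i) * (\<Prod>i<k. fact (Q - 1 - i))"
    using vdm_interval[of "b - int Q" Q] prod_fact_split_rev[of n k] unfolding Q_def by simp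
  have nz: "(\<Prod>i<k. fact (Q - 1 - i)) \<noteq> (0::real)" by simp
  show ?thesis unfolding main I T prod_fact_split[of \<tau> k] power_int_add[OF disjI1[OF a]]
    using nz by (simp add: field_simps)
qed

lemma rect_const_eq:
  "rect_const a w n = a powi (\<Sum>i<n. int i + int w + 1) * (1 + a\<^sup>2) ^ (\<Sum>i<n. i + 1) / (\<Prod>i<n. fact i)"
  if "a \<noteq> 0"
proof (induction n)
  case (Suc n)
  have "a ^ (n + w + 1) = a powi (int n + int w + 1)"
    by (metis of_nat_1 of_nat_add power_int_of_nat)
  moreover have IH: "rect_const a w n = a powi (\<Sum>i<n. int i + int w + 1) * (1 + a\<^sup>2) ^ (\<Sum>i<n. i + 1) / (\<Prod>i<n. fact i)"
    using Suc that by blast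
  ultimately have "rect_const a w (Suc n) = (a powi (\<Sum>i<n. int i + int w + 1) * a powi (int n + int w + 1)) *
      ((1 + a\<^sup>2) ^ (\<Sum>i<n. i + 1) * (1 + a\<^sup>2) ^ (n + 1)) / ((\<Prod>i<n. fact i) * fact n)"
    unfolding rect_const.simps unfolding IH Suc_eq_plus1 by simp
  then show ?case
    unfolding sum.lessThan_Suc prod.lessThan_Suc power_int_add[OF disjI1[OF that]] power_add .
qed simp

lemma sum_int_lessThan: "2 * (\<Sum>i<n. int i) = int n * (int n - 1)"
  by (induction n) (auto simp: algebra_simps)

lemma sum_int_interval: "2 * (\<Sum>x\<in>{c + 1..c + int n}. x) = int n * (2 * c + int n + 1)"
proof (induction n)
  case (Suc n)
  have "{c + 1..c + int (Suc n)} = insert (c + int n + 1) {c + 1..c + int n}" by auto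
  then have "(\<Sum>x\<in>{c + 1..c + int (Suc n)}. x) = (c + int n + 1) + (\<Sum>x\<in>{c + 1..c + int n}. x)"
    by (simp only:) (rule sum.insert, auto)
  then show ?case using Suc by (simp add: algebra_simps)
qed simp

text \<open>The powers of \<open>a\<close> from the two halves and from the sum over
  \<open>H\<close> cancel, so that \<open>a\<close> survives only through
  \<open>1 + a\<^sup>2\<close> and the entries. Each sum is doubled to stay polynomial over the
  integers.\<close>

lemma weight_exponent_eq_0:
  fixes m k n N R \<epsilon> :: nat
  assumes "k \<le> m" "m \<le> N" "R = N + k - m" "n + m = N + \<epsilon>" "\<epsilon> \<le> 1"
  shows "(\<Sum>i<m. int i + int N + 1) + (\<Sum>i<n. int i + int R + 1)
    + ((\<Sum>x\<in>{int m + int R + 1..int m + int R + int (m - k)}. - x)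
     + (\<Sum>x\<in>{int m + int R - int (n + k) + 1..int m + int R}. x - (int N + int R + 1))
     + (\<Sum>i<k. (int N + int R + 1) - 2 * (int m + int R) + 2 * int i)) = 0" (is "?A + ?B + (?C + ?D + ?E) = 0")
proof -
  have A: "2 * ?A = int m * (int m - 1) + 2 * int m * (int N + 1)"
    using sum_int_lessThan[of m] by (simp add: sum.distrib algebra_simps)
  have B: "2 * ?B = int n * (int n - 1) + 2 * int n * (int R + 1)"
    using sum_int_lessThan[of n] by (simp add: sum.distrib algebra_simps)
  have C: "2 * ?C = - (int (m - k) * (2 * (int m + int R) + int (m - k) + 1))"
    using sum_int_interval[of "int m + int R" "m - k"] by (simp add: sum_negf)
  have D: "2 * ?D = int (n + k) * (2 * (int m + int R - int (n + k)) + int (n + k) + 1)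
      - 2 * int (n + k) * (int N + int R + 1)"
    using sum_int_interval[of "int m + int R - int (n + k)" "n + k"] by (simp add: sum_subtractf)
  have E: "2 * ?E = 2 * int k * (int N + int R + 1 - 2 * (int m + int R)) + 2 * (int k * (int k - 1))"
  proof -
    have "(\<Sum>i<k. c + 2 * int i) = int k * c + 2 * (\<Sum>i<k. int i)" for c
      by (simp add: sum.distrib sum_distrib_left)
    then have "?E = int k * (int N + int R + 1 - 2 * (int m + int R)) + 2 * (\<Sum>i<k. int i)" .
    then show ?thesis using sum_int_lessThan[of k] by simp
  qed
  have eqs: "int (m - k) = int m - int k" "int R = int N + int k - int m" "int n = int N + int \<epsilon> - int m"
    using assms by auto
  have "\<epsilon> = 0 \<or> \<epsilon> = 1" using assms(5) by auto
  then have "2 * ?A + 2 * ?B + (2 * ?C + 2 * ?D + 2 * ?E) = 0"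
    unfolding A B C D E unfolding of_nat_add eqs by (auto simp: algebra_simps)
  then show ?thesis by simp
qed

text \<open>On the odd cut, the prefactors from \<open>partial_haf_odd\<close> complete the
  factorials and the powers of \<open>a\<close> in \<open>rect_const\<close> by one term, but add no
  power of \<open>1 + a\<^sup>2\<close>; hence the upper limit \<open>m - 1\<close> in the exponent.
  The completed factorials cancel those of \<open>hole_sum\<close>.\<close>

lemma aztec_F_1_eq_dt:
  fixes N m k :: nat
  assumes "a \<noteq> 0" "1 \<le> m" "m \<le> N" "k \<le> m"
  shows "aztec_F N m (k + 1) a 1 =
    (1 + a\<^sup>2) ^ ((\<Sum>i<m - 1. i + 1) + (\<Sum>i<N - m. i + 1)) * dt k (entry a (m - k) (N - m + 1 + k))"
proof -
  define R where "R = N + k - m"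
  let ?n = "N - m + 1"
  obtain m' where m': "m = Suc m'" using assms(2) by (cases m) auto
  let ?cl = "rect_const a N (m - 1) * a ^ (m + N) / fact (m - 1)"
  let ?cr = "rect_const a R (N - m) * a ^ (N - m + R + 1) / fact (N - m)"
  have pw: "a ^ j = a powi int j" for j by simp
  have cl: "?cl = a powi (\<Sum>i<m. int i + int N + 1) * (1 + a\<^sup>2) ^ (\<Sum>i<m - 1. i + 1) / (\<Prod>i<m. fact i)"
    unfolding rect_const_eq[OF assms(1)] pw using assms(1) by (simp add: m' power_int_add add_ac)
  have cr: "?cr = a powi (\<Sum>i<?n. int i + int R + 1) * (1 + a\<^sup>2) ^ (\<Sum>i<N - m. i + 1) / (\<Prod>i<?n. fact i)"
    unfolding rect_const_eq[OF assms(1)] pw using assms(1) by (simp add: power_int_add add_ac)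
  have I: "{int m..int m + int R} = {int m + int R - int (?n + k) + 1..int m + int R}"
    and T: "{int m + int R + 1..int m + int N} = {int m + int R + 1..int m + int R + int (m - k)}"
    using assms by (auto simp: R_def of_nat_diff)
  have mk: "m - k + k = m" using assms by simp
  have "aztec_F N m (k + 1) a 1 = ?cl * ?cr * (\<Prod>i<m - k + k. fact i) * (\<Prod>i<?n. fact i) *
      a powi ((\<Sum>x\<in>{int m + int R + 1..int m + int R + int (m - k)}. - x)
     + (\<Sum>x\<in>{int m + int R - int (?n + k) + 1..int m + int R}. x - (int N + int R + 1))
     + (\<Sum>i<k. (int N + int R + 1) - 2 * (int m + int R) + 2 * int i)) * dt k (entry a (m - k) (?n + k))"
    unfolding aztec_F_1_sum[OF assms R_def] unfolding I T by (rule hole_sum[OF assms(1)])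
  also have "\<dots> = (1 + a\<^sup>2) ^ ((\<Sum>i<m - 1. i + 1) + (\<Sum>i<N - m. i + 1)) *
      a powi ((\<Sum>i<m. int i + int N + 1) + (\<Sum>i<?n. int i + int R + 1)
      + ((\<Sum>x\<in>{int m + int R + 1..int m + int R + int (m - k)}. - x)
     + (\<Sum>x\<in>{int m + int R - int (?n + k) + 1..int m + int R}. x - (int N + int R + 1))
     + (\<Sum>i<k. (int N + int R + 1) - 2 * (int m + int R) + 2 * int i))) * dt k (entry a (m - k) (?n + k))"
    unfolding cl cr mk unfolding power_int_add[OF disjI1[OF assms(1)]] power_add by simp
  also have "(\<Sum>i<m. int i + int N + 1) + (\<Sum>i<?n. int i + int R + 1)
      + ((\<Sum>x\<in>{int m + int R + 1..int m + int R + int (m - k)}. - x)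
     + (\<Sum>x\<in>{int m + int R - int (?n + k) + 1..int m + int R}. x - (int N + int R + 1))
     + (\<Sum>i<k. (int N + int R + 1) - 2 * (int m + int R) + 2 * int i)) = 0"
    by (rule weight_exponent_eq_0[where \<epsilon> = 1]) (use assms R_def in auto)
  finally show ?thesis by simp
qed

lemma aztec_F_0_eq_dt:
  fixes N m k :: nat
  assumes "a \<noteq> 0" "m < N" "k \<le> m"
  shows "aztec_F N m (k + 1) a 0 =
    (1 + a\<^sup>2) ^ ((\<Sum>i<m. i + 1) + (\<Sum>i<N - m. i + 1)) * dt k (entry a (m - k) (N - m + k))"
proof -
  define R where "R = N + k - m"
  let ?n = "N - m"
  have cl: "rect_const a N m = a powi (\<Sum>i<m. int i + int N + 1) * (1 + a\<^sup>2) ^ (\<Sum>i<m. i + 1) / (\<Prod>i<m. fact i)"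
    and cr: "rect_const a R (N - m) = a powi (\<Sum>i<?n. int i + int R + 1) * (1 + a\<^sup>2) ^ (\<Sum>i<N - m. i + 1) / (\<Prod>i<?n. fact i)"
    by (rule rect_const_eq[OF assms(1)])+
  have I: "{int m + 1..int m + int R} = {int m + int R - int (?n + k) + 1..int m + int R}"
    and T: "{int m + int R + 1..int m + int N} = {int m + int R + 1..int m + int R + int (m - k)}"
    using assms by (auto simp: R_def of_nat_diff)
  have mk: "m - k + k = m" using assms by simp
  have "aztec_F N m (k + 1) a 0 = rect_const a N m * rect_const a R (N - m) * (\<Prod>i<m - k + k. fact i) * (\<Prod>i<?n. fact i) *
      a powi ((\<Sum>x\<in>{int m + int R + 1..int m + int R + int (m - k)}. - x)
     + (\<Sum>x\<in>{int m + int R - int (?n + k) + 1..int m + int R}. x - (int N + int R + 1))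
     + (\<Sum>i<k. (int N + int R + 1) - 2 * (int m + int R) + 2 * int i)) * dt k (entry a (m - k) (?n + k))"
    unfolding aztec_F_0_sum[OF assms R_def] unfolding I T by (rule hole_sum[OF assms(1)])
  also have "\<dots> = (1 + a\<^sup>2) ^ ((\<Sum>i<m. i + 1) + (\<Sum>i<N - m. i + 1)) *
      a powi ((\<Sum>i<m. int i + int N + 1) + (\<Sum>i<?n. int i + int R + 1)
      + ((\<Sum>x\<in>{int m + int R + 1..int m + int R + int (m - k)}. - x)
     + (\<Sum>x\<in>{int m + int R - int (?n + k) + 1..int m + int R}. x - (int N + int R + 1))
     + (\<Sum>i<k. (int N + int R + 1) - 2 * (int m + int R) + 2 * int i))) * dt k (entry a (m - k) (?n + k))"
    unfolding cl cr mk unfolding power_int_add[OF disjI1[OF assms(1)]] power_add by simp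
  also have "(\<Sum>i<m. int i + int N + 1) + (\<Sum>i<?n. int i + int R + 1)
      + ((\<Sum>x\<in>{int m + int R + 1..int m + int R + int (m - k)}. - x)
     + (\<Sum>x\<in>{int m + int R - int (?n + k) + 1..int m + int R}. x - (int N + int R + 1))
     + (\<Sum>i<k. (int N + int R + 1) - 2 * (int m + int R) + 2 * int i)) = 0"
    by (rule weight_exponent_eq_0[where \<epsilon> = 0]) (use assms R_def in auto)
  finally show ?thesis by simp
qed

section \<open>Barnes' function at the integers\<close>

definition stirling_rem :: "nat \<Rightarrow> real" where
  "stirling_rem n = ln (fact n) - (real n + 1/2) * ln (real n) + real n"

lemma convergent_stirling_rem: "convergent stirling_rem"
proof -
  let ?d = "\<lambda>n. stirling_rem (Suc n) - stirling_rem n"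
  let ?g = "\<lambda>n. 1 - (real n + 1/2) * (ln (real n + 1) - ln (real n))"
  have "eventually (\<lambda>n. ?d n = ?g n) sequentially"
  proof (rule eventually_sequentiallyI)
    fix n :: nat assume n: "1 \<le> n"
    have "ln (fact (Suc n)) = ln (real n + 1) + ln (fact n :: real)"
      by (simp add: ln_mult add.commute)
    then show "?d n = ?g n" by (simp add: stirling_rem_def algebra_simps)
  qed
  moreover have "summable ?g"
  proof (rule summable_comparison_test_bigo)
    show "summable (\<lambda>n. norm (1 / real n ^ 2))"
      using inverse_power_summable[of 2] by (simp add: field_simps)
    show "?g \<in> O(\<lambda>n. 1 / real n ^ 2)" by real_asymp
  qed
  ultimately have "summable ?d" by (simp add: summable_cong)
  then have "convergent (\<lambda>n. \<Sum>i<n. ?d i)" by (simp add: summable_iff_convergent)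
  then have "convergent (\<lambda>n. stirling_rem n - stirling_rem 0)"
    by (simp add: sum_lessThan_telescope)
  then show ?thesis using convergent_add_const_iff[of "- stirling_rem 0" stirling_rem] by simp
qed

lemma wallis_partial:
  "(\<Prod>k=1..n. (4 * real k ^ 2) / (4 * real k ^ 2 - 1)) = (2 ^ n * fact n) ^ 4 / ((fact (2 * n))\<^sup>2 * (2 * real n + 1))"
proof (induction n)
  case (Suc n)
  have f: "fact (2 * Suc n) = (2 * real n + 2) * ((2 * real n + 1) * fact (2 * n))"
    by (simp add: algebra_simps)
  have nz: "fact (2 * n) \<noteq> (0::real)" "2 * real n + 1 \<noteq> 0" "2 * real n + 3 \<noteq> 0" by auto
  have "4 * real (Suc n) ^ 2 - 1 = (2 * real n + 1) * (2 * real n + 3)"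
    by (simp add: algebra_simps power2_eq_square)
  moreover have "4 * real (Suc n) ^ 2 = (2 * (real n + 1)) ^ 2" by (simp add: algebra_simps power2_eq_square)
  moreover have "(\<Prod>k=1..Suc n. (4 * real k ^ 2) / (4 * real k ^ 2 - 1))
    = (\<Prod>k=1..n. (4 * real k ^ 2) / (4 * real k ^ 2 - 1)) * ((4 * real (Suc n) ^ 2) / (4 * real (Suc n) ^ 2 - 1))"
    by (rule prod.cl_ivl_Suc[THEN trans]) simp
  ultimately have "(\<Prod>k=1..Suc n. (4 * real k ^ 2) / (4 * real k ^ 2 - 1))
     = (2 ^ n * fact n) ^ 4 / ((fact (2 * n))\<^sup>2 * (2 * real n + 1)) * ((2 * (real n + 1)) ^ 2 / ((2 * real n + 1) * (2 * real n + 3)))"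
    using Suc by (simp only:)
  also have "\<dots> = (2 ^ Suc n * fact (Suc n)) ^ 4 / ((fact (2 * Suc n))\<^sup>2 * (2 * real (Suc n) + 1))"
    unfolding f using nz by (simp add: divide_simps) (simp add: algebra_simps power2_eq_square power4_eq_xxxx)
  finally show ?case .
qed simp

text \<open>The limit \<open>c\<close> exists because the increments are of order n^-2. The
  logarithm of Wallis' partial product combines the remainders at \<open>n\<close> and
  \<open>2 n\<close> with coefficients 4 and -2, which determines \<open>c\<close>.\<close>

lemma stirling_rem_LIMSEQ: "stirling_rem \<longlonglongrightarrow> ln (2 * pi) / 2"
proof -
  obtain c where c: "stirling_rem \<longlonglongrightarrow> c" using convergent_stirling_rem by (auto simp: convergent_def)
  let ?W = "\<lambda>n. \<Prod>k=1..n. (4 * real k ^ 2) / (4 * real k ^ 2 - 1)"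
  let ?e = "\<lambda>n. 4 * (real n + 1/2) * ln (real n) + 4 * real n * ln 2 - 2 * (2 * real n + 1/2) * ln (2 * real n) - ln (2 * real n + 1)"
  have "(\<lambda>n. ln (?W n)) \<longlonglongrightarrow> ln (pi / 2)"
    by (intro tendsto_ln wallis) simp
  moreover have "(\<lambda>n. ln (?W n)) \<longlonglongrightarrow> 4 * c - 2 * c + - 2 * ln 2"
  proof (rule Lim_transform_eventually)
    have "(\<lambda>n. stirling_rem (2 * n)) \<longlonglongrightarrow> c"
      using LIMSEQ_subseq_LIMSEQ[OF c, of "\<lambda>n. 2 * n"] by (simp add: strict_mono_def comp_def)
    moreover have "?e \<longlonglongrightarrow> - 2 * ln 2" by real_asymp
    ultimately show "(\<lambda>n. 4 * stirling_rem n - 2 * stirling_rem (2 * n) + ?e n) \<longlonglongrightarrow> 4 * c - 2 * c + - 2 * ln 2"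
      by (intro tendsto_intros c)
    show "eventually (\<lambda>n. 4 * stirling_rem n - 2 * stirling_rem (2 * n) + ?e n = ln (?W n)) sequentially"
    proof (rule eventually_sequentiallyI)
      fix n :: nat assume n: "1 \<le> n"
      have "ln (?W n) = ln ((2 ^ n * fact n) ^ 4) - ln ((fact (2 * n))\<^sup>2 * (2 * real n + 1))"
        unfolding wallis_partial by (subst ln_div) (simp_all add: add_pos_nonneg add_nonneg_pos)
      also have "ln ((2 ^ n * fact n) ^ 4) = 4 * (real n * ln 2 + ln (fact n :: real))"
        by (simp add: ln_realpow ln_mult)
      also have "ln ((fact (2 * n))\<^sup>2 * (2 * real n + 1)) = 2 * ln (fact (2 * n) :: real) + ln (2 * real n + 1)"
        by (subst ln_mult) (simp_all add: ln_realpow add_pos_nonneg)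
      finally show "4 * stirling_rem n - 2 * stirling_rem (2 * n) + ?e n = ln (?W n)"
        by (simp add: stirling_rem_def algebra_simps)
    qed
  qed
  ultimately have "ln (pi / 2) = 4 * c - 2 * c + - 2 * ln 2" by (rule LIMSEQ_unique)
  moreover have "ln (pi / 2) = ln (2 * pi) - 2 * ln 2"
    by (simp add: ln_div ln_mult)
  ultimately have "c = ln (2 * pi) / 2" by simp
  then show ?thesis using c by (simp only:)
qed

section \<open>The Weierstrass product at integers\<close>

definition barnes_factor :: "nat \<Rightarrow> nat \<Rightarrow> real" where
  "barnes_factor k n = (1 + real k / real (Suc n)) ^ Suc n * exp ((real k)\<^sup>2 / (2 * real (Suc n)) - real k)"

definition barnes_ratio :: "nat \<Rightarrow> nat \<Rightarrow> real" where
  "barnes_ratio k M = (real M + real k + 1) ^ M * fact k / fact (M + k) * exp ((2 * real k + 1) / 2 * harm M - real M)"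

text \<open>The functional equation of G at the level of partial products. Raising \<open>k\<close>
  by 1 shifts the bases of the powers, so the quotient telescopes; the harmonic number comes from
  the quadratic terms in the exponentials.\<close>

lemma barnes_factor_Suc_prod:
  "(\<Prod>n<M. barnes_factor (Suc k) n) = (\<Prod>n<M. barnes_factor k n) * barnes_ratio k M"
proof (induction M)
  case 0
  then show ?case by (simp add: barnes_ratio_def harm_def)
next
  case (Suc M)
  let ?x = "real M + real k + 1"
  have x: "?x > 0" by simp
  have 1: "1 + real (Suc k) / real (Suc M) = (?x + 1) / (real M + 1)"
    "1 + real k / real (Suc M) = ?x / (real M + 1)" by (simp_all add: field_simps)
  let ?E1 = "exp ((real k)\<^sup>2 / (2 * real (Suc M)) - real k)"
    and ?E2 = "exp ((2 * real k + 1) / 2 * (1 / real (Suc M)) - 1)"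
    and ?E3 = "exp ((2 * real k + 1) / 2 * harm M - real M)"
  have sq: "(real (Suc k))\<^sup>2 / (2 * y) - real (Suc k) = ((real k)\<^sup>2 / (2 * y) - real k) + ((2 * real k + 1) / 2 * (1 / y) - 1)"
    if "y > 0" for y using that by (simp add: field_simps power2_eq_square)
  have 2: "exp ((real (Suc k))\<^sup>2 / (2 * real (Suc M)) - real (Suc k)) = ?E1 * ?E2"
    unfolding exp_add[symmetric] by (rule arg_cong[where f = exp], rule sq) simp
  have 3: "exp ((2 * real k + 1) / 2 * harm (Suc M) - real (Suc M)) = ?E3 * ?E2"
  proof -
    have "c * harm (Suc M) - real (Suc M) = (c * harm M - real M) + (c * (1 / real (Suc M)) - 1)" for c
      unfolding harm_Suc inverse_eq_divide by (simp add: distrib_left)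
    then show ?thesis unfolding exp_add[symmetric] by (rule arg_cong)
  qed
  have 4: "real (Suc M) + real k + 1 = ?x + 1" "fact (Suc M + k) = ?x * fact (M + k)" by simp_all
  have b1: "barnes_factor (Suc k) M = ((?x + 1) / (real M + 1)) ^ Suc M * (?E1 * ?E2)"
    unfolding barnes_factor_def 1 2 ..
  have b2: "barnes_factor k M = (?x / (real M + 1)) ^ Suc M * ?E1"
    unfolding barnes_factor_def 1 ..
  have b3: "barnes_ratio k (Suc M) = (?x + 1) ^ Suc M * fact k / (?x * fact (M + k)) * (?E3 * ?E2)"
    unfolding barnes_ratio_def 3 4 ..
  have b4: "barnes_ratio k M = ?x ^ M * fact k / fact (M + k) * ?E3"
    unfolding barnes_ratio_def ..
  have alg: "P * (x ^ M * f / g * e3) * (((x + 1) / y) ^ Suc M * (e1 * e2))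
      = P * ((x / y) ^ Suc M * e1) * ((x + 1) ^ Suc M * f / (x * g) * (e3 * e2))"
    if "x \<noteq> 0" for P x y f g e1 e2 e3 :: real
    using that by (simp add: power_divide ac_simps)
  show ?case unfolding prod.lessThan_Suc Suc b1 b2 b3 b4 by (rule alg) (use x in simp)
qed

lemma barnes_ratio_pos: "0 < barnes_ratio k M"
  unfolding barnes_ratio_def by (intro mult_pos_pos divide_pos_pos zero_less_power) (auto simp: add_nonneg_pos)

lemma n_ln_one_plus_LIMSEQ:
  fixes c :: real
  assumes "0 \<le> c"
  shows "(\<lambda>n. real n * ln (1 + c / real n)) \<longlonglongrightarrow> c"
proof -
  have "(\<lambda>n. ln ((1 + c / real n) ^ n)) \<longlonglongrightarrow> ln (exp c)"
    by (rule tendsto_ln[OF tendsto_exp_limit_sequentially]) simp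
  moreover have "ln ((1 + c / real n) ^ n) = real n * ln (1 + c / real n)" for n
    by (rule ln_realpow)
  ultimately show ?thesis by simp
qed

lemma shifted_log_LIMSEQ:
  fixes c :: real
  assumes "0 \<le> c"
  shows "(\<lambda>M. real M * ln (real M + c + 1) - (real M + c + 1/2) * ln (real M + c)
    + (real M + c) + (2 * c + 1) / 2 * ln (real M) - real M) \<longlonglongrightarrow> c + 1"
proof (rule Lim_transform_eventually)
  have "(\<lambda>M. ln (1 + c / real M)) \<longlonglongrightarrow> ln (1 + 0)"
    by (intro tendsto_ln tendsto_add tendsto_const lim_const_over_n) auto
  then have "(\<lambda>M. real M * ln (1 + (c + 1) / real M) - real M * ln (1 + c / real M) - (c + 1/2) * ln (1 + c / real M) + c)
      \<longlonglongrightarrow> (c + 1) - c - (c + 1/2) * ln (1 + 0) + c"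
    using assms by (intro tendsto_intros n_ln_one_plus_LIMSEQ) auto
  then show "(\<lambda>M. real M * ln (1 + (c + 1) / real M) - real M * ln (1 + c / real M) - (c + 1/2) * ln (1 + c / real M) + c)
      \<longlonglongrightarrow> c + 1" by (simp add: add.commute)
  show "eventually (\<lambda>M. real M * ln (1 + (c + 1) / real M) - real M * ln (1 + c / real M) - (c + 1/2) * ln (1 + c / real M) + c
      = real M * ln (real M + c + 1) - (real M + c + 1/2) * ln (real M + c)
    + (real M + c) + (2 * c + 1) / 2 * ln (real M) - real M) sequentially"
  proof (rule eventually_sequentiallyI)
    fix M :: nat assume M: "1 \<le> M"
    have "ln (1 + b / real M) = ln (real M + b) - ln (real M)" if "0 \<le> b" for b
    proof -
      have "1 + b / real M = (real M + b) / real M" using M by (simp add: field_simps)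
      then show ?thesis using M that by (simp add: ln_divide_pos)
    qed
    then have 1: "ln (1 + (c + 1) / real M) = ln (real M + c + 1) - ln (real M)"
      and 2: "ln (1 + c / real M) = ln (real M + c) - ln (real M)" using assms by (simp_all add: add.assoc)
    show "real M * ln (1 + (c + 1) / real M) - real M * ln (1 + c / real M) - (c + 1/2) * ln (1 + c / real M) + c
      = real M * ln (real M + c + 1) - (real M + c + 1/2) * ln (real M + c)
    + (real M + c) + (2 * c + 1) / 2 * ln (real M) - real M"
      unfolding 1 2 by (simp add: field_simps)
  qed
qed

text \<open>The logarithm splits into convergent pieces: the Stirling remainder of
  \<open>fact (M + k)\<close>, the harmonic number minus a logarithm, and the elementary expression
  of \<open>shifted_log_LIMSEQ\<close>.\<close>

lemma barnes_ratio_LIMSEQ: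
  "barnes_ratio k \<longlonglongrightarrow> fact k * exp (real k + 1 + (2 * real k + 1) / 2 * euler_mascheroni) / sqrt (2 * pi)"
proof -
  let ?e = "\<lambda>M. real M * ln (real M + real k + 1) - (real M + real k + 1/2) * ln (real M + real k)
    + (real M + real k) + (2 * real k + 1) / 2 * ln (real M) - real M"
  let ?l = "ln (fact k) - ln (2 * pi) / 2 + (2 * real k + 1) / 2 * euler_mascheroni + (real k + 1)"
  have e: "?e \<longlonglongrightarrow> real k + 1" by (rule shifted_log_LIMSEQ) simp
  have s: "(\<lambda>M. stirling_rem (M + k)) \<longlonglongrightarrow> ln (2 * pi) / 2"
    by (rule LIMSEQ_ignore_initial_segment[OF stirling_rem_LIMSEQ])
  have "(\<lambda>M. ln (barnes_ratio k M)) \<longlonglongrightarrow> ?l"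
  proof (rule Lim_transform_eventually)
    show "(\<lambda>M. ln (fact k) - stirling_rem (M + k) + (2 * real k + 1) / 2 * (harm M - ln (real M)) + ?e M) \<longlonglongrightarrow> ?l"
      using euler_mascheroni_LIMSEQ by (intro tendsto_intros s e) simp
    show "eventually (\<lambda>M. ln (fact k) - stirling_rem (M + k) + (2 * real k + 1) / 2 * (harm M - ln (real M)) + ?e M
      = ln (barnes_ratio k M)) sequentially"
    proof (rule eventually_sequentiallyI)
      fix M :: nat assume M: "1 \<le> M"
      have "ln (barnes_ratio k M) = ln ((real M + real k + 1) ^ M * fact k / fact (M + k)) + ((2 * real k + 1) / 2 * harm M - real M)"
        unfolding barnes_ratio_def by (subst ln_mult) (simp_all add: add_nonneg_pos)
      also have "ln ((real M + real k + 1) ^ M * fact k / fact (M + k))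
        = real M * ln (real M + real k + 1) + ln (fact k) - ln (fact (M + k) :: real)"
        by (simp add: ln_div ln_mult ln_realpow add_nonneg_pos)
      finally have calculation: "ln (barnes_ratio k M) = real M * ln (real M + real k + 1) + ln (fact k) - ln (fact (M + k) :: real)
        + ((2 * real k + 1) / 2 * harm M - real M)" .
      show "ln (fact k) - stirling_rem (M + k) + (2 * real k + 1) / 2 * (harm M - ln (real M)) + ?e M
        = ln (barnes_ratio k M)"
      proof -
        define c where "c = (2 * real k + 1) / 2"
        show ?thesis using calculation unfolding c_def[symmetric] by (simp add: stirling_rem_def algebra_simps)
      qed
    qed
  qed
  then have "(\<lambda>M. exp (ln (barnes_ratio k M))) \<longlonglongrightarrow> exp ?l" by (rule tendsto_exp)
  moreover have "exp ?l = fact k * exp (real k + 1 + (2 * real k + 1) / 2 * euler_mascheroni) / sqrt (2 * pi)"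
  proof -
    have "exp (ln (2 * pi) / 2) = sqrt (2 * pi)"
      using powr_half_sqrt[of "2 * pi"] by (simp add: powr_def)
    then show ?thesis unfolding exp_add exp_diff by simp
  qed
  ultimately show ?thesis by (simp add: barnes_ratio_pos)
qed

text \<open>The denominator is the prefactor in \<open>barnes_G\<close>. Each induction step
  contributes \<open>fact k\<close>, in accordance with G(k+2) = k! G(k+1).\<close>

lemma barnes_factor_LIMSEQ:
  "(\<lambda>M. \<Prod>n<M. barnes_factor k n) \<longlonglongrightarrow>
    (\<Prod>i<k. fact i) / ((2 * pi) powr (real k / 2) * exp (- (real k + (real k)\<^sup>2 * (1 + euler_mascheroni)) / 2))"
proof (induction k)
  case 0
  then show ?case by (simp add: barnes_factor_def)
next
  case (Suc k)
  let ?p = "(\<Prod>i<k. fact i) / ((2 * pi) powr (real k / 2) * exp (- (real k + (real k)\<^sup>2 * (1 + euler_mascheroni)) / 2))"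
  let ?r = "fact k * exp (real k + 1 + (2 * real k + 1) / 2 * euler_mascheroni) / sqrt (2 * pi)"
  have "(\<lambda>M. \<Prod>n<M. barnes_factor (Suc k) n) \<longlonglongrightarrow> ?p * ?r"
    unfolding barnes_factor_Suc_prod by (intro tendsto_mult Suc barnes_ratio_LIMSEQ)
  moreover have "?p * ?r = (\<Prod>i<Suc k. fact i) / ((2 * pi) powr (real (Suc k) / 2) *
      exp (- (real (Suc k) + (real (Suc k))\<^sup>2 * (1 + euler_mascheroni)) / 2))"
  proof -
    have half: "real (Suc k) / 2 = real k / 2 + 1 / 2" by simp
    have pw: "(2 * pi) powr (real (Suc k) / 2) = (2 * pi) powr (real k / 2) * sqrt (2 * pi)"
      unfolding half powr_add using powr_half_sqrt[of "2 * pi"] by simp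
    have ex: "exp (- (real k + (real k)\<^sup>2 * (1 + euler_mascheroni)) / 2) =
      exp (- (real (Suc k) + (real (Suc k))\<^sup>2 * (1 + euler_mascheroni)) / 2) *
      exp (real k + 1 + (2 * real k + 1) / 2 * euler_mascheroni)"
      unfolding exp_add[symmetric] by (simp add: field_simps power2_eq_square)
    show ?thesis unfolding pw ex prod.lessThan_Suc by simp
  qed
  ultimately show ?case by simp
qed

lemma barnes_G_nat: "barnes_G (real k + 1) = (\<Prod>i<k. fact i)"
proof -
  let ?c = "(2 * pi) powr (real k / 2) * exp (- (real k + (real k)\<^sup>2 * (1 + euler_mascheroni)) / 2)"
  have c: "?c > 0" by simp
  have "(\<lambda>M. \<Prod>n\<le>M. barnes_factor k n) \<longlonglongrightarrow> (\<Prod>i<k. fact i) / ?c"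
    using LIMSEQ_Suc[OF barnes_factor_LIMSEQ[of k]] by (simp add: lessThan_Suc_atMost)
  \<comment> \<open>Convergence of an infinite product demands a limit different from 0.\<close>
  moreover have "(\<Prod>i<k. fact i) / ?c \<noteq> 0" using c by simp
  ultimately have "raw_has_prod (barnes_factor k) 0 ((\<Prod>i<k. fact i) / ?c)"
    by (simp add: raw_has_prod_def)
  then have "barnes_factor k has_prod ((\<Prod>i<k. fact i) / ?c)" by (simp add: has_prod_def)
  then have "prodinf (barnes_factor k) = (\<Prod>i<k. fact i) / ?c" using has_prod_unique by force
  then show ?thesis using c
    unfolding barnes_G_def Let_def barnes_factor_def by simp
qed

section \<open>Characteristic functions of the geometric and Bernoulli laws\<close>

lemma norm_add3: "norm (x + y + z) \<le> norm x + norm y + norm (z :: 'a::real_normed_vector)"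
  using norm_triangle_ineq[of "x + y" z] norm_triangle_ineq[of x y] by linarith

lemma norm_diff_le_via: "norm (x - y) \<le> norm (x - u) + norm (y - u :: 'a::real_normed_vector)"
  using norm_triangle_ineq4[of "x - u" "y - u"] by simp

lemma cis_approx:
  shows "cmod (cis t - 1) \<le> \<bar>t\<bar>"
    and "cmod (cis t - (1 + \<i> * of_real t)) \<le> t\<^sup>2 / 2"
    and "cmod (cis t - (1 + \<i> * of_real t - of_real (t\<^sup>2 / 2))) \<le> \<bar>t\<bar> ^ 3 / 6"
proof -
  have s1: "(\<Sum>k\<le>1. f k) = f 0 + f 1" and s2: "(\<Sum>k\<le>2. f k) = f 0 + f 1 + f 2" for f :: "nat \<Rightarrow> complex"
    by (simp_all add: numeral_2_eq_2)
  show "cmod (cis t - 1) \<le> \<bar>t\<bar>"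
    using iexp_approx1[of t 0] by (simp add: cis_conv_exp)
  show "cmod (cis t - (1 + \<i> * of_real t)) \<le> t\<^sup>2 / 2"
    using iexp_approx1[of t 1] unfolding s1 by (simp add: cis_conv_exp numeral_2_eq_2)
  show "cmod (cis t - (1 + \<i> * of_real t - of_real (t\<^sup>2 / 2))) \<le> \<bar>t\<bar> ^ 3 / 6"
  proof -
    have "(\<Sum>k\<le>2. (\<i> * complex_of_real t) ^ k / fact k) = 1 + \<i> * of_real t - of_real (t\<^sup>2 / 2)"
      unfolding s2 by (simp add: power_mult_distrib)
    then show ?thesis using iexp_approx1[of t 2] by (simp add: cis_conv_exp fact_numeral)
  qed
qed

text \<open>The Taylor remainder \<open>t ^ 4 / 24\<close> and \<open>t\<^sup>2 \<le> 10\<close> on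
  this range leave the coefficient 1/2 - 10/24 = 1/12.\<close>

lemma one_minus_cos_ge:
  assumes "\<bar>t\<bar> \<le> pi"
  shows "t\<^sup>2 / 12 \<le> 1 - cos t"
proof -
  have s3: "(\<Sum>k\<le>3. f k) = f 0 + f 1 + f 2 + f 3" for f :: "nat \<Rightarrow> complex"
    by (simp add: eval_nat_numeral)
  have "cmod (cis t - (1 + \<i> * of_real t + (\<i> * of_real t)\<^sup>2 / 2 + (\<i> * of_real t) ^ 3 / 6)) \<le> t ^ 4 / 24"
    using iexp_approx1[of t 3] unfolding s3 by (simp add: cis_conv_exp fact_numeral eval_nat_numeral)
  then have "\<bar>Re (cis t - (1 + \<i> * of_real t + (\<i> * of_real t)\<^sup>2 / 2 + (\<i> * of_real t) ^ 3 / 6))\<bar> \<le> t ^ 4 / 24"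
    using abs_Re_le_cmod order_trans by blast
  moreover have "Re (1 + \<i> * of_real t + (\<i> * of_real t)\<^sup>2 / 2 + (\<i> * of_real t) ^ 3 / 6) = 1 - t\<^sup>2 / 2"
    by (simp add: power2_eq_square power3_eq_cube)
  ultimately have "\<bar>cos t - (1 - t\<^sup>2 / 2)\<bar> \<le> t ^ 4 / 24" by (simp only: minus_complex.sel cis.sel)
  moreover have "t ^ 4 \<le> t\<^sup>2 * 10"
  proof -
    have "\<bar>t\<bar>\<^sup>2 \<le> pi\<^sup>2" using assms by (intro power_mono) auto
    also have "pi\<^sup>2 \<le> 3.15\<^sup>2" using pi_approx pi_gt_zero by (intro power_mono) auto
    finally have "t\<^sup>2 \<le> 10" by (simp add: power2_eq_square)
    then have "t\<^sup>2 * t\<^sup>2 \<le> t\<^sup>2 * 10" by (intro mult_left_mono) auto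
    then show ?thesis by (simp add: power4_eq_xxxx power2_eq_square mult.assoc)
  qed
  ultimately show ?thesis unfolding abs_le_iff by linarith
qed

text \<open>Parametrised by the mean \<open>r\<close> of the geometric law; its variance is
  \<open>r + r\<^sup>2\<close>.\<close>

definition geo_char :: "real \<Rightarrow> real \<Rightarrow> complex" where
  "geo_char r t = 1 / (1 - of_real r * (cis t - 1))"

text \<open>The law of minus a Bernoulli variable with mean \<open>\<beta>\<close>: the reversed
  sign lets the two means cancel in a product.\<close>

definition ber_char :: "real \<Rightarrow> real \<Rightarrow> complex" where
  "ber_char \<beta> t = 1 + of_real \<beta> * (cis (- t) - 1)"

lemma cmod_geo_denominator: "0 \<le> r \<Longrightarrow> 1 \<le> cmod (1 - of_real r * (cis t - 1))"
proof -
  assume "0 \<le> r"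
  then have "0 \<le> r * (1 - cos t)" by simp
  then have "1 \<le> Re (1 - of_real r * (cis t - 1))" by (simp add: algebra_simps)
  also have "\<dots> \<le> cmod (1 - of_real r * (cis t - 1))" by (rule complex_Re_le_cmod)
  finally show ?thesis .
qed

lemma geo_denominator_nonzero: "0 \<le> r \<Longrightarrow> 1 - of_real r * (cis t - 1) \<noteq> 0"
  using cmod_geo_denominator[of r t] by auto

lemma cmod_geo_char: "0 \<le> r \<Longrightarrow> cmod (geo_char r t) \<le> 1"
  using cmod_geo_denominator[of r t] by (simp add: geo_char_def norm_divide divide_le_eq)

lemma cmod_ber_char_square: "(cmod (ber_char \<beta> t))\<^sup>2 = 1 - 2 * (\<beta> * (1 - \<beta>)) * (1 - cos t)"
proof -
  have "(cmod (ber_char \<beta> t))\<^sup>2 = (1 - \<beta> + \<beta> * cos t)\<^sup>2 + (\<beta> * sin t)\<^sup>2"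
    unfolding cmod_power2 ber_char_def by (simp add: algebra_simps)
  also have "\<dots> = (1 - \<beta>)\<^sup>2 + 2 * (1 - \<beta>) * (\<beta> * cos t) + ((\<beta> * cos t)\<^sup>2 + (\<beta> * sin t)\<^sup>2)"
    unfolding power2_sum[of "1 - \<beta>"] by simp
  also have "(\<beta> * cos t)\<^sup>2 + (\<beta> * sin t)\<^sup>2 = \<beta>\<^sup>2"
    unfolding power_mult_distrib distrib_left[symmetric] by simp
  finally show ?thesis by (simp add: power2_eq_square algebra_simps)
qed

text \<open>The decay of the whole integrand rests on this bound, since the geometric factor is only
  estimated by 1.\<close>

lemma cmod_ber_char:
  assumes "0 \<le> \<beta>" "\<beta> \<le> 1" "\<bar>t\<bar> \<le> pi"
  shows "cmod (ber_char \<beta> t) \<le> exp (- (\<beta> * (1 - \<beta>)) * t\<^sup>2 / 12)"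
proof -
  have b: "0 \<le> \<beta> * (1 - \<beta>)" using assms by simp
  have "(cmod (ber_char \<beta> t))\<^sup>2 \<le> 1 - 2 * (\<beta> * (1 - \<beta>)) * (t\<^sup>2 / 12)"
    unfolding cmod_ber_char_square mult.assoc[of 2]
    using mult_left_mono[OF one_minus_cos_ge[OF assms(3)] b] by linarith
  also have "\<dots> \<le> exp (- (2 * (\<beta> * (1 - \<beta>)) * (t\<^sup>2 / 12)))"
    using exp_ge_add_one_self[of "- (2 * (\<beta> * (1 - \<beta>)) * (t\<^sup>2 / 12))"] by simp
  also have "\<dots> = (exp (- (\<beta> * (1 - \<beta>)) * t\<^sup>2 / 12))\<^sup>2"
    by (simp add: power2_eq_square exp_add[symmetric])
  finally show ?thesis by (rule power2_le_imp_le) simp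
qed

text \<open>The cumulant expansion to second order, for mean \<open>c\<close> and variance
  \<open>\<kappa>\<close>.\<close>

definition gauss_exponent :: "real \<Rightarrow> real \<Rightarrow> real \<Rightarrow> complex" where
  "gauss_exponent c \<kappa> t = Complex (- \<kappa> * t\<^sup>2 / 2) (c * t)"

lemma exp_gauss_exponent: "exp (gauss_exponent c \<kappa> t) = of_real (exp (- \<kappa> * t\<^sup>2 / 2)) * cis (c * t)"
  by (simp add: gauss_exponent_def exp_eq_polar)

lemma cmod_exp_gauss_exponent: "cmod (exp (gauss_exponent c \<kappa> t)) = exp (- \<kappa> * t\<^sup>2 / 2)"
  by (simp add: gauss_exponent_def norm_exp_eq_Re)

lemma abs_exp_neg_approx:
  fixes x :: real
  assumes "0 \<le> x"
  shows "\<bar>exp (- x) - 1 + x\<bar> \<le> x\<^sup>2" "\<bar>exp (- x) - 1\<bar> \<le> x"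
proof -
  have 1: "1 - x \<le> exp (- x)" using exp_ge_add_one_self[of "- x"] by simp
  have "(1 + x) * exp (- x) \<le> exp x * exp (- x)"
    using exp_ge_add_one_self[of x] by (intro mult_right_mono) auto
  then have "(1 + x) * exp (- x) \<le> 1" by (simp add: exp_add[symmetric])
  moreover have "1 \<le> (1 + x) * (1 - x + x\<^sup>2)" using assms by (simp add: algebra_simps power2_eq_square)
  ultimately have "(1 + x) * exp (- x) \<le> (1 + x) * (1 - x + x\<^sup>2)" by linarith
  then have "exp (- x) \<le> 1 - x + x\<^sup>2" using assms by simp
  then show "\<bar>exp (- x) - 1 + x\<bar> \<le> x\<^sup>2" using 1 by simp
  show "\<bar>exp (- x) - 1\<bar> \<le> x" using 1 assms by simp
qed

text \<open>The comparison polynomial is the second-order expansion of any characteristic function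
  with mean \<open>c\<close> and second moment \<open>\<kappa> + c\<^sup>2\<close>, so the two
  concrete laws can be compared with the same expression. The range
  \<open>\<bar>t\<bar> \<le> 4\<close> contains the circle and turns surplus powers of
  \<open>t\<close> into constants.\<close>

lemma exp_gauss_exponent_approx:
  assumes "\<bar>c\<bar> \<le> R" "0 \<le> \<kappa>" "\<kappa> \<le> K" "\<bar>t\<bar> \<le> 4"
  shows "cmod (exp (gauss_exponent c \<kappa> t) - (1 + \<i> * of_real (c * t) - of_real ((\<kappa> + c\<^sup>2) * t\<^sup>2 / 2)))
    \<le> (R ^ 3 / 6 + (R + 2 * R\<^sup>2) * K + K\<^sup>2) * \<bar>t\<bar> ^ 3"
proof -
  have R: "0 \<le> R" and K: "0 \<le> K" using assms by auto
  define P where "P = cis (c * t)"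
  define P2 where "P2 = 1 + \<i> * of_real (c * t) - of_real ((c * t)\<^sup>2 / 2)"
  define x where "x = \<kappa> * t\<^sup>2 / 2"
  define E where "E = exp (- x)"
  have x: "0 \<le> x" using assms by (simp add: x_def)
  have t2: "t\<^sup>2 = \<bar>t\<bar>\<^sup>2" by simp
  have ct: "\<bar>c * t\<bar> \<le> R * \<bar>t\<bar>" using assms by (simp add: abs_mult mult_right_mono)
  have 1: "cmod (P - P2) \<le> R ^ 3 / 6 * \<bar>t\<bar> ^ 3"
  proof -
    have "cmod (P - P2) \<le> \<bar>c * t\<bar> ^ 3 / 6" unfolding P_def P2_def by (rule cis_approx(3))
    also have "\<dots> \<le> (R * \<bar>t\<bar>) ^ 3 / 6" using ct by (intro divide_right_mono power_mono) auto
    finally show ?thesis by (simp add: power_mult_distrib)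
  qed
  have 2: "cmod (P2 - 1) \<le> (R + 2 * R\<^sup>2) * \<bar>t\<bar>"
  proof -
    have "cmod (P2 - 1) \<le> cmod (\<i> * of_real (c * t)) + cmod (of_real ((c * t)\<^sup>2 / 2))"
      unfolding P2_def using norm_triangle_ineq4[of "\<i> * of_real (c * t)" "of_real ((c * t)\<^sup>2 / 2)"] by simp
    also have "\<dots> = \<bar>c * t\<bar> + \<bar>c * t\<bar>\<^sup>2 / 2"
      unfolding norm_mult norm_of_real norm_ii by simp
    also have "\<dots> \<le> R * \<bar>t\<bar> + (R * \<bar>t\<bar>)\<^sup>2 / 2"
      using ct by (intro add_mono divide_right_mono power_mono) auto
    also have "(R * \<bar>t\<bar>)\<^sup>2 / 2 = R\<^sup>2 / 2 * (\<bar>t\<bar> * \<bar>t\<bar>)" by (simp add: power2_eq_square)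
    also have "\<dots> \<le> R\<^sup>2 / 2 * (4 * \<bar>t\<bar>)" using assms by (intro mult_left_mono mult_right_mono) auto
    finally show ?thesis by (simp add: algebra_simps)
  qed
  have x_le: "x \<le> K * \<bar>t\<bar>\<^sup>2 / 2"
    unfolding x_def t2 using assms by (intro divide_right_mono mult_right_mono) auto
  have 3: "\<bar>E - 1\<bar> \<le> K * \<bar>t\<bar>\<^sup>2"
  proof -
    have "\<bar>E - 1\<bar> \<le> x" unfolding E_def by (rule abs_exp_neg_approx(2)[OF x])
    moreover have "0 \<le> K * \<bar>t\<bar>\<^sup>2" using K by simp
    ultimately show ?thesis using x_le by linarith
  qed
  have 4: "\<bar>E - 1 + x\<bar> \<le> K\<^sup>2 * \<bar>t\<bar> ^ 3"
  proof -
    have "\<bar>E - 1 + x\<bar> \<le> x\<^sup>2" unfolding E_def by (rule abs_exp_neg_approx(1)[OF x])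
    also have "\<dots> \<le> (K * \<bar>t\<bar>\<^sup>2 / 2)\<^sup>2" using x x_le by (intro power_mono) auto
    also have "\<dots> = K\<^sup>2 / 4 * (\<bar>t\<bar> * \<bar>t\<bar> ^ 3)" by (simp add: power2_eq_square power3_eq_cube)
    also have "\<dots> \<le> K\<^sup>2 / 4 * (4 * \<bar>t\<bar> ^ 3)" using assms by (intro mult_left_mono mult_right_mono) auto
    finally show ?thesis by simp
  qed
  have E1: "\<bar>E\<bar> \<le> 1" using x by (simp add: E_def)
  have "exp (gauss_exponent c \<kappa> t) - (1 + \<i> * of_real (c * t) - of_real ((\<kappa> + c\<^sup>2) * t\<^sup>2 / 2))
      = of_real E * (P - P2) + (P2 - 1) * of_real (E - 1) + of_real (E - 1 + x)"
  proof -
    have 1: "of_real ((\<kappa> + c\<^sup>2) * t\<^sup>2 / 2) = of_real x + (of_real ((c * t)\<^sup>2 / 2) :: complex)"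
      by (simp add: x_def power_mult_distrib add_divide_distrib distrib_right)
    have 2: "- \<kappa> * t\<^sup>2 / 2 = - x" by (simp add: x_def)
    have "e * q - (u - (x' + y)) = e * (q - (u - y)) + (u - y - 1) * (e - 1) + (e - 1 + x')" for e q u x' y :: complex
      by (simp add: algebra_simps)
    then show ?thesis unfolding exp_gauss_exponent 1 2 P_def[symmetric] E_def[symmetric] of_real_diff of_real_add of_real_1 P2_def .
  qed
  then have "cmod (exp (gauss_exponent c \<kappa> t) - (1 + \<i> * of_real (c * t) - of_real ((\<kappa> + c\<^sup>2) * t\<^sup>2 / 2)))
      \<le> cmod (of_real E * (P - P2)) + cmod ((P2 - 1) * of_real (E - 1)) + cmod (of_real (E - 1 + x))"
    by (simp only: norm_add3)
  also have "\<dots> = \<bar>E\<bar> * cmod (P - P2) + cmod (P2 - 1) * \<bar>E - 1\<bar> + \<bar>E - 1 + x\<bar>"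
    unfolding norm_mult norm_of_real ..
  also have "\<dots> \<le> 1 * (R ^ 3 / 6 * \<bar>t\<bar> ^ 3) + ((R + 2 * R\<^sup>2) * \<bar>t\<bar>) * (K * \<bar>t\<bar>\<^sup>2) + K\<^sup>2 * \<bar>t\<bar> ^ 3"
    using 1 2 3 4 E1 R by (intro add_mono mult_mono) auto
  also have "\<dots> = (R ^ 3 / 6 + (R + 2 * R\<^sup>2) * K + K\<^sup>2) * \<bar>t\<bar> ^ 3"
    by (simp add: algebra_simps power2_eq_square power3_eq_cube)
  finally show ?thesis .
qed

lemma ber_char_approx:
  assumes "0 \<le> \<beta>" "\<beta> \<le> 1" "\<bar>t\<bar> \<le> 4"
  shows "cmod (ber_char \<beta> t - exp (gauss_exponent (- \<beta>) (\<beta> * (1 - \<beta>)) t)) \<le> 5 * \<bar>t\<bar> ^ 3"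
proof -
  let ?T = "1 + \<i> * of_real (- \<beta> * t) - of_real ((\<beta> * (1 - \<beta>) + (- \<beta>)\<^sup>2) * t\<^sup>2 / 2)"
  have "cmod (exp (gauss_exponent (- \<beta>) (\<beta> * (1 - \<beta>)) t) - ?T) \<le> (1 ^ 3 / 6 + (1 + 2 * 1\<^sup>2) * 1 + 1\<^sup>2) * \<bar>t\<bar> ^ 3"
    by (rule exp_gauss_exponent_approx) (use assms in \<open>auto intro: mult_le_one\<close>)
  moreover have "ber_char \<beta> t - ?T = of_real \<beta> * (cis (- t) - (1 + \<i> * of_real (- t) - of_real ((- t)\<^sup>2 / 2)))"
    unfolding ber_char_def by (simp add: algebra_simps power2_eq_square)
  then have "cmod (ber_char \<beta> t - ?T) = \<beta> * cmod (cis (- t) - (1 + \<i> * of_real (- t) - of_real ((- t)\<^sup>2 / 2)))"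
    using assms by (simp only: norm_mult norm_of_real abs_of_nonneg)
  then have "cmod (ber_char \<beta> t - ?T) \<le> 1 * (\<bar>- t\<bar> ^ 3 / 6)"
    using cis_approx(3)[of "- t"] assms by (simp only:) (intro mult_mono, auto)
  moreover have "cmod (ber_char \<beta> t - exp (gauss_exponent (- \<beta>) (\<beta> * (1 - \<beta>)) t))
    \<le> cmod (ber_char \<beta> t - ?T) + cmod (exp (gauss_exponent (- \<beta>) (\<beta> * (1 - \<beta>)) t) - ?T)"
    by (rule norm_diff_le_via)
  ultimately have "cmod (ber_char \<beta> t - exp (gauss_exponent (- \<beta>) (\<beta> * (1 - \<beta>)) t))
      \<le> 1 * (\<bar>- t\<bar> ^ 3 / 6) + (1 ^ 3 / 6 + (1 + 2 * 1\<^sup>2) * 1 + 1\<^sup>2) * \<bar>t\<bar> ^ 3"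
    by (meson add_mono order_trans)
  also have "\<dots> = 13 / 3 * \<bar>t\<bar> ^ 3" by simp
  also have "\<dots> \<le> 5 * \<bar>t\<bar> ^ 3" by (intro mult_right_mono) auto
  finally show ?thesis .
qed

text \<open>Three terms of the geometric series in \<open>r (cis t - 1)\<close>; the remainder is
  the third power times \<open>geo_char\<close> itself, which is bounded by 1.\<close>

lemma geo_char_approx:
  assumes "0 \<le> r" "r \<le> R" "\<bar>t\<bar> \<le> 4"
  shows "cmod (geo_char r t - exp (gauss_exponent r (r + r\<^sup>2) t))
    \<le> (R ^ 3 + R + R\<^sup>2 + (R ^ 3 + (R + 2 * R\<^sup>2) * (R + R\<^sup>2) + (R + R\<^sup>2)\<^sup>2)) * \<bar>t\<bar> ^ 3"
proof -
  have R: "0 \<le> R" using assms by simp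
  define z where "z = cis t - 1"
  let ?T = "1 + \<i> * of_real (r * t) - of_real ((r + r\<^sup>2 + r\<^sup>2) * t\<^sup>2 / 2)"
  have nz: "1 - of_real r * z \<noteq> 0" using geo_denominator_nonzero[OF assms(1)] by (simp add: z_def)
  have z1: "cmod z \<le> \<bar>t\<bar>" unfolding z_def by (rule cis_approx(1))
  have e1: "cmod (exp (gauss_exponent r (r + r\<^sup>2) t) - ?T) \<le> (R ^ 3 / 6 + (R + 2 * R\<^sup>2) * (R + R\<^sup>2) + (R + R\<^sup>2)\<^sup>2) * \<bar>t\<bar> ^ 3"
    by (rule exp_gauss_exponent_approx) (use assms in \<open>auto intro!: add_mono power_mono\<close>)
  have "geo_char r t - ?T = (of_real r * z) ^ 3 * geo_char r t
      + of_real r * (z - (\<i> * of_real t - of_real (t\<^sup>2 / 2))) + (of_real r)\<^sup>2 * ((z - \<i> * of_real t) * (z + \<i> * of_real t))"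
  proof -
    have "geo_char r t = 1 + of_real r * z + (of_real r * z)\<^sup>2 + (of_real r * z) ^ 3 * geo_char r t"
      unfolding geo_char_def z_def[symmetric] using nz
      by (simp add: divide_simps) (simp add: algebra_simps power2_eq_square power3_eq_cube)
    moreover have "1 + of_real r * z + (of_real r * z)\<^sup>2 - ?T = of_real r * (z - (\<i> * of_real t - of_real (t\<^sup>2 / 2)))
      + (of_real r)\<^sup>2 * ((z - \<i> * of_real t) * (z + \<i> * of_real t))"
      by (simp add: algebra_simps power2_eq_square)
    moreover have "x = s + y \<Longrightarrow> s - u = v + v' \<Longrightarrow> x - u = y + v + v'" for x s y u v v' :: complex
      by (simp add: diff_eq_eq ac_simps)
    ultimately show ?thesis by blast
  qed
  then have "cmod (geo_char r t - ?T) \<le> cmod ((of_real r * z) ^ 3 * geo_char r t)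
      + cmod (of_real r * (z - (\<i> * of_real t - of_real (t\<^sup>2 / 2)))) + cmod ((of_real r)\<^sup>2 * ((z - \<i> * of_real t) * (z + \<i> * of_real t)))"
    by (simp only: norm_add3)
  also have "\<dots> \<le> R ^ 3 * \<bar>t\<bar> ^ 3 + R * \<bar>t\<bar> ^ 3 + R\<^sup>2 * \<bar>t\<bar> ^ 3"
  proof (intro add_mono)
    have "cmod ((of_real r * z) ^ 3 * geo_char r t) = (r * cmod z) ^ 3 * cmod (geo_char r t)"
      using assms by (simp add: norm_mult norm_power)
    also have "\<dots> \<le> (R * \<bar>t\<bar>) ^ 3 * 1"
      using assms z1 cmod_geo_char[OF assms(1)] by (intro mult_mono power_mono) auto
    finally show "cmod ((of_real r * z) ^ 3 * geo_char r t) \<le> R ^ 3 * \<bar>t\<bar> ^ 3" by (simp add: power_mult_distrib)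
    have "cmod (z - (\<i> * of_real t - of_real (t\<^sup>2 / 2))) \<le> \<bar>t\<bar> ^ 3 / 6"
      using cis_approx(3)[of t] unfolding z_def by (simp add: algebra_simps)
    then have "cmod (of_real r * (z - (\<i> * of_real t - of_real (t\<^sup>2 / 2)))) \<le> R * (\<bar>t\<bar> ^ 3 / 6)"
      unfolding norm_mult using assms by (intro mult_mono) auto
    also have "\<dots> \<le> R * \<bar>t\<bar> ^ 3" using R by (intro mult_left_mono) auto
    finally show "cmod (of_real r * (z - (\<i> * of_real t - of_real (t\<^sup>2 / 2)))) \<le> R * \<bar>t\<bar> ^ 3" .
    have a: "cmod (z - \<i> * of_real t) \<le> t\<^sup>2 / 2"
      using cis_approx(2)[of t] unfolding z_def by (simp add: algebra_simps)
    have "cmod (z + \<i> * of_real t) \<le> cmod z + cmod (\<i> * of_real t)" by (rule norm_triangle_ineq)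
    then have b: "cmod (z + \<i> * of_real t) \<le> 2 * \<bar>t\<bar>" using z1 by (simp add: norm_mult)
    have "cmod ((of_real r)\<^sup>2 * ((z - \<i> * of_real t) * (z + \<i> * of_real t))) \<le> R\<^sup>2 * (t\<^sup>2 / 2 * (2 * \<bar>t\<bar>))"
      unfolding norm_mult norm_power using assms a b by (intro mult_mono power_mono) auto
    also have "t\<^sup>2 / 2 * (2 * \<bar>t\<bar>) = \<bar>t\<bar> ^ 3" by (simp add: power3_eq_cube power2_eq_square)
    finally show "cmod ((of_real r)\<^sup>2 * ((z - \<i> * of_real t) * (z + \<i> * of_real t))) \<le> R\<^sup>2 * \<bar>t\<bar> ^ 3" .
  qed
  finally have e2: "cmod (geo_char r t - ?T) \<le> (R ^ 3 + R + R\<^sup>2) * \<bar>t\<bar> ^ 3" by (simp add: algebra_simps)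
  have "cmod (geo_char r t - exp (gauss_exponent r (r + r\<^sup>2) t))
    \<le> cmod (geo_char r t - ?T) + cmod (exp (gauss_exponent r (r + r\<^sup>2) t) - ?T)"
    by (rule norm_diff_le_via)
  also have "\<dots> \<le> (R ^ 3 + R + R\<^sup>2) * \<bar>t\<bar> ^ 3 + (R ^ 3 / 6 + (R + 2 * R\<^sup>2) * (R + R\<^sup>2) + (R + R\<^sup>2)\<^sup>2) * \<bar>t\<bar> ^ 3"
    using e1 e2 by (intro add_mono)
  also have "\<dots> \<le> (R ^ 3 + R + R\<^sup>2 + (R ^ 3 + (R + 2 * R\<^sup>2) * (R + R\<^sup>2) + (R + R\<^sup>2)\<^sup>2)) * \<bar>t\<bar> ^ 3"
    unfolding distrib_right[symmetric] using R by (intro mult_right_mono add_mono) auto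
  finally show ?thesis .
qed

text \<open>Division by \<open>e\<close> reduces this to the unit disc. The factor
  \<open>e ^ (m - 1)\<close> preserves the Gaussian decay of all but one of the factors.\<close>

lemma norm_power_diff_scaled:
  fixes z w :: complex
  assumes "cmod z \<le> e" "cmod w \<le> e" "0 < e"
  shows "cmod (z ^ m - w ^ m) \<le> real m * cmod (z - w) * e ^ (m - 1)"
proof (cases m)
  case (Suc n)
  have "cmod ((z / of_real e) ^ m - (w / of_real e) ^ m) \<le> real m * cmod (z / of_real e - w / of_real e)"
    by (rule norm_power_diff) (use assms in \<open>auto simp: norm_divide\<close>)
  moreover have "(z / of_real e) ^ m - (w / of_real e) ^ m = (z ^ m - w ^ m) / of_real (e ^ m)"
    by (simp add: power_divide diff_divide_distrib)
  moreover have "z / of_real e - w / of_real e = (z - w) / of_real e" by (simp add: diff_divide_distrib)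
  ultimately have "cmod (z ^ m - w ^ m) / e ^ m \<le> real m * (cmod (z - w) / e)"
    using assms(3) by (simp add: norm_divide norm_power)
  then have "cmod (z ^ m - w ^ m) \<le> real m * (cmod (z - w) / e) * e ^ m"
    using assms(3) by (simp add: divide_le_eq)
  then show ?thesis using assms(3) Suc by simp
qed simp

section \<open>The saddle point integral\<close>

lemma cmod_exp_minus_one: "cmod (exp x - 1) \<le> exp (cmod x) * cmod x"
  using Taylor_exp_field[of x 0] by simp

lemma cmod_gauss_exponent:
  assumes "\<bar>c\<bar> \<le> C" "0 \<le> \<kappa>" "\<kappa> \<le> K" "\<bar>t\<bar> \<le> 4"
  shows "cmod (gauss_exponent c \<kappa> t) \<le> (C + 2 * K) * \<bar>t\<bar>"
proof -
  have "cmod (gauss_exponent c \<kappa> t) \<le> \<bar>- \<kappa> * t\<^sup>2 / 2\<bar> + \<bar>c * t\<bar>"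
    unfolding gauss_exponent_def using cmod_le[of "Complex (- \<kappa> * t\<^sup>2 / 2) (c * t)"] by simp
  also have "\<bar>- \<kappa> * t\<^sup>2 / 2\<bar> = \<kappa> * (\<bar>t\<bar> * \<bar>t\<bar>) / 2"
    using assms by (simp add: abs_mult power2_eq_square)
  also have "\<dots> \<le> K * (4 * \<bar>t\<bar>) / 2"
    using assms by (intro divide_right_mono mult_mono) auto
  also have "\<bar>c * t\<bar> \<le> C * \<bar>t\<bar>" using assms by (simp add: abs_mult mult_right_mono)
  finally show ?thesis by (simp add: algebra_simps)
qed

text \<open>The equation \<open>m r = (N - m) \<beta>\<close> is the saddle point condition: it makes the terms linear in \<open>t\<close>
  cancel. The exponents \<open>p\<close> and \<open>q\<close> may differ from \<open>m\<close> and \<open>N - m\<close> by a bounded amount \<open>h\<close>.\<close>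

definition admissible :: "real \<Rightarrow> real \<Rightarrow> real \<Rightarrow> real \<Rightarrow> nat \<Rightarrow> nat \<Rightarrow> nat \<Rightarrow> nat \<Rightarrow> real \<Rightarrow> real \<Rightarrow> bool" where
  "admissible R b0 \<gamma> h N m p q r \<beta> \<longleftrightarrow> 1 \<le> N \<and> m \<le> N \<and> 0 \<le> r \<and> r \<le> R \<and> 0 \<le> \<beta> \<and> \<beta> \<le> 1 \<and> b0 \<le> \<beta> * (1 - \<beta>) \<and>
    real m * r = (real N - real m) * \<beta> \<and> \<bar>real p - real m\<bar> \<le> h \<and> \<bar>real q - (real N - real m)\<bar> \<le> h \<and>
    \<gamma> * real N \<le> real q - 1 \<and> \<gamma> * real N \<le> real N - real m"

definition total_variance :: "nat \<Rightarrow> nat \<Rightarrow> real \<Rightarrow> real \<Rightarrow> real" where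
  "total_variance N m r \<beta> = real m * (r + r\<^sup>2) + (real N - real m) * (\<beta> * (1 - \<beta>))"

lemma total_variance_ge:
  assumes "admissible R b0 \<gamma> h N m p q r \<beta>" "0 < b0" "0 < \<gamma>"
  shows "b0 * \<gamma> * real N \<le> total_variance N m r \<beta>"
proof -
  have "b0 * (\<gamma> * real N) \<le> \<beta> * (1 - \<beta>) * (real N - real m)"
    using assms by (intro mult_mono) (auto simp: admissible_def)
  moreover have "0 \<le> real m * (r + r\<^sup>2)" using assms by (simp add: admissible_def)
  ultimately show ?thesis unfolding total_variance_def by (simp add: mult_ac)
qed

lemma total_variance_le:
  assumes "admissible R b0 \<gamma> h N m p q r \<beta>"
  shows "total_variance N m r \<beta> \<le> (R + R\<^sup>2 + 1) * real N"
proof -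
  have "real m * (r + r\<^sup>2) \<le> real N * (R + R\<^sup>2)"
    using assms by (intro mult_mono add_mono power_mono) (auto simp: admissible_def)
  moreover have "(real N - real m) * (\<beta> * (1 - \<beta>)) \<le> real N * 1"
    using assms by (intro mult_mono mult_le_one) (auto simp: admissible_def)
  ultimately show ?thesis unfolding total_variance_def by (simp add: algebra_simps)
qed

text \<open>The divisor 6 reflects the rate \<open>t\<^sup>2 / 12\<close> of
  \<open>cmod_ber_char\<close> against the rate \<open>t\<^sup>2 / 2\<close> of a Gaussian. With
  this loss one envelope dominates the integrand and its limit alike.\<close>

lemma gauss_le_envelope:
  assumes "admissible R b0 \<gamma> h N m p q r \<beta>" "0 < b0" "0 < \<gamma>"
  shows "exp (- total_variance N m r \<beta> * t\<^sup>2 / 2) \<le> exp (- (b0 * \<gamma> * real N / 6) * t\<^sup>2 / 2)"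
proof -
  have "b0 * \<gamma> * real N / 6 \<le> total_variance N m r \<beta>"
  proof -
    have "0 \<le> b0 * \<gamma> * real N" using assms by simp
    then show ?thesis using total_variance_ge[OF assms] by simp
  qed
  then have "b0 * \<gamma> * real N / 6 * t\<^sup>2 \<le> total_variance N m r \<beta> * t\<^sup>2" by (intro mult_right_mono) auto
  then show ?thesis by (simp add: mult_ac)
qed

text \<open>Three replacements: the geometric factors by Gaussian exponentials, then the Bernoulli
  factors, then the exponents \<open>p\<close>, \<open>q\<close> by \<open>m\<close>,
  \<open>N - m\<close>. The first two cost \<open>N \<bar>t\<bar> ^ 3\<close> and the last costs
  \<open>\<bar>t\<bar>\<close>, each times the envelope.\<close>

lemma char_product_approx:
  fixes R b0 \<gamma> h :: real
  assumes "0 \<le> R" "0 < b0" "0 < \<gamma>" "0 \<le> h"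
  obtains C where "0 \<le> C" and
    "\<And>N m p q r \<beta> t. admissible R b0 \<gamma> h N m p q r \<beta> \<Longrightarrow> \<bar>t\<bar> \<le> pi \<Longrightarrow>
      cmod (geo_char r t ^ p * ber_char \<beta> t ^ q - of_real (exp (- total_variance N m r \<beta> * t\<^sup>2 / 2)))
      \<le> C * (\<bar>t\<bar> + real N * \<bar>t\<bar> ^ 3) * exp (- (b0 * \<gamma> * real N / 6) * t\<^sup>2 / 2)"
proof -
  define KA where "KA = R ^ 3 + R + R\<^sup>2 + (R ^ 3 + (R + 2 * R\<^sup>2) * (R + R\<^sup>2) + (R + R\<^sup>2)\<^sup>2)"
  define W where "W = (R + 2 * (R + R\<^sup>2)) + (1 + 2 * 1)"
  define K3 where "K3 = exp (h * W * 4) * (h * W)"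
  have nn: "0 \<le> KA" "0 \<le> W" "0 \<le> K3" using assms by (simp_all add: KA_def W_def K3_def)
  let ?C = "(1 + h) * (KA + 5) + K3"
  show ?thesis
  proof (rule that[of ?C])
    show "0 \<le> ?C" using nn assms by simp
    fix N m p q r \<beta> t
    assume adm: "admissible R b0 \<gamma> h N m p q r \<beta>" and t: "\<bar>t\<bar> \<le> pi"
    have a: "1 \<le> real N" "real m \<le> real N" "0 \<le> r" "r \<le> R" "0 \<le> \<beta>" "\<beta> \<le> 1" "b0 \<le> \<beta> * (1 - \<beta>)"
      "real m * r = (real N - real m) * \<beta>" "\<bar>real p - real m\<bar> \<le> h" "\<bar>real q - (real N - real m)\<bar> \<le> h"
      "\<gamma> * real N \<le> real q - 1" "\<gamma> * real N \<le> real N - real m"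
      using adm by (auto simp: admissible_def)
    have t4: "\<bar>t\<bar> \<le> 4" using t pi_less_4 by linarith
    define E0 where "E0 = exp (- (b0 * \<gamma> * real N / 6) * t\<^sup>2 / 2)"
    define b where "b = \<beta> * (1 - \<beta>)"
    define A where "A = geo_char r t"
    define B where "B = ber_char \<beta> t"
    define wA where "wA = gauss_exponent r (r + r\<^sup>2) t"
    define wB where "wB = gauss_exponent (- \<beta>) b t"
    define e where "e = exp (- b * t\<^sup>2 / 12)"
    have b1: "0 \<le> b" "b \<le> 1" "b0 \<le> b" using a by (auto simp: b_def intro: mult_le_one)
    have e: "0 < e" "e \<le> 1" using b1 by (simp_all add: e_def)
    have epow: "e ^ n \<le> E0" if "\<gamma> * real N \<le> real n" for n
    proof -
      have "\<gamma> * real N * b0 \<le> real n * b" using that b1 assms a by (intro mult_mono) auto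
      then have "\<gamma> * real N * b0 * t\<^sup>2 \<le> real n * b * t\<^sup>2" by (intro mult_right_mono) auto
      then have "- (real n * b * t\<^sup>2) / 12 \<le> - (b0 * \<gamma> * real N / 6) * t\<^sup>2 / 2" by (simp add: mult_ac)
      moreover have "e ^ n = exp (- (real n * b * t\<^sup>2) / 12)"
        unfolding e_def exp_of_nat_mult[symmetric] by (simp add: mult_ac)
      ultimately show ?thesis by (simp add: E0_def)
    qed
    have q1: "1 \<le> q" using a assms by (metis diff_ge_0_iff_ge mult_nonneg_nonneg of_nat_0_le_iff less_imp_le of_nat_1 of_nat_le_iff order_trans)
    have normA: "cmod A \<le> 1" unfolding A_def by (rule cmod_geo_char[OF a(3)])
    have normA': "cmod (exp wA) \<le> 1"
    proof -
      have "0 \<le> (r + r\<^sup>2) * t\<^sup>2" using a by simp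
      then show ?thesis unfolding wA_def cmod_exp_gauss_exponent exp_le_one_iff mult_minus_left by linarith
    qed
    have normB: "cmod B \<le> e" unfolding B_def e_def b_def using cmod_ber_char[OF a(5,6) t] by simp
    have normB': "cmod (exp wB) \<le> e"
    proof -
      have "b * t\<^sup>2 / 12 \<le> b * t\<^sup>2 / 2" using b1 by (intro divide_left_mono) auto
      then show ?thesis unfolding wB_def cmod_exp_gauss_exponent e_def by simp
    qed
    have T1: "cmod ((A ^ p - exp wA ^ p) * B ^ q) \<le> real p * (KA * \<bar>t\<bar> ^ 3) * E0"
    proof -
      have "cmod (A ^ p - exp wA ^ p) \<le> real p * cmod (A - exp wA)"
        by (rule norm_power_diff[OF normA normA'])
      also have "\<dots> \<le> real p * (KA * \<bar>t\<bar> ^ 3)"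
        unfolding A_def wA_def KA_def by (intro mult_left_mono geo_char_approx a t4) simp
      finally have 1: "cmod (A ^ p - exp wA ^ p) \<le> real p * (KA * \<bar>t\<bar> ^ 3)" .
      have "cmod (B ^ q) \<le> e ^ q" unfolding norm_power using normB by (intro power_mono) auto
      also have "\<dots> \<le> E0" using a by (intro epow) auto
      finally show ?thesis unfolding norm_mult using 1 nn by (intro mult_mono) auto
    qed
    have T2: "cmod (exp wA ^ p * (B ^ q - exp wB ^ q)) \<le> real q * (5 * \<bar>t\<bar> ^ 3) * E0"
    proof -
      have "cmod (B ^ q - exp wB ^ q) \<le> real q * cmod (B - exp wB) * e ^ (q - 1)"
        by (rule norm_power_diff_scaled[OF normB normB' e(1)])
      also have "\<dots> \<le> real q * (5 * \<bar>t\<bar> ^ 3) * E0"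
      proof (intro mult_mono mult_left_mono)
        show "cmod (B - exp wB) \<le> 5 * \<bar>t\<bar> ^ 3"
          unfolding B_def wB_def b_def by (rule ber_char_approx[OF a(5,6) t4])
        show "e ^ (q - 1) \<le> E0" using a q1 by (intro epow) (simp add: of_nat_diff)
      qed (use e in auto)
      finally have 1: "cmod (B ^ q - exp wB ^ q) \<le> real q * (5 * \<bar>t\<bar> ^ 3) * E0" .
      have "cmod (exp wA ^ p) \<le> 1" unfolding norm_power using normA' by (simp add: power_le_one)
      then have "cmod (exp wA ^ p * (B ^ q - exp wB ^ q)) \<le> 1 * (real q * (5 * \<bar>t\<bar> ^ 3) * E0)"
        unfolding norm_mult using 1 by (intro mult_mono) auto
      then show ?thesis by simp
    qed
    define G where "G = exp (- total_variance N m r \<beta> * t\<^sup>2 / 2)"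
    have GE: "G \<le> E0" unfolding G_def E0_def by (rule gauss_le_envelope[OF adm assms(2,3)])
    have T3: "cmod (exp wA ^ p * exp wB ^ q - of_real G) \<le> K3 * \<bar>t\<bar> * E0"
    proof -
      \<comment> \<open>The excess of the exponents, bounded by \<open>h\<close>. What remains
        without it is exactly the Gaussian: the linear terms cancel by the saddle point condition
        and the variances add up.\<close>
      define x where "x = of_real (real p - real m) * wA + of_real (real q - (real N - real m)) * wB"
      have "of_real (real m) * wA + of_real (real N - real m) * wB = of_real (- total_variance N m r \<beta> * t\<^sup>2 / 2)"
      proof (rule complex_eqI)
        show "Re (of_real (real m) * wA + of_real (real N - real m) * wB) = Re (of_real (- total_variance N m r \<beta> * t\<^sup>2 / 2))"
          unfolding total_variance_def wA_def wB_def gauss_exponent_def b_def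
          by (simp add: algebra_simps add_divide_distrib diff_divide_distrib)
        have "(real m * r) * t - ((real N - real m) * \<beta>) * t = 0" using a(8) by simp
        then show "Im (of_real (real m) * wA + of_real (real N - real m) * wB) = Im (of_real (- total_variance N m r \<beta> * t\<^sup>2 / 2))"
          unfolding wA_def wB_def gauss_exponent_def by (simp add: algebra_simps)
      qed
      moreover have "of_nat p * wA + of_nat q * wB = (of_real (real m) * wA + of_real (real N - real m) * wB) + x"
        unfolding x_def by (simp add: algebra_simps)
      moreover have "exp wA ^ p * exp wB ^ q = exp (of_nat p * wA + of_nat q * wB)"
        by (simp add: exp_add exp_of_nat_mult)
      ultimately have "exp wA ^ p * exp wB ^ q = of_real G * exp x"
        by (simp only: exp_add G_def exp_of_real[symmetric] of_real_minus of_real_mult of_real_divide of_real_power of_real_numeral)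
      then have "exp wA ^ p * exp wB ^ q - of_real G = of_real G * (exp x - 1)" by (simp add: algebra_simps)
      then have 1: "cmod (exp wA ^ p * exp wB ^ q - of_real G) = G * cmod (exp x - 1)"
        by (simp add: norm_mult G_def)
      have x: "cmod x \<le> h * W * \<bar>t\<bar>"
      proof -
        have "cmod x \<le> cmod (of_real (real p - real m) * wA) + cmod (of_real (real q - (real N - real m)) * wB)"
          unfolding x_def by (rule norm_triangle_ineq)
        also have "\<dots> \<le> h * ((R + 2 * (R + R\<^sup>2)) * \<bar>t\<bar>) + h * ((1 + 2 * 1) * \<bar>t\<bar>)"
          unfolding norm_mult norm_of_real wA_def wB_def
          by (intro add_mono mult_mono cmod_gauss_exponent) (use a assms t4 b1 in \<open>auto intro: power_mono\<close>)
        finally show ?thesis by (simp add: W_def algebra_simps)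
      qed
      also have "h * W * \<bar>t\<bar> \<le> h * W * 4" using t4 nn assms by (intro mult_left_mono) auto
      finally have x4: "cmod x \<le> h * W * 4" .
      have "cmod (exp x - 1) \<le> exp (cmod x) * cmod x" by (rule cmod_exp_minus_one)
      also have "\<dots> \<le> exp (h * W * 4) * (h * W * \<bar>t\<bar>)" using x x4 by (intro mult_mono) auto
      finally have "cmod (exp x - 1) \<le> K3 * \<bar>t\<bar>" by (simp add: K3_def)
      then have "G * cmod (exp x - 1) \<le> E0 * (K3 * \<bar>t\<bar>)"
        using GE by (intro mult_mono) (auto simp: E0_def)
      then show ?thesis unfolding 1 by (simp add: mult_ac)
    qed
    have E0: "0 \<le> E0" by (simp add: E0_def)
    have pN: "real p \<le> (1 + h) * real N" "real q \<le> (1 + h) * real N"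
    proof -
      have "h * 1 \<le> h * real N" using a assms by (intro mult_left_mono) auto
      moreover have "real p \<le> real m + h" "real q \<le> real N - real m + h" using a(9,10) by auto
      ultimately show "real p \<le> (1 + h) * real N" "real q \<le> (1 + h) * real N"
        using a(2) by (auto simp: algebra_simps)
    qed
    have "cmod (A ^ p * B ^ q - of_real G) \<le> cmod ((A ^ p - exp wA ^ p) * B ^ q) + cmod (exp wA ^ p * (B ^ q - exp wB ^ q))
        + cmod (exp wA ^ p * exp wB ^ q - of_real G)"
      using norm_add3[of "(A ^ p - exp wA ^ p) * B ^ q" "exp wA ^ p * (B ^ q - exp wB ^ q)" "exp wA ^ p * exp wB ^ q - of_real G"]
      by (simp add: algebra_simps)
    also have "\<dots> \<le> real p * (KA * \<bar>t\<bar> ^ 3) * E0 + real q * (5 * \<bar>t\<bar> ^ 3) * E0 + K3 * \<bar>t\<bar> * E0"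
      using T1 T2 T3 by (intro add_mono)
    also have "\<dots> \<le> ((1 + h) * real N) * (KA * \<bar>t\<bar> ^ 3) * E0 + ((1 + h) * real N) * (5 * \<bar>t\<bar> ^ 3) * E0 + K3 * \<bar>t\<bar> * E0"
      using pN nn E0 by (intro add_mono mult_right_mono) auto
    also have "\<dots> = (1 + h) * (KA + 5) * (real N * \<bar>t\<bar> ^ 3) * E0 + K3 * \<bar>t\<bar> * E0"
      by (simp add: algebra_simps)
    also have "\<dots> \<le> ?C * (real N * \<bar>t\<bar> ^ 3) * E0 + ?C * \<bar>t\<bar> * E0"
      using nn E0 assms by (intro add_mono mult_right_mono) auto
    finally show "cmod (geo_char r t ^ p * ber_char \<beta> t ^ q - of_real (exp (- total_variance N m r \<beta> * t\<^sup>2 / 2)))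
      \<le> ?C * (\<bar>t\<bar> + real N * \<bar>t\<bar> ^ 3) * exp (- (b0 * \<gamma> * real N / 6) * t\<^sup>2 / 2)"
      unfolding A_def B_def G_def E0_def by (simp add: algebra_simps)
  qed
qed

section \<open>Edge factors and Gaussian moments\<close>

definition edge_factor :: "nat \<Rightarrow> nat \<Rightarrow> real \<Rightarrow> complex" where
  "edge_factor i l t = (cis t - 1) ^ i * (cis (- t) - 1) ^ l"

definition edge_limit :: "nat \<Rightarrow> nat \<Rightarrow> real \<Rightarrow> complex" where
  "edge_limit i l t = (\<i> * of_real t) ^ i * (- \<i> * of_real t) ^ l"

lemma edge_limit_eq: "edge_limit i l t = \<i> ^ i * (- \<i>) ^ l * of_real (t ^ (i + l))"
  unfolding edge_limit_def power_mult_distrib by (simp add: power_add mult_ac)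

lemma cmod_edge_limit: "cmod (edge_limit i l t) = \<bar>t\<bar> ^ (i + l)"
  unfolding edge_limit_eq by (simp add: norm_mult norm_power power_abs)

lemma cmod_edge_factor: "cmod (edge_factor i l t) \<le> \<bar>t\<bar> ^ (i + l)"
  unfolding edge_factor_def norm_mult norm_power power_add
  using cis_approx(1)[of t] cis_approx(1)[of "- t"] by (intro mult_mono power_mono) auto

lemma edge_factor_approx:
  "cmod (edge_factor i l t - edge_limit i l t) \<le> real (i + l) * \<bar>t\<bar> ^ (i + l + 1)"
proof (cases "t = 0")
  case True
  then show ?thesis by (cases i; cases l) (simp_all add: edge_factor_def edge_limit_def)
next
  case False
  have pw: "cmod (z ^ j - w ^ j) \<le> real j * \<bar>t\<bar> ^ (j + 1)"
    if "cmod z \<le> \<bar>t\<bar>" "cmod w \<le> \<bar>t\<bar>" "cmod (z - w) \<le> t\<^sup>2 / 2" for z w j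
  proof (cases j)
    case (Suc n)
    have "cmod (z ^ j - w ^ j) \<le> real j * cmod (z - w) * \<bar>t\<bar> ^ (j - 1)"
      by (rule norm_power_diff_scaled) (use that False in auto)
    also have "\<dots> \<le> real j * \<bar>t\<bar>\<^sup>2 * \<bar>t\<bar> ^ (j - 1)"
    proof (intro mult_right_mono mult_left_mono)
      have "0 \<le> t\<^sup>2" by simp
      then show "cmod (z - w) \<le> \<bar>t\<bar>\<^sup>2" using that(3) unfolding power2_abs by linarith
    qed auto
    also have "\<dots> = real j * \<bar>t\<bar> ^ (j + 1)" using Suc by (simp add: power2_eq_square)
    finally show ?thesis .
  qed simp
  have z: "cmod (cis t - 1) \<le> \<bar>t\<bar>" "cmod (cis (- t) - 1) \<le> \<bar>t\<bar>"
    using cis_approx(1)[of t] cis_approx(1)[of "- t"] by auto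
  have w: "cmod (\<i> * of_real t) \<le> \<bar>t\<bar>" "cmod (- \<i> * of_real t) \<le> \<bar>t\<bar>" by (simp_all add: norm_mult)
  have d1: "cmod ((cis t - 1) - \<i> * of_real t) \<le> t\<^sup>2 / 2"
    using cis_approx(2)[of t] by (simp add: diff_diff_eq)
  have d2: "cmod ((cis (- t) - 1) - (- \<i> * of_real t)) \<le> t\<^sup>2 / 2"
    using cis_approx(2)[of "- t"] by (simp add: algebra_simps)
  have "edge_factor i l t - edge_limit i l t = ((cis t - 1) ^ i - (\<i> * of_real t) ^ i) * (cis (- t) - 1) ^ l
      + (\<i> * of_real t) ^ i * ((cis (- t) - 1) ^ l - (- \<i> * of_real t) ^ l)"
    unfolding edge_factor_def edge_limit_def by (simp add: algebra_simps)
  then have "cmod (edge_factor i l t - edge_limit i l t) \<le> cmod ((cis t - 1) ^ i - (\<i> * of_real t) ^ i) * cmod (cis (- t) - 1) ^ l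
      + cmod (\<i> * of_real t) ^ i * cmod ((cis (- t) - 1) ^ l - (- \<i> * of_real t) ^ l)"
    unfolding norm_mult[symmetric] norm_power[symmetric] by (simp only: norm_triangle_ineq)
  also have "\<dots> \<le> (real i * \<bar>t\<bar> ^ (i + 1)) * \<bar>t\<bar> ^ l + \<bar>t\<bar> ^ i * (real l * \<bar>t\<bar> ^ (l + 1))"
    using pw[OF z(1) w(1) d1, of i] pw[OF z(2) w(2) d2, of l] z w by (intro add_mono mult_mono power_mono) auto
  also have "\<dots> = real (i + l) * \<bar>t\<bar> ^ (i + l + 1)" by (simp add: power_add algebra_simps)
  finally show ?thesis .
qed

definition gauss_moment :: "nat \<Rightarrow> real" where
  "gauss_moment n = (if even n then fact n / (2 ^ (n div 2) * fact (n div 2)) else 0)"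

lemma std_normal_moment: "has_bochner_integral lborel (\<lambda>x. std_normal_density x * x ^ n) (gauss_moment n)"
proof (cases "even n")
  case True
  then obtain k where "n = 2 * k" by (elim evenE)
  then show ?thesis using std_normal_moment_even[of k] by (simp add: gauss_moment_def)
next
  case False
  then obtain k where "n = 2 * k + 1" by (elim oddE)
  then show ?thesis using std_normal_moment_odd[of k] by (simp add: gauss_moment_def)
qed

lemma std_normal_abs_moment: "\<exists>K\<ge>0. has_bochner_integral lborel (\<lambda>x. std_normal_density x * \<bar>x\<bar> ^ n) K"
proof (cases "even n")
  case True
  then obtain k where "n = 2 * k" by (elim evenE)
  then have "has_bochner_integral lborel (\<lambda>x. std_normal_density x * \<bar>x\<bar> ^ n) (fact (2 * k) / (2 ^ k * fact k))"
    using std_normal_moment_even[of k] by (simp add: power_even_abs)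
  then show ?thesis by (intro exI[of _ "fact (2 * k) / (2 ^ k * fact k)"]) simp
next
  case False
  then obtain k where "n = 2 * k + 1" by (elim oddE)
  then have "has_bochner_integral lborel (\<lambda>x. std_normal_density x * \<bar>x\<bar> ^ n) (sqrt (2 / pi) * 2 ^ k * fact k)"
    using std_normal_moment_abs_odd[of k] by simp
  then show ?thesis by (intro exI[of _ "sqrt (2 / pi) * 2 ^ k * fact k"]) simp
qed

text \<open>Homogeneity of \<open>g\<close> under positive scaling covers the powers of
  \<open>x\<close> and of its absolute value by a single substitution.\<close>

lemma scale_gauss_integral:
  fixes g :: "real \<Rightarrow> real"
  assumes "has_bochner_integral lborel (\<lambda>x. std_normal_density x * g x) K" "0 < v"
    and g: "\<And>c x. 0 < c \<Longrightarrow> g (c * x) = c ^ n * g x"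
  shows "has_bochner_integral lborel (\<lambda>x. g x * exp (- v * x\<^sup>2 / 2)) (sqrt (2 * pi) * K / sqrt v ^ (n + 1))"
proof -
  have v: "0 < sqrt v" using assms by simp
  have "has_bochner_integral lborel (\<lambda>x. std_normal_density (0 + sqrt v * x) * g (0 + sqrt v * x)) (K /\<^sub>R \<bar>sqrt v\<bar>)"
    using lborel_has_bochner_integral_real_affine_iff[of "sqrt v" "\<lambda>x. std_normal_density x * g x" K 0] assms(1) v by simp
  then have "has_bochner_integral lborel (\<lambda>x. (sqrt (2 * pi) / sqrt v ^ n) * (std_normal_density (0 + sqrt v * x) * g (0 + sqrt v * x)))
      ((sqrt (2 * pi) / sqrt v ^ n) * (K /\<^sub>R \<bar>sqrt v\<bar>))"
    by (rule has_bochner_integral_mult_right)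
  moreover have "(sqrt (2 * pi) / sqrt v ^ n) * (std_normal_density (0 + sqrt v * x) * g (0 + sqrt v * x)) = g x * exp (- v * x\<^sup>2 / 2)" for x
    using v g[OF v, of x] assms(2) by (simp add: std_normal_density_def power_mult_distrib)
  moreover have "(sqrt (2 * pi) / sqrt v ^ n) * (K /\<^sub>R \<bar>sqrt v\<bar>) = sqrt (2 * pi) * K / sqrt v ^ (n + 1)"
    using v by (simp add: divide_inverse mult_ac)
  ultimately show ?thesis by simp
qed

lemma gauss_integral:
  assumes "0 < v"
  shows "has_bochner_integral lborel (\<lambda>x. x ^ n * exp (- v * x\<^sup>2 / 2)) (sqrt (2 * pi) * gauss_moment n / sqrt v ^ (n + 1))"
  by (rule scale_gauss_integral[OF std_normal_moment assms]) (simp add: power_mult_distrib)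

lemma gauss_abs_integral:
  obtains K where "0 \<le> K" "\<And>v. 0 < v \<Longrightarrow> has_bochner_integral lborel (\<lambda>x. \<bar>x\<bar> ^ n * exp (- v * x\<^sup>2 / 2)) (K / sqrt v ^ (n + 1))"
proof -
  obtain K where K: "0 \<le> K" "has_bochner_integral lborel (\<lambda>x. std_normal_density x * \<bar>x\<bar> ^ n) K"
    using std_normal_abs_moment by blast
  show ?thesis
  proof (rule that[of "sqrt (2 * pi) * K"])
    fix v :: real assume "0 < v"
    then show "has_bochner_integral lborel (\<lambda>x. \<bar>x\<bar> ^ n * exp (- v * x\<^sup>2 / 2)) (sqrt (2 * pi) * K / sqrt v ^ (n + 1))"
      by (rule scale_gauss_integral[OF K(2)]) (simp add: abs_mult power_mult_distrib)
  qed (use K in simp)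
qed

definition saddle_integral :: "nat \<Rightarrow> nat \<Rightarrow> real \<Rightarrow> real \<Rightarrow> nat \<Rightarrow> nat \<Rightarrow> complex" where
  "saddle_integral p q r \<beta> i l =
    (LINT t|lborel. indicator {-pi..pi} t *\<^sub>R (geo_char r t ^ p * ber_char \<beta> t ^ q * edge_factor i l t))"

lemma continuous_geo_char: "0 \<le> r \<Longrightarrow> continuous_on S (geo_char r)"
  unfolding geo_char_def cis_conv_exp
  by (intro continuous_intros) (use geo_denominator_nonzero in \<open>auto simp: cis_conv_exp\<close>)

lemma continuous_ber_char: "continuous_on S (ber_char \<beta>)"
  unfolding ber_char_def cis_conv_exp by (intro continuous_intros)

lemma continuous_edge_factor: "continuous_on S (edge_factor i l)"
  unfolding edge_factor_def cis_conv_exp by (intro continuous_intros)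

text \<open>With n = i + l, the errors \<open>\<bar>t\<bar> ^ (n + 1)\<close> and
  \<open>N \<bar>t\<bar> ^ (n + 3)\<close> both integrate against the envelope to the order
  N^(-(n+2)/2). The normalising factor has order N^((n+1)/2), which leaves N^(-1/2).\<close>

lemma saddle_integral_approx:
  fixes R b0 \<gamma> h :: real
  assumes "0 \<le> R" "0 < b0" "0 < \<gamma>" "0 \<le> h"
  obtains C where "0 \<le> C" and
    "\<And>N m p q r \<beta>. admissible R b0 \<gamma> h N m p q r \<beta> \<Longrightarrow>
      cmod (saddle_integral p q r \<beta> i l * of_real (sqrt (total_variance N m r \<beta>) ^ (i + l + 1) / sqrt (2 * pi))
        - \<i> ^ i * (- \<i>) ^ l * of_real (gauss_moment (i + l))) \<le> C / sqrt (real N)"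
proof -
  let ?n = "i + l"
  obtain C0 where C0: "0 \<le> C0" "\<And>N m p q r \<beta> t. admissible R b0 \<gamma> h N m p q r \<beta> \<Longrightarrow> \<bar>t\<bar> \<le> pi \<Longrightarrow>
      cmod (geo_char r t ^ p * ber_char \<beta> t ^ q - of_real (exp (- total_variance N m r \<beta> * t\<^sup>2 / 2)))
      \<le> C0 * (\<bar>t\<bar> + real N * \<bar>t\<bar> ^ 3) * exp (- (b0 * \<gamma> * real N / 6) * t\<^sup>2 / 2)"
    using char_product_approx[OF assms] by blast
  obtain K1 where K1: "0 \<le> K1" "\<And>v. 0 < v \<Longrightarrow> has_bochner_integral lborel (\<lambda>x. \<bar>x\<bar> ^ (?n + 1) * exp (- v * x\<^sup>2 / 2)) (K1 / sqrt v ^ (?n + 1 + 1))"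
    using gauss_abs_integral[of "?n + 1"] by blast
  obtain K3 where K3: "0 \<le> K3" "\<And>v. 0 < v \<Longrightarrow> has_bochner_integral lborel (\<lambda>x. \<bar>x\<bar> ^ (?n + 3) * exp (- v * x\<^sup>2 / 2)) (K3 / sqrt v ^ (?n + 3 + 1))"
    using gauss_abs_integral[of "?n + 3"] by blast
  \<comment> \<open>\<open>C0\<close> accounts for the characteristic functions,
    \<open>real ?n\<close> for the edge factor, and 1 for the Gaussian tail outside the
    circle.\<close>
  define C1 where "C1 = C0 + real ?n + 1"
  define c where "c = sqrt (b0 * \<gamma> / 6)"
  have c: "0 < c" using assms by (simp add: c_def)
  define S1 where "S1 = sqrt (R + R\<^sup>2 + 1)"
  let ?C = "C1 * (K1 / c ^ (?n + 2) + K3 / c ^ (?n + 4)) * S1 ^ (?n + 1) / sqrt (2 * pi)"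
  have C1: "0 \<le> C1" using C0 by (simp add: C1_def)
  show ?thesis
  proof (rule that[of ?C])
    have "0 \<le> S1" using assms by (simp add: S1_def)
    then show "0 \<le> ?C" using C1 K1(1) K3(1) c by simp
    fix N m p q r \<beta> assume adm: "admissible R b0 \<gamma> h N m p q r \<beta>"
    then have N: "1 \<le> real N" and r: "0 \<le> r" by (auto simp: admissible_def)
    define v where "v = b0 * \<gamma> * real N / 6"
    define S where "S = total_variance N m r \<beta>"
    have v: "0 < v" using assms N by (simp add: v_def)
    have S: "0 < S"
    proof -
      have "0 < b0 * \<gamma> * real N" using assms N by simp
      then show ?thesis using total_variance_ge[OF adm assms(2,3)] unfolding S_def by linarith
    qed
    have sv: "sqrt v = c * sqrt (real N)" unfolding v_def c_def by (simp add: real_sqrt_mult[symmetric] mult_ac)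
    let ?f = "\<lambda>t. indicator {-pi..pi} t *\<^sub>R (geo_char r t ^ p * ber_char \<beta> t ^ q * edge_factor i l t)"
    let ?G = "\<lambda>t. of_real (exp (- S * t\<^sup>2 / 2)) * edge_limit i l t"
    let ?b = "\<lambda>t. C1 * (\<bar>t\<bar> ^ (?n + 1) * exp (- v * t\<^sup>2 / 2) + real N * (\<bar>t\<bar> ^ (?n + 3) * exp (- v * t\<^sup>2 / 2)))"
    have intf: "integrable lborel ?f"
      by (intro borel_integrable_compact continuous_intros continuous_geo_char[OF r] continuous_ber_char continuous_edge_factor) simp
    have hG: "has_bochner_integral lborel ?G (\<i> ^ i * (- \<i>) ^ l * of_real (sqrt (2 * pi) * gauss_moment ?n / sqrt S ^ (?n + 1)))"
    proof -
      have "has_bochner_integral lborel (\<lambda>x. complex_of_real (x ^ ?n * exp (- S * x\<^sup>2 / 2))) (of_real (sqrt (2 * pi) * gauss_moment ?n / sqrt S ^ (?n + 1)))"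
        by (rule has_bochner_integral_of_real[OF gauss_integral[OF S]])
      then have "has_bochner_integral lborel (\<lambda>x. \<i> ^ i * (- \<i>) ^ l * complex_of_real (x ^ ?n * exp (- S * x\<^sup>2 / 2)))
        (\<i> ^ i * (- \<i>) ^ l * of_real (sqrt (2 * pi) * gauss_moment ?n / sqrt S ^ (?n + 1)))"
        by (rule has_bochner_integral_mult_right)
      moreover have "(\<lambda>x. \<i> ^ i * (- \<i>) ^ l * complex_of_real (x ^ ?n * exp (- S * x\<^sup>2 / 2))) = ?G"
        unfolding edge_limit_eq by (auto simp: mult_ac)
      ultimately show ?thesis by simp
    qed
    have hb: "has_bochner_integral lborel ?b (C1 * (K1 / sqrt v ^ (?n + 2) + real N * (K3 / sqrt v ^ (?n + 4))))"
      using has_bochner_integral_mult_right[OF has_bochner_integral_add[OF K1(2)[OF v] has_bochner_integral_mult_right[OF K3(2)[OF v], of "real N"]], of C1]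
      by (simp add: ac_simps)
    have bound: "cmod (?f t - ?G t) \<le> ?b t" for t
    proof (cases "\<bar>t\<bar> \<le> pi")
      case True
      define H where "H = geo_char r t ^ p * ber_char \<beta> t ^ q"
      define g where "g = exp (- S * t\<^sup>2 / 2)"
      define E0 where "E0 = exp (- v * t\<^sup>2 / 2)"
      have g: "0 \<le> g" "g \<le> E0" unfolding g_def E0_def S_def v_def
        using gauss_le_envelope[OF adm assms(2,3), of t] by simp_all
      have H: "cmod (H - of_real g) \<le> C0 * (\<bar>t\<bar> + real N * \<bar>t\<bar> ^ 3) * E0"
        unfolding H_def g_def E0_def S_def v_def by (rule C0(2)[OF adm True])
      have "?f t - ?G t = (H - of_real g) * edge_factor i l t + of_real g * (edge_factor i l t - edge_limit i l t)"
        using True by (simp add: H_def g_def abs_le_iff algebra_simps)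
      then have "cmod (?f t - ?G t) \<le> cmod (H - of_real g) * cmod (edge_factor i l t) + g * cmod (edge_factor i l t - edge_limit i l t)"
        using norm_triangle_ineq[of "(H - of_real g) * edge_factor i l t" "of_real g * (edge_factor i l t - edge_limit i l t)"] g(1)
        by (simp add: norm_mult)
      also have "\<dots> \<le> (C0 * (\<bar>t\<bar> + real N * \<bar>t\<bar> ^ 3) * E0) * \<bar>t\<bar> ^ ?n + E0 * (real ?n * \<bar>t\<bar> ^ (?n + 1))"
        using H g cmod_edge_factor[of i l t] edge_factor_approx[of i l t] C0(1)
        by (intro add_mono mult_mono) (auto simp: E0_def)
      also have "\<dots> = (C0 + real ?n) * (\<bar>t\<bar> ^ (?n + 1) * E0) + C0 * (real N * (\<bar>t\<bar> ^ (?n + 3) * E0))"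
        by (simp add: algebra_simps power_add)
      also have "\<dots> \<le> C1 * (\<bar>t\<bar> ^ (?n + 1) * E0) + C1 * (real N * (\<bar>t\<bar> ^ (?n + 3) * E0))"
        by (intro add_mono mult_right_mono) (auto simp: C1_def E0_def)
      finally show ?thesis by (simp add: E0_def distrib_left)
    next
      case False
      \<comment> \<open>Off the circle the integrand is 0. There
        \<open>\<bar>t\<bar> \<ge> 1\<close> allows one more power of \<open>\<bar>t\<bar>\<close>,
        so the tail fits into the same bound.\<close>
      then have t: "1 \<le> \<bar>t\<bar>" using pi_gt3 by linarith
      have "cmod (?f t - ?G t) = exp (- S * t\<^sup>2 / 2) * \<bar>t\<bar> ^ ?n"
        using False by (auto simp: norm_mult cmod_edge_limit abs_le_iff indicator_def)
      also have "\<dots> \<le> exp (- v * t\<^sup>2 / 2) * \<bar>t\<bar> ^ (?n + 1)"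
        using gauss_le_envelope[OF adm assms(2,3), of t] t
        by (intro mult_mono power_increasing) (auto simp: S_def v_def)
      also have "\<dots> \<le> C1 * (\<bar>t\<bar> ^ (?n + 1) * exp (- v * t\<^sup>2 / 2))"
        using C0(1) mult_right_mono[of 1 C1 "\<bar>t\<bar> ^ (?n + 1) * exp (- v * t\<^sup>2 / 2)"] by (simp add: C1_def mult.commute)
      also have "\<dots> \<le> ?b t" using C1 by (intro mult_left_mono) auto
      finally show ?thesis .
    qed
    have "cmod (saddle_integral p q r \<beta> i l - \<i> ^ i * (- \<i>) ^ l * of_real (sqrt (2 * pi) * gauss_moment ?n / sqrt S ^ (?n + 1)))
      = cmod (LINT t|lborel. ?f t - ?G t)"
      unfolding saddle_integral_def using intf hG
      by (simp add: has_bochner_integral_integrable has_bochner_integral_integral_eq integrable.intros Bochner_Integration.integral_diff)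
    also have "\<dots> \<le> (LINT t|lborel. ?b t)"
    proof (rule Bochner_Integration.integral_norm_bound_integral)
      show "integrable lborel (\<lambda>t. ?f t - ?G t)"
        by (rule Bochner_Integration.integrable_diff[OF intf integrable.intros[OF hG]])
      show "integrable lborel ?b" by (rule integrable.intros[OF hb])
    qed (rule bound)
    also have "\<dots> = C1 * (K1 / sqrt v ^ (?n + 2) + real N * (K3 / sqrt v ^ (?n + 4)))"
      using hb by (rule has_bochner_integral_integral_eq)
    also have "\<dots> = C1 * (K1 / c ^ (?n + 2) + K3 / c ^ (?n + 4)) / sqrt (real N) ^ (?n + 2)"
    proof -
      define s where "s = sqrt (real N)"
      have s: "0 < s" using N by (simp add: s_def)
      have Ns: "real N = s ^ 2" by (simp add: s_def)
      have "real N * (K3 / (c * s) ^ (?n + 4)) = K3 / c ^ (?n + 4) / s ^ (?n + 2)"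
        unfolding Ns power_mult_distrib using s c by (simp add: power_add field_simps power2_eq_square power4_eq_xxxx)
      then show ?thesis unfolding sv s_def[symmetric] power_mult_distrib by (simp add: add_divide_distrib distrib_left)
    qed
    finally have main: "cmod (saddle_integral p q r \<beta> i l - \<i> ^ i * (- \<i>) ^ l * of_real (sqrt (2 * pi) * gauss_moment ?n / sqrt S ^ (?n + 1)))
      \<le> C1 * (K1 / c ^ (?n + 2) + K3 / c ^ (?n + 4)) / sqrt (real N) ^ (?n + 2)" .
    have "saddle_integral p q r \<beta> i l * of_real (sqrt S ^ (?n + 1) / sqrt (2 * pi)) - \<i> ^ i * (- \<i>) ^ l * of_real (gauss_moment ?n)
      = (saddle_integral p q r \<beta> i l - \<i> ^ i * (- \<i>) ^ l * of_real (sqrt (2 * pi) * gauss_moment ?n / sqrt S ^ (?n + 1)))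
        * of_real (sqrt S ^ (?n + 1) / sqrt (2 * pi))"
    proof -
      have "(sqrt (2 * pi) * gauss_moment ?n / sqrt S ^ (?n + 1)) * (sqrt S ^ (?n + 1) / sqrt (2 * pi)) = gauss_moment ?n"
        using S by simp
      then have "of_real (sqrt (2 * pi) * gauss_moment ?n / sqrt S ^ (?n + 1)) * of_real (sqrt S ^ (?n + 1) / sqrt (2 * pi)) = complex_of_real (gauss_moment ?n)"
        unfolding of_real_mult[symmetric] by (rule arg_cong)
      then show ?thesis by (simp only: left_diff_distrib mult.assoc)
    qed
    then have "cmod (saddle_integral p q r \<beta> i l * of_real (sqrt S ^ (?n + 1) / sqrt (2 * pi)) - \<i> ^ i * (- \<i>) ^ l * of_real (gauss_moment ?n))
      \<le> (C1 * (K1 / c ^ (?n + 2) + K3 / c ^ (?n + 4)) / sqrt (real N) ^ (?n + 2)) * (sqrt S ^ (?n + 1) / sqrt (2 * pi))"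
      using main S by (simp add: norm_mult norm_divide norm_power mult_right_mono del: times_divide_eq_right times_divide_eq_left)
    also have "\<dots> \<le> (C1 * (K1 / c ^ (?n + 2) + K3 / c ^ (?n + 4)) / sqrt (real N) ^ (?n + 2)) * ((S1 * sqrt (real N)) ^ (?n + 1) / sqrt (2 * pi))"
    proof (intro mult_left_mono divide_right_mono power_mono)
      show "sqrt S \<le> S1 * sqrt (real N)"
        unfolding S1_def real_sqrt_mult[symmetric] S_def using total_variance_le[OF adm] by simp
    qed (use C1 K1 K3 c S in auto)
    also have "\<dots> = ?C / sqrt (real N)"
    proof -
      have "(S1 * sqrt (real N)) ^ (?n + 1) / sqrt (real N) ^ (?n + 2) = S1 ^ (?n + 1) / sqrt (real N)"
        using N by (simp add: power_mult_distrib)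
      moreover have "X / s2 * (Y / p) = X * (Y / s2) / p" for X Y s2 p :: real by simp
      ultimately show ?thesis by (simp only:) simp
    qed
    finally show "cmod (saddle_integral p q r \<beta> i l * of_real (sqrt (total_variance N m r \<beta>) ^ (?n + 1) / sqrt (2 * pi))
        - \<i> ^ i * (- \<i>) ^ l * of_real (gauss_moment ?n)) \<le> ?C / sqrt (real N)" unfolding S_def .
  qed
qed

section \<open>Contour integrals for the entries\<close>

definition circle_mean :: "(real \<Rightarrow> complex) \<Rightarrow> complex" where
  "circle_mean f = (LINT t|lborel. indicator {-pi..pi} t *\<^sub>R f t) / of_real (2 * pi)"

lemma circle_integrable:
  fixes f :: "real \<Rightarrow> complex"
  assumes "continuous_on UNIV f"
  shows "integrable lborel (\<lambda>t. indicator {-pi..pi} t *\<^sub>R f t)"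
  by (rule borel_integrable_compact) (auto intro: continuous_on_subset[OF assms])

lemma circle_mean_add:
  assumes "continuous_on UNIV f" "continuous_on UNIV g"
  shows "circle_mean (\<lambda>t. f t + g t) = circle_mean f + circle_mean g"
  unfolding circle_mean_def scaleR_add_right
  by (subst Bochner_Integration.integral_add) (simp_all add: circle_integrable assms add_divide_distrib)

lemma circle_mean_scale: "circle_mean (\<lambda>t. c * f t) = c * circle_mean f"
proof -
  have "(\<lambda>t. indicator {-pi..pi} t *\<^sub>R (c * f t)) = (\<lambda>t. c * (indicator {-pi..pi} t *\<^sub>R f t))"
    by (simp add: mult_scaleR_right)
  then show ?thesis unfolding circle_mean_def by (simp only: integral_mult_right_zero times_divide_eq_right)
qed

lemma circle_mean_sum:
  assumes "\<And>x. x \<in> A \<Longrightarrow> continuous_on UNIV (f x)"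
  shows "circle_mean (\<lambda>t. \<Sum>x\<in>A. c x * f x t) = (\<Sum>x\<in>A. c x * circle_mean (f x))"
  using assms
proof (induction A rule: infinite_finite_induct)
  case (insert x A)
  have "continuous_on UNIV (\<lambda>t. c x * f x t)" "continuous_on UNIV (\<lambda>t. \<Sum>x\<in>A. c x * f x t)"
    using insert.prems by (auto intro!: continuous_intros)
  then have "circle_mean (\<lambda>t. c x * f x t + (\<Sum>x\<in>A. c x * f x t)) = c x * circle_mean (f x) + (\<Sum>x\<in>A. c x * circle_mean (f x))"
    using insert by (subst circle_mean_add) (simp_all add: circle_mean_scale)
  then show ?case using insert.hyps by simp
qed (simp_all add: circle_mean_def)

lemma cmod_circle_mean:
  assumes "continuous_on UNIV f" "\<And>t. cmod (f t) \<le> 1"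
  shows "cmod (circle_mean f) \<le> 1"
proof -
  have "cmod (LINT t|lborel. indicator {-pi..pi} t *\<^sub>R f t) \<le> (LINT t|lborel. indicator {-pi..pi} t)"
  proof (rule Bochner_Integration.integral_norm_bound_integral[OF circle_integrable[OF assms(1)]])
    show "integrable lborel (indicat_real {-pi..pi})" by simp
    show "cmod (indicator {-pi..pi} t *\<^sub>R f t) \<le> indicat_real {-pi..pi} t" for t
      using assms(2) by (simp add: indicator_def)
  qed
  then show ?thesis by (simp add: circle_mean_def norm_divide)
qed

lemma circle_mean_cis: "circle_mean (\<lambda>t. cis (of_int j * t)) = (if j = 0 then 1 else 0)"
proof (cases "j = 0")
  case True
  have "(LINT t|lborel. indicator {-pi..pi} t *\<^sub>R (1::complex)) = of_real pi - of_real (- pi)"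
    by (rule integral_FTC_Icc) (auto intro!: derivative_eq_intros)
  then show ?thesis using True by (simp add: circle_mean_def)
next
  case False
  have "(LINT t|lborel. indicator {-pi..pi} t *\<^sub>R cis (of_int j * t))
      = cis (of_int j * pi) / (\<i> * of_int j) - cis (of_int j * - pi) / (\<i> * of_int j)"
  proof (rule integral_FTC_Icc)
    show "continuous_on {-pi..pi} (\<lambda>t. cis (of_int j * t))"
      unfolding cis_conv_exp by (intro continuous_intros)
    show "((\<lambda>t. cis (of_int j * t) / (\<i> * of_int j)) has_vector_derivative cis (of_int j * t)) (at t within {-pi..pi})" for t
    proof -
      have "((\<lambda>z. exp (\<i> * of_int j * z) / (\<i> * of_int j)) has_field_derivative exp (\<i> * of_int j * of_real t)) (at (of_real t))"
        using False by (auto intro!: derivative_eq_intros)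
      then have "((\<lambda>x. exp (\<i> * of_int j * of_real x) / (\<i> * of_int j)) has_vector_derivative exp (\<i> * of_int j * of_real t)) (at t within {-pi..pi})"
        by (rule has_vector_derivative_real_field)
      then show ?thesis by (simp add: cis_conv_exp mult.assoc)
    qed
  qed simp
  moreover have "cis (of_int j * pi) = cis (of_int j * - pi) * cis (2 * pi * of_int j)"
    unfolding cis_mult by (simp add: algebra_simps)
  ultimately show ?thesis using False by (simp add: circle_mean_def cis_multiple_2pi)
qed

lemma continuous_cis_mult: "continuous_on S (\<lambda>t. cis (c * t))"
  unfolding cis_conv_exp by (intro continuous_intros)

lemma geo_char_rec:
  assumes "0 < \<rho>" "\<rho> < 1"
  shows "geo_char (\<rho> / (1 - \<rho>)) t = of_real (1 - \<rho>) + of_real \<rho> * (cis t * geo_char (\<rho> / (1 - \<rho>)) t)"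
proof -
  have r: "1 - of_real (\<rho> / (1 - \<rho>)) * (cis t - 1) \<noteq> 0"
    using assms by (intro geo_denominator_nonzero) simp
  have "geo_char (\<rho> / (1 - \<rho>)) t * (1 - of_real (\<rho> / (1 - \<rho>)) * (cis t - 1)) = 1"
    using r by (simp add: geo_char_def)
  then have "geo_char (\<rho> / (1 - \<rho>)) t * (of_real (1 - \<rho>) * (1 - of_real (\<rho> / (1 - \<rho>)) * (cis t - 1))) = of_real (1 - \<rho>)"
    by (metis mult.left_commute mult.right_neutral)
  moreover have "of_real (1 - \<rho>) * (1 - of_real (\<rho> / (1 - \<rho>)) * (cis t - 1)) = 1 - of_real \<rho> * cis t"
  proof -
    have "of_real (1 - \<rho>) * of_real (\<rho> / (1 - \<rho>)) = complex_of_real \<rho>"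
      unfolding of_real_mult[symmetric] using assms by simp
    then have "of_real (1 - \<rho>) * (of_real (\<rho> / (1 - \<rho>)) * (cis t - 1)) = of_real \<rho> * (cis t - 1)"
      by (simp only: mult.assoc[symmetric])
    then show ?thesis by (simp only: right_diff_distrib) (simp add: algebra_simps)
  qed
  ultimately have "geo_char (\<rho> / (1 - \<rho>)) t * (1 - of_real \<rho> * cis t) = of_real (1 - \<rho>)" by (simp only:)
  then show ?thesis by (simp only: right_diff_distrib mult_1_right diff_eq_eq) (simp only: mult_ac)
qed

text \<open>Negative binomial probabilities, obtained without power series:
  \<open>geo_char_rec\<close> yields a recurrence in \<open>p\<close> and \<open>j\<close> that
  matches Pascal's rule. Its boundary values at negative \<open>j\<close> vanish because iterating
  the recurrence extracts ever higher powers of \<open>\<rho> < 1\<close> from coefficients bounded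
  by 1.\<close>

lemma geo_char_coeff:
  assumes "0 < \<rho>" "\<rho> < 1"
  shows "circle_mean (\<lambda>t. geo_char (\<rho> / (1 - \<rho>)) t ^ p * cis (- real j * t))
    = of_real ((1 - \<rho>) ^ p * \<rho> ^ j * real ((p + j - 1) choose j))"
proof -
  define A where "A = geo_char (\<rho> / (1 - \<rho>))"
  define c where "c p j = circle_mean (\<lambda>t. A t ^ p * cis (- of_int j * t))" for p and j :: int
  have r: "0 \<le> \<rho> / (1 - \<rho>)" using assms by simp
  have cont: "continuous_on UNIV (\<lambda>t. A t ^ p * cis (- of_int j * t))" for p j
    unfolding A_def by (intro continuous_intros continuous_geo_char[OF r] continuous_cis_mult)
  have rec: "c (Suc p) j = of_real (1 - \<rho>) * c p j + of_real \<rho> * c (Suc p) (j - 1)" for p j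
  proof -
    have "A t ^ Suc p * cis (- of_int j * t) = of_real (1 - \<rho>) * (A t ^ p * cis (- of_int j * t))
        + of_real \<rho> * (A t ^ Suc p * cis (- of_int (j - 1) * t))" for t
    proof -
      have "cis (- of_int (j - 1) * t) = cis t * cis (- of_int j * t)"
        unfolding cis_mult by (simp add: algebra_simps)
      moreover have "A t ^ Suc p = (of_real (1 - \<rho>) + of_real \<rho> * (cis t * A t)) * A t ^ p"
        using geo_char_rec[OF assms, of t] unfolding A_def[symmetric] by (simp only: power_Suc)
      moreover have "(x + y * (u * v)) * w * z = x * (w * z) + y * (v * w * (u * z))" for u v w x y z :: complex
        by (simp add: algebra_simps)
      ultimately show ?thesis by (metis power_Suc)
    qed
    then have "c (Suc p) j = circle_mean (\<lambda>t. of_real (1 - \<rho>) * (A t ^ p * cis (- of_int j * t))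
        + of_real \<rho> * (A t ^ Suc p * cis (- of_int (j - 1) * t)))" unfolding c_def by (simp only:)
    also have "\<dots> = of_real (1 - \<rho>) * c p j + of_real \<rho> * c (Suc p) (j - 1)"
      unfolding c_def by (subst circle_mean_add) (intro continuous_intros cont | simp only: circle_mean_scale)+
    finally show ?thesis .
  qed
  have bound: "cmod (c p j) \<le> 1" for p j
    unfolding c_def
  proof (rule cmod_circle_mean[OF cont])
    show "cmod (A t ^ p * cis (- of_int j * t)) \<le> 1" for t
      using cmod_geo_char[OF r, of t] by (simp add: norm_mult norm_power A_def power_le_one)
  qed
  have c0: "c 0 j = (if j = 0 then 1 else 0)" for j
    unfolding c_def using circle_mean_cis[of "- j"] by simp
  have neg: "c p j = 0" if "j < 0" for p j using that
  proof (induction p arbitrary: j)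
    case 0
    then show ?case by (simp add: c0)
  next
    case (Suc p)
    have "c (Suc p) j = of_real (\<rho> ^ n) * c (Suc p) (j - int n)" for n
    proof (induction n)
      case (Suc n)
      have "c (Suc p) (j - int n) = of_real \<rho> * c (Suc p) (j - int n - 1)"
        using rec[of p "j - int n"] Suc.IH \<open>j < 0\<close> by (simp add: \<open>\<And>j. j < 0 \<Longrightarrow> c p j = 0\<close>)
      then show ?case using Suc.IH by (simp add: algebra_simps)
    qed simp
    then have "cmod (c (Suc p) j) = \<rho> ^ n * cmod (c (Suc p) (j - int n))" for n
      using assms by (metis abs_of_nonneg less_imp_le norm_mult norm_of_real zero_le_power)
    moreover have "\<rho> ^ n * cmod (c (Suc p) (j - int n)) \<le> \<rho> ^ n * 1" for n
      using assms bound by (intro mult_left_mono) auto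
    ultimately have "cmod (c (Suc p) j) \<le> \<rho> ^ n" for n by (metis mult.right_neutral)
    moreover have "(\<lambda>n. \<rho> ^ n) \<longlonglongrightarrow> 0" using assms by (intro LIMSEQ_power_zero) simp
    ultimately have "cmod (c (Suc p) j) \<le> 0" by (intro LIMSEQ_le_const[of "\<lambda>n. \<rho> ^ n"]) auto
    then show ?case by simp
  qed
  have "c p (int j) = of_real ((1 - \<rho>) ^ p * \<rho> ^ j * real ((p + j - 1) choose j))"
  proof (induction p arbitrary: j)
    case 0
    then show ?case by (cases j) (simp_all add: c0)
  next
    case (Suc p)
    note IHp = Suc.IH
    show ?case
    proof (induction j)
      case 0
      then show ?case using rec[of p 0] IHp[of 0] neg[of "-1" "Suc p"] by simp
    next
      case (Suc j)
      have "c (Suc p) (int (Suc j)) = of_real (1 - \<rho>) * c p (int (Suc j)) + of_real \<rho> * c (Suc p) (int j)"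
        using rec[of p "int (Suc j)"] by simp
      also have "\<dots> = of_real ((1 - \<rho>) ^ Suc p * \<rho> ^ Suc j * (real ((p + j) choose Suc j) + real ((p + j) choose j)))"
        unfolding Suc.IH IHp by (simp add: algebra_simps)
      finally show ?case by simp
    qed
  qed
  then show ?thesis unfolding c_def A_def by simp
qed

definition circle_entry :: "nat \<Rightarrow> nat \<Rightarrow> real \<Rightarrow> real \<Rightarrow> nat \<Rightarrow> nat \<Rightarrow> complex" where
  "circle_entry \<tau> Q r \<beta> i l = circle_mean (\<lambda>t. geo_char r t ^ (\<tau> + 1 + i) * (ber_char \<beta> t ^ (Q - 1 - l) * cis (- t) ^ l))"

text \<open>On the circle of radius \<open>\<rho>\<close>, 1/(1-u) is a constant times
  \<open>geo_char\<close> and 1 + a^2/u a constant times \<open>ber_char\<close>, the constants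
  being the values at u = \<rho>. Any radius below 1 is allowed; the saddle point enters only when
  the asymptotics are assembled.\<close>

lemma entry_circle_entry:
  assumes "0 < \<rho>" "\<rho> < 1"
  shows "of_real (entry a \<tau> Q i l) = of_real ((1 / (1 - \<rho>)) ^ (\<tau> + 1 + i) * ((1 + a\<^sup>2 / \<rho>) ^ (Q - 1 - l) * (1 / \<rho>) ^ l))
    * circle_entry \<tau> Q (\<rho> / (1 - \<rho>)) (a\<^sup>2 / (\<rho> + a\<^sup>2)) i l"
proof -
  define X where "X = 1 / (1 - \<rho>)"
  define W where "W = 1 + a\<^sup>2 / \<rho>"
  define n where "n = Q - 1 - l"
  define p where "p = \<tau> + 1 + i"
  define A where "A = geo_char (\<rho> / (1 - \<rho>))"
  define B where "B = ber_char (a\<^sup>2 / (\<rho> + a\<^sup>2))"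
  have r: "0 \<le> \<rho> / (1 - \<rho>)" using assms by simp
  have a: "0 < \<rho> + a\<^sup>2" using assms by (simp add: add_pos_nonneg)
  have WB: "of_real W * B t = of_real (a\<^sup>2 / \<rho>) * cis (- t) + 1" for t
  proof -
    have "W * (a\<^sup>2 / (\<rho> + a\<^sup>2)) = a\<^sup>2 / \<rho>"
    proof -
      have "W = (\<rho> + a\<^sup>2) / \<rho>" using assms by (simp add: W_def add_divide_distrib)
      then show ?thesis using a by simp
    qed
    then have "of_real W * of_real (a\<^sup>2 / (\<rho> + a\<^sup>2)) = complex_of_real (a\<^sup>2 / \<rho>)"
      by (simp only: of_real_mult[symmetric])
    then have "of_real W * (of_real (a\<^sup>2 / (\<rho> + a\<^sup>2)) * (cis (- t) - 1)) = of_real (a\<^sup>2 / \<rho>) * (cis (- t) - 1)"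
      by (simp only: mult.assoc[symmetric])
    then have "of_real W * B t = of_real W + of_real (a\<^sup>2 / \<rho>) * (cis (- t) - 1)"
      unfolding B_def ber_char_def by (simp only: distrib_left mult_1_right)
    then show ?thesis by (simp only: W_def of_real_add right_diff_distrib) simp
  qed
  have WBn: "of_real W ^ n * B t ^ n * cis (- t) ^ l
      = (\<Sum>s\<le>n. of_real (real (n choose s) * (a\<^sup>2 / \<rho>) ^ s) * cis (- real (l + s) * t))" for t
  proof -
    have "of_real W ^ n * B t ^ n = (\<Sum>s\<le>n. of_nat (n choose s) * (of_real (a\<^sup>2 / \<rho>) * cis (- t)) ^ s * 1 ^ (n - s))"
      unfolding power_mult_distrib[symmetric] WB by (rule binomial_ring)
    moreover have "(of_real (a\<^sup>2 / \<rho>) * cis (- t)) ^ s * cis (- t) ^ l = of_real ((a\<^sup>2 / \<rho>) ^ s) * cis (- real (l + s) * t)" for s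
    proof -
      have "cis (- t) ^ s * cis (- t) ^ l = cis (- real (l + s) * t)"
        unfolding power_add[symmetric] unfolding Complex.DeMoivre by (simp add: algebra_simps)
      then show ?thesis by (simp only: power_mult_distrib of_real_power mult.assoc)
    qed
    ultimately show ?thesis by (simp add: sum_distrib_right mult.assoc)
  qed
  have cont: "continuous_on UNIV (\<lambda>t. A t ^ p * cis (- real j * t))" for j
    unfolding A_def by (intro continuous_intros continuous_geo_char[OF r] continuous_cis_mult)
  have "of_real W ^ n * circle_entry \<tau> Q (\<rho> / (1 - \<rho>)) (a\<^sup>2 / (\<rho> + a\<^sup>2)) i l
      = circle_mean (\<lambda>t. of_real W ^ n * (A t ^ p * (B t ^ n * cis (- t) ^ l)))"
    unfolding circle_entry_def circle_mean_scale A_def B_def n_def p_def ..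
  also have "\<dots> = circle_mean (\<lambda>t. \<Sum>s\<le>n. of_real (real (n choose s) * (a\<^sup>2 / \<rho>) ^ s) * (A t ^ p * cis (- real (l + s) * t)))"
  proof -
    have "of_real W ^ n * (A t ^ p * (B t ^ n * cis (- t) ^ l))
      = (\<Sum>s\<le>n. of_real (real (n choose s) * (a\<^sup>2 / \<rho>) ^ s) * (A t ^ p * cis (- real (l + s) * t)))" for t
    proof -
      have "of_real W ^ n * (A t ^ p * (B t ^ n * cis (- t) ^ l)) = A t ^ p * (of_real W ^ n * B t ^ n * cis (- t) ^ l)"
        by (simp add: mult_ac)
      then show ?thesis unfolding WBn sum_distrib_left by (simp only: mult.left_commute)
    qed
    then show ?thesis by (simp only:)
  qed
  also have "\<dots> = (\<Sum>s\<le>n. of_real (real (n choose s) * (a\<^sup>2 / \<rho>) ^ s) * circle_mean (\<lambda>t. A t ^ p * cis (- real (l + s) * t)))"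
    by (rule circle_mean_sum[OF cont])
  also have "\<dots> = (\<Sum>s\<le>n. of_real (real (n choose s) * (a\<^sup>2 / \<rho>) ^ s) * of_real ((1 - \<rho>) ^ p * \<rho> ^ (l + s) * real ((p + (l + s) - 1) choose (l + s))))"
    unfolding A_def geo_char_coeff[OF assms] ..
  also have "\<dots> = of_real ((1 - \<rho>) ^ p * \<rho> ^ l * entry a \<tau> Q i l)"
  proof -
    have "real (n choose s) * (a\<^sup>2 / \<rho>) ^ s * ((1 - \<rho>) ^ p * \<rho> ^ (l + s) * real ((p + (l + s) - 1) choose (l + s)))
      = (1 - \<rho>) ^ p * \<rho> ^ l * (real (n choose s) * a ^ (2 * s) * real ((\<tau> + i + l + s) choose (l + s)))" for s
      using assms by (simp add: p_def power_add power_mult power_divide add.assoc)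
    then show ?thesis unfolding entry_def n_def[symmetric] sum_distrib_left of_real_mult[symmetric] of_real_sum[symmetric]
      by (simp only:)
  qed
  finally have e: "of_real W ^ n * circle_entry \<tau> Q (\<rho> / (1 - \<rho>)) (a\<^sup>2 / (\<rho> + a\<^sup>2)) i l = of_real ((1 - \<rho>) ^ p * \<rho> ^ l * entry a \<tau> Q i l)" .
  have "X ^ p * (1 / \<rho>) ^ l * ((1 - \<rho>) ^ p * \<rho> ^ l * entry a \<tau> Q i l) = entry a \<tau> Q i l"
    using assms by (simp add: X_def power_divide)
  then have "of_real (entry a \<tau> Q i l) = of_real (X ^ p * (1 / \<rho>) ^ l) * complex_of_real ((1 - \<rho>) ^ p * \<rho> ^ l * entry a \<tau> Q i l)"
    by (simp only: of_real_mult[symmetric])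
  then show ?thesis unfolding e[symmetric] X_def[symmetric] W_def[symmetric] p_def[symmetric] n_def[symmetric]
    by (simp add: mult_ac)
qed

definition signed_binomial :: "nat \<Rightarrow> nat \<Rightarrow> complex" where
  "signed_binomial i j = of_nat (i choose j) * (- 1) ^ (i - j)"

lemma power_diff_signed_binomial:
  assumes "i < k"
  shows "(x - y) ^ i = (\<Sum>j<k. signed_binomial i j * (x ^ j * y ^ (i - j)))"
proof -
  have "(x + - y) ^ i = (\<Sum>j\<le>i. of_nat (i choose j) * x ^ j * (- y) ^ (i - j))" by (rule binomial_ring)
  also have "\<dots> = (\<Sum>j\<le>i. signed_binomial i j * (x ^ j * y ^ (i - j)))"
    by (rule sum.cong) (simp_all add: signed_binomial_def power_minus[of y] mult_ac)
  also have "\<dots> = (\<Sum>j<k. signed_binomial i j * (x ^ j * y ^ (i - j)))"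
    by (rule sum.mono_neutral_left) (use assms in \<open>auto simp: signed_binomial_def\<close>)
  finally show ?thesis by simp
qed

lemma dt_signed_binomial: "dt k signed_binomial = 1"
  by (subst dt_lower_triangular) (simp_all add: signed_binomial_def)

text \<open>With \<open>A\<close> and \<open>B\<close> the two characteristic functions, \<open>A - 1 = r (e\<^bsup>it\<^esup> - 1) A\<close> and
  \<open>e\<^bsup>-it\<^esup> - B = (1 - \<beta>) (e\<^bsup>-it\<^esup> - 1)\<close>, so the change of basis is binomial.\<close>

lemma saddle_integral_eq_sum:
  assumes "i < k" "l < k" "k \<le> Q" "0 \<le> r"
  shows "of_real (r ^ i) * (of_real ((1 - \<beta>) ^ l) * (saddle_integral (\<tau> + 1 + i) (Q - 1 - l) r \<beta> i l / of_real (2 * pi)))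
    = (\<Sum>j<k. (\<Sum>h<k. signed_binomial i h * circle_entry \<tau> Q r \<beta> h j) * signed_binomial l j)"
proof -
  define A where "A = geo_char r"
  define B where "B = ber_char \<beta>"
  let ?g = "\<lambda>h j t. A t ^ (\<tau> + 1 + h) * (B t ^ (Q - 1 - j) * cis (- t) ^ j)"
  have cont: "continuous_on UNIV (?g h j)" for h j
    unfolding A_def B_def by (intro continuous_intros continuous_geo_char[OF assms(4)] continuous_ber_char)
  have Ar: "of_real r * (cis t - 1) * A t = A t - 1" for t
    using geo_denominator_nonzero[OF assms(4), of t] by (simp add: A_def geo_char_def field_simps)
  have e1: "of_real (r ^ i) * ((cis t - 1) ^ i * A t ^ (\<tau> + 1 + i)) = (\<Sum>h<k. signed_binomial i h * A t ^ (\<tau> + 1 + h))" for t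
  proof -
    have "of_real (r ^ i) * ((cis t - 1) ^ i * A t ^ (\<tau> + 1 + i)) = A t ^ (\<tau> + 1) * (of_real r * (cis t - 1) * A t) ^ i"
      by (simp add: power_mult_distrib power_add mult_ac)
    also have "\<dots> = A t ^ (\<tau> + 1) * (\<Sum>h<k. signed_binomial i h * (A t ^ h * 1 ^ (i - h)))"
      unfolding Ar power_diff_signed_binomial[OF assms(1)] ..
    finally show ?thesis by (simp add: sum_distrib_left power_add mult_ac)
  qed
  have Bb: "of_real (1 - \<beta>) * (cis (- t) - 1) = cis (- t) - B t" for t
    by (simp add: B_def ber_char_def algebra_simps)
  have e2: "of_real ((1 - \<beta>) ^ l) * ((cis (- t) - 1) ^ l * B t ^ (Q - 1 - l)) = (\<Sum>j<k. signed_binomial l j * (B t ^ (Q - 1 - j) * cis (- t) ^ j))" for t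
  proof -
    have "of_real ((1 - \<beta>) ^ l) * ((cis (- t) - 1) ^ l * B t ^ (Q - 1 - l)) = (of_real (1 - \<beta>) * (cis (- t) - 1)) ^ l * B t ^ (Q - 1 - l)"
      by (simp add: power_mult_distrib)
    also have "\<dots> = (\<Sum>j<k. signed_binomial l j * (cis (- t) ^ j * B t ^ (l - j)) * B t ^ (Q - 1 - l))"
      unfolding Bb power_diff_signed_binomial[OF assms(2)] sum_distrib_right ..
    also have "\<dots> = (\<Sum>j<k. signed_binomial l j * (B t ^ (Q - 1 - j) * cis (- t) ^ j))"
    proof (rule sum.cong)
      fix j assume "j \<in> {..<k}"
      show "signed_binomial l j * (cis (- t) ^ j * B t ^ (l - j)) * B t ^ (Q - 1 - l) = signed_binomial l j * (B t ^ (Q - 1 - j) * cis (- t) ^ j)"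
      proof (cases "j \<le> l")
        case True
        then have "B t ^ (Q - 1 - j) = B t ^ (l - j) * B t ^ (Q - 1 - l)"
          using assms unfolding power_add[symmetric] by simp
        then show ?thesis by (simp add: mult_ac)
      next
        case False
        then show ?thesis by (simp add: signed_binomial_def)
      qed
    qed simp
    finally show ?thesis .
  qed
  have "of_real (r ^ i) * (of_real ((1 - \<beta>) ^ l) * (saddle_integral (\<tau> + 1 + i) (Q - 1 - l) r \<beta> i l / of_real (2 * pi)))
    = circle_mean (\<lambda>t. of_real (r ^ i) * (of_real ((1 - \<beta>) ^ l) * (A t ^ (\<tau> + 1 + i) * B t ^ (Q - 1 - l) * edge_factor i l t)))"
    unfolding circle_mean_scale by (simp only: circle_mean_def saddle_integral_def A_def B_def)
  also have "\<dots> = circle_mean (\<lambda>t. \<Sum>j<k. signed_binomial l j * (\<Sum>h<k. signed_binomial i h * ?g h j t))"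
  proof -
    have "of_real (r ^ i) * (of_real ((1 - \<beta>) ^ l) * (A t ^ (\<tau> + 1 + i) * B t ^ (Q - 1 - l) * edge_factor i l t))
      = (\<Sum>j<k. signed_binomial l j * (\<Sum>h<k. signed_binomial i h * ?g h j t))" for t
    proof -
      have "of_real (r ^ i) * (of_real ((1 - \<beta>) ^ l) * (A t ^ (\<tau> + 1 + i) * B t ^ (Q - 1 - l) * edge_factor i l t))
        = (of_real (r ^ i) * ((cis t - 1) ^ i * A t ^ (\<tau> + 1 + i))) * (of_real ((1 - \<beta>) ^ l) * ((cis (- t) - 1) ^ l * B t ^ (Q - 1 - l)))"
        by (simp add: edge_factor_def mult_ac)
      also have "\<dots> = (\<Sum>j<k. (\<Sum>h<k. signed_binomial i h * A t ^ (\<tau> + 1 + h)) * (signed_binomial l j * (B t ^ (Q - 1 - j) * cis (- t) ^ j)))"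
        unfolding e1 e2 sum_distrib_left ..
      also have "\<dots> = (\<Sum>j<k. signed_binomial l j * (\<Sum>h<k. signed_binomial i h * ?g h j t))"
        by (intro sum.cong refl) (simp add: sum_distrib_left sum_distrib_right mult_ac)
      finally show ?thesis .
    qed
    then show ?thesis by (simp only:)
  qed
  also have "\<dots> = (\<Sum>j<k. signed_binomial l j * circle_mean (\<lambda>t. \<Sum>h<k. signed_binomial i h * ?g h j t))"
    by (rule circle_mean_sum) (intro continuous_on_sum continuous_on_mult_left cont)
  also have "\<dots> = (\<Sum>j<k. signed_binomial l j * (\<Sum>h<k. signed_binomial i h * circle_entry \<tau> Q r \<beta> h j))"
    unfolding circle_entry_def A_def[symmetric] B_def[symmetric] by (subst circle_mean_sum[OF cont]) (rule refl)
  finally show ?thesis by (simp only: mult.commute)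
qed

text \<open>The binomial matrices acting on rows and columns have determinant 1, so the new basis
  costs only the powers of \<open>r\<close> and \<open>1 - \<beta>\<close> that it produces.\<close>

lemma dt_circle_entry:
  assumes "k \<le> Q" "0 \<le> r"
  shows "dt k (circle_entry \<tau> Q r \<beta>) = of_real (\<Prod>i<k. (r * (1 - \<beta>)) ^ i)
    * dt k (\<lambda>i l. saddle_integral (\<tau> + 1 + i) (Q - 1 - l) r \<beta> i l / of_real (2 * pi))"
proof -
  let ?J = "\<lambda>i l. saddle_integral (\<tau> + 1 + i) (Q - 1 - l) r \<beta> i l / of_real (2 * pi)"
  have "dt k (circle_entry \<tau> Q r \<beta>) = dt k signed_binomial * dt k (circle_entry \<tau> Q r \<beta>) * dt k (\<lambda>j l. signed_binomial l j)"
    by (simp add: dt_transpose[of k signed_binomial] dt_signed_binomial)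
  also have "\<dots> = dt k (\<lambda>i l. \<Sum>j<k. (\<Sum>h<k. signed_binomial i h * circle_entry \<tau> Q r \<beta> h j) * signed_binomial l j)"
    by (simp only: dt_mult)
  also have "\<dots> = dt k (\<lambda>i l. of_real (r ^ i) * (of_real ((1 - \<beta>) ^ l) * ?J i l))"
    by (rule dt_cong) (simp only: saddle_integral_eq_sum[OF _ _ assms])
  also have "\<dots> = (\<Prod>i<k. of_real (r ^ i)) * ((\<Prod>i<k. of_real ((1 - \<beta>) ^ i)) * dt k ?J)"
    by (simp only: dt_scale_rows dt_scale_cols)
  also have "(\<Prod>i<k. of_real (r ^ i)) * ((\<Prod>i<k. of_real ((1 - \<beta>) ^ i)) * dt k ?J) = of_real (\<Prod>i<k. (r * (1 - \<beta>)) ^ i) * dt k ?J"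
    by (simp add: power_mult_distrib prod.distrib)
  finally show ?thesis .
qed

section \<open>Asymptotics of the determinant\<close>

lemma gauss_moment_rec: "gauss_moment (n + 2) = real (n + 1) * gauss_moment n"
proof (cases "even n")
  case True
  then obtain m where n: "n = 2 * m" by (elim evenE)
  have "fact (2 * m + 2) / (2 ^ (m + 1) * fact (m + 1)) = (2 * real m + 1) * (fact (2 * m) / (2 ^ m * fact m) :: real)"
  proof -
    have "fact (2 * m + 2) = (2 * real m + 2) * ((2 * real m + 1) * fact (2 * m))"
      by (simp add: algebra_simps)
    moreover have "2 ^ (m + 1) * fact (m + 1) = (2 * real m + 2) * (2 ^ m * fact m :: real)" by (simp add: algebra_simps)
    moreover have "2 * real m + 2 \<noteq> 0" by linarith
    ultimately show ?thesis by (simp only: mult_divide_mult_cancel_left) simp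
  qed
  then show ?thesis by (simp add: gauss_moment_def n)
qed (simp add: gauss_moment_def)

text \<open>The coefficient of the Hermite polynomial \<open>He\<^sub>l\<close> in \<open>x\<^sup>n\<close>; these factor the Hankel matrix because
  \<open>He\<^sub>l\<close> has squared norm \<open>l!\<close>.\<close>

definition hermite_coeff :: "nat \<Rightarrow> nat \<Rightarrow> real" where
  "hermite_coeff n l = (if l \<le> n then real (n choose l) * gauss_moment (n - l) else 0)"

lemma hermite_coeff_Suc_0: "hermite_coeff (Suc n) 0 = hermite_coeff n 1"
proof (cases n)
  case (Suc m)
  then show ?thesis using gauss_moment_rec[of m] by (simp add: hermite_coeff_def)
qed (simp add: hermite_coeff_def gauss_moment_def)

text \<open>The three-term relation x He_l = He_(l+1) + l He_(l-1), read off on the expansion of x^n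
  in Hermite polynomials.\<close>

lemma hermite_coeff_Suc_Suc:
  "hermite_coeff (Suc n) (Suc l) = hermite_coeff n l + real (l + 2) * hermite_coeff n (l + 2)"
proof -
  consider "n < l" | "n = l" | "n = Suc l" | "l + 2 \<le> n" by linarith
  then show ?thesis
  proof cases
    case 4
    then obtain m where "n = l + 2 + m" using le_Suc_ex by blast
    then have n: "n = Suc (Suc l + m)" by simp
    have "real (Suc (Suc l) * (n choose Suc (Suc l))) = real (Suc m * (n choose Suc l))"
      by (simp only: n Suc_times_binomial_add)
    then have "real (l + 2) * real (n choose (l + 2)) = real (m + 1) * real (n choose Suc l)"
      by (simp only: of_nat_mult) simp
    then have "real (l + 2) * (real (n choose (l + 2)) * gauss_moment m) = real (n choose Suc l) * gauss_moment (m + 2)"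
      unfolding gauss_moment_rec by (simp only: mult.assoc[symmetric]) (simp add: mult.commute)
    moreover have "hermite_coeff n (l + 2) = real (n choose (l + 2)) * gauss_moment m"
      "hermite_coeff n l = real (n choose l) * gauss_moment (m + 2)"
      "hermite_coeff (Suc n) (Suc l) = (real (n choose l) + real (n choose Suc l)) * gauss_moment (m + 2)"
      by (simp_all add: hermite_coeff_def n)
    ultimately show ?thesis by (simp only: distrib_right)
  qed (simp_all add: hermite_coeff_def gauss_moment_def)
qed

text \<open>Multiplication by x is symmetric for the normal law. On coefficients, the recursion
  expands both sides into the same expression; the truncation at \<open>K\<close> loses nothing
  because \<open>hermite_coeff n l\<close> vanishes for \<open>l > n\<close>.\<close>

lemma hermite_kernel_shift:
  assumes "i < K" "j < K"
  shows "(\<Sum>l<Suc K. fact l * hermite_coeff (Suc i) l * hermite_coeff j l)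
    = (\<Sum>l<Suc K. fact l * hermite_coeff i l * hermite_coeff (Suc j) l)"
proof -
  have half: "(\<Sum>l<Suc K. fact l * hermite_coeff (Suc i) l * hermite_coeff j l)
    = (\<Sum>l<K. fact (Suc l) * (hermite_coeff i l * hermite_coeff j (Suc l) + hermite_coeff i (Suc l) * hermite_coeff j l))"
    if "i < K" for i j
  proof -
    have "(\<Sum>l<Suc K. fact l * hermite_coeff (Suc i) l * hermite_coeff j l)
      = hermite_coeff i 1 * hermite_coeff j 0
      + (\<Sum>l<K. fact (Suc l) * (hermite_coeff i l + real (l + 2) * hermite_coeff i (l + 2)) * hermite_coeff j (Suc l))"
      unfolding sum.lessThan_Suc_shift by (simp only: hermite_coeff_Suc_0 hermite_coeff_Suc_Suc fact_0 mult_1)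
    also have "\<dots> = (\<Sum>l<K. fact (Suc l) * (hermite_coeff i l * hermite_coeff j (Suc l)))
      + (hermite_coeff i 1 * hermite_coeff j 0 + (\<Sum>l<K. fact (Suc (Suc l)) * (hermite_coeff i (Suc (Suc l)) * hermite_coeff j (Suc l))))"
    proof -
      have "fact (Suc l) * (hermite_coeff i l + real (l + 2) * hermite_coeff i (l + 2)) * hermite_coeff j (Suc l)
        = fact (Suc l) * (hermite_coeff i l * hermite_coeff j (Suc l)) + fact (Suc (Suc l)) * (hermite_coeff i (Suc (Suc l)) * hermite_coeff j (Suc l))" for l
      proof -
        have "fact (Suc (Suc l)) = real (l + 2) * fact (Suc l)" by (simp only: fact_Suc) simp
        then show ?thesis by (simp add: algebra_simps del: fact_Suc)
      qed
      then show ?thesis by (simp only: sum.distrib)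
    qed
    also have "hermite_coeff i 1 * hermite_coeff j 0 + (\<Sum>l<K. fact (Suc (Suc l)) * (hermite_coeff i (Suc (Suc l)) * hermite_coeff j (Suc l)))
      = (\<Sum>l<Suc K. fact (Suc l) * (hermite_coeff i (Suc l) * hermite_coeff j l))"
      unfolding sum.lessThan_Suc_shift by simp
    also have "\<dots> = (\<Sum>l<K. fact (Suc l) * (hermite_coeff i (Suc l) * hermite_coeff j l))"
      using that by (simp add: hermite_coeff_def)
    finally show ?thesis by (simp only: sum.distrib[symmetric] distrib_left)
  qed
  have "(\<Sum>l<Suc K. fact l * hermite_coeff i l * hermite_coeff (Suc j) l) = (\<Sum>l<Suc K. fact l * hermite_coeff (Suc j) l * hermite_coeff i l)"
    by (simp only: mult.assoc mult.commute[of "hermite_coeff i _"])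
  then show ?thesis using half[OF assms(1), of j] half[OF assms(2), of i] by (simp only: mult.commute add.commute)
qed

text \<open>Since factors x can be moved from one argument to the other, \<open>i\<close> may be
  lowered to 0, where a single term survives.\<close>

lemma gauss_moment_hermite:
  assumes "i + j \<le> K"
  shows "gauss_moment (i + j) = (\<Sum>l<Suc K. fact l * hermite_coeff i l * hermite_coeff j l)"
  using assms
proof (induction i arbitrary: j)
  case 0
  have "(\<Sum>l<Suc K. fact l * hermite_coeff 0 l * hermite_coeff j l) = hermite_coeff j 0"
    unfolding sum.lessThan_Suc_shift by (simp add: hermite_coeff_def gauss_moment_def)
  then show ?case by (simp add: hermite_coeff_def)
next
  case (Suc i)
  have "gauss_moment (Suc i + j) = gauss_moment (i + Suc j)" by simp
  also have "\<dots> = (\<Sum>l<Suc K. fact l * hermite_coeff i l * hermite_coeff (Suc j) l)"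
    by (rule Suc.IH) (use Suc.prems in simp)
  also have "\<dots> = (\<Sum>l<Suc K. fact l * hermite_coeff (Suc i) l * hermite_coeff j l)"
  proof (cases "j < K")
    case True
    then show ?thesis using Suc.prems by (intro hermite_kernel_shift[symmetric]) auto
  qed (use Suc.prems in simp)
  finally show ?case .
qed

lemma dt_gauss_moment: "dt k (\<lambda>i j. gauss_moment (i + j)) = (\<Prod>i<k. fact i)"
proof -
  have h1: "dt k hermite_coeff = 1"
    by (subst dt_lower_triangular) (simp_all add: hermite_coeff_def gauss_moment_def)
  have "dt k (\<lambda>i j. gauss_moment (i + j)) = dt k (\<lambda>i j. \<Sum>l<k. hermite_coeff i l * (fact l * hermite_coeff j l))"
  proof (rule dt_cong)
    fix i j assume ij: "i < k" "j < k"
    have "gauss_moment (i + j) = (\<Sum>l<Suc (2 * k). fact l * hermite_coeff i l * hermite_coeff j l)"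
      using ij by (intro gauss_moment_hermite) simp
    also have "\<dots> = (\<Sum>l<k. fact l * hermite_coeff i l * hermite_coeff j l)"
      by (rule sum.mono_neutral_right) (use ij in \<open>auto simp: hermite_coeff_def\<close>)
    finally show "gauss_moment (i + j) = (\<Sum>l<k. hermite_coeff i l * (fact l * hermite_coeff j l))"
      by (simp only: mult_ac)
  qed
  also have "\<dots> = dt k hermite_coeff * dt k (\<lambda>l j. fact l * hermite_coeff j l)" by (rule dt_mult[symmetric])
  also have "\<dots> = (\<Prod>i<k. fact i)"
    unfolding dt_scale_rows dt_transpose[of k hermite_coeff] h1 by simp
  finally show ?thesis .
qed

lemma dt_of_real: "dt n (\<lambda>i j. complex_of_real (f i j)) = of_real (dt n f)"
  unfolding dt_leibniz by (simp add: of_real_sum of_real_prod sign_def)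

text \<open>Dividing all entries by \<open>H\<close> puts them in the unit disc, where the
  difference of two products is at most the sum of the differences of the factors. As
  \<open>H \<ge> 1\<close>, the division does not enlarge these differences.\<close>

lemma dt_perturb:
  fixes f g :: "nat \<Rightarrow> nat \<Rightarrow> complex"
  assumes "\<And>i j. i < n \<Longrightarrow> j < n \<Longrightarrow> cmod (f i j - g i j) \<le> e"
    and "\<And>i j. i < n \<Longrightarrow> j < n \<Longrightarrow> cmod (g i j) \<le> G" "0 \<le> e" "e \<le> E" "0 \<le> G"
  shows "cmod (dt n f - dt n g) \<le> fact n * (real n * (G + E + 1) ^ n) * e"
proof -
  define H where "H = G + E + 1"
  have H: "1 \<le> H" "0 < H" using assms by (simp_all add: H_def)
  have summand: "cmod (signof p * (\<Prod>i = 0..<n. f i (p i)) - signof p * (\<Prod>i = 0..<n. g i (p i))) \<le> real n * H ^ n * e"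
    if p: "p permutes {0..<n}" for p
  proof -
    have pn: "p i < n" if "i < n" for i using that permutes_in_image[OF p, of i] by auto
    have scale: "(\<Prod>i = 0..<n. h i (p i)) = of_real (H ^ n) * (\<Prod>i = 0..<n. h i (p i) / of_real H)" for h :: "nat \<Rightarrow> nat \<Rightarrow> complex"
      using H by (simp add: prod_dividef)
    have small: "cmod (f i (p i) / of_real H) \<le> 1" "cmod (g i (p i) / of_real H) \<le> 1" if "i \<in> {0..<n}" for i
    proof -
      have i: "i < n" using that by simp
      have "cmod (g i (p i)) \<le> G" by (rule assms(2)[OF i pn[OF i]])
      moreover have "cmod (f i (p i)) \<le> cmod (g i (p i)) + e"
        using assms(1)[OF i pn[OF i]] norm_triangle_ineq2[of "f i (p i)" "g i (p i)"] by linarith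
      ultimately have "cmod (f i (p i)) \<le> H" "cmod (g i (p i)) \<le> H"
        unfolding H_def using assms(3-5) by linarith+
      then show "cmod (f i (p i) / of_real H) \<le> 1" "cmod (g i (p i) / of_real H) \<le> 1"
        using H by (simp_all add: norm_divide)
    qed
    have "cmod ((\<Prod>i = 0..<n. f i (p i) / of_real H) - (\<Prod>i = 0..<n. g i (p i) / of_real H))
      \<le> (\<Sum>i = 0..<n. cmod (f i (p i) / of_real H - g i (p i) / of_real H))"
      by (rule norm_prod_diff) (use small in auto)
    also have "\<dots> \<le> (\<Sum>i = 0..<n. e)"
    proof (rule sum_mono)
      fix i assume "i \<in> {0..<n}"
      then have i: "i < n" by simp
      have "cmod (f i (p i) / of_real H - g i (p i) / of_real H) = cmod (f i (p i) - g i (p i)) / H"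
        using H by (simp add: diff_divide_distrib[symmetric] norm_divide)
      also have "\<dots> \<le> e / 1" using assms(1)[OF i pn[OF i]] assms H by (intro frac_le) auto
      finally show "cmod (f i (p i) / of_real H - g i (p i) / of_real H) \<le> e" by simp
    qed
    finally have d: "cmod ((\<Prod>i = 0..<n. f i (p i) / of_real H) - (\<Prod>i = 0..<n. g i (p i) / of_real H)) \<le> real n * e" by simp
    have "cmod (signof p * (\<Prod>i = 0..<n. f i (p i)) - signof p * (\<Prod>i = 0..<n. g i (p i)))
      = H ^ n * cmod ((\<Prod>i = 0..<n. f i (p i) / of_real H) - (\<Prod>i = 0..<n. g i (p i) / of_real H))"
    proof -
      have s: "cmod (signof p) = 1" by (simp add: sign_def)
      have hn: "cmod (of_real (H ^ n)) = H ^ n" using H by (simp only: norm_of_real) simp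
      show ?thesis unfolding right_diff_distrib[symmetric] scale[of f] scale[of g] norm_mult s hn by simp
    qed
    also have "\<dots> \<le> H ^ n * (real n * e)" using d H by (intro mult_left_mono) auto
    finally show ?thesis by (simp add: mult_ac)
  qed
  have "cmod (dt n f - dt n g) \<le> (\<Sum>p | p permutes {0..<n}. real n * H ^ n * e)"
    unfolding dt_leibniz sum_subtractf[symmetric] by (rule sum_norm_le) (use summand in simp)
  also have "\<dots> = fact n * (real n * H ^ n) * e" by (simp add: card_permutations)
  finally show ?thesis by (simp add: H_def)
qed

text \<open>The scaling \<open>s ^ (i + l + 1)\<close> splits into a row and a column factor and
  amounts to \<open>s ^ (k * k)\<close> in the determinant. The phases scale out as well, since \<i>
  times -\<i> is 1, and leave the Hankel matrix of moments.\<close>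

lemma dt_saddle_integral_approx:
  fixes R b0 \<gamma> h :: real
  assumes "0 \<le> R" "0 < b0" "0 < \<gamma>" "0 \<le> h"
  obtains C where "0 \<le> C" and
    "\<And>N m \<tau> Q r \<beta>. 1 \<le> N \<Longrightarrow> 0 < total_variance N m r \<beta> \<Longrightarrow>
      (\<And>i l. i < k \<Longrightarrow> l < k \<Longrightarrow> admissible R b0 \<gamma> h N m (\<tau> + 1 + i) (Q - 1 - l) r \<beta>) \<Longrightarrow>
      cmod (dt k (\<lambda>i l. saddle_integral (\<tau> + 1 + i) (Q - 1 - l) r \<beta> i l / of_real (2 * pi))
          * of_real (sqrt (total_variance N m r \<beta>) ^ (k * k) * sqrt (2 * pi) ^ k) - of_real (\<Prod>i<k. fact i)) \<le> C / sqrt (real N)"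
proof -
  have "\<exists>c\<ge>0. \<forall>N m p q r \<beta>. admissible R b0 \<gamma> h N m p q r \<beta> \<longrightarrow>
      cmod (saddle_integral p q r \<beta> i l * of_real (sqrt (total_variance N m r \<beta>) ^ (i + l + 1) / sqrt (2 * pi))
        - \<i> ^ i * (- \<i>) ^ l * of_real (gauss_moment (i + l))) \<le> c / sqrt (real N)" for i l
    using saddle_integral_approx[OF assms, of i l] by metis
  then obtain c where c: "\<And>i l. 0 \<le> c i l" "\<And>i l N m p q r \<beta>. admissible R b0 \<gamma> h N m p q r \<beta> \<Longrightarrow>
      cmod (saddle_integral p q r \<beta> i l * of_real (sqrt (total_variance N m r \<beta>) ^ (i + l + 1) / sqrt (2 * pi))
        - \<i> ^ i * (- \<i>) ^ l * of_real (gauss_moment (i + l))) \<le> c i l / sqrt (real N)"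
    by metis
  define c' where "c' = (\<Sum>i<k. \<Sum>l<k. c i l)"
  have c': "c i l \<le> c'" if "i < k" "l < k" for i l
  proof -
    have "c i l \<le> (\<Sum>l<k. c i l)" using c(1) that by (intro member_le_sum) auto
    also have "\<dots> \<le> c'" unfolding c'_def using c(1) that by (intro member_le_sum[of i "{..<k}" "\<lambda>i. \<Sum>l<k. c i l"] sum_nonneg) auto
    finally show ?thesis .
  qed
  have c'0: "0 \<le> c'" unfolding c'_def using c(1) by (intro sum_nonneg) auto
  define G where "G = (\<Sum>i<2 * k. \<bar>gauss_moment i\<bar>)"
  have G0: "0 \<le> G" unfolding G_def by (intro sum_nonneg) auto
  let ?C = "fact k * (real k * (G + c' + 1) ^ k) * c'"
  show ?thesis
  proof (rule that[of ?C])
    show "0 \<le> ?C" using c'0 G0 by simp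
    fix N m \<tau> Q r \<beta>
    assume N: "1 \<le> N" and S0: "0 < total_variance N m r \<beta>"
      and adm: "\<And>i l. i < k \<Longrightarrow> l < k \<Longrightarrow> admissible R b0 \<gamma> h N m (\<tau> + 1 + i) (Q - 1 - l) r \<beta>"
    define s where "s = sqrt (total_variance N m r \<beta>)"
    have s: "0 < s" using S0 by (simp add: s_def)
    let ?I = "\<lambda>i l. saddle_integral (\<tau> + 1 + i) (Q - 1 - l) r \<beta> i l"
    define D where "D i l = ?I i l * of_real (s ^ (i + l + 1) / sqrt (2 * pi))" for i l
    define g where "g i l = \<i> ^ i * ((- \<i>) ^ l * complex_of_real (gauss_moment (i + l)))" for i l
    have "cmod (dt k D - dt k g) \<le> fact k * (real k * (G + c' + 1) ^ k) * (c' / sqrt (real N))"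
    proof (rule dt_perturb)
      fix i l assume il: "i < k" "l < k"
      have "cmod (D i l - g i l) \<le> c i l / sqrt (real N)"
        using c(2)[OF adm[OF il], of i l] unfolding D_def g_def s_def by (simp only: mult.assoc)
      also have "\<dots> \<le> c' / sqrt (real N)" by (intro divide_right_mono c' il) simp
      finally show "cmod (D i l - g i l) \<le> c' / sqrt (real N)" .
      have "cmod (g i l) = \<bar>gauss_moment (i + l)\<bar>" by (simp add: g_def norm_mult norm_power)
      also have "\<dots> \<le> G" unfolding G_def using il by (intro member_le_sum) auto
      finally show "cmod (g i l) \<le> G" .
    next
      show "c' / sqrt (real N) \<le> c'" using N c'0 by (simp add: divide_le_eq mult_le_cancel_left1)
    qed (use c'0 G0 in auto)
    moreover have "dt k g = of_real (\<Prod>i<k. fact i)"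
    proof -
      have "dt k g = (\<Prod>i<k. \<i> ^ i) * ((\<Prod>i<k. (- \<i>) ^ i) * dt k (\<lambda>i l. complex_of_real (gauss_moment (i + l))))"
        unfolding g_def by (simp only: dt_scale_rows dt_scale_cols)
      also have "\<dots> = (\<Prod>i<k. (\<i> * - \<i>) ^ i) * dt k (\<lambda>i l. complex_of_real (gauss_moment (i + l)))"
        by (simp only: power_mult_distrib prod.distrib mult.assoc)
      also have "\<dots> = of_real (\<Prod>i<k. fact i)" unfolding dt_of_real dt_gauss_moment by simp
      finally show ?thesis .
    qed
    moreover have "dt k D = dt k (\<lambda>i l. ?I i l / of_real (2 * pi)) * of_real (s ^ (k * k) * sqrt (2 * pi) ^ k)"
    proof -
      have "D i l = of_real (s ^ i * sqrt (2 * pi)) * (of_real (s ^ Suc l) * (?I i l / of_real (2 * pi)))" for i l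
      proof -
        have "s ^ (i + l + 1) / sqrt (2 * pi) = s ^ i * sqrt (2 * pi) * s ^ Suc l / (2 * pi)"
          by (simp add: power_add field_simps)
        then show ?thesis unfolding D_def by (simp only:) (simp add: mult_ac)
      qed
      then have "dt k D = dt k (\<lambda>i l. of_real (s ^ i * sqrt (2 * pi)) * (of_real (s ^ Suc l) * (?I i l / of_real (2 * pi))))"
        by (intro dt_cong)
      then have "dt k D = (\<Prod>i<k. of_real (s ^ i * sqrt (2 * pi))) * ((\<Prod>i<k. of_real (s ^ Suc i)) * dt k (\<lambda>i l. ?I i l / of_real (2 * pi)))"
        by (simp only: dt_scale_rows dt_scale_cols)
      also have "\<dots> = of_real ((\<Prod>i<k. s ^ i * s ^ Suc i) * sqrt (2 * pi) ^ k) * dt k (\<lambda>i l. ?I i l / of_real (2 * pi))"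
        by (simp add: prod.distrib mult_ac)
      also have "(\<Prod>i<k. s ^ i * s ^ Suc i) = s ^ (k * k)"
        by (induction k) (simp_all add: power_add algebra_simps)
      finally show ?thesis by (simp only: mult.commute)
    qed
    ultimately show "cmod (dt k (\<lambda>i l. ?I i l / of_real (2 * pi))
          * of_real (sqrt (total_variance N m r \<beta>) ^ (k * k) * sqrt (2 * pi) ^ k) - of_real (\<Prod>i<k. fact i)) \<le> ?C / sqrt (real N)"
      unfolding s_def by simp
  qed
qed

text \<open>Let \<open>X\<close> and \<open>W\<close> denote 1/(1-\<rho>) and 1 + a^2/\<rho>. Index
  \<open>i\<close> contributes \<open>X\<close> to the power \<tau> + 1 + 2i and \<open>W\<close> to
  the power Q - 1 - 2i; summed over \<open>i < k\<close>, the exponents become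
  \<open>k (\<tau> + k)\<close> and \<open>k (Q - k)\<close>. This is how the unshifted exponents
  come back.\<close>

lemma dt_entry:
  assumes "0 < \<rho>" "\<rho> < 1" "k \<le> Q"
  shows "of_real (dt k (entry a \<tau> Q)) = of_real (((1 / (1 - \<rho>)) ^ (\<tau> + k) * (1 + a\<^sup>2 / \<rho>) ^ (Q - k)) ^ k)
    * dt k (\<lambda>i l. saddle_integral (\<tau> + 1 + i) (Q - 1 - l) (\<rho> / (1 - \<rho>)) (a\<^sup>2 / (\<rho> + a\<^sup>2)) i l / of_real (2 * pi))"
proof -
  define X where "X = 1 / (1 - \<rho>)"
  define W where "W = 1 + a\<^sup>2 / \<rho>"
  define r where "r = \<rho> / (1 - \<rho>)"
  define \<beta> where "\<beta> = a\<^sup>2 / (\<rho> + a\<^sup>2)"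
  let ?J = "dt k (\<lambda>i l. saddle_integral (\<tau> + 1 + i) (Q - 1 - l) r \<beta> i l / of_real (2 * pi))"
  have r: "0 \<le> r" using assms by (simp add: r_def)
  have "0 < W" using assms unfolding W_def by (intro add_pos_nonneg) auto
  then have W: "W \<noteq> 0" by simp
  have "of_real (dt k (entry a \<tau> Q)) = dt k (\<lambda>i l. of_real (X ^ (\<tau> + 1 + i)) * (of_real (W ^ (Q - 1 - l) * (1 / \<rho>) ^ l) * circle_entry \<tau> Q r \<beta> i l))"
    unfolding dt_of_real[symmetric] entry_circle_entry[OF assms(1,2)] X_def W_def r_def \<beta>_def by (simp only: of_real_mult mult.assoc)
  also have "\<dots> = of_real (\<Prod>i<k. X ^ (\<tau> + 1 + i)) * (of_real (\<Prod>i<k. W ^ (Q - 1 - i) * (1 / \<rho>) ^ i) * dt k (circle_entry \<tau> Q r \<beta>))"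
    by (simp only: dt_scale_rows dt_scale_cols of_real_prod)
  also have "\<dots> = of_real ((\<Prod>i<k. X ^ (\<tau> + 1 + i)) * ((\<Prod>i<k. W ^ (Q - 1 - i) * (1 / \<rho>) ^ i) * (\<Prod>i<k. (r * (1 - \<beta>)) ^ i))) * ?J"
    unfolding dt_circle_entry[OF assms(3) r] by (simp only: of_real_mult mult.assoc)
  also have "(\<Prod>i<k. X ^ (\<tau> + 1 + i)) * ((\<Prod>i<k. W ^ (Q - 1 - i) * (1 / \<rho>) ^ i) * (\<Prod>i<k. (r * (1 - \<beta>)) ^ i))
      = (\<Prod>i<k. X ^ (\<tau> + 1 + i) * (W ^ (Q - 1 - i) * (X / W) ^ i))"
  proof -
    have "1 / \<rho> * (r * (1 - \<beta>)) = X / W"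
    proof -
      have a: "0 < \<rho> + a\<^sup>2" using assms by (simp add: add_pos_nonneg)
      have "W = (\<rho> + a\<^sup>2) / \<rho>" "1 - \<beta> = \<rho> / (\<rho> + a\<^sup>2)"
        using assms a by (simp_all add: W_def \<beta>_def field_simps)
      then show ?thesis using assms by (simp add: X_def r_def)
    qed
    then show ?thesis by (simp only: prod.distrib[symmetric] mult.assoc power_mult_distrib[symmetric])
  qed
  also have "\<dots> = (X ^ (\<tau> + k) * W ^ (Q - k)) ^ k"
    using assms(3)
  proof (induction k)
    case (Suc k)
    then obtain d where Q: "Q = Suc k + d" using le_Suc_ex by blast
    have "(\<Prod>i<Suc k. X ^ (\<tau> + 1 + i) * (W ^ (Q - 1 - i) * (X / W) ^ i))
      = (X ^ (\<tau> + k) * W ^ Suc d) ^ k * (X ^ (\<tau> + 1 + k) * (W ^ d * (X / W) ^ k))"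
      using Suc by (simp add: Q)
    also have "(X ^ (\<tau> + k) * W ^ Suc d) ^ k = X ^ ((\<tau> + k) * k) * (W ^ (d * k) * W ^ k)"
      by (simp add: power_mult_distrib power_mult)
    also have "X ^ ((\<tau> + k) * k) * (W ^ (d * k) * W ^ k) * (X ^ (\<tau> + 1 + k) * (W ^ d * (X / W) ^ k))
      = (X ^ ((\<tau> + k) * k) * X ^ (\<tau> + 1 + k) * X ^ k) * (W ^ (d * k) * W ^ d)"
      using W by (simp add: power_divide)
    also have "\<dots> = X ^ ((\<tau> + Suc k) * Suc k) * W ^ (d * Suc k)"
      unfolding power_add[symmetric] by (simp add: algebra_simps)
    finally show ?case by (simp only: Q power_mult power_mult_distrib diff_add_inverse)
  qed simp
  finally show ?thesis unfolding X_def W_def r_def \<beta>_def .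
qed

lemma abs_ln_le:
  fixes x :: real
  assumes "\<bar>x - 1\<bar> \<le> 1 / 2"
  shows "\<bar>ln x\<bar> \<le> 2 * \<bar>x - 1\<bar>"
proof -
  have x: "0 < x" "1 / 2 \<le> x" using assms unfolding abs_le_iff by linarith+
  have "ln x \<le> x - 1" using ln_le_minus_one[OF x(1)] .
  moreover have "- ln x \<le> 1 / x - 1"
    using ln_le_minus_one[of "1 / x"] x by (simp add: ln_div)
  moreover have "1 / x - 1 \<le> 2 * \<bar>x - 1\<bar>"
  proof -
    have "1 / x - 1 = (1 - x) / x" using x by (simp add: diff_divide_distrib)
    also have "\<dots> \<le> \<bar>x - 1\<bar> / (1 / 2)" using x by (intro frac_le) auto
    finally show ?thesis by simp
  qed
  moreover have "x - 1 \<le> \<bar>x - 1\<bar>" "0 \<le> \<bar>x - 1\<bar>" by simp_all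
  ultimately have "ln x \<le> 2 * y" "- ln x \<le> 2 * y" if "y = \<bar>x - 1\<bar>" for y
    unfolding that[symmetric] by linarith+
  then show ?thesis by (intro abs_leI) simp_all
qed

lemma ln_dt_entry_approx:
  fixes R b0 \<gamma> h :: real
  assumes "0 \<le> R" "0 < b0" "0 < \<gamma>" "0 \<le> h"
  obtains C N0 where "0 \<le> C" and
    "\<And>N m \<tau> Q \<rho>. N0 \<le> N \<Longrightarrow> 0 < \<rho> \<Longrightarrow> \<rho> < 1 \<Longrightarrow> k \<le> Q \<Longrightarrow>
      0 < total_variance N m (\<rho> / (1 - \<rho>)) (a\<^sup>2 / (\<rho> + a\<^sup>2)) \<Longrightarrow>
      (\<And>i l. i < k \<Longrightarrow> l < k \<Longrightarrow> admissible R b0 \<gamma> h N m (\<tau> + 1 + i) (Q - 1 - l) (\<rho> / (1 - \<rho>)) (a\<^sup>2 / (\<rho> + a\<^sup>2))) \<Longrightarrow>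
      0 < dt k (entry a \<tau> Q) \<and>
      \<bar>ln (dt k (entry a \<tau> Q)) - (real k * (real (\<tau> + k) * ln (1 / (1 - \<rho>)) + real (Q - k) * ln (1 + a\<^sup>2 / \<rho>))
        - (real k)\<^sup>2 / 2 * ln (total_variance N m (\<rho> / (1 - \<rho>)) (a\<^sup>2 / (\<rho> + a\<^sup>2))) - real k / 2 * ln (2 * pi) + ln (\<Prod>i<k. fact i))\<bar>
      \<le> C / sqrt (real N)"
proof -
  obtain C where C: "0 \<le> C" "\<And>N m \<tau> Q r \<beta>. 1 \<le> N \<Longrightarrow> 0 < total_variance N m r \<beta> \<Longrightarrow>
      (\<And>i l. i < k \<Longrightarrow> l < k \<Longrightarrow> admissible R b0 \<gamma> h N m (\<tau> + 1 + i) (Q - 1 - l) r \<beta>) \<Longrightarrow>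
      cmod (dt k (\<lambda>i l. saddle_integral (\<tau> + 1 + i) (Q - 1 - l) r \<beta> i l / of_real (2 * pi))
          * of_real (sqrt (total_variance N m r \<beta>) ^ (k * k) * sqrt (2 * pi) ^ k) - of_real (\<Prod>i<k. fact i)) \<le> C / sqrt (real N)"
    using dt_saddle_integral_approx[OF assms] by blast
  \<comment> \<open>From here on \<open>C / sqrt (real N) \<le> 1 / 2\<close>, so the normalised
    determinant is within 1/2 of its limit: it is positive and \<open>abs_ln_le\<close>
    applies.\<close>
  define N0 where "N0 = nat \<lceil>4 * C\<^sup>2\<rceil> + 1"
  show ?thesis
  proof (rule that[of "2 * C" N0])
    show "0 \<le> 2 * C" using C by simp
    fix N m \<tau> Q \<rho>
    assume N: "N0 \<le> N" and \<rho>: "0 < \<rho>" "\<rho> < 1" and kQ: "k \<le> Q"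
      and S0: "0 < total_variance N m (\<rho> / (1 - \<rho>)) (a\<^sup>2 / (\<rho> + a\<^sup>2))"
      and adm: "\<And>i l. i < k \<Longrightarrow> l < k \<Longrightarrow> admissible R b0 \<gamma> h N m (\<tau> + 1 + i) (Q - 1 - l) (\<rho> / (1 - \<rho>)) (a\<^sup>2 / (\<rho> + a\<^sup>2))"
    define S where "S = total_variance N m (\<rho> / (1 - \<rho>)) (a\<^sup>2 / (\<rho> + a\<^sup>2))"
    define X where "X = 1 / (1 - \<rho>)"
    define W where "W = 1 + a\<^sup>2 / \<rho>"
    define P where "P = (\<Prod>i<k. fact i :: real)"
    define Z where "Z = (X ^ (\<tau> + k) * W ^ (Q - k)) ^ k"
    define Y where "Y = sqrt S ^ (k * k) * sqrt (2 * pi) ^ k"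
    define d where "d = dt k (entry a \<tau> Q)"
    have S: "0 < S" using S0 by (simp add: S_def)
    have X: "0 < X" using \<rho> by (simp add: X_def)
    have W: "0 < W" using \<rho> unfolding W_def by (intro add_pos_nonneg) auto
    have Z: "0 < Z" using X W by (simp add: Z_def)
    have Y: "0 < Y" using S by (simp add: Y_def)
    have P: "1 \<le> P" unfolding P_def by (rule prod_ge_1) simp
    have N1: "1 \<le> N" using N by (simp add: N0_def)
    have e: "C / sqrt (real N) \<le> 1 / 2"
    proof -
      have "(2 * C)\<^sup>2 \<le> real N" using N unfolding N0_def power_mult_distrib by simp linarith
      then have "2 * C \<le> sqrt (real N)" by (rule real_le_rsqrt)
      then show ?thesis using N1 by (simp add: divide_le_eq)
    qed
    have "complex_of_real (d / Z * Y - P) = dt k (\<lambda>i l. saddle_integral (\<tau> + 1 + i) (Q - 1 - l) (\<rho> / (1 - \<rho>)) (a\<^sup>2 / (\<rho> + a\<^sup>2)) i l / of_real (2 * pi))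
          * of_real Y - of_real P"
    proof -
      have "of_real d = complex_of_real Z * dt k (\<lambda>i l. saddle_integral (\<tau> + 1 + i) (Q - 1 - l) (\<rho> / (1 - \<rho>)) (a\<^sup>2 / (\<rho> + a\<^sup>2)) i l / of_real (2 * pi))"
        unfolding d_def Z_def X_def W_def by (rule dt_entry[OF \<rho> kQ])
      then show ?thesis using Z by (simp only: of_real_diff of_real_mult of_real_divide) simp
    qed
    then have "cmod (complex_of_real (d / Z * Y - P)) \<le> C / sqrt (real N)"
      using C(2)[OF N1 S0 adm] unfolding Y_def S_def P_def by (simp only:)
    then have 1: "\<bar>d / Z * Y - P\<bar> \<le> C / sqrt (real N)" by (simp only: norm_of_real)
    define x where "x = d / Z * Y / P"
    have "\<bar>x - 1\<bar> = \<bar>d / Z * Y - P\<bar> / P"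
    proof -
      have "x - 1 = (d / Z * Y - P) / P" using P by (simp add: x_def diff_divide_distrib)
      then show ?thesis using P by (simp add: abs_divide)
    qed
    also have "\<dots> \<le> C / sqrt (real N) / 1" using 1 P C(1) by (intro frac_le) auto
    finally have x1: "\<bar>x - 1\<bar> \<le> C / sqrt (real N)" by simp
    then have x0: "0 < x" using e by linarith
    have lx: "\<bar>ln x\<bar> \<le> 2 * C / sqrt (real N)" using abs_ln_le[of x] x1 e by simp
    have d: "d = x * Z * P / Y" using Z Y P by (simp add: x_def)
    then have d0: "0 < d" using x0 Z Y P by simp
    have "ln d = ln x + ln Z + ln P - ln Y" unfolding d using x0 Z Y P by (simp add: ln_mult ln_div)
    moreover have "ln Z = real k * (real (\<tau> + k) * ln X + real (Q - k) * ln W)"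
      unfolding Z_def using X W by (simp add: ln_realpow ln_mult)
    moreover have "ln Y = (real k)\<^sup>2 / 2 * ln S + real k / 2 * ln (2 * pi)"
    proof -
      have p: "0 < sqrt S" "0 < sqrt (2 * pi)" using S by simp_all
      then have "ln Y = real (k * k) * ln (sqrt S) + real k * ln (sqrt (2 * pi))"
        unfolding Y_def by (simp only: ln_mult_pos zero_less_power ln_realpow)
      then show ?thesis using S by (simp add: ln_sqrt power2_eq_square)
    qed
    ultimately have "\<bar>ln d - (real k * (real (\<tau> + k) * ln X + real (Q - k) * ln W) - (real k)\<^sup>2 / 2 * ln S - real k / 2 * ln (2 * pi) + ln P)\<bar> \<le> 2 * C / sqrt (real N)"
      using lx by simp
    then show "0 < dt k (entry a \<tau> Q) \<and>
      \<bar>ln (dt k (entry a \<tau> Q)) - (real k * (real (\<tau> + k) * ln (1 / (1 - \<rho>)) + real (Q - k) * ln (1 + a\<^sup>2 / \<rho>))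
        - (real k)\<^sup>2 / 2 * ln (total_variance N m (\<rho> / (1 - \<rho>)) (a\<^sup>2 / (\<rho> + a\<^sup>2))) - real k / 2 * ln (2 * pi) + ln (\<Prod>i<k. fact i))\<bar>
      \<le> 2 * C / sqrt (real N)"
      using d0 unfolding d_def X_def W_def S_def P_def by simp
  qed
qed

section \<open>The saddle point and the expansion\<close>

text \<open>The radicand exceeds the square of \<open>a (1 - 2 \<mu>)\<close> by the positive amount
  \<open>4 (a\<^sup>2 + 1) \<mu> (1 - \<mu>)\<close>.\<close>

lemma x0_less:
  assumes "0 < a" "0 < \<mu>" "\<mu> < 1"
  shows "x0 a \<mu> < - a"
proof -
  have "(a * (1 - 2 * \<mu>))\<^sup>2 < a\<^sup>2 + 4 * \<mu> * (1 - \<mu>)"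
  proof -
    have "0 < 4 * (a\<^sup>2 + 1) * (\<mu> * (1 - \<mu>))" using assms by (simp add: add_nonneg_pos)
    moreover have "a\<^sup>2 + 4 * \<mu> * (1 - \<mu>) = (a * (1 - 2 * \<mu>))\<^sup>2 + 4 * (a\<^sup>2 + 1) * (\<mu> * (1 - \<mu>))"
      by (simp add: power2_eq_square algebra_simps)
    ultimately show ?thesis by linarith
  qed
  then have "a * (1 - 2 * \<mu>) < sqrt (a\<^sup>2 + 4 * \<mu> * (1 - \<mu>))" by (rule real_less_rsqrt)
  then have "- a - sqrt (a\<^sup>2 + 4 * \<mu> * (1 - \<mu>)) < - a * (2 * (1 - \<mu>))" by (simp add: algebra_simps)
  then show ?thesis using assms unfolding x0_def by (subst pos_divide_less_eq) simp_all
qed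

lemma x0_root:
  assumes "0 < \<mu>" "\<mu> < 1"
  shows "(1 - \<mu>) * (x0 a \<mu>)\<^sup>2 + a * x0 a \<mu> = \<mu>"
proof -
  define D where "D = sqrt (a\<^sup>2 + 4 * \<mu> * (1 - \<mu>))"
  have "D\<^sup>2 = a\<^sup>2 + 4 * \<mu> * (1 - \<mu>)" unfolding D_def using assms by (subst real_sqrt_pow2) auto
  moreover have x: "2 * (1 - \<mu>) * x0 a \<mu> = - a - D" unfolding x0_def D_def using assms by simp
  then have "(2 * (1 - \<mu>) * x0 a \<mu> + a)\<^sup>2 = D\<^sup>2" by simp
  ultimately have "4 * (1 - \<mu>) * ((1 - \<mu>) * (x0 a \<mu>)\<^sup>2 + a * x0 a \<mu>) = 4 * (1 - \<mu>) * \<mu>"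
    by (simp add: power2_eq_square algebra_simps)
  then show ?thesis using assms by simp
qed

text \<open>To the left of \<open>- a\<close> the arguments of both logarithms are positive. This
  half-line is open, so the formula for the first derivative holds near \<open>x\<close> and may be
  differentiated again.\<close>

lemma deriv2_phi0:
  assumes "0 < a" "x < - a"
  shows "(deriv ^^ 2) (phi0 a \<mu>) x = - (1 - \<mu>) * (a / (1 - a * x))\<^sup>2 + \<mu> * (1 / (x + a)\<^sup>2 - 1 / x\<^sup>2)"
proof -
  let ?g = "\<lambda>z. - (1 - \<mu>) * (a / (1 - a * z)) + \<mu> * (1 / z - 1 / (z + a))"
  have pos: "0 < 1 - a * z" if "z < - a" for z
  proof -
    have "a * z < 0" using that assms by (simp add: mult_pos_neg)
    then show ?thesis by simp
  qed
  have d1: "deriv (phi0 a \<mu>) z = ?g z" if z: "z < - a" for z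
  proof (rule DERIV_imp_deriv)
    have z0: "z < 0" "z + a < 0" using z assms by auto
    then have q: "0 < z / (z + a)" by (simp add: zero_less_divide_iff)
    have 1: "((\<lambda>z. ln (1 - a * z)) has_field_derivative - (a / (1 - a * z))) (at z)"
      using pos[OF z] by (auto intro!: derivative_eq_intros)
    have "((\<lambda>z. z / (z + a)) has_field_derivative (z + a - z) / (z + a)\<^sup>2) (at z)"
      using z0 by (auto intro!: derivative_eq_intros simp: power2_eq_square)
    then have "((\<lambda>z. ln (z / (z + a))) has_field_derivative inverse (z / (z + a)) * ((z + a - z) / (z + a)\<^sup>2)) (at z)"
      by (rule DERIV_chain2[where g = "\<lambda>z. z / (z + a)", OF DERIV_ln[OF q]])
    moreover have "inverse (z / w) * ((w - z) / w\<^sup>2) = 1 / z - 1 / w" if "w < 0" for w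
      using that z0 by (simp add: field_simps power2_eq_square)
    ultimately have 2: "((\<lambda>z. ln (z / (z + a))) has_field_derivative 1 / z - 1 / (z + a)) (at z)"
      using z0 by metis
    have "((\<lambda>z. (1 - \<mu>) * ln (1 - a * z) + \<mu> * ln (z / (z + a))) has_field_derivative
        (1 - \<mu>) * - (a / (1 - a * z)) + \<mu> * (1 / z - 1 / (z + a))) (at z)"
      by (intro DERIV_add DERIV_cmult 1 2)
    then show "(phi0 a \<mu> has_field_derivative ?g z) (at z)"
      by (simp only: phi0_def [abs_def] mult_minus_left mult_minus_right)
  qed
  have "x < 0" "x + a < 0" using assms by auto
  then have nz: "x \<noteq> 0" "x + a \<noteq> 0" "1 - a * x \<noteq> 0" using pos[OF assms(2)] by auto
  have "eventually (\<lambda>z. z \<in> {..<- a}) (nhds x)" using assms by (intro eventually_nhds_in_open) auto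
  then have "eventually (\<lambda>z. deriv (phi0 a \<mu>) z = ?g z) (nhds x)"
    by eventually_elim (simp add: d1)
  then have "deriv (deriv (phi0 a \<mu>)) x = deriv ?g x" by (rule deriv_cong_ev) simp
  also have "\<dots> = - (1 - \<mu>) * (a / (1 - a * x))\<^sup>2 + \<mu> * (1 / (x + a)\<^sup>2 - 1 / x\<^sup>2)"
  proof (rule DERIV_imp_deriv)
    have 1: "((\<lambda>z. a / (1 - a * z)) has_field_derivative (a / (1 - a * x))\<^sup>2) (at x)"
      using nz by (auto intro!: derivative_eq_intros simp: power2_eq_square)
    have 2: "((\<lambda>z. 1 / z) has_field_derivative - (1 / x\<^sup>2)) (at x)"
      using nz by (auto intro!: derivative_eq_intros simp: power2_eq_square)
    have 3: "((\<lambda>z. 1 / (z + a)) has_field_derivative - (1 / (x + a)\<^sup>2)) (at x)"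
      using nz by (auto intro!: derivative_eq_intros simp: power2_eq_square)
    have "(?g has_field_derivative - (1 - \<mu>) * (a / (1 - a * x))\<^sup>2 + \<mu> * (- (1 / x\<^sup>2) - - (1 / (x + a)\<^sup>2))) (at x)"
      by (intro DERIV_add DERIV_cmult DERIV_diff 1 2 3)
    then show "(?g has_field_derivative - (1 - \<mu>) * (a / (1 - a * x))\<^sup>2 + \<mu> * (1 / (x + a)\<^sup>2 - 1 / x\<^sup>2)) (at x)" by simp
  qed
  finally show ?thesis by (simp add: numeral_2_eq_2)
qed

definition saddle :: "real \<Rightarrow> real \<Rightarrow> real" where
  "saddle a \<mu> = - a / x0 a \<mu>"

context
  fixes a \<mu> :: real
  assumes a: "0 < a" and \<mu>: "0 < \<mu>" "\<mu> < 1"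
begin

lemma saddle_bounds: "0 < saddle a \<mu>" "saddle a \<mu> < 1"
proof -
  have x: "x0 a \<mu> < 0" using x0_less[OF a \<mu>] a by linarith
  then show "0 < saddle a \<mu>" using a x by (simp add: saddle_def divide_pos_neg)
  show "saddle a \<mu> < 1"
    unfolding saddle_def using x x0_less[OF a \<mu>] by (simp only: neg_divide_less_eq mult_1)
qed

text \<open>The two factors of the integrand at the saddle point are the arguments of the logarithms
  in \<open>phi0\<close>; this is why their powers add up to \<open>N\<close> times
  \<open>phi0\<close> at \<open>x0\<close>.\<close>

lemma saddle_x0: "1 / (1 - saddle a \<mu>) = x0 a \<mu> / (x0 a \<mu> + a)" "1 + a\<^sup>2 / saddle a \<mu> = 1 - a * x0 a \<mu>"
  using x0_less[OF a \<mu>] a by (simp_all add: saddle_def field_simps power2_eq_square)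

text \<open>The quadratic equation for \<open>x = x0 a \<mu>\<close> rearranges to
  \<open>\<mu> (1 - a x) = (1 - \<mu>) (x\<^sup>2 + a x)\<close>, the vanishing of the derivative of
  \<open>phi0\<close>; multiplying by \<open>a\<^sup>2 / x\<^sup>2\<close> expresses it through the
  radius.\<close>

lemma saddle_equation: "\<mu> * (saddle a \<mu> * (saddle a \<mu> + a\<^sup>2)) = (1 - \<mu>) * (a\<^sup>2 * (1 - saddle a \<mu>))"
proof -
  define x where "x = x0 a \<mu>"
  have x: "x \<noteq> 0" using x0_less[OF a \<mu>] a by (simp add: x_def)
  have root: "(1 - \<mu>) * x\<^sup>2 + a * x = \<mu>" unfolding x_def by (rule x0_root[OF \<mu>])
  have "\<mu> * (1 - a * x) = (1 - \<mu>) * (x\<^sup>2 + a * x)"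
  proof -
    have "(1 - \<mu>) * (x\<^sup>2 + a * x) = ((1 - \<mu>) * x\<^sup>2 + a * x) - \<mu> * (a * x)" by (simp add: algebra_simps)
    moreover have "\<mu> * (1 - a * x) = \<mu> - \<mu> * (a * x)" by (simp add: algebra_simps)
    ultimately show ?thesis by (simp only: root)
  qed
  then have "\<mu> * (1 - a * x) * (a\<^sup>2 / x\<^sup>2) = (1 - \<mu>) * (x\<^sup>2 + a * x) * (a\<^sup>2 / x\<^sup>2)" by simp
  moreover have "\<mu> * (1 - a * x) * (a\<^sup>2 / x\<^sup>2) = \<mu> * (- a / x * (- a / x + a\<^sup>2))"
    using x by (simp add: field_simps power2_eq_square)
  moreover have "(1 - \<mu>) * (x\<^sup>2 + a * x) * (a\<^sup>2 / x\<^sup>2) = (1 - \<mu>) * (a\<^sup>2 * (1 - - a / x))"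
    using x by (simp add: field_simps power2_eq_square)
  ultimately show ?thesis unfolding saddle_def x_def[symmetric] by metis
qed

text \<open>The critical point equation as a balance of means. Multiplied by \<open>N\<close>, it is
  the saddle point condition in \<open>admissible\<close>.\<close>

lemma saddle_mean: "\<mu> * (saddle a \<mu> / (1 - saddle a \<mu>)) = (1 - \<mu>) * (a\<^sup>2 / (saddle a \<mu> + a\<^sup>2))"
proof -
  have "0 < saddle a \<mu> + a\<^sup>2" using saddle_bounds by (simp add: add_pos_nonneg)
  then show ?thesis using saddle_equation saddle_bounds by (simp add: frac_eq_eq mult_ac)
qed

text \<open>Expressed through \<open>r\<close> and \<open>\<beta>\<close>, the right-hand side is
  \<open>\<mu> ((1 + r)\<^sup>2 - 1) - (1 - \<mu>) \<beta>\<^sup>2\<close>. It differs from the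
  variance by \<open>\<mu> r - (1 - \<mu>) \<beta>\<close>, which is 0 by
  \<open>saddle_mean\<close>.\<close>

lemma saddle_variance:
  fixes r \<beta> :: real
  defines "r \<equiv> saddle a \<mu> / (1 - saddle a \<mu>)" and "\<beta> \<equiv> a\<^sup>2 / (saddle a \<mu> + a\<^sup>2)"
  shows "\<mu> * (r + r\<^sup>2) + (1 - \<mu>) * (\<beta> * (1 - \<beta>)) = \<bar>x0 a \<mu>\<bar>\<^sup>2 * (deriv ^^ 2) (phi0 a \<mu>) (x0 a \<mu>)"
proof -
  define x where "x = x0 a \<mu>"
  have x: "x < - a" unfolding x_def by (rule x0_less[OF a \<mu>])
  have nz: "x \<noteq> 0" "x + a \<noteq> 0" using x a by auto
  have ax: "0 < 1 - a * x" using x a mult_pos_neg[of a x] by simp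
  have r: "1 + r = x / (x + a)"
    unfolding r_def x_def saddle_x0(1)[symmetric] using saddle_bounds by (simp add: field_simps)
  have \<beta>: "\<beta> = - (a * x / (1 - a * x))"
    unfolding \<beta>_def x_def[symmetric] saddle_def using nz ax a by (simp add: field_simps power2_eq_square)
  have mean: "\<mu> * r = (1 - \<mu>) * \<beta>" unfolding r_def \<beta>_def by (rule saddle_mean)
  have "\<bar>x\<bar>\<^sup>2 * (deriv ^^ 2) (phi0 a \<mu>) x = - (1 - \<mu>) * \<beta>\<^sup>2 + \<mu> * ((1 + r)\<^sup>2 - 1)"
  proof -
    have "x\<^sup>2 * (p * (a / w)\<^sup>2 + \<mu> * (1 / v\<^sup>2 - 1 / x\<^sup>2)) = p * (- (a * x / w))\<^sup>2 + \<mu> * ((x / v)\<^sup>2 - 1)" for p v w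
      using nz by (simp add: power_divide power_mult_distrib algebra_simps)
    then show ?thesis unfolding deriv2_phi0[OF a x] r \<beta> power2_abs .
  qed
  also have "\<dots> = \<mu> * (r + r\<^sup>2) + (1 - \<mu>) * (\<beta> * (1 - \<beta>)) + (\<mu> * r - (1 - \<mu>) * \<beta>)"
    by (simp add: power2_eq_square algebra_simps)
  finally show ?thesis unfolding mean x_def by simp
qed

text \<open>The bound on the geometric mean is \<open>saddle_mean\<close> with the right-hand side
  estimated by 1. For the Bernoulli variance, \<open>saddle_equation\<close> bounds the radius from
  below in terms of \<delta> and \<open>a\<close>, and \<beta> (1 - \<beta>) = a^2 \<rho> / (\<rho>
  + a^2)^2.\<close>

lemma saddle_uniform_bounds:
  assumes "0 < \<delta>" "\<delta> \<le> \<mu>" "\<mu> \<le> 1 - \<delta>"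
  shows "saddle a \<mu> / (1 - saddle a \<mu>) \<le> 1 / \<delta>"
    and "a\<^sup>2 * (\<delta> * a\<^sup>2 / (1 + a\<^sup>2 + \<delta> * a\<^sup>2)) / (1 + a\<^sup>2)\<^sup>2
      \<le> a\<^sup>2 / (saddle a \<mu> + a\<^sup>2) * (1 - a\<^sup>2 / (saddle a \<mu> + a\<^sup>2))"
proof -
  define \<rho> where "\<rho> = saddle a \<mu>"
  have \<rho>: "0 < \<rho>" "\<rho> < 1" using saddle_bounds by (simp_all add: \<rho>_def)
  have s: "0 < \<rho> + a\<^sup>2" using \<rho> by (simp add: add_pos_nonneg)
  have "\<delta> * (\<rho> / (1 - \<rho>)) \<le> \<mu> * (\<rho> / (1 - \<rho>))" using assms \<rho> by (intro mult_right_mono) auto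
  also have "\<dots> = (1 - \<mu>) * (a\<^sup>2 / (\<rho> + a\<^sup>2))" unfolding \<rho>_def by (rule saddle_mean)
  also have "\<dots> \<le> 1 * 1" using \<mu> \<rho> s by (intro mult_mono) auto
  finally show "saddle a \<mu> / (1 - saddle a \<mu>) \<le> 1 / \<delta>" using assms by (simp add: \<rho>_def field_simps)
  have "\<delta> * (a\<^sup>2 * (1 - \<rho>)) \<le> (1 - \<mu>) * (a\<^sup>2 * (1 - \<rho>))" using assms \<rho> by (intro mult_right_mono) auto
  also have "\<dots> = \<mu> * (\<rho> * (\<rho> + a\<^sup>2))" unfolding \<rho>_def by (rule saddle_equation[symmetric])
  also have "\<dots> \<le> 1 * (\<rho> * (1 + a\<^sup>2))" using \<mu> \<rho> s by (intro mult_mono) auto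
  finally have "\<delta> * a\<^sup>2 \<le> \<rho> * (1 + a\<^sup>2 + \<delta> * a\<^sup>2)" by (simp add: algebra_simps)
  moreover have "0 < 1 + a\<^sup>2 + \<delta> * a\<^sup>2" using assms by (simp add: add_pos_nonneg)
  ultimately have low: "\<delta> * a\<^sup>2 / (1 + a\<^sup>2 + \<delta> * a\<^sup>2) \<le> \<rho>" by (simp add: pos_divide_le_eq)
  have "a\<^sup>2 * (\<delta> * a\<^sup>2 / (1 + a\<^sup>2 + \<delta> * a\<^sup>2)) / (1 + a\<^sup>2)\<^sup>2 \<le> a\<^sup>2 * \<rho> / (\<rho> + a\<^sup>2)\<^sup>2"
    using low \<rho> s by (intro frac_le mult_left_mono power_mono) auto
  also have "\<dots> = a\<^sup>2 / (\<rho> + a\<^sup>2) * (1 - a\<^sup>2 / (\<rho> + a\<^sup>2))"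
  proof -
    have "1 - a\<^sup>2 / (\<rho> + a\<^sup>2) = \<rho> / (\<rho> + a\<^sup>2)" using s by (simp add: field_simps)
    then show ?thesis by (simp add: power2_eq_square)
  qed
  finally show "a\<^sup>2 * (\<delta> * a\<^sup>2 / (1 + a\<^sup>2 + \<delta> * a\<^sup>2)) / (1 + a\<^sup>2)\<^sup>2
      \<le> a\<^sup>2 / (saddle a \<mu> + a\<^sup>2) * (1 - a\<^sup>2 / (saddle a \<mu> + a\<^sup>2))" by (simp add: \<rho>_def)
qed

end

lemma sum_Suc_lessThan: "real (\<Sum>i<n. i + 1) = real n * (real n + 1) / 2"
  by (induction n) (simp_all add: field_simps)

text \<open>\<open>L\<close> collects sums of consecutive integers. For \<epsilon> = 1 the first of
  them stops one term earlier, losing \<open>m\<close>; this is the term with \<epsilon> in the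
  coefficient of \<open>N\<close>.\<close>

lemma aztec_F_eq_dt:
  assumes "\<epsilon> \<in> {0, 1}" "0 < a" "1 \<le> m" "m < N" "k \<le> m"
  obtains L where "aztec_F N m (k + 1) a \<epsilon> = (1 + a\<^sup>2) ^ L * dt k (entry a (m - k) (N - m + \<epsilon> + k))"
    and "real L = (1/2 - real m / real N + (real m / real N)\<^sup>2) * (real N)\<^sup>2 + (1/2 - real \<epsilon> * (real m / real N)) * real N"
proof -
  have N: "real N \<noteq> 0" using assms by simp
  have R: "(1/2 - real m / real N + (real m / real N)\<^sup>2) * (real N)\<^sup>2 + (1/2 - real \<epsilon> * (real m / real N)) * real N
    = (real N)\<^sup>2 / 2 - real m * real N + (real m)\<^sup>2 + real N / 2 - real \<epsilon> * real m"
    using N by (simp add: power2_eq_square distrib_right left_diff_distrib)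
  show ?thesis
  proof (cases "\<epsilon> = 1")
  case True
  have "real (\<Sum>i<m - 1. i + 1) = (real m - 1) * real m / 2"
    unfolding sum_Suc_lessThan using assms by (simp add: of_nat_diff)
  then have "real ((\<Sum>i<m - 1. i + 1) + (\<Sum>i<N - m. i + 1)) = (real m - 1) * real m / 2 + (real N - real m) * (real N - real m + 1) / 2"
    using sum_Suc_lessThan[of "N - m"] assms by (simp add: of_nat_diff)
  then have "real ((\<Sum>i<m - 1. i + 1) + (\<Sum>i<N - m. i + 1)) = (real N)\<^sup>2 / 2 - real m * real N + (real m)\<^sup>2 + real N / 2 - real \<epsilon> * real m"
    unfolding True by (simp add: field_simps power2_eq_square del: of_nat_sum)
  moreover have "aztec_F N m (k + 1) a \<epsilon> = (1 + a\<^sup>2) ^ ((\<Sum>i<m - 1. i + 1) + (\<Sum>i<N - m. i + 1)) * dt k (entry a (m - k) (N - m + \<epsilon> + k))"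
    unfolding True by (rule aztec_F_1_eq_dt) (use assms in auto)
  ultimately show ?thesis using that unfolding R by blast
next
  case False
  then have e: "\<epsilon> = 0" using assms by simp
  have "real ((\<Sum>i<m. i + 1) + (\<Sum>i<N - m. i + 1)) = real m * (real m + 1) / 2 + (real N - real m) * (real N - real m + 1) / 2"
    using sum_Suc_lessThan[of m] sum_Suc_lessThan[of "N - m"] assms by (simp add: of_nat_diff)
  then have "real ((\<Sum>i<m. i + 1) + (\<Sum>i<N - m. i + 1)) = (real N)\<^sup>2 / 2 - real m * real N + (real m)\<^sup>2 + real N / 2 - real \<epsilon> * real m"
    unfolding e by (simp add: field_simps power2_eq_square del: of_nat_sum)
  moreover have "aztec_F N m (k + 1) a \<epsilon> = (1 + a\<^sup>2) ^ ((\<Sum>i<m. i + 1) + (\<Sum>i<N - m. i + 1)) * dt k (entry a (m - k) (N - m + \<epsilon> + k))"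
    unfolding e add_0_right by (rule aztec_F_0_eq_dt) (use assms in auto)
  ultimately show ?thesis using that unfolding R by blast
  qed
qed

lemma ln_aztec_F_approx:
  fixes \<epsilon> k M :: nat
  assumes \<epsilon>: "\<epsilon> \<in> {0, 1}" and a: "0 < a" and \<delta>: "0 < \<delta>"
  obtains C N0 where "0 \<le> C" and
    "\<And>N m. N0 \<le> N \<Longrightarrow> m \<in> {1..N} \<Longrightarrow> \<delta> \<le> real m / real N \<Longrightarrow> real m / real N \<le> 1 - \<delta> \<Longrightarrow>
      \<bar>ln (aztec_F N m (k + 1) a \<epsilon>)
         - (F2 a (real m / real N) * (real N)\<^sup>2
            + F1 a \<epsilon> k (real m / real N) * real N
            - (real k)\<^sup>2 / 2 * ln (real N)
            + F0 a \<epsilon> k (real m / real N))\<bar> \<le> C / sqrt (real N)"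
proof -
  \<comment> \<open>\<open>R\<close> and \<open>b0\<close> are the bounds of
    \<open>saddle_uniform_bounds\<close>. Half of \<delta> suffices for \<open>\<gamma>\<close>,
    with room for the 1 subtracted from \<open>q\<close>, and \<open>h\<close> covers all shifts of
    the exponents by \<open>k\<close>, \<open>i\<close>, \<open>l\<close> and \<epsilon>.\<close>
  define R where "R = 1 / \<delta>"
  define b0 where "b0 = a\<^sup>2 * (\<delta> * a\<^sup>2 / (1 + a\<^sup>2 + \<delta> * a\<^sup>2)) / (1 + a\<^sup>2)\<^sup>2"
  define \<gamma> where "\<gamma> = \<delta> / 2"
  define h where "h = real k + 2"
  have par: "0 \<le> R" "0 < b0" "0 < \<gamma>" "0 \<le> h"
  proof -
    have "0 < 1 + a\<^sup>2" "0 < 1 + a\<^sup>2 + \<delta> * a\<^sup>2" using a \<delta> by (simp_all add: add_pos_nonneg)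
    then show "0 < b0" unfolding b0_def using a \<delta> by (intro divide_pos_pos mult_pos_pos zero_less_power)
  qed (use \<delta> in \<open>simp_all add: R_def \<gamma>_def h_def\<close>)
  obtain C N1 where C: "0 \<le> C" and N1: "\<And>N m \<tau> Q \<rho>. N1 \<le> N \<Longrightarrow> 0 < \<rho> \<Longrightarrow> \<rho> < 1 \<Longrightarrow> k \<le> Q \<Longrightarrow>
      0 < total_variance N m (\<rho> / (1 - \<rho>)) (a\<^sup>2 / (\<rho> + a\<^sup>2)) \<Longrightarrow>
      (\<And>i l. i < k \<Longrightarrow> l < k \<Longrightarrow> admissible R b0 \<gamma> h N m (\<tau> + 1 + i) (Q - 1 - l) (\<rho> / (1 - \<rho>)) (a\<^sup>2 / (\<rho> + a\<^sup>2))) \<Longrightarrow>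
      0 < dt k (entry a \<tau> Q) \<and>
      \<bar>ln (dt k (entry a \<tau> Q)) - (real k * (real (\<tau> + k) * ln (1 / (1 - \<rho>)) + real (Q - k) * ln (1 + a\<^sup>2 / \<rho>))
        - (real k)\<^sup>2 / 2 * ln (total_variance N m (\<rho> / (1 - \<rho>)) (a\<^sup>2 / (\<rho> + a\<^sup>2))) - real k / 2 * ln (2 * pi) + ln (\<Prod>i<k. fact i))\<bar>
      \<le> C / sqrt (real N)"
    using ln_dt_entry_approx[OF par, of k a] by metis
  \<comment> \<open>Ensures \<open>\<delta> * N \<ge> k + 2\<close>, hence
    \<open>k \<le> m < N\<close> and exponents of linear size.\<close>
  define N0 where "N0 = N1 + nat \<lceil>(real k + 2) / \<delta>\<rceil> + 1"
  show ?thesis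
  proof (rule that[OF C, of N0])
    fix N m
    assume N: "N0 \<le> N" and m: "m \<in> {1..N}" and \<mu>1: "\<delta> \<le> real m / real N" and \<mu>2: "real m / real N \<le> 1 - \<delta>"
    define \<mu> where "\<mu> = real m / real N"
    define \<rho> where "\<rho> = saddle a \<mu>"
    define r where "r = \<rho> / (1 - \<rho>)"
    define \<beta> where "\<beta> = a\<^sup>2 / (\<rho> + a\<^sup>2)"
    define n where "n = N - m + \<epsilon>"
    have Npos: "0 < real N" using N by (simp add: N0_def)
    have m\<mu>: "real m = \<mu> * real N" using Npos by (simp add: \<mu>_def)
    have \<mu>: "0 < \<mu>" "\<mu> < 1" using \<mu>1 \<mu>2 \<delta> by (simp_all add: \<mu>_def)
    have \<delta>N: "real k + 2 \<le> \<delta> * real N"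
    proof -
      have "(real k + 2) / \<delta> \<le> real N" using N unfolding N0_def by linarith
      then show ?thesis using \<delta> by (simp add: pos_divide_le_eq mult.commute)
    qed
    have m_ge: "\<delta> * real N \<le> real m" using \<mu>1 Npos by (simp add: pos_le_divide_eq)
    have m_le: "\<delta> * real N \<le> real N - real m" using \<mu>2 Npos by (simp add: pos_divide_le_eq left_diff_distrib)
    have km: "k \<le> m" "m < N" using \<delta>N m_ge m_le by linarith+
    have rho: "0 < \<rho>" "\<rho> < 1" using saddle_bounds[OF a \<mu>] by (simp_all add: \<rho>_def)
    have s: "0 < \<rho> + a\<^sup>2" using rho by (simp add: add_pos_nonneg)
    have \<beta>: "0 \<le> \<beta>" "\<beta> \<le> 1" using rho s by (simp_all add: \<beta>_def)
    have r0: "0 < r" using rho by (simp add: r_def)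
    have rR: "r \<le> R" unfolding r_def \<rho>_def R_def by (rule saddle_uniform_bounds(1)[OF a \<mu> \<delta>]) (use \<mu>1 \<mu>2 in \<open>simp_all add: \<mu>_def\<close>)
    have bb: "b0 \<le> \<beta> * (1 - \<beta>)" unfolding \<beta>_def \<rho>_def b0_def by (rule saddle_uniform_bounds(2)[OF a \<mu> \<delta>]) (use \<mu>1 \<mu>2 in \<open>simp_all add: \<mu>_def\<close>)
    have mean: "real m * r = (real N - real m) * \<beta>"
    proof -
      have "\<mu> * r = (1 - \<mu>) * \<beta>" unfolding r_def \<beta>_def \<rho>_def by (rule saddle_mean[OF a \<mu>])
      then have "real N * (\<mu> * r) = real N * ((1 - \<mu>) * \<beta>)" by simp
      then show ?thesis unfolding m\<mu> by (simp add: algebra_simps)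
    qed
    have \<epsilon>1: "\<epsilon> \<le> 1" using \<epsilon> by auto
    have nr: "real n = real N - real m + real \<epsilon>" using km by (simp add: n_def of_nat_diff)
    have adm: "admissible R b0 \<gamma> h N m (m - k + 1 + i) (n + k - 1 - l) r \<beta>" if "i < k" "l < k" for i l
    proof -
      have p: "real (m - k + 1 + i) = real m - real k + 1 + real i" using km by (simp add: of_nat_diff)
      have q: "real (n + k - 1 - l) = real n + real k - 1 - real l" using that by (simp add: of_nat_diff)
      have "real i < real k" "real l < real k" "0 \<le> real \<epsilon>" "real \<epsilon> \<le> 1" using that \<epsilon>1 by simp_all
      then have "\<bar>real (m - k + 1 + i) - real m\<bar> \<le> h" "\<bar>real (n + k - 1 - l) - (real N - real m)\<bar> \<le> h"
        "\<gamma> * real N \<le> real (n + k - 1 - l) - 1" "\<gamma> * real N \<le> real N - real m"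
        unfolding p q nr h_def \<gamma>_def using m_le \<delta>N by (auto simp: abs_le_iff)
      then show ?thesis unfolding admissible_def using Npos km r0 rR \<beta> bb mean by simp
    qed
    define \<sigma> where "\<sigma> = \<bar>x0 a \<mu>\<bar>\<^sup>2 * (deriv ^^ 2) (phi0 a \<mu>) (x0 a \<mu>)"
    have var: "\<mu> * (r + r\<^sup>2) + (1 - \<mu>) * (\<beta> * (1 - \<beta>)) = \<sigma>"
      unfolding r_def \<beta>_def \<rho>_def \<sigma>_def by (rule saddle_variance[OF a \<mu>])
    have \<sigma>: "0 < \<sigma>"
      unfolding var[symmetric] using \<mu> r0 \<beta> by (intro add_pos_nonneg mult_pos_pos mult_nonneg_nonneg) auto
    have S: "total_variance N m r \<beta> = real N * \<sigma>"
      unfolding var[symmetric] total_variance_def m\<mu> by (simp add: algebra_simps)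
    then have S0: "0 < total_variance N m r \<beta>" using Npos \<sigma> by simp
    define d where "d = dt k (entry a (m - k) (n + k))"
    have dmain: "0 < d \<and> \<bar>ln d - (real k * (real (m - k + k) * ln (1 / (1 - \<rho>)) + real (n + k - k) * ln (1 + a\<^sup>2 / \<rho>))
        - (real k)\<^sup>2 / 2 * ln (total_variance N m r \<beta>) - real k / 2 * ln (2 * pi) + ln (\<Prod>i<k. fact i))\<bar>
      \<le> C / sqrt (real N)"
      unfolding d_def r_def \<beta>_def
      by (rule N1) (use N rho S0 adm in \<open>simp_all add: N0_def r_def \<beta>_def\<close>)
    obtain L where F: "aztec_F N m (k + 1) a \<epsilon> = (1 + a\<^sup>2) ^ L * d"
      and L: "real L = (1/2 - \<mu> + \<mu>\<^sup>2) * (real N)\<^sup>2 + (1/2 - real \<epsilon> * \<mu>) * real N"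
      using aztec_F_eq_dt[OF \<epsilon> a _ km(2) km(1)] m unfolding d_def n_def \<mu>_def by auto
    have "ln (aztec_F N m (k + 1) a \<epsilon>) = real L * ln (1 + a\<^sup>2) + ln d"
    proof -
      have "0 < 1 + a\<^sup>2" by (simp add: add_pos_nonneg)
      then show ?thesis unfolding F using dmain by (simp only: ln_mult_pos zero_less_power ln_realpow)
    qed
    moreover have "F2 a \<mu> * (real N)\<^sup>2 + F1 a \<epsilon> k \<mu> * real N - (real k)\<^sup>2 / 2 * ln (real N) + F0 a \<epsilon> k \<mu>
      = real L * ln (1 + a\<^sup>2) + (real k * (real (m - k + k) * ln (1 / (1 - \<rho>)) + real (n + k - k) * ln (1 + a\<^sup>2 / \<rho>))
        - (real k)\<^sup>2 / 2 * ln (total_variance N m r \<beta>) - real k / 2 * ln (2 * pi) + ln (\<Prod>i<k. fact i))"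
    proof -
      define lX where "lX = ln (1 / (1 - \<rho>))"
      define lW where "lW = ln (1 + a\<^sup>2 / \<rho>)"
      have lnS: "ln (total_variance N m r \<beta>) = ln (real N) + ln \<sigma>"
        unfolding S using Npos \<sigma> by (rule ln_mult_pos)
      have phi: "phi0 a \<mu> (x0 a \<mu>) = (1 - \<mu>) * lW + \<mu> * lX"
        unfolding phi0_def lX_def lW_def \<rho>_def saddle_x0[OF a \<mu>] ..
      have lW: "ln (1 - a * x0 a \<mu>) = lW" unfolding lW_def \<rho>_def saddle_x0[OF a \<mu>] ..
      have mk: "real (m - k + k) = \<mu> * real N" using km m\<mu> by simp
      \<comment> \<open>The summand \<epsilon> here produces the term
        \<open>\<epsilon> k ln (1 - a x0)\<close> of \<open>F0\<close>.\<close>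
      have nk: "real (n + k - k) = (1 - \<mu>) * real N + real \<epsilon>" using nr m\<mu> by (simp add: algebra_simps)
      show ?thesis
        unfolding F2_def F1_def F0_def phi lnS lW mk nk L \<sigma>_def[symmetric] barnes_G_nat lX_def[symmetric] lW_def[symmetric]
        by (simp add: algebra_simps)
    qed
    ultimately show "\<bar>ln (aztec_F N m (k + 1) a \<epsilon>)
         - (F2 a (real m / real N) * (real N)\<^sup>2
            + F1 a \<epsilon> k (real m / real N) * real N
            - (real k)\<^sup>2 / 2 * ln (real N)
            + F0 a \<epsilon> k (real m / real N))\<bar> \<le> C / sqrt (real N)"
      using dmain unfolding \<mu>_def[symmetric] by (simp only: add_diff_cancel_left)
  qed
qed

theorem theorem1p1:
  fixes a :: real and \<epsilon> :: nat
  assumes "\<epsilon> \<in> {0, 1}" and "0 < a" and "a \<le> 1"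
  shows "(\<forall>\<mu>. 0 < \<mu> \<and> \<mu> < 1 \<longrightarrow> x0 a \<mu> < - a) \<and>
    (\<forall>\<delta>>0. \<forall>M::nat. \<exists>C::real. \<exists>N0::nat. \<forall>N\<ge>N0. \<forall>m\<in>{1..N}. \<forall>k\<le>M.
       \<delta> \<le> real m / real N \<and> real m / real N \<le> 1 - \<delta> \<longrightarrow>
       \<bar>ln (aztec_F N m (k + 1) a \<epsilon>)
         - (F2 a (real m / real N) * (real N)\<^sup>2
            + F1 a \<epsilon> k (real m / real N) * real N
            - (real k)\<^sup>2 / 2 * ln (real N)
            + F0 a \<epsilon> k (real m / real N))\<bar>
       \<le> C * real N powr (-1/2))"
proof (intro conjI allI impI)
  fix \<mu> :: real assume "0 < \<mu> \<and> \<mu> < 1"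
  then show "x0 a \<mu> < - a" using x0_less[OF assms(2)] by simp
next
  fix \<delta> :: real and M :: nat
  assume \<delta>: "0 < \<delta>"
  let ?E = "\<lambda>k N m. \<bar>ln (aztec_F N m (k + 1) a \<epsilon>)
         - (F2 a (real m / real N) * (real N)\<^sup>2
            + F1 a \<epsilon> k (real m / real N) * real N
            - (real k)\<^sup>2 / 2 * ln (real N)
            + F0 a \<epsilon> k (real m / real N))\<bar>"
  have "\<exists>C N0. 0 \<le> C \<and> (\<forall>N m. N0 \<le> N \<longrightarrow> m \<in> {1..N} \<longrightarrow> \<delta> \<le> real m / real N \<longrightarrow> real m / real N \<le> 1 - \<delta> \<longrightarrow>
      ?E k N m \<le> C / sqrt (real N))" for k
    using ln_aztec_F_approx[OF assms(1,2) \<delta>, of k] by metis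
  then obtain C N0 where C: "\<And>k. 0 \<le> C k" and E: "\<And>k N m. N0 k \<le> N \<Longrightarrow> m \<in> {1..N} \<Longrightarrow>
      \<delta> \<le> real m / real N \<Longrightarrow> real m / real N \<le> 1 - \<delta> \<Longrightarrow> ?E k N m \<le> C k / sqrt (real N)"
    by metis
  show "\<exists>C::real. \<exists>N0::nat. \<forall>N\<ge>N0. \<forall>m\<in>{1..N}. \<forall>k\<le>M.
       \<delta> \<le> real m / real N \<and> real m / real N \<le> 1 - \<delta> \<longrightarrow> ?E k N m \<le> C * real N powr (-1/2)"
  \<comment> \<open>Every \<open>k\<close> has its own constants. As \<open>k\<close> ranges over a
    finite set, their sums serve all values at once.\<close>
  proof (intro exI[of _ "\<Sum>k\<le>M. C k"] exI[of _ "\<Sum>k\<le>M. N0 k"] allI ballI impI)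
    fix N m k
    assume N: "(\<Sum>k\<le>M. N0 k) \<le> N" and m: "m \<in> {1..N}" and k: "k \<le> M"
      and \<mu>: "\<delta> \<le> real m / real N \<and> real m / real N \<le> 1 - \<delta>"
    have "N0 k \<le> (\<Sum>k\<le>M. N0 k)" using k by (intro member_le_sum) auto
    then have "?E k N m \<le> C k / sqrt (real N)" using N m \<mu> by (intro E) auto
    also have "\<dots> \<le> (\<Sum>k\<le>M. C k) / sqrt (real N)"
      using k C by (intro divide_right_mono member_le_sum) auto
    also have "1 / sqrt (real N) = real N powr (-1/2)"
      by (simp add: powr_minus_divide powr_half_sqrt)
    then have "(\<Sum>k\<le>M. C k) / sqrt (real N) = (\<Sum>k\<le>M. C k) * real N powr (-1/2)"
      by (metis mult.right_neutral times_divide_eq_right)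
    finally show "?E k N m \<le> (\<Sum>k\<le>M. C k) * real N powr (-1/2)" .
  qed
qed

end
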